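(* Let $(\Lambda,d)$ be a finitely aligned $k$-graph. Then the following are equivalent: (1) $\Lambda$ is aperiodic. (2) Every non-zero ideal of $C^*(\Lambda)$ contains a vertex projection, i.e. contains $s_v$ for some $v\in\Lambda^0$. (3) The $\partial\Lambda$ representation $\pi_S:C^*(\Lambda)\to\mathcal{B}(\ell^2(\partial\Lambda))$ is faithful.
   Context: Conventions. $\mathbb{N}$ contains $0$, $k\ge 1$ is an integer, $\mathbb{N}^k$ and $(\mathbb{N}\cup\{\infty\})^k$ are ordered coordinatewise, and $m\vee n$, $m\wedge n$ denote the coordinatewise maximum and minimum. A $k$-graph $(\Lambda,d)$ is a countable small category $\Lambda$ (identified with its set of morphisms, called paths) with a functor $d:\Lambda\to\mathbb{N}^k$ satisfying the factorisation property: whenever $d(\lambda)=m+n$ there exist unique $\mu,\nu\in\Lambda$ with $d(\mu)=m$, $d(\nu)=n$ and $\lambda=\mu\nu$. Write $\Lambda^n=\{\lambda\in\Lambda: d(\lambda)=n\}$. Objects are identified with their identity morphisms, which form $\Lambda^0$ (the vertices). $r(\lambda),s(\lambda)\in\Lambda^0$ are the unique vertices with $\lambda=r(\lambda)\lambda=\lambda s(\lambda)$; the product $\mu\nu$ is defined exactly when $s(\mu)=r(\nu)$. For $m\le n\le d(\lambda)$, $\lambda(m,n)$ is the unique path in $\Lambda^{n-m}$ with $\lambda=\lambda'\lambda(m,n)\lambda''$, $d(\lambda')=m$, $d(\lambda'')=d(\lambda)-n$. For $v\in\Lambda^0$ and $X\subseteq\Lambda$: $vX=\{\lambda\in X:r(\lambda)=v\}$.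 A $k$-graph morphism is a degree-preserving functor. For $\mu,\nu\in\Lambda$, $\operatorname{MCE}(\mu,\nu)=\{\lambda\in\Lambda: d(\lambda)=d(\mu)\vee d(\nu),\ \lambda(0,d(\mu))=\mu,\ \lambda(0,d(\nu))=\nu\}$. $\Lambda$ is finitely aligned if $\operatorname{MCE}(\mu,\nu)$ is finite for all $\mu,\nu\in\Lambda$. A set $E\subseteq v\Lambda$ is exhaustive if for every $\mu\in v\Lambda$ there is $\lambda\in E$ with $\operatorname{MCE}(\mu,\lambda)\neq\emptyset$; $v\operatorname{FE}(\Lambda)$ is the set of finite exhaustive subsets of $v\Lambda$. A Cuntz-Krieger $\Lambda$-family is a set $\{t_\lambda:\lambda\in\Lambda\}$ of partial isometries in a $C^*$-algebra such that: (CK1) $\{t_v:v\in\Lambda^0\}$ are mutually orthogonal projections; (CK2) $t_\mu t_\nu=t_{\mu\nu}$ whenever $s(\mu)=r(\nu)$; (CK3) $t_\mu^*t_\nu=\sum_{\mu\alpha=\nu\beta\in\operatorname{MCE}(\mu,\nu)}t_\alpha t_\beta^*$ for all $\mu,\nu\in\Lambda$; (CK4) $\prod_{\lambda\in E}(t_v-t_\lambda t_\lambda^* )=0$ for all $v\in\Lambda^0$ and $E\in v\operatorname{FE}(\Lambda)$. $C^*(\Lambda)$ is the universal $C^*$-algebra generated by a Cuntz-Krieger $\Lambda$-family $\{s_\lambda:\lambda\in\Lambda\}$: for any Cuntz-Krieger $\Lambda$-family $\{t_\lambda\}$ there is a unique homomorphism $\pi_t$ with $\pi_t(s_\lambda)=t_\lambda$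 for all $\lambda$. Ideals are closed and two-sided. For $m\in(\mathbb{N}\cup\{\infty\})^k$, $\Omega_{k,m}$ is the $k$-graph with morphisms $(p,q)$, $p\le q\le m$, $p,q\in\mathbb{N}^k$, $r(p,q)=(p,p)$, $s(p,q)=(q,q)$, $d(p,q)=q-p$, $(p,q)(q,l)=(p,l)$; the vertex $(q,q)$ is written $q$. For a $k$-graph morphism $x:\Omega_{k,m}\to\Lambda$ put $r(x)=x(0)$, $d(x)=m$. For $n\in\mathbb{N}^k$, $n\le d(x)$, $\sigma^n(x):\Omega_{k,d(x)-n}\to\Lambda$ is $\sigma^n(x)(p,q)=x(n+p,n+q)$. For $\lambda\in\Lambda$ with $s(\lambda)=r(x)$, $\lambda x$ is the unique morphism $\Omega_{k,d(x)+d(\lambda)}\to\Lambda$ with $(\lambda x)(0,d(\lambda))=\lambda$ and $\sigma^{d(\lambda)}(\lambda x)=x$. $\partial\Lambda$ is the set of all $k$-graph morphisms $x:\Omega_{k,m}\to\Lambda$ ($m\in(\mathbb{N}\cup\{\infty\})^k$) such that for all $n\in\mathbb{N}^k$ with $n\le d(x)$ and all $E\in x(n)\operatorname{FE}(\Lambda)$ there exists $p\in\mathbb{N}^k$ with $p\le d(x)-n$ and $x(n,n+p)\in E$. The $\partial\Lambda$ representation: let $\{\zeta_x:x\in\partial\Lambda\}$ be the standard orthonormal basis of $\ell^2(\partial\Lambda)$, and for $\lambda\in\Lambda$ let $S_\lambda\zeta_x=\zeta_{\lambda x}$ if $s(\lambda)=r(x)$ and $S_\lambda\zeta_x=0$ otherwise.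 It is known that $\lambda x\in\partial\Lambda$ when $x\in\partial\Lambda$ and $s(\lambda)=r(x)$, and that $\{S_\lambda\}$ is a Cuntz-Krieger $\Lambda$-family in $\mathcal{B}(\ell^2(\partial\Lambda))$; $\pi_S$ is the representation of $C^*(\Lambda)$ with $\pi_S(s_\lambda)=S_\lambda$ for all $\lambda$. $\Lambda$ is aperiodic if for every pair of distinct $\alpha,\beta\in\Lambda$ with $s(\alpha)=s(\beta)$ there exists $\tau\in s(\alpha)\Lambda$ such that $\operatorname{MCE}(\alpha\tau,\beta\tau)=\emptyset$. *)

theory Defs
  imports
    "HOL-Analysis.Analysis"
    "HOL-Algebra.Module"
    "HOL-Library.Function_Algebras"
begin

section \<open>Higher-rank graphs\<close>

text \<open>
  The rank is the cardinality of the finite (hence nonempty) index type \<open>'k\<close>: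
  \<open>'k \<Rightarrow> nat\<close> and \<open>'k \<Rightarrow> enat\<close> are the monoids of finite and of extended degrees, with the
  pointwise order, lattice operations and arithmetic.  A small category is given by its morphisms
  alone, objects being identified with identity morphisms; \<open>\<mu> \<cdot> \<nu>\<close> is meaningful only when
  \<open>src \<mu> = rng \<nu>\<close>.
\<close>

record ('l, 'k) kgraph =
  paths :: "'l set"
  rng :: "'l \<Rightarrow> 'l"
  src :: "'l \<Rightarrow> 'l"
  cmp :: "'l \<Rightarrow> 'l \<Rightarrow> 'l" (infixr \<open>\<cdot>\<index>\<close> 75)
  deg :: "'l \<Rightarrow> 'k \<Rightarrow> nat"

locale k_graph =
  fixes \<Lambda> :: "('l, 'k::finite) kgraph" (structure)
  assumes countable_paths: "countable (paths \<Lambda>)"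
    and rng_closed: "\<mu> \<in> paths \<Lambda> \<Longrightarrow> rng \<Lambda> \<mu> \<in> paths \<Lambda>"
    and src_closed: "\<mu> \<in> paths \<Lambda> \<Longrightarrow> src \<Lambda> \<mu> \<in> paths \<Lambda>"
    and rng_src_of_rng:
      "\<mu> \<in> paths \<Lambda> \<Longrightarrow> rng \<Lambda> (rng \<Lambda> \<mu>) = rng \<Lambda> \<mu> \<and> src \<Lambda> (rng \<Lambda> \<mu>) = rng \<Lambda> \<mu>"
    and rng_src_of_src:
      "\<mu> \<in> paths \<Lambda> \<Longrightarrow> rng \<Lambda> (src \<Lambda> \<mu>) = src \<Lambda> \<mu> \<and> src \<Lambda> (src \<Lambda> \<mu>) = src \<Lambda> \<mu>"
    and cmp_closed:
      "\<lbrakk>\<mu> \<in> paths \<Lambda>; \<nu> \<in> paths \<Lambda>; src \<Lambda> \<mu> = rng \<Lambda> \<nu>\<rbrakk> \<Longrightarrow> \<mu> \<cdot> \<nu> \<in> paths \<Lambda>"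
    and rng_cmp:
      "\<lbrakk>\<mu> \<in> paths \<Lambda>; \<nu> \<in> paths \<Lambda>; src \<Lambda> \<mu> = rng \<Lambda> \<nu>\<rbrakk> \<Longrightarrow> rng \<Lambda> (\<mu> \<cdot> \<nu>) = rng \<Lambda> \<mu>"
    and src_cmp:
      "\<lbrakk>\<mu> \<in> paths \<Lambda>; \<nu> \<in> paths \<Lambda>; src \<Lambda> \<mu> = rng \<Lambda> \<nu>\<rbrakk> \<Longrightarrow> src \<Lambda> (\<mu> \<cdot> \<nu>) = src \<Lambda> \<nu>"
    and cmp_assoc:
      "\<lbrakk>\<mu> \<in> paths \<Lambda>; \<nu> \<in> paths \<Lambda>; \<tau> \<in> paths \<Lambda>; src \<Lambda> \<mu> = rng \<Lambda> \<nu>; src \<Lambda> \<nu> = rng \<Lambda> \<tau>\<rbrakk>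
        \<Longrightarrow> (\<mu> \<cdot> \<nu>) \<cdot> \<tau> = \<mu> \<cdot> (\<nu> \<cdot> \<tau>)"
    and rng_cmp_id: "\<mu> \<in> paths \<Lambda> \<Longrightarrow> rng \<Lambda> \<mu> \<cdot> \<mu> = \<mu>"
    and cmp_src_id: "\<mu> \<in> paths \<Lambda> \<Longrightarrow> \<mu> \<cdot> src \<Lambda> \<mu> = \<mu>"
    and deg_id: "\<mu> \<in> paths \<Lambda> \<Longrightarrow> deg \<Lambda> (rng \<Lambda> \<mu>) = 0 \<and> deg \<Lambda> (src \<Lambda> \<mu>) = 0"
    and deg_cmp:
      "\<lbrakk>\<mu> \<in> paths \<Lambda>; \<nu> \<in> paths \<Lambda>; src \<Lambda> \<mu> = rng \<Lambda> \<nu>\<rbrakk> \<Longrightarrow> deg \<Lambda> (\<mu> \<cdot> \<nu>) = deg \<Lambda> \<mu> + deg \<Lambda> \<nu>"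
    and factorisation:
      "\<lbrakk>\<tau> \<in> paths \<Lambda>; deg \<Lambda> \<tau> = m + n\<rbrakk> \<Longrightarrow>
        \<exists>!p. fst p \<in> paths \<Lambda> \<and> snd p \<in> paths \<Lambda> \<and> src \<Lambda> (fst p) = rng \<Lambda> (snd p) \<and>
          deg \<Lambda> (fst p) = m \<and> deg \<Lambda> (snd p) = n \<and> \<tau> = fst p \<cdot> snd p"

definition vertices :: "('l, 'k) kgraph \<Rightarrow> 'l set" where
  "vertices \<Lambda> = {v \<in> paths \<Lambda>. deg \<Lambda> v = 0}"

definition seg :: "('l, 'k) kgraph \<Rightarrow> 'l \<Rightarrow> ('k \<Rightarrow> nat) \<Rightarrow> ('k \<Rightarrow> nat) \<Rightarrow> 'l" where
  "seg \<Lambda> \<tau> m n = (THE \<mu>. \<mu> \<in> paths \<Lambda> \<and> deg \<Lambda> \<mu> = n - m \<and>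
     (\<exists>\<alpha> \<in> paths \<Lambda>. \<exists>\<beta> \<in> paths \<Lambda>. src \<Lambda> \<alpha> = rng \<Lambda> \<mu> \<and> src \<Lambda> \<mu> = rng \<Lambda> \<beta> \<and>
        deg \<Lambda> \<alpha> = m \<and> deg \<Lambda> \<beta> = deg \<Lambda> \<tau> - n \<and> \<tau> = \<alpha> \<cdot>\<^bsub>\<Lambda>\<^esub> \<mu> \<cdot>\<^bsub>\<Lambda>\<^esub> \<beta>))"

definition MCE :: "('l, 'k) kgraph \<Rightarrow> 'l \<Rightarrow> 'l \<Rightarrow> 'l set" where
  "MCE \<Lambda> \<mu> \<nu> = {\<tau> \<in> paths \<Lambda>. deg \<Lambda> \<tau> = sup (deg \<Lambda> \<mu>) (deg \<Lambda> \<nu>) \<and>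
     seg \<Lambda> \<tau> 0 (deg \<Lambda> \<mu>) = \<mu> \<and> seg \<Lambda> \<tau> 0 (deg \<Lambda> \<nu>) = \<nu>}"

definition finitely_aligned :: "('l, 'k) kgraph \<Rightarrow> bool" where
  "finitely_aligned \<Lambda> \<longleftrightarrow> (\<forall>\<mu> \<in> paths \<Lambda>. \<forall>\<nu> \<in> paths \<Lambda>. finite (MCE \<Lambda> \<mu> \<nu>))"

definition exhaustive :: "('l, 'k) kgraph \<Rightarrow> 'l \<Rightarrow> 'l set \<Rightarrow> bool" where
  "exhaustive \<Lambda> v E \<longleftrightarrow> E \<subseteq> {\<mu> \<in> paths \<Lambda>. rng \<Lambda> \<mu> = v} \<and>
     (\<forall>\<mu> \<in> paths \<Lambda>. rng \<Lambda> \<mu> = v \<longrightarrow> (\<exists>\<nu> \<in> E. MCE \<Lambda> \<mu> \<nu> \<noteq> {}))"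

definition FE :: "('l, 'k) kgraph \<Rightarrow> 'l \<Rightarrow> 'l set set" where
  "FE \<Lambda> v = {E. finite E \<and> exhaustive \<Lambda> v E}"

definition aperiodic :: "('l, 'k) kgraph \<Rightarrow> bool" where
  "aperiodic \<Lambda> \<longleftrightarrow>
     (\<forall>\<alpha> \<in> paths \<Lambda>. \<forall>\<beta> \<in> paths \<Lambda>. \<alpha> \<noteq> \<beta> \<and> src \<Lambda> \<alpha> = src \<Lambda> \<beta> \<longrightarrow>
        (\<exists>\<tau> \<in> paths \<Lambda>. rng \<Lambda> \<tau> = src \<Lambda> \<alpha> \<and> MCE \<Lambda> (\<alpha> \<cdot>\<^bsub>\<Lambda>\<^esub> \<tau>) (\<beta> \<cdot>\<^bsub>\<Lambda>\<^esub> \<tau>) = {}))"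


section \<open>The boundary-path space\<close>

definition emb :: "('k \<Rightarrow> nat) \<Rightarrow> 'k \<Rightarrow> enat" where
  "emb n = (\<lambda>i. enat (n i))"

definition Omega :: "('k \<Rightarrow> enat) \<Rightarrow> (('k \<Rightarrow> nat) \<times> ('k \<Rightarrow> nat), 'k) kgraph" where
  "Omega m = \<lparr>paths = {(p, q). p \<le> q \<and> emb q \<le> m},
     rng = (\<lambda>(p, q). (p, p)), src = (\<lambda>(p, q). (q, q)),
     cmp = (\<lambda>(p, q) (q', l). (p, l)), deg = (\<lambda>(p, q). q - p)\<rparr>"

definition kgraph_morphism :: "('a, 'k) kgraph \<Rightarrow> ('b, 'k) kgraph \<Rightarrow> ('a \<Rightarrow> 'b) \<Rightarrow> bool" where
  "kgraph_morphism \<Gamma> \<Lambda> \<phi> \<longleftrightarrow> \<phi> \<in> paths \<Gamma> \<rightarrow>\<^sub>E paths \<Lambda> \<and>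
     (\<forall>\<mu> \<in> paths \<Gamma>. deg \<Lambda> (\<phi> \<mu>) = deg \<Gamma> \<mu> \<and>
        rng \<Lambda> (\<phi> \<mu>) = \<phi> (rng \<Gamma> \<mu>) \<and> src \<Lambda> (\<phi> \<mu>) = \<phi> (src \<Gamma> \<mu>)) \<and>
     (\<forall>\<mu> \<in> paths \<Gamma>. \<forall>\<nu> \<in> paths \<Gamma>. src \<Gamma> \<mu> = rng \<Gamma> \<nu> \<longrightarrow> \<phi> (\<mu> \<cdot>\<^bsub>\<Gamma>\<^esub> \<nu>) = \<phi> \<mu> \<cdot>\<^bsub>\<Lambda>\<^esub> \<phi> \<nu>)"

text \<open>
  A morphism \<open>x: \<Omega>\<^sub>k\<^sub>,\<^sub>m \<rightarrow> \<Lambda>\<close> is the pair of its degree \<open>m\<close> and the underlying function, which is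
  \<open>undefined\<close> outside \<open>\<Omega>\<^sub>k\<^sub>,\<^sub>m\<close>, so that equality of pairs is equality of morphisms.
\<close>

type_synonym ('l, 'k) gpath = "('k \<Rightarrow> enat) \<times> (('k \<Rightarrow> nat) \<times> ('k \<Rightarrow> nat) \<Rightarrow> 'l)"

definition gpaths :: "('l, 'k) kgraph \<Rightarrow> ('l, 'k) gpath set" where
  "gpaths \<Lambda> = {(m, \<phi>). kgraph_morphism (Omega m) \<Lambda> \<phi>}"

definition gp_rng :: "('l, 'k) gpath \<Rightarrow> 'l" where
  "gp_rng x = snd x (0, 0)"

definition gp_shift :: "('k \<Rightarrow> nat) \<Rightarrow> ('l, 'k) gpath \<Rightarrow> ('l, 'k) gpath" where
  "gp_shift n x = (fst x - emb n,
     restrict (\<lambda>(p, q). snd x (n + p, n + q)) (paths (Omega (fst x - emb n))))"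

definition gp_prepend :: "('l, 'k) kgraph \<Rightarrow> 'l \<Rightarrow> ('l, 'k) gpath \<Rightarrow> ('l, 'k) gpath" where
  "gp_prepend \<Lambda> \<mu> x = (THE y. y \<in> gpaths \<Lambda> \<and> fst y = fst x + emb (deg \<Lambda> \<mu>) \<and>
     snd y (0, deg \<Lambda> \<mu>) = \<mu> \<and> gp_shift (deg \<Lambda> \<mu>) y = x)"

definition boundary :: "('l, 'k) kgraph \<Rightarrow> ('l, 'k) gpath set" where
  "boundary \<Lambda> = {x \<in> gpaths \<Lambda>. \<forall>n. emb n \<le> fst x \<longrightarrow>
     (\<forall>E \<in> FE \<Lambda> (snd x (n, n)). \<exists>p. emb p \<le> fst x - emb n \<and> snd x (n, n + p) \<in> E)}"


section \<open>C*-algebras\<close>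

definition complex_field :: "complex ring" where
  "complex_field = \<lparr>carrier = UNIV, mult = (*), one = 1, zero = 0, add = (+)\<rparr>"

text \<open>
  C*-algebras need not be unital: the inherited field \<open>one\<close> is not constrained and never used.
\<close>

record 'a cstar = "(complex, 'a) module" +
  adj :: "'a \<Rightarrow> 'a"
  nrm :: "'a \<Rightarrow> real"

text \<open>Cut down to the carrier because \<^locale>\<open>Metric_space\<close> asks for symmetry everywhere.\<close>

definition cstar_dist :: "'a cstar \<Rightarrow> 'a \<Rightarrow> 'a \<Rightarrow> real" where
  "cstar_dist A x y = (if x \<in> carrier A \<and> y \<in> carrier A then nrm A (x \<ominus>\<^bsub>A\<^esub> y) else 0)"

locale cstar_algebra = module complex_field A for A :: "'a cstar" (structure) +
  assumes mult_closed: "\<lbrakk>x \<in> carrier A; y \<in> carrier A\<rbrakk> \<Longrightarrow> x \<otimes> y \<in> carrier A"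
    and mult_assoc: "\<lbrakk>x \<in> carrier A; y \<in> carrier A; z \<in> carrier A\<rbrakk> \<Longrightarrow> (x \<otimes> y) \<otimes> z = x \<otimes> (y \<otimes> z)"
    and mult_l_distr:
      "\<lbrakk>x \<in> carrier A; y \<in> carrier A; z \<in> carrier A\<rbrakk> \<Longrightarrow> (x \<oplus> y) \<otimes> z = x \<otimes> z \<oplus> y \<otimes> z"
    and mult_r_distr:
      "\<lbrakk>x \<in> carrier A; y \<in> carrier A; z \<in> carrier A\<rbrakk> \<Longrightarrow> z \<otimes> (x \<oplus> y) = z \<otimes> x \<oplus> z \<otimes> y"
    and smult_mult_l: "\<lbrakk>x \<in> carrier A; y \<in> carrier A\<rbrakk> \<Longrightarrow> (c \<odot> x) \<otimes> y = c \<odot> (x \<otimes> y)"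
    and smult_mult_r: "\<lbrakk>x \<in> carrier A; y \<in> carrier A\<rbrakk> \<Longrightarrow> x \<otimes> (c \<odot> y) = c \<odot> (x \<otimes> y)"
    and adj_closed: "x \<in> carrier A \<Longrightarrow> adj A x \<in> carrier A"
    and adj_adj: "x \<in> carrier A \<Longrightarrow> adj A (adj A x) = x"
    and adj_add: "\<lbrakk>x \<in> carrier A; y \<in> carrier A\<rbrakk> \<Longrightarrow> adj A (x \<oplus> y) = adj A x \<oplus> adj A y"
    and adj_smult: "x \<in> carrier A \<Longrightarrow> adj A (c \<odot> x) = cnj c \<odot> adj A x"
    and adj_mult: "\<lbrakk>x \<in> carrier A; y \<in> carrier A\<rbrakk> \<Longrightarrow> adj A (x \<otimes> y) = adj A y \<otimes> adj A x"
    and nrm_nonneg: "x \<in> carrier A \<Longrightarrow> 0 \<le> nrm A x"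
    and nrm_eq_0: "x \<in> carrier A \<Longrightarrow> nrm A x = 0 \<longleftrightarrow> x = \<zero>"
    and nrm_add: "\<lbrakk>x \<in> carrier A; y \<in> carrier A\<rbrakk> \<Longrightarrow> nrm A (x \<oplus> y) \<le> nrm A x + nrm A y"
    and nrm_smult: "x \<in> carrier A \<Longrightarrow> nrm A (c \<odot> x) = cmod c * nrm A x"
    and nrm_mult: "\<lbrakk>x \<in> carrier A; y \<in> carrier A\<rbrakk> \<Longrightarrow> nrm A (x \<otimes> y) \<le> nrm A x * nrm A y"
    and cstar_identity: "x \<in> carrier A \<Longrightarrow> nrm A (adj A x \<otimes> x) = (nrm A x)\<^sup>2"
    and complete: "Metric_space.mcomplete (carrier A) (cstar_dist A)"

definition cstar_closed :: "'a cstar \<Rightarrow> 'a set \<Rightarrow> bool" where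
  "cstar_closed A I \<longleftrightarrow> closedin (Metric_space.mtopology (carrier A) (cstar_dist A)) I"

definition cstar_generates :: "'a cstar \<Rightarrow> 'a set \<Rightarrow> bool" where
  "cstar_generates A G \<longleftrightarrow> G \<subseteq> carrier A \<and>
     (\<forall>C. G \<subseteq> C \<and> C \<subseteq> carrier A \<and> cstar_closed A C \<and> \<zero>\<^bsub>A\<^esub> \<in> C \<and>
        (\<forall>x \<in> C. \<forall>y \<in> C. x \<oplus>\<^bsub>A\<^esub> y \<in> C \<and> x \<otimes>\<^bsub>A\<^esub> y \<in> C) \<and>
        (\<forall>x \<in> C. adj A x \<in> C \<and> (\<forall>c. c \<odot>\<^bsub>A\<^esub> x \<in> C))
        \<longrightarrow> C = carrier A)"

definition cstar_ideal :: "'a cstar \<Rightarrow> 'a set \<Rightarrow> bool" where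
  "cstar_ideal A I \<longleftrightarrow> I \<subseteq> carrier A \<and> cstar_closed A I \<and> \<zero>\<^bsub>A\<^esub> \<in> I \<and>
     (\<forall>x \<in> I. \<forall>y \<in> I. x \<oplus>\<^bsub>A\<^esub> y \<in> I) \<and> (\<forall>x \<in> I. \<forall>c. c \<odot>\<^bsub>A\<^esub> x \<in> I) \<and>
     (\<forall>x \<in> I. \<forall>a \<in> carrier A. a \<otimes>\<^bsub>A\<^esub> x \<in> I \<and> x \<otimes>\<^bsub>A\<^esub> a \<in> I)"

definition cstar_hom :: "'a cstar \<Rightarrow> 'b cstar \<Rightarrow> ('a \<Rightarrow> 'b) set" where
  "cstar_hom A B = {\<pi> \<in> carrier A \<rightarrow>\<^sub>E carrier B.
     (\<forall>x \<in> carrier A. \<forall>y \<in> carrier A.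
        \<pi> (x \<oplus>\<^bsub>A\<^esub> y) = \<pi> x \<oplus>\<^bsub>B\<^esub> \<pi> y \<and> \<pi> (x \<otimes>\<^bsub>A\<^esub> y) = \<pi> x \<otimes>\<^bsub>B\<^esub> \<pi> y) \<and>
     (\<forall>x \<in> carrier A. \<pi> (adj A x) = adj B (\<pi> x) \<and> (\<forall>c. \<pi> (c \<odot>\<^bsub>A\<^esub> x) = c \<odot>\<^bsub>B\<^esub> \<pi> x))}"


section \<open>Bounded operators on square-summable families\<close>

definition ell2 :: "'x set \<Rightarrow> ('x \<Rightarrow> complex) set" where
  "ell2 X = {f. (\<forall>x. x \<notin> X \<longrightarrow> f x = 0) \<and> (\<lambda>x. (cmod (f x))\<^sup>2) summable_on X}"

definition ell2_inner :: "'x set \<Rightarrow> ('x \<Rightarrow> complex) \<Rightarrow> ('x \<Rightarrow> complex) \<Rightarrow> complex" where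
  "ell2_inner X f g = (\<Sum>\<^sub>\<infinity>x\<in>X. f x * cnj (g x))"

definition ell2_norm :: "'x set \<Rightarrow> ('x \<Rightarrow> complex) \<Rightarrow> real" where
  "ell2_norm X f = sqrt (\<Sum>\<^sub>\<infinity>x\<in>X. (cmod (f x))\<^sup>2)"

definition ell2_basis :: "'x \<Rightarrow> 'x \<Rightarrow> complex" where
  "ell2_basis x = (\<lambda>y. if y = x then 1 else 0)"

type_synonym 'x ell2_op = "('x \<Rightarrow> complex) \<Rightarrow> ('x \<Rightarrow> complex)"

definition bounded_ops :: "'x set \<Rightarrow> 'x ell2_op set" where
  "bounded_ops X = {T \<in> ell2 X \<rightarrow>\<^sub>E ell2 X.
     (\<forall>f \<in> ell2 X. \<forall>g \<in> ell2 X. T (\<lambda>x. f x + g x) = (\<lambda>x. T f x + T g x)) \<and>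
     (\<forall>c. \<forall>f \<in> ell2 X. T (\<lambda>x. c * f x) = (\<lambda>x. c * T f x)) \<and>
     (\<exists>K. \<forall>f \<in> ell2 X. ell2_norm X (T f) \<le> K * ell2_norm X f)}"

definition B_ell2 :: "'x set \<Rightarrow> 'x ell2_op cstar" where
  "B_ell2 X = \<lparr>carrier = bounded_ops X,
     mult = compose (ell2 X),
     one = restrict id (ell2 X),
     zero = restrict (\<lambda>f x. 0) (ell2 X),
     add = (\<lambda>S T. restrict (\<lambda>f x. S f x + T f x) (ell2 X)),
     smult = (\<lambda>c T. restrict (\<lambda>f x. c * T f x) (ell2 X)),
     adj = (\<lambda>T. THE T'. T' \<in> bounded_ops X \<and>
       (\<forall>f \<in> ell2 X. \<forall>g \<in> ell2 X. ell2_inner X (T f) g = ell2_inner X f (T' g))),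
     nrm = (\<lambda>T. SUP f \<in> {f \<in> ell2 X. ell2_norm X f \<le> 1}. ell2_norm X (T f))\<rparr>"


section \<open>Cuntz-Krieger families and the C*-algebra of a higher-rank graph\<close>

text \<open>
  In (CK4) the product over the finite set \<open>E\<close> is taken along an arbitrary enumeration of \<open>E\<close>
  (the factors commute, by (CK3)).  All factors lie in the corner of \<open>A\<close> with unit \<open>t v\<close>, which
  therefore serves as the empty product; this changes nothing since \<open>E\<close> is nonempty.
\<close>

locale CK_family = cstar_algebra A
  for \<Lambda> :: "('l, 'k::finite) kgraph" and A :: "'a cstar" (structure) and t :: "'l \<Rightarrow> 'a" +
  assumes in_carrier: "\<mu> \<in> paths \<Lambda> \<Longrightarrow> t \<mu> \<in> carrier A"
    and partial_isometry: "\<mu> \<in> paths \<Lambda> \<Longrightarrow> t \<mu> \<otimes> adj A (t \<mu>) \<otimes> t \<mu> = t \<mu>"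
    and CK1_projection: "v \<in> vertices \<Lambda> \<Longrightarrow> adj A (t v) = t v \<and> t v \<otimes> t v = t v"
    and CK1_orthogonal: "\<lbrakk>v \<in> vertices \<Lambda>; w \<in> vertices \<Lambda>; v \<noteq> w\<rbrakk> \<Longrightarrow> t v \<otimes> t w = \<zero>"
    and CK2: "\<lbrakk>\<mu> \<in> paths \<Lambda>; \<nu> \<in> paths \<Lambda>; src \<Lambda> \<mu> = rng \<Lambda> \<nu>\<rbrakk> \<Longrightarrow> t \<mu> \<otimes> t \<nu> = t (\<mu> \<cdot>\<^bsub>\<Lambda>\<^esub> \<nu>)"
    and CK3: "\<lbrakk>\<mu> \<in> paths \<Lambda>; \<nu> \<in> paths \<Lambda>\<rbrakk> \<Longrightarrow>
      adj A (t \<mu>) \<otimes> t \<nu> =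
        finsum A (\<lambda>(\<alpha>, \<beta>). t \<alpha> \<otimes> adj A (t \<beta>))
          {(\<alpha>, \<beta>). \<alpha> \<in> paths \<Lambda> \<and> \<beta> \<in> paths \<Lambda> \<and> src \<Lambda> \<mu> = rng \<Lambda> \<alpha> \<and> src \<Lambda> \<nu> = rng \<Lambda> \<beta> \<and>
             \<mu> \<cdot>\<^bsub>\<Lambda>\<^esub> \<alpha> = \<nu> \<cdot>\<^bsub>\<Lambda>\<^esub> \<beta> \<and> \<mu> \<cdot>\<^bsub>\<Lambda>\<^esub> \<alpha> \<in> MCE \<Lambda> \<mu> \<nu>}"
    and CK4: "\<lbrakk>v \<in> vertices \<Lambda>; E \<in> FE \<Lambda> v; distinct es; set es = E\<rbrakk> \<Longrightarrow>
      foldr (\<lambda>\<mu> a. (t v \<ominus> t \<mu> \<otimes> adj A (t \<mu>)) \<otimes> a) es (t v) = \<zero>"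

definition CK_universal_for ::
    "'b cstar itself \<Rightarrow> ('l, 'k::finite) kgraph \<Rightarrow> 'a cstar \<Rightarrow> ('l \<Rightarrow> 'a) \<Rightarrow> bool" where
  "CK_universal_for _ \<Lambda> A s \<longleftrightarrow>
     (\<forall>(B :: 'b cstar) t. CK_family \<Lambda> B t \<longrightarrow>
        (\<exists>!\<pi>. \<pi> \<in> cstar_hom A B \<and> (\<forall>\<mu> \<in> paths \<Lambda>. \<pi> (s \<mu>) = t \<mu>)))"

text \<open>
  \<open>(A, s)\<close> is \<open>C*(\<Lambda>)\<close> with its universal family.  HOL cannot quantify over types inside a formula,
  so the target algebras range over all C*-algebras whose carrier is a subset of one of two types:
  that of \<open>A\<close>, and that of the operators on \<open>l2\<close> of the set of paths.  The second one alone is large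
  enough for the property to determine \<open>(A, s)\<close> up to isomorphism and to yield the universal
  property for targets on every type: the image of a Cuntz-Krieger family of the countable
  category \<open>\<Lambda>\<close> generates a separable C*-algebra, which has at most continuum many elements, and
  the type of operators has at least that many.
\<close>

definition is_kgraph_cstar ::
    "('l, 'k::finite) kgraph \<Rightarrow> 'a cstar \<Rightarrow> ('l \<Rightarrow> 'a) \<Rightarrow> bool" where
  "is_kgraph_cstar \<Lambda> A s \<longleftrightarrow> CK_family \<Lambda> A s \<and> cstar_generates A (s ` paths \<Lambda>) \<and>
     CK_universal_for TYPE('a cstar) \<Lambda> A s \<and>
     CK_universal_for TYPE(('l, 'k) gpath ell2_op cstar) \<Lambda> A s"

definition induced_hom ::
    "('l, 'k) kgraph \<Rightarrow> 'a cstar \<Rightarrow> ('l \<Rightarrow> 'a) \<Rightarrow> 'b cstar \<Rightarrow> ('l \<Rightarrow> 'b) \<Rightarrow> 'a \<Rightarrow> 'b" where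
  "induced_hom \<Lambda> A s B t = (THE \<pi>. \<pi> \<in> cstar_hom A B \<and> (\<forall>\<mu> \<in> paths \<Lambda>. \<pi> (s \<mu>) = t \<mu>))"


section \<open>The boundary-path representation\<close>

definition boundary_op :: "('l, 'k) kgraph \<Rightarrow> 'l \<Rightarrow> ('l, 'k) gpath ell2_op" where
  "boundary_op \<Lambda> \<mu> = (THE T. T \<in> bounded_ops (boundary \<Lambda>) \<and>
     (\<forall>x \<in> boundary \<Lambda>. T (ell2_basis x) =
        (if src \<Lambda> \<mu> = gp_rng x then ell2_basis (gp_prepend \<Lambda> \<mu> x) else (\<lambda>_. 0))))"

definition boundary_rep ::
    "('l, 'k) kgraph \<Rightarrow> 'a cstar \<Rightarrow> ('l \<Rightarrow> 'a) \<Rightarrow> 'a \<Rightarrow> ('l, 'k) gpath ell2_op" where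
  "boundary_rep \<Lambda> A s = induced_hom \<Lambda> A s (B_ell2 (boundary \<Lambda>)) (boundary_op \<Lambda>)"

end

theory Submission
  imports Defs
begin

text \<open>
  The key point is that one concrete representation \<open>\<rho>\<close> of \<open>C*(\<Lambda>)\<close> is isometric: the one on
  \<open>\<ell>\<^sup>2(\<partial>\<Lambda> \<times> \<int>\<^sup>k)\<close> in which a path also adds its degree to the second coordinate.  This grading replaces the
  gauge action: the norm of a homogeneous component of \<open>\<rho>(x)\<close> is at most \<open>\<parallel>\<rho>(x)\<parallel>\<close>.  In degree 0, finitely
  many generators lie in a span in which gap projections of the form (CK4) separate finitely many matrix
  entries, each of which is seen by \<open>\<rho>\<close>.  Both facts give bounds \<open>\<parallel>x\<parallel> \<le> C \<parallel>\<rho>(x)\<parallel>\<close>, where \<open>C\<close> grows only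
  polynomially when \<open>x\<close> is replaced by powers of \<open>x\<^sup>* x\<close>, so that in fact \<open>\<parallel>x\<parallel> \<le> \<parallel>\<rho>(x)\<parallel>\<close>.

  (1) implies (2): if \<open>a \<noteq> 0\<close> lies in an ideal, then \<open>\<rho>(a)\<close> has a non-zero matrix coefficient.  Approximate
  \<open>a\<close> by a finite combination of elements \<open>t\<^sub>\<mu> t\<^sub>\<nu>\<^sup>*\<close> and compress it to \<open>t\<^sub>p\<^sup>* a t\<^sub>q\<close>, with paths \<open>p\<close> and \<open>q\<close> so
  long that by aperiodicity only a multiple of a vertex projection remains; this projection has distance less
  than 1 from the ideal and hence belongs to it.

  (2) implies (3), because \<open>\<pi>\<^sub>S\<close> kills no vertex projection.

  (3) implies (1): if \<open>\<alpha> \<noteq> \<beta>\<close> violate aperiodicity, then \<open>\<alpha>x = \<beta>x\<close> for every boundary path \<open>x\<close>, so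
  \<open>S\<^sub>\<alpha> = S\<^sub>\<beta>\<close>, while \<open>\<rho>\<close> shows that \<open>s\<^sub>\<alpha> \<noteq> s\<^sub>\<beta>\<close>.
\<close>

section \<open>Paths and minimal common extensions\<close>

text \<open>The constants come from crude counting. A finite set \<open>P\<close> of paths that is
  closed under minimal common extensions and under swaps of initial segments gives a
  finite-dimensional algebra of degree 0. Cutting an element of it by gaps on both sides yields
  \<open>card P\<close> squared pieces; powers stay in the same algebra, so this constant does not
  grow. An element with degrees in a box of radius R has at most (2R+1)^k homogeneous components,
  which is the price of the triangle inequality; its n-th power has degrees in a box of radius nR,
  hence the polynomial growth. Taking n-th roots replaces conditional expectations and integration
  over the torus. A gap is either zero by (CK4), when the paths that it removes are exhaustive, or
  some path avoids all of them and exhibits a vertex projection. This dichotomy is where (CK4) meets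
  the representation. Exhaustiveness is used once more on the side of the points: a boundary path
  outside finitely many cylinders is separated from them by a single finite path. Together with
  aperiodicity this supplies the long paths of the compression.\<close>

definition prefix_of :: "('l, 'k) kgraph \<Rightarrow> 'l \<Rightarrow> 'l \<Rightarrow> bool" where
  "prefix_of \<Lambda> \<mu> \<tau> \<longleftrightarrow> \<mu> \<in> paths \<Lambda> \<and> (\<exists>\<alpha> \<in> paths \<Lambda>. src \<Lambda> \<mu> = rng \<Lambda> \<alpha> \<and> \<tau> = \<mu> \<cdot>\<^bsub>\<Lambda>\<^esub> \<alpha>)"

context k_graph
begin

abbreviation "\<P> \<equiv> paths \<Lambda>"
abbreviation "\<V> \<equiv> vertices \<Lambda>"
abbreviation "\<r> \<equiv> rng \<Lambda>"
abbreviation "\<s> \<equiv> src \<Lambda>"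
abbreviation "\<d> \<equiv> deg \<Lambda>"
abbreviation "\<M> \<equiv> MCE \<Lambda>"
abbreviation "\<E> \<equiv> FE \<Lambda>"
abbreviation "\<G> \<equiv> gpaths \<Lambda>"
abbreviation "\<B> \<equiv> boundary \<Lambda>"
abbreviation "prepend \<equiv> gp_prepend \<Lambda>"
abbreviation prefix (infix \<open>\<preceq>\<close> 50) where "\<mu> \<preceq> \<tau> \<equiv> prefix_of \<Lambda> \<mu> \<tau>"

section \<open>Factorisation, vertices and segments\<close>

lemma factor_ex:
  assumes "\<tau> \<in> \<P>" "m \<le> \<d> \<tau>"
  obtains \<alpha> \<beta> where "\<alpha> \<in> \<P>" "\<beta> \<in> \<P>" "\<s> \<alpha> = \<r> \<beta>" "\<d> \<alpha> = m"
    "\<d> \<beta> = \<d> \<tau> - m" "\<tau> = \<alpha> \<cdot> \<beta>"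
proof -
  have "\<d> \<tau> = m + (\<d> \<tau> - m)"
    using assms(2) by (auto simp: fun_eq_iff le_fun_def)
  then show ?thesis using factorisation[OF assms(1)] that by blast
qed

lemma factor_unique:
  assumes "\<alpha> \<in> \<P>" "\<beta> \<in> \<P>" "\<s> \<alpha> = \<r> \<beta>"
    "\<alpha>' \<in> \<P>" "\<beta>' \<in> \<P>" "\<s> \<alpha>' = \<r> \<beta>'"
    "\<alpha> \<cdot> \<beta> = \<alpha>' \<cdot> \<beta>'" "\<d> \<alpha> = \<d> \<alpha>'"
  shows "\<alpha> = \<alpha>'" "\<beta> = \<beta>'"
proof -
  have d: "\<d> (\<alpha> \<cdot> \<beta>) = \<d> \<alpha> + \<d> \<beta>" "\<d> (\<alpha> \<cdot> \<beta>) = \<d> \<alpha> + \<d> \<beta>'"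
    using deg_cmp assms by metis+
  then have db: "\<d> \<beta> = \<d> \<beta>'" by simp
  let ?P = "\<lambda>q. fst q \<in> \<P> \<and> snd q \<in> \<P> \<and> \<s> (fst q) = \<r> (snd q) \<and>
    \<d> (fst q) = \<d> \<alpha> \<and> \<d> (snd q) = \<d> \<beta> \<and> \<alpha> \<cdot> \<beta> = fst q \<cdot> snd q"
  have "\<exists>!q. ?P q"
    by (rule factorisation[OF cmp_closed d(1)]) (fact assms)+
  then have "The ?P = (\<alpha>, \<beta>)" "The ?P = (\<alpha>', \<beta>')"
    by (rule the1_equality; use assms db in simp)+
  then have "(\<alpha>, \<beta>) = (\<alpha>', \<beta>')" by simp
  then show "\<alpha> = \<alpha>'" "\<beta> = \<beta>'" by auto
qed

lemma cancel_left:
  assumes "\<alpha> \<in> \<P>" "\<beta> \<in> \<P>" "\<beta>' \<in> \<P>" "\<s> \<alpha> = \<r> \<beta>" "\<s> \<alpha> = \<r> \<beta>'"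
    "\<alpha> \<cdot> \<beta> = \<alpha> \<cdot> \<beta>'"
  shows "\<beta> = \<beta>'"
  using factor_unique(2)[OF assms(1,2,4,1,3,5,6) refl] .

lemma cancel_right:
  assumes "\<alpha> \<in> \<P>" "\<alpha>' \<in> \<P>" "\<beta> \<in> \<P>" "\<s> \<alpha> = \<r> \<beta>" "\<s> \<alpha>' = \<r> \<beta>"
    "\<alpha> \<cdot> \<beta> = \<alpha>' \<cdot> \<beta>"
  shows "\<alpha> = \<alpha>'"
proof -
  have "\<d> \<alpha> + \<d> \<beta> = \<d> \<alpha>' + \<d> \<beta>" using deg_cmp assms by metis
  then show ?thesis using factor_unique(1)[OF assms(1,3,4,2,3,5,6)] by simp
qed

text \<open>A path of degree 0 factors as \<open>\<r> v \<cdot> v\<close> and as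
  \<open>v \<cdot> \<s> v\<close>, both with degrees (0, 0); uniqueness makes it an
  identity.\<close>

lemma vertexD:
  assumes "v \<in> \<V>"
  shows "v \<in> \<P>" "\<r> v = v" "\<s> v = v" "\<d> v = 0"
proof -
  show v: "v \<in> \<P>" "\<d> v = 0" using assms by (auto simp: vertices_def)
  have "\<r> v = v"
    using factor_unique(1)[of "\<r> v" v v "\<s> v"] v rng_closed src_closed rng_src_of_rng
      rng_src_of_src rng_cmp_id cmp_src_id deg_id by simp
  then show "\<r> v = v" "\<s> v = v" using rng_src_of_rng[OF v(1)] by auto
qed

lemma rng_vertex [simp, intro]: "\<mu> \<in> \<P> \<Longrightarrow> \<r> \<mu> \<in> \<V>"
  and src_vertex [simp, intro]: "\<mu> \<in> \<P> \<Longrightarrow> \<s> \<mu> \<in> \<V>"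
  by (simp_all add: vertices_def rng_closed src_closed deg_id)

lemma deg_0_iff: "\<mu> \<in> \<P> \<Longrightarrow> \<d> \<mu> = 0 \<longleftrightarrow> \<mu> \<in> \<V>"
  by (simp add: vertices_def)

declare rng_closed [simp, intro] src_closed [simp, intro] cmp_closed [simp, intro]
  rng_cmp [simp] src_cmp [simp] rng_cmp_id [simp] cmp_src_id [simp]

lemma rng_src_simps [simp]:
  assumes "\<mu> \<in> \<P>"
  shows "\<r> (\<r> \<mu>) = \<r> \<mu>" "\<s> (\<r> \<mu>) = \<r> \<mu>"
    "\<r> (\<s> \<mu>) = \<s> \<mu>" "\<s> (\<s> \<mu>) = \<s> \<mu>"
    "\<d> (\<r> \<mu>) = 0" "\<d> (\<s> \<mu>) = 0"
  using assms rng_src_of_rng rng_src_of_src deg_id by auto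

text \<open>Uniqueness of the middle piece is unique factorisation used twice: cut off
  \<open>\<alpha>\<close>, then split what is left.\<close>

lemma seg_eq:
  assumes "\<alpha> \<in> \<P>" "\<mu> \<in> \<P>" "\<beta> \<in> \<P>" "\<s> \<alpha> = \<r> \<mu>" "\<s> \<mu> = \<r> \<beta>"
  shows "seg \<Lambda> (\<alpha> \<cdot> \<mu> \<cdot> \<beta>) (\<d> \<alpha>) (\<d> \<alpha> + \<d> \<mu>) = \<mu>"
  unfolding seg_def
proof (rule the_equality)
  have d: "\<d> (\<alpha> \<cdot> \<mu> \<cdot> \<beta>) = \<d> \<alpha> + (\<d> \<mu> + \<d> \<beta>)"
    using assms by (simp add: deg_cmp)
  have d': "\<d> \<beta> = \<d> (\<alpha> \<cdot> \<mu> \<cdot> \<beta>) - (\<d> \<alpha> + \<d> \<mu>)"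
    "\<d> \<mu> = \<d> \<alpha> + \<d> \<mu> - \<d> \<alpha>"
    unfolding d by (auto simp: fun_eq_iff)
  show "\<mu> \<in> \<P> \<and> \<d> \<mu> = \<d> \<alpha> + \<d> \<mu> - \<d> \<alpha> \<and>
    (\<exists>\<alpha>'\<in>\<P>. \<exists>\<beta>'\<in>\<P>. \<s> \<alpha>' = \<r> \<mu> \<and> \<s> \<mu> = \<r> \<beta>' \<and> \<d> \<alpha>' = \<d> \<alpha> \<and>
        \<d> \<beta>' = \<d> (\<alpha> \<cdot> \<mu> \<cdot> \<beta>) - (\<d> \<alpha> + \<d> \<mu>) \<and> \<alpha> \<cdot> \<mu> \<cdot> \<beta> = \<alpha>' \<cdot> \<mu> \<cdot> \<beta>')"
    using assms d' by blast
next
  fix \<nu>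
  assume "\<nu> \<in> \<P> \<and> \<d> \<nu> = \<d> \<alpha> + \<d> \<mu> - \<d> \<alpha> \<and>
    (\<exists>\<alpha>'\<in>\<P>. \<exists>\<beta>'\<in>\<P>. \<s> \<alpha>' = \<r> \<nu> \<and> \<s> \<nu> = \<r> \<beta>' \<and> \<d> \<alpha>' = \<d> \<alpha> \<and>
        \<d> \<beta>' = \<d> (\<alpha> \<cdot> \<mu> \<cdot> \<beta>) - (\<d> \<alpha> + \<d> \<mu>) \<and> \<alpha> \<cdot> \<mu> \<cdot> \<beta> = \<alpha>' \<cdot> \<nu> \<cdot> \<beta>')"
  then obtain \<alpha>' \<beta>' where *: "\<nu> \<in> \<P>" "\<d> \<nu> = \<d> \<alpha> + \<d> \<mu> - \<d> \<alpha>"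
    "\<alpha>'\<in>\<P>" "\<beta>'\<in>\<P>" "\<s> \<alpha>' = \<r> \<nu>" "\<s> \<nu> = \<r> \<beta>'"
    "\<d> \<alpha>' = \<d> \<alpha>" "\<alpha> \<cdot> \<mu> \<cdot> \<beta> = \<alpha>' \<cdot> \<nu> \<cdot> \<beta>'" by blast
  have "\<mu> \<cdot> \<beta> = \<nu> \<cdot> \<beta>'"
    using factor_unique(2)[of \<alpha> "\<mu> \<cdot> \<beta>" \<alpha>' "\<nu> \<cdot> \<beta>'"] assms * by auto
  moreover have "\<d> \<mu> = \<d> \<nu>" using *(2) by (auto simp: fun_eq_iff)
  ultimately show "\<nu> = \<mu>"
    using factor_unique(1)[of \<mu> \<beta> \<nu> \<beta>'] assms * by auto
qed

lemma seg_initial: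
  assumes "\<mu> \<in> \<P>" "\<beta> \<in> \<P>" "\<s> \<mu> = \<r> \<beta>"
  shows "seg \<Lambda> (\<mu> \<cdot> \<beta>) 0 (\<d> \<mu>) = \<mu>"
  using seg_eq[of "\<r> \<mu>" \<mu> \<beta>] assms
  by (simp flip: cmp_assoc)

section \<open>The order by initial segments\<close>

lemma prefix_ofI: "\<lbrakk>\<mu> \<in> \<P>; \<alpha> \<in> \<P>; \<s> \<mu> = \<r> \<alpha>\<rbrakk> \<Longrightarrow> \<mu> \<preceq> \<mu> \<cdot> \<alpha>"
  by (auto simp: prefix_of_def)

lemma prefix_ofE:
  assumes "\<mu> \<preceq> \<tau>"
  obtains \<alpha> where "\<mu> \<in> \<P>" "\<alpha> \<in> \<P>" "\<s> \<mu> = \<r> \<alpha>" "\<tau> = \<mu> \<cdot> \<alpha>"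
  using assms by (auto simp: prefix_of_def)

lemma prefix_of_paths: "\<mu> \<preceq> \<tau> \<Longrightarrow> \<mu> \<in> \<P>" "\<mu> \<preceq> \<tau> \<Longrightarrow> \<tau> \<in> \<P>"
  by (auto elim: prefix_ofE)

lemma prefix_of_rng: "\<mu> \<preceq> \<tau> \<Longrightarrow> \<r> \<mu> = \<r> \<tau>"
  by (auto elim: prefix_ofE)

lemma prefix_of_refl [simp]: "\<mu> \<in> \<P> \<Longrightarrow> \<mu> \<preceq> \<mu>"
  using prefix_ofI[of \<mu> "\<s> \<mu>"] by simp

lemma prefix_of_trans: "\<lbrakk>\<mu> \<preceq> \<nu>; \<nu> \<preceq> \<tau>\<rbrakk> \<Longrightarrow> \<mu> \<preceq> \<tau>"
  by (elim prefix_ofE) (auto simp: cmp_assoc intro!: prefix_ofI)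

lemma prefix_of_deg: "\<mu> \<preceq> \<tau> \<Longrightarrow> \<d> \<mu> \<le> \<d> \<tau>"
  by (elim prefix_ofE) (auto simp: deg_cmp le_fun_def)

text \<open>The initial segment of \<open>\<nu>\<close> of degree \<open>\<d> \<mu>\<close> is also
  one of \<open>\<tau>\<close>, and \<open>\<tau>\<close> has only one of that degree.\<close>

lemma prefix_of_comparable:
  assumes "\<mu> \<preceq> \<tau>" "\<nu> \<preceq> \<tau>" "\<d> \<mu> \<le> \<d> \<nu>"
  shows "\<mu> \<preceq> \<nu>"
proof -
  obtain \<alpha> where a: "\<mu> \<in> \<P>" "\<alpha> \<in> \<P>" "\<s> \<mu> = \<r> \<alpha>" "\<tau> = \<mu> \<cdot> \<alpha>"
    using assms(1) by (rule prefix_ofE)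
  obtain \<beta> where b: "\<nu> \<in> \<P>" "\<beta> \<in> \<P>" "\<s> \<nu> = \<r> \<beta>" "\<tau> = \<nu> \<cdot> \<beta>"
    using assms(2) by (rule prefix_ofE)
  obtain \<mu>' \<gamma> where c: "\<mu>' \<in> \<P>" "\<gamma> \<in> \<P>" "\<s> \<mu>' = \<r> \<gamma>" "\<d> \<mu>' = \<d> \<mu>"
    "\<nu> = \<mu>' \<cdot> \<gamma>" using factor_ex[OF b(1) assms(3)] by metis
  have "\<mu> = \<mu>'"
    using factor_unique(1)[of \<mu> \<alpha> \<mu>' "\<gamma> \<cdot> \<beta>"] a b c by (simp add: cmp_assoc)
  then show ?thesis using c by (auto intro: prefix_ofI)
qed

lemma prefix_of_eq:
  assumes "\<mu> \<preceq> \<tau>" "\<nu> \<preceq> \<tau>" "\<d> \<mu> = \<d> \<nu>"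
  shows "\<mu> = \<nu>"
proof -
  obtain \<alpha> where a: "\<mu> \<in> \<P>" "\<alpha> \<in> \<P>" "\<s> \<mu> = \<r> \<alpha>" "\<tau> = \<mu> \<cdot> \<alpha>"
    using assms(1) by (rule prefix_ofE)
  obtain \<beta> where b: "\<nu> \<in> \<P>" "\<beta> \<in> \<P>" "\<s> \<nu> = \<r> \<beta>" "\<tau> = \<nu> \<cdot> \<beta>"
    using assms(2) by (rule prefix_ofE)
  show ?thesis using factor_unique(1)[OF a(1-3) b(1-3)] a(4) b(4) assms(3) by simp
qed

lemma prefix_of_same_deg: "\<lbrakk>\<mu> \<preceq> \<tau>; \<d> \<mu> = \<d> \<tau>\<rbrakk> \<Longrightarrow> \<mu> = \<tau>"
  using prefix_of_eq[of \<mu> \<tau> \<tau>] prefix_of_refl[OF prefix_of_paths(2)] by simp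

lemma prefix_of_ex:
  assumes "\<tau> \<in> \<P>" "m \<le> \<d> \<tau>"
  obtains \<alpha> where "\<alpha> \<preceq> \<tau>" "\<d> \<alpha> = m"
proof -
  obtain \<alpha> \<beta> where "\<alpha> \<in> \<P>" "\<beta> \<in> \<P>" "\<s> \<alpha> = \<r> \<beta>" "\<d> \<alpha> = m" "\<tau> = \<alpha> \<cdot> \<beta>"
    using factor_ex[OF assms] by metis
  then show ?thesis using prefix_ofI[of \<alpha> \<beta>] that[of \<alpha>] by simp
qed

lemma prefix_of_cmp:
  assumes "\<mu> \<in> \<P>" "\<alpha> \<in> \<P>" "\<beta> \<in> \<P>" "\<s> \<mu> = \<r> \<alpha>" "\<s> \<mu> = \<r> \<beta>"
  shows "\<mu> \<cdot> \<alpha> \<preceq> \<mu> \<cdot> \<beta> \<longleftrightarrow> \<alpha> \<preceq> \<beta>"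
proof
  assume "\<mu> \<cdot> \<alpha> \<preceq> \<mu> \<cdot> \<beta>"
  then obtain \<gamma> where g: "\<gamma> \<in> \<P>" "\<s> (\<mu> \<cdot> \<alpha>) = \<r> \<gamma>" "\<mu> \<cdot> \<beta> = (\<mu> \<cdot> \<alpha>) \<cdot> \<gamma>"
    by (rule prefix_ofE)
  then have s: "\<s> \<alpha> = \<r> \<gamma>" using assms by simp
  have "\<mu> \<cdot> \<beta> = \<mu> \<cdot> \<alpha> \<cdot> \<gamma>"
    unfolding g(3) by (rule cmp_assoc[OF assms(1,2) g(1) assms(4) s])
  then have "\<beta> = \<alpha> \<cdot> \<gamma>"
    using cancel_left[of \<mu> \<beta> "\<alpha> \<cdot> \<gamma>"] assms g s by simp
  then show "\<alpha> \<preceq> \<beta>"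
    using prefix_ofI[OF assms(2) g(1) s] by simp
next
  assume "\<alpha> \<preceq> \<beta>"
  then obtain \<gamma> where g: "\<gamma> \<in> \<P>" "\<s> \<alpha> = \<r> \<gamma>" "\<beta> = \<alpha> \<cdot> \<gamma>"
    by (rule prefix_ofE)
  have "\<mu> \<cdot> \<beta> = (\<mu> \<cdot> \<alpha>) \<cdot> \<gamma>"
    unfolding g(3) by (rule cmp_assoc[OF assms(1,2) g(1) assms(4) g(2), symmetric])
  then show "\<mu> \<cdot> \<alpha> \<preceq> \<mu> \<cdot> \<beta>"
    using prefix_ofI[of "\<mu> \<cdot> \<alpha>" \<gamma>] assms g by simp
qed

section \<open>Minimal common extensions in terms of the order\<close>

lemma seg_initial_iff:
  assumes "\<tau> \<in> \<P>" "\<mu> \<in> \<P>" "\<d> \<mu> \<le> \<d> \<tau>"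
  shows "seg \<Lambda> \<tau> 0 (\<d> \<mu>) = \<mu> \<longleftrightarrow> \<mu> \<preceq> \<tau>"
proof -
  obtain \<alpha> \<beta> where *: "\<alpha> \<in> \<P>" "\<beta> \<in> \<P>" "\<s> \<alpha> = \<r> \<beta>" "\<d> \<alpha> = \<d> \<mu>"
    "\<tau> = \<alpha> \<cdot> \<beta>" using factor_ex[OF assms(1,3)] by metis
  then have "seg \<Lambda> \<tau> 0 (\<d> \<mu>) = \<alpha>" "\<alpha> \<preceq> \<tau>"
    using seg_initial[of \<alpha> \<beta>] prefix_ofI[of \<alpha> \<beta>] by simp_all
  then show ?thesis
    using prefix_of_eq[of \<mu> \<tau> \<alpha>] *(4) by auto
qed

text \<open>Replaces the segments of the definition by the order; nearly all later arguments about
  minimal common extensions pass through this form.\<close>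

lemma MCE_iff:
  assumes "\<mu> \<in> \<P>" "\<nu> \<in> \<P>"
  shows "\<tau> \<in> \<M> \<mu> \<nu> \<longleftrightarrow> \<d> \<tau> = sup (\<d> \<mu>) (\<d> \<nu>) \<and> \<mu> \<preceq> \<tau> \<and> \<nu> \<preceq> \<tau>"
  using seg_initial_iff[of \<tau> \<mu>] seg_initial_iff[of \<tau> \<nu>] assms prefix_of_paths(2)[of \<mu> \<tau>]
  by (auto simp: MCE_def)

lemma MCE_commute: "\<M> \<mu> \<nu> = \<M> \<nu> \<mu>"
  by (auto simp: MCE_def sup_commute)

text \<open>Cut \<open>\<tau>\<close> at the join of the two degrees: by comparability both paths
  are initial segments of the piece.\<close>

lemma MCE_common_extension:
  assumes "\<mu> \<preceq> \<tau>" "\<nu> \<preceq> \<tau>"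
  obtains \<omega> where "\<omega> \<in> \<M> \<mu> \<nu>" "\<omega> \<preceq> \<tau>"
proof -
  obtain \<omega> where "\<omega> \<preceq> \<tau>" "\<d> \<omega> = sup (\<d> \<mu>) (\<d> \<nu>)"
    using prefix_of_ex[of \<tau> "sup (\<d> \<mu>) (\<d> \<nu>)"] prefix_of_deg assms prefix_of_paths(2)[OF assms(1)]
    by (metis le_sup_iff)
  then show ?thesis
    using that[of \<omega>] prefix_of_comparable[OF assms(1), of \<omega>] prefix_of_comparable[OF assms(2), of \<omega>]
      MCE_iff[of \<mu> \<nu> \<omega>] prefix_of_paths(1)[OF assms(1)] prefix_of_paths(1)[OF assms(2)] by simp
qed

lemma MCE_empty_iff:
  assumes "\<mu> \<in> \<P>" "\<nu> \<in> \<P>"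
  shows "\<M> \<mu> \<nu> = {} \<longleftrightarrow> (\<nexists>\<tau>. \<mu> \<preceq> \<tau> \<and> \<nu> \<preceq> \<tau>)"
  using MCE_common_extension[of \<mu> _ \<nu>] MCE_iff[OF assms] by (metis equals0I equals0D)

lemma MCE_empty_mono:
  assumes "\<M> \<mu> \<nu> = {}" "\<mu> \<preceq> \<mu>'" "\<nu> \<preceq> \<nu>'"
  shows "\<M> \<mu>' \<nu>' = {}"
  using assms MCE_empty_iff[of \<mu> \<nu>] MCE_empty_iff[of \<mu>' \<nu>'] prefix_of_paths[OF assms(2)]
    prefix_of_paths[OF assms(3)] prefix_of_trans by blast

lemma MCE_prefix:
  assumes "\<mu> \<preceq> \<nu>"
  shows "\<M> \<mu> \<nu> = {\<nu>}"
proof -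
  have "sup (\<d> \<mu>) (\<d> \<nu>) = \<d> \<nu>" using prefix_of_deg[OF assms] by (simp add: sup.absorb2)
  then have "\<tau> \<in> \<M> \<mu> \<nu> \<longleftrightarrow> \<tau> = \<nu>" for \<tau>
    using assms prefix_of_paths[OF assms] prefix_of_refl[of \<nu>] MCE_iff[of \<mu> \<nu> \<tau>] prefix_of_same_deg[of \<nu> \<tau>]
    by (metis (no_types))
  then show ?thesis by blast
qed

lemma MCE_same_deg:
  assumes "\<mu> \<in> \<P>" "\<nu> \<in> \<P>" "\<d> \<mu> = \<d> \<nu>" "\<mu> \<noteq> \<nu>"
  shows "\<M> \<mu> \<nu> = {}"
  using MCE_empty_iff[OF assms(1,2)] prefix_of_eq[OF _ _ assms(3)] assms(4) by blast

end

section \<open>C*-algebras\<close>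

lemma complex_field_simps [simp]:
  "carrier complex_field = UNIV" "x \<oplus>\<^bsub>complex_field\<^esub> y = x + y" "x \<otimes>\<^bsub>complex_field\<^esub> y = x * y"
  "\<one>\<^bsub>complex_field\<^esub> = 1" "\<zero>\<^bsub>complex_field\<^esub> = 0"
  by (simp_all add: complex_field_def)

lemma complex_field_cring: "cring complex_field"
proof (rule cringI)
  show "abelian_group complex_field"
    by (rule abelian_groupI) (auto simp: algebra_simps intro: exI[of _ "- x" for x] add.left_inverse)
  show "comm_monoid complex_field"
    by (rule comm_monoidI) auto
qed (auto simp: algebra_simps)

context cstar_algebra
begin

section \<open>Linear structure, involution and norm\<close>

lemmas cs_closed [simp, intro] = mult_closed adj_closed
declare adj_adj [simp]

lemma smult_carrier [simp, intro]: "x \<in> carrier A \<Longrightarrow> c \<odot> x \<in> carrier A"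
  using smult_closed[of c x] by simp

lemma smult_add_left: "x \<in> carrier A \<Longrightarrow> (c + d) \<odot> x = c \<odot> x \<oplus> d \<odot> x"
  using smult_l_distr[of c d x] by simp

lemma smult_add_right: "\<lbrakk>x \<in> carrier A; y \<in> carrier A\<rbrakk> \<Longrightarrow> c \<odot> (x \<oplus> y) = c \<odot> x \<oplus> c \<odot> y"
  using smult_r_distr[of c x y] by simp

lemma smult_smult [simp]: "x \<in> carrier A \<Longrightarrow> c \<odot> (d \<odot> x) = (c * d) \<odot> x"
  using smult_assoc1[of c d x] by simp

lemma smult_1 [simp]: "x \<in> carrier A \<Longrightarrow> 1 \<odot> x = x"
  using smult_one[of x] by simp

lemma smult_0 [simp]: "x \<in> carrier A \<Longrightarrow> 0 \<odot> x = \<zero>"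
  using smult_l_null[of x] by simp

lemma smult_zero [simp]: "c \<odot> \<zero> = \<zero>"
  using smult_r_null[of c] by simp

lemma uminus_smult: "x \<in> carrier A \<Longrightarrow> \<ominus> x = (-1) \<odot> x"
proof -
  assume x: "x \<in> carrier A"
  have "(-1) \<odot> x \<oplus> x = (-1 + 1) \<odot> x" using x by (simp only: smult_add_left smult_1)
  then have "(-1) \<odot> x \<oplus> x = \<zero>" using x by simp
  then show ?thesis using x M.minus_equality by blast
qed

lemma minus_smult: "\<lbrakk>x \<in> carrier A; y \<in> carrier A\<rbrakk> \<Longrightarrow> x \<ominus> y = x \<oplus> (-1) \<odot> y"
  by (simp add: a_minus_def uminus_smult)

lemma mult_zero [simp]: "x \<in> carrier A \<Longrightarrow> x \<otimes> \<zero> = \<zero>" "x \<in> carrier A \<Longrightarrow> \<zero> \<otimes> x = \<zero>"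
  using smult_mult_r[of x \<zero> 0] smult_mult_l[of \<zero> x 0] by auto

lemma adj_zero [simp]: "adj A \<zero> = \<zero>"
  using adj_smult[of \<zero> 0] by simp

lemma nrm_zero [simp]: "nrm A \<zero> = 0" by (simp add: nrm_eq_0)

lemma nrm_pos: "\<lbrakk>x \<in> carrier A; x \<noteq> \<zero>\<rbrakk> \<Longrightarrow> 0 < nrm A x"
  using nrm_eq_0[of x] nrm_nonneg[of x] by linarith

lemma mult_minus_left: "\<lbrakk>x \<in> carrier A; y \<in> carrier A; z \<in> carrier A\<rbrakk> \<Longrightarrow> (x \<ominus> y) \<otimes> z = x \<otimes> z \<ominus> y \<otimes> z"
  by (simp add: minus_smult mult_l_distr smult_mult_l)

lemma mult_minus_right: "\<lbrakk>x \<in> carrier A; y \<in> carrier A; z \<in> carrier A\<rbrakk> \<Longrightarrow> z \<otimes> (x \<ominus> y) = z \<otimes> x \<ominus> z \<otimes> y"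
  by (simp add: minus_smult mult_r_distr smult_mult_r)

lemma smult_minus_right: "\<lbrakk>x \<in> carrier A; y \<in> carrier A\<rbrakk> \<Longrightarrow> c \<odot> (x \<ominus> y) = c \<odot> x \<ominus> c \<odot> y"
  by (simp add: minus_smult smult_add_right)

lemma adj_minus: "\<lbrakk>x \<in> carrier A; y \<in> carrier A\<rbrakk> \<Longrightarrow> adj A (x \<ominus> y) = adj A x \<ominus> adj A y"
  by (simp add: minus_smult adj_add adj_smult)

lemma minus_self [simp]: "x \<in> carrier A \<Longrightarrow> x \<ominus> x = \<zero>"
  by (simp add: a_minus_def M.r_neg)

lemma minus_zero [simp]: "x \<in> carrier A \<Longrightarrow> x \<ominus> \<zero> = x"
  by (simp add: minus_smult)

lemma minus_eq_zero_iff: "\<lbrakk>x \<in> carrier A; y \<in> carrier A\<rbrakk> \<Longrightarrow> x \<ominus> y = \<zero> \<longleftrightarrow> x = y"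
  by (metis M.add.inv_closed M.l_zero M.minus_minus M.minus_equality M.r_neg a_minus_def minus_add_cancel)

lemma minus_add_cancel: "\<lbrakk>x \<in> carrier A; y \<in> carrier A\<rbrakk> \<Longrightarrow> (x \<ominus> y) \<oplus> y = x"
  by (simp add: a_minus_def M.a_assoc M.l_neg)

lemma minus_trans: "\<lbrakk>x \<in> carrier A; y \<in> carrier A; z \<in> carrier A\<rbrakk> \<Longrightarrow> x \<ominus> z = (x \<ominus> y) \<oplus> (y \<ominus> z)"
  by (simp add: a_minus_def M.a_assoc) (simp add: M.a_assoc[symmetric] M.l_neg)

lemma nrm_minus_commute: "\<lbrakk>x \<in> carrier A; y \<in> carrier A\<rbrakk> \<Longrightarrow> nrm A (x \<ominus> y) = nrm A (y \<ominus> x)"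
proof -
  assume *: "x \<in> carrier A" "y \<in> carrier A"
  then have "y \<ominus> x = (-1) \<odot> (x \<ominus> y)" by (simp add: minus_smult smult_add_right M.a_comm)
  then show ?thesis using * by (simp add: nrm_smult)
qed

lemma nrm_triangle_minus:
  "\<lbrakk>x \<in> carrier A; y \<in> carrier A; z \<in> carrier A\<rbrakk> \<Longrightarrow> nrm A (x \<ominus> z) \<le> nrm A (x \<ominus> y) + nrm A (y \<ominus> z)"
  using nrm_add[of "x \<ominus> y" "y \<ominus> z"] minus_trans[of x y z] by simp

lemma nrm_diff_le: "\<lbrakk>x \<in> carrier A; y \<in> carrier A\<rbrakk> \<Longrightarrow> nrm A x \<le> nrm A y + nrm A (x \<ominus> y)"
  using nrm_add[of "x \<ominus> y" y] minus_add_cancel[of x y] by simp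

text \<open>The C*-identity and submultiplicativity give one inequality for every element; applied
  to \<open>x\<close> and to its adjoint it gives both.\<close>

lemma nrm_adj [simp]: assumes "x \<in> carrier A" shows "nrm A (adj A x) = nrm A x"
proof -
  have "nrm A y \<le> nrm A (adj A y)" if y: "y \<in> carrier A" for y
  proof (cases "nrm A y = 0")
    case False
    have "(nrm A y)\<^sup>2 \<le> nrm A (adj A y) * nrm A y"
      using cstar_identity[OF y] nrm_mult[of "adj A y" y] y by simp
    then show ?thesis using False nrm_nonneg[OF y] by (simp add: power2_eq_square)
  qed (use that nrm_nonneg in simp)
  from this[of x] this[of "adj A x"] assms show ?thesis by simp
qed

lemma nrm_projection:
  assumes "p \<in> carrier A" "adj A p = p" "p \<otimes> p = p"
  shows "nrm A p \<le> 1"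
proof -
  have "(nrm A p)\<^sup>2 = nrm A p" using cstar_identity[of p] assms by simp
  then have "nrm A p = 0 \<or> nrm A p = 1" by (simp add: power2_eq_square)
  then show ?thesis by auto
qed

lemma nrm_projection_eq_1:
  assumes "p \<in> carrier A" "adj A p = p" "p \<otimes> p = p" "p \<noteq> \<zero>"
  shows "nrm A p = 1"
proof -
  have "(nrm A p)\<^sup>2 = nrm A p" using cstar_identity[of p] assms by simp
  then show ?thesis using nrm_eq_0[of p] assms by (simp add: power2_eq_square)
qed

lemma nrm_mult_le_left:
  assumes "x \<in> carrier A" "y \<in> carrier A" "nrm A x \<le> 1" shows "nrm A (x \<otimes> y) \<le> nrm A y"
  using nrm_mult[of x y] mult_left_le_one_le[of "nrm A y" "nrm A x"] nrm_nonneg assms by fastforce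

lemma nrm_mult_le_right:
  assumes "x \<in> carrier A" "y \<in> carrier A" "nrm A y \<le> 1" shows "nrm A (x \<otimes> y) \<le> nrm A x"
  using nrm_mult[of x y] mult_right_le_one_le[of "nrm A x" "nrm A y"] nrm_nonneg assms by fastforce

lemma nrm_finsum: "\<lbrakk>finite I; f \<in> I \<rightarrow> carrier A\<rbrakk> \<Longrightarrow> nrm A (finsum A f I) \<le> (\<Sum>i\<in>I. nrm A (f i))"
proof (induction I rule: finite_induct)
  case (insert i I)
  then have "f i \<in> carrier A" "finsum A f I \<in> carrier A" by auto
  with insert show ?case using nrm_add[of "f i" "finsum A f I"] by (simp add: M.finsum_insert)
qed simp

lemma mult_finsum_right:
  "\<lbrakk>finite I; f \<in> I \<rightarrow> carrier A; a \<in> carrier A\<rbrakk> \<Longrightarrow> a \<otimes> finsum A f I = finsum A (\<lambda>i. a \<otimes> f i) I"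
proof (induction I rule: finite_induct)
  case (insert i I)
  then have "f i \<in> carrier A" "finsum A f I \<in> carrier A" "(\<lambda>i. a \<otimes> f i) \<in> I \<rightarrow> carrier A" by auto
  with insert show ?case by (simp add: M.finsum_insert mult_r_distr)
qed simp

lemma mult_finsum_left:
  "\<lbrakk>finite I; f \<in> I \<rightarrow> carrier A; a \<in> carrier A\<rbrakk> \<Longrightarrow> finsum A f I \<otimes> a = finsum A (\<lambda>i. f i \<otimes> a) I"
proof (induction I rule: finite_induct)
  case (insert i I)
  then have "f i \<in> carrier A" "finsum A f I \<in> carrier A" "(\<lambda>i. f i \<otimes> a) \<in> I \<rightarrow> carrier A" by auto
  with insert show ?case by (simp add: M.finsum_insert mult_l_distr)
qed simp

lemma adj_finsum:
  "\<lbrakk>finite I; f \<in> I \<rightarrow> carrier A\<rbrakk> \<Longrightarrow> adj A (finsum A f I) = finsum A (\<lambda>i. adj A (f i)) I"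
proof (induction I rule: finite_induct)
  case (insert i I)
  then have "f i \<in> carrier A" "finsum A f I \<in> carrier A" "(\<lambda>i. adj A (f i)) \<in> I \<rightarrow> carrier A" by auto
  with insert show ?case by (simp add: M.finsum_insert adj_add)
qed simp

section \<open>Metric, closed sets and completeness\<close>

lemma metric: "Metric_space (carrier A) (cstar_dist A)"
proof
  fix x y z
  show "0 \<le> cstar_dist A x y" by (simp add: cstar_dist_def nrm_nonneg)
  show "cstar_dist A x y = cstar_dist A y x" by (auto simp: cstar_dist_def intro: nrm_minus_commute)
  assume "x \<in> carrier A" "y \<in> carrier A"
  then show "cstar_dist A x y = 0 \<longleftrightarrow> x = y"
    by (simp add: cstar_dist_def nrm_eq_0 minus_eq_zero_iff)
  assume "z \<in> carrier A"
  then show "cstar_dist A x z \<le> cstar_dist A x y + cstar_dist A y z"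
    using \<open>x \<in> carrier A\<close> \<open>y \<in> carrier A\<close> by (simp add: cstar_dist_def nrm_triangle_minus)
qed

text \<open>Closedness as approximability by norm; this form serves for ideals, kernels and
  generated subalgebras.\<close>

lemma closed_iff:
  "cstar_closed A C \<longleftrightarrow> C \<subseteq> carrier A \<and>
     (\<forall>x \<in> carrier A. (\<forall>e>0. \<exists>c \<in> C. nrm A (x \<ominus> c) < e) \<longrightarrow> x \<in> C)"
proof -
  interpret Metric_space "carrier A" "cstar_dist A" by (rule metric)
  have "disjnt C (mball x r) \<longleftrightarrow> (\<forall>c\<in>C. \<not> nrm A (x \<ominus> c) < r)"
    if "C \<subseteq> carrier A" "x \<in> carrier A" for x r
    using that by (auto simp: disjnt_def mball_def cstar_dist_def)
  then have "cstar_closed A C \<longleftrightarrow> C \<subseteq> carrier A \<and>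
      (\<forall>x. x \<in> carrier A - C \<longrightarrow> (\<exists>r>0. \<forall>c\<in>C. \<not> nrm A (x \<ominus> c) < r))"
    unfolding cstar_closed_def closedin_metric by (intro conj_cong refl all_cong) auto
  then show ?thesis by (meson DiffD1 DiffD2 DiffI)
qed

lemma Cauchy_converges:
  assumes "\<And>n. \<sigma> n \<in> carrier A"
    and "\<And>e. e > 0 \<Longrightarrow> \<exists>N. \<forall>m \<ge> N. \<forall>n \<ge> N. nrm A (\<sigma> m \<ominus> \<sigma> n) < e"
  obtains l where "l \<in> carrier A" "(\<lambda>n. nrm A (\<sigma> n \<ominus> l)) \<longlonglongrightarrow> 0"
proof -
  interpret Metric_space "carrier A" "cstar_dist A" by (rule metric)
  have "MCauchy \<sigma>" using assms by (auto simp: MCauchy_def cstar_dist_def)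
  then obtain l where "limitin mtopology \<sigma> l sequentially"
    using complete by (auto simp: mcomplete_def)
  then have l: "l \<in> carrier A" "\<And>e. e > 0 \<Longrightarrow> \<forall>\<^sub>F n in sequentially. cstar_dist A (\<sigma> n) l < e"
    by (auto simp: limitin_metric elim: eventually_mono)
  have "(\<lambda>n. nrm A (\<sigma> n \<ominus> l)) \<longlonglongrightarrow> 0"
    using l assms(1) by (intro tendstoI) (auto simp: dist_real_def nrm_nonneg cstar_dist_def)
  then show thesis using that l(1) by blast
qed

text \<open>The steps are dominated by a geometric series, whose tail \<open>q ^ n / (1 - q)\<close>
  tends to 0.\<close>

lemma contraction_converges:
  assumes "\<And>n. \<sigma> n \<in> carrier A" "0 \<le> q" "q < 1"
    and step: "\<And>n. nrm A (\<sigma> (Suc n) \<ominus> \<sigma> n) \<le> q ^ n"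
  obtains l where "l \<in> carrier A" "(\<lambda>n. nrm A (\<sigma> n \<ominus> l)) \<longlonglongrightarrow> 0"
proof (rule Cauchy_converges[of \<sigma>])
  have le: "nrm A (\<sigma> (n + k) \<ominus> \<sigma> n) \<le> (\<Sum>i<k. q ^ (n + i))" for n k
  proof (induction k)
    case (Suc k)
    then show ?case
      using nrm_triangle_minus[of "\<sigma> (n + Suc k)" "\<sigma> (n + k)" "\<sigma> n"] step[of "n + k"] assms(1) by simp
  qed (use assms(1) in simp)
  have bound: "nrm A (\<sigma> (n + k) \<ominus> \<sigma> n) \<le> q ^ n / (1 - q)" for n k
  proof -
    have "(\<Sum>i<k. q ^ (n + i)) = q ^ n * (\<Sum>i<k. q ^ i)" by (simp add: power_add sum_distrib_left)
    also have "(\<Sum>i<k. q ^ i) = (1 - q ^ k) / (1 - q)" using assms(3) sum_gp_strict[of q k] by simp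
    also have "\<dots> \<le> 1 / (1 - q)" using assms(2,3) by (intro divide_right_mono) auto
    finally show ?thesis using le[of n k] assms(2) by (simp add: mult_left_mono order_trans)
  qed
  fix e :: real assume e: "e > 0"
  have "(\<lambda>n. q ^ n / (1 - q)) \<longlonglongrightarrow> 0 / (1 - q)"
    using assms(2,3) by (intro tendsto_divide LIMSEQ_power_zero) auto
  then have "\<forall>\<^sub>F n in sequentially. q ^ n / (1 - q) < e / 2"
    using e by (intro order_tendstoD(2)[of _ 0]) auto
  then obtain N where N: "q ^ N / (1 - q) < e / 2" by (auto simp: eventually_sequentially)
  have "nrm A (\<sigma> m \<ominus> \<sigma> n) < e" if "m \<ge> N" "n \<ge> N" for m n
  proof -
    have "nrm A (\<sigma> m \<ominus> \<sigma> N) < e / 2" "nrm A (\<sigma> n \<ominus> \<sigma> N) < e / 2"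
      using le_less_trans[OF bound[of N "m - N"] N] le_less_trans[OF bound[of N "n - N"] N] that by auto
    then show ?thesis
      using nrm_triangle_minus[of "\<sigma> m" "\<sigma> N" "\<sigma> n"] nrm_minus_commute[of "\<sigma> n" "\<sigma> N"] assms(1) by simp
  qed
  then show "\<exists>N. \<forall>m \<ge> N. \<forall>n \<ge> N. nrm A (\<sigma> m \<ominus> \<sigma> n) < e" by blast
qed (use assms(1) that in auto)

text \<open>In the absence of commutativity the difference of squares is x(x - y) + (x -
  y)y.\<close>

lemma nrm_square_diff:
  assumes "x \<in> carrier A" "y \<in> carrier A"
  shows "nrm A (x \<otimes> x \<ominus> y \<otimes> y) \<le> (nrm A x + nrm A y) * nrm A (x \<ominus> y)"
proof -
  have "x \<otimes> x \<ominus> y \<otimes> y = (x \<otimes> x \<ominus> x \<otimes> y) \<oplus> (x \<otimes> y \<ominus> y \<otimes> y)"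
    using assms by (intro minus_trans) auto
  also have "\<dots> = x \<otimes> (x \<ominus> y) \<oplus> (x \<ominus> y) \<otimes> y"
    using assms by (simp add: mult_minus_left mult_minus_right)
  finally have "nrm A (x \<otimes> x \<ominus> y \<otimes> y) \<le> nrm A (x \<otimes> (x \<ominus> y)) + nrm A ((x \<ominus> y) \<otimes> y)"
    using assms by (simp add: nrm_add)
  also have "\<dots> \<le> nrm A x * nrm A (x \<ominus> y) + nrm A (x \<ominus> y) * nrm A y"
    using assms by (intro add_mono nrm_mult) auto
  finally show ?thesis by (simp add: algebra_simps)
qed

text \<open>With a unit this is \<open>b = 1 - sqrt (1 - c)\<close>, obtained as the fixed point of
  \<open>b \<mapsto> (c + b\<^sup>2) / 2\<close>, a contraction of a ball of radius less than 1.\<close>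

lemma sqrt_one_minus:
  assumes "c \<in> carrier A" "adj A c = c" "nrm A c < 1"
  obtains b where "b \<in> carrier A" "adj A b = b" "c \<oplus> b \<otimes> b = 2 \<odot> b"
proof -
  \<comment> \<open>The smaller root of \<open>nrm A c + q\<^sup>2 = 2 * q\<close>: the iteration
    maps the ball of radius \<open>q\<close> into itself and has Lipschitz constant at most
    \<open>q\<close> there.\<close>
  define q where "q = 1 - sqrt (1 - nrm A c)"
  have r: "0 \<le> nrm A c" using assms by (simp add: nrm_nonneg)
  have q: "0 \<le> q" "q < 1" "nrm A c + q\<^sup>2 = 2 * q"
    using r assms(3) by (auto simp: q_def power2_eq_square algebra_simps)
  define f where "f x = (1 / 2) \<odot> (c \<oplus> x \<otimes> x)" for x
  define \<sigma> where "\<sigma> n = (f ^^ n) \<zero>" for n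
  have \<sigma>_Suc: "\<sigma> (Suc n) = f (\<sigma> n)" for n by (simp add: \<sigma>_def)
  have f_closed: "f x \<in> carrier A" if "x \<in> carrier A" for x using that assms by (simp add: f_def)
  have \<sigma>: "\<sigma> n \<in> carrier A \<and> adj A (\<sigma> n) = \<sigma> n \<and> nrm A (\<sigma> n) \<le> q" for n
  proof (induction n)
    case (Suc n)
    have "nrm A (f (\<sigma> n)) \<le> (nrm A c + nrm A (\<sigma> n \<otimes> \<sigma> n)) / 2"
      using Suc nrm_add[of c "\<sigma> n \<otimes> \<sigma> n"] assms by (simp add: f_def nrm_smult)
    also have "nrm A (\<sigma> n \<otimes> \<sigma> n) \<le> q\<^sup>2"
      using Suc nrm_mult[of "\<sigma> n" "\<sigma> n"] mult_mono[of "nrm A (\<sigma> n)" q "nrm A (\<sigma> n)" q] q nrm_nonneg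
      by (simp add: power2_eq_square)
    finally have "nrm A (f (\<sigma> n)) \<le> q" using q by simp
    then show ?case
      using Suc assms by (simp add: \<sigma>_Suc f_closed) (simp add: f_def adj_smult adj_add adj_mult)
  qed (use q in \<open>simp add: \<sigma>_def\<close>)
  have f_diff: "nrm A (f x \<ominus> f y) = nrm A (x \<otimes> x \<ominus> y \<otimes> y) / 2"
    if "x \<in> carrier A" "y \<in> carrier A" for x y
  proof -
    have "(c \<oplus> x \<otimes> x) \<ominus> (c \<oplus> y \<otimes> y) = x \<otimes> x \<ominus> y \<otimes> y"
      using that assms by (simp add: a_minus_def M.minus_add M.a_ac M.r_neg1 M.r_neg2)
    then have "f x \<ominus> f y = (1 / 2) \<odot> (x \<otimes> x \<ominus> y \<otimes> y)"
      using that assms by (simp add: f_def flip: smult_minus_right)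
    then show ?thesis using that by (simp add: nrm_smult)
  qed
  have "nrm A (\<sigma> (Suc n) \<ominus> \<sigma> n) \<le> q ^ n" for n
  proof (induction n)
    case 0
    then show ?case using \<sigma>[of "Suc 0"] q by (simp add: \<sigma>_def f_closed)
  next
    case (Suc n)
    have "nrm A (\<sigma> (Suc (Suc n)) \<ominus> \<sigma> (Suc n)) = nrm A (\<sigma> (Suc n) \<otimes> \<sigma> (Suc n) \<ominus> \<sigma> n \<otimes> \<sigma> n) / 2"
      using f_diff[of "\<sigma> (Suc n)" "\<sigma> n"] \<sigma> f_closed by (simp add: \<sigma>_Suc)
    also have "\<dots> \<le> (nrm A (\<sigma> (Suc n)) + nrm A (\<sigma> n)) * nrm A (\<sigma> (Suc n) \<ominus> \<sigma> n) / 2"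
      using nrm_square_diff[of "\<sigma> (Suc n)" "\<sigma> n"] \<sigma> by simp
    also have "\<dots> \<le> (2 * q) * q ^ n / 2"
      using \<sigma>[of n] \<sigma>[of "Suc n"] Suc q by (intro divide_right_mono mult_mono) (auto simp: nrm_nonneg)
    finally show ?case by simp
  qed
  then obtain b where b: "b \<in> carrier A" "(\<lambda>n. nrm A (\<sigma> n \<ominus> b)) \<longlonglongrightarrow> 0"
    using contraction_converges[of \<sigma> q] \<sigma> q by blast
  \<comment> \<open>Both properties of the limit, selfadjointness and the fixed point equation,
    follow by bounding a difference by the distances of the iterates to \<open>b\<close>.\<close>
  have eq0: "x = \<zero>" if "x \<in> carrier A" "\<And>n. nrm A x \<le> K * nrm A (\<sigma> n \<ominus> b) + K' * nrm A (\<sigma> (Suc n) \<ominus> b)" for x K K'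
  proof -
    have "(\<lambda>n. K * nrm A (\<sigma> n \<ominus> b) + K' * nrm A (\<sigma> (Suc n) \<ominus> b)) \<longlonglongrightarrow> K * 0 + K' * 0"
      using b(2) LIMSEQ_Suc[OF b(2)] by (intro tendsto_intros)
    then have "nrm A x \<le> 0" using that(2) by (intro LIMSEQ_le_const[of _ 0]) auto
    then show ?thesis using that(1) nrm_eq_0 nrm_nonneg by (meson antisym)
  qed
  have "adj A b \<ominus> b = \<zero>"
  proof (rule eq0[where K = 2 and K' = 0])
    fix n
    have "nrm A (adj A b \<ominus> b) \<le> nrm A (adj A b \<ominus> \<sigma> n) + nrm A (\<sigma> n \<ominus> b)"
      using b \<sigma> by (intro nrm_triangle_minus) auto
    also have "adj A b \<ominus> \<sigma> n = adj A (b \<ominus> \<sigma> n)" using b \<sigma> by (simp add: adj_minus)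
    also have "nrm A \<dots> = nrm A (\<sigma> n \<ominus> b)" using b \<sigma> nrm_minus_commute[of b "\<sigma> n"] by simp
    finally show "nrm A (adj A b \<ominus> b) \<le> 2 * nrm A (\<sigma> n \<ominus> b) + 0 * nrm A (\<sigma> (Suc n) \<ominus> b)" by simp
  qed (use b in simp)
  then have badj: "adj A b = b" using b by (simp add: minus_eq_zero_iff)
  have "f b \<ominus> b = \<zero>"
  proof (rule eq0[where K = "(q + nrm A b) / 2" and K' = 1])
    fix n
    have "nrm A (f b \<ominus> b) \<le> nrm A (f b \<ominus> \<sigma> (Suc n)) + nrm A (\<sigma> (Suc n) \<ominus> b)"
      using b \<sigma> f_closed by (intro nrm_triangle_minus) auto
    also have "nrm A (f b \<ominus> \<sigma> (Suc n)) = nrm A (\<sigma> n \<otimes> \<sigma> n \<ominus> b \<otimes> b) / 2"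
      using f_diff[of "\<sigma> n" b] b \<sigma> nrm_minus_commute[of "f b" "f (\<sigma> n)"] f_closed by (simp add: \<sigma>_Suc)
    also have "\<dots> \<le> (nrm A (\<sigma> n) + nrm A b) * nrm A (\<sigma> n \<ominus> b) / 2"
      using nrm_square_diff[of "\<sigma> n" b] b \<sigma> by simp
    also have "\<dots> \<le> (q + nrm A b) * nrm A (\<sigma> n \<ominus> b) / 2"
      using \<sigma>[of n] b by (intro divide_right_mono mult_right_mono) (auto simp: nrm_nonneg)
    finally show "nrm A (f b \<ominus> b) \<le> (q + nrm A b) / 2 * nrm A (\<sigma> n \<ominus> b) + 1 * nrm A (\<sigma> (Suc n) \<ominus> b)"
      by simp
  qed (use b f_closed in simp)
  then have "f b = b" using b f_closed by (simp add: minus_eq_zero_iff)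
  then have "2 \<odot> f b = 2 \<odot> b" by simp
  then have "c \<oplus> b \<otimes> b = 2 \<odot> b" using b assms by (simp add: f_def)
  then show thesis using that b badj by blast
qed

end

section \<open>Operators on square-summable families\<close>

lemma ell2_support: "f \<in> ell2 X \<Longrightarrow> x \<notin> X \<Longrightarrow> f x = 0"
  by (simp add: ell2_def)

lemma ell2_norm_nonneg [simp]: "0 \<le> ell2_norm X f"
  by (simp add: ell2_norm_def infsum_nonneg)

text \<open>Membership and norm bound follow from finite partial sums, so that estimates can be made
  with \<open>L2_set\<close> on finite sets.\<close>

lemma ell2I:
  assumes "\<And>x. x \<notin> X \<Longrightarrow> f x = 0"
    and le: "\<And>F. \<lbrakk>finite F; F \<subseteq> X\<rbrakk> \<Longrightarrow> L2_set (\<lambda>x. cmod (f x)) F \<le> c"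
  shows "f \<in> ell2 X" "ell2_norm X f \<le> c"
proof -
  have c: "0 \<le> c" using le[of "{}"] by simp
  have le': "(\<Sum>x\<in>F. (cmod (f x))\<^sup>2) \<le> c\<^sup>2" if "finite F" "F \<subseteq> X" for F
    using le[OF that] c unfolding L2_set_def by (metis real_sqrt_le_iff real_sqrt_abs abs_of_nonneg)
  have s: "(\<lambda>x. (cmod (f x))\<^sup>2) summable_on X"
    by (rule nonneg_bdd_above_summable_on) (auto intro!: bdd_aboveI2[where M = "c\<^sup>2"] le')
  then show "f \<in> ell2 X" using assms(1) by (simp add: ell2_def)
  have "(\<Sum>\<^sub>\<infinity>x\<in>X. (cmod (f x))\<^sup>2) \<le> c\<^sup>2"
    by (rule infsum_le_finite_sums[OF s le'])
  then show "ell2_norm X f \<le> c"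
    using c unfolding ell2_norm_def by (metis real_sqrt_le_iff real_sqrt_abs abs_of_nonneg)
qed

lemma L2_set_le_ell2_norm:
  assumes "f \<in> ell2 X" "finite F" "F \<subseteq> X"
  shows "L2_set (\<lambda>x. cmod (f x)) F \<le> ell2_norm X f"
  unfolding L2_set_def ell2_norm_def using assms
  by (auto simp: ell2_def intro!: finite_sum_le_infsum)

lemma cmod_le_ell2_norm: "f \<in> ell2 X \<Longrightarrow> cmod (f x) \<le> ell2_norm X f"
  using L2_set_le_ell2_norm[of f X "{x}"] ell2_support[of f X x] by (cases "x \<in> X") auto

lemma ell2_0 [simp]: "(\<lambda>_. 0) \<in> ell2 X" "ell2_norm X (\<lambda>_. 0) = 0"
  by (simp_all add: ell2_def ell2_norm_def)

lemma ell2_add: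
  assumes "f \<in> ell2 X" "g \<in> ell2 X"
  shows ell2_add_closed: "(\<lambda>x. f x + g x) \<in> ell2 X"
    and ell2_norm_add: "ell2_norm X (\<lambda>x. f x + g x) \<le> ell2_norm X f + ell2_norm X g"
proof -
  have "L2_set (\<lambda>x. cmod (f x + g x)) F \<le> ell2_norm X f + ell2_norm X g" if F: "finite F" "F \<subseteq> X" for F
  proof -
    have "L2_set (\<lambda>x. cmod (f x + g x)) F \<le> L2_set (\<lambda>x. cmod (f x) + cmod (g x)) F"
      by (intro L2_set_mono norm_triangle_ineq) auto
    also have "\<dots> \<le> L2_set (\<lambda>x. cmod (f x)) F + L2_set (\<lambda>x. cmod (g x)) F"
      by (rule L2_set_triangle_ineq)
    also have "\<dots> \<le> ell2_norm X f + ell2_norm X g"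
      using L2_set_le_ell2_norm F assms by (intro add_mono)
    finally show ?thesis .
  qed
  from ell2I[OF _ this] assms show "(\<lambda>x. f x + g x) \<in> ell2 X"
    "ell2_norm X (\<lambda>x. f x + g x) \<le> ell2_norm X f + ell2_norm X g"
    by (auto simp: ell2_support)
qed

lemma ell2_cmult:
  assumes "f \<in> ell2 X"
  shows ell2_cmult_closed: "(\<lambda>x. c * f x) \<in> ell2 X"
    and ell2_norm_cmult: "ell2_norm X (\<lambda>x. c * f x) = cmod c * ell2_norm X f"
proof -
  have s: "(\<lambda>x. (cmod (f x))\<^sup>2) summable_on X" using assms by (simp add: ell2_def)
  then show "(\<lambda>x. c * f x) \<in> ell2 X" using assms
    by (auto simp: ell2_def norm_mult power_mult_distrib intro: summable_on_cmult_right)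
  show "ell2_norm X (\<lambda>x. c * f x) = cmod c * ell2_norm X f"
    using infsum_cmult_right[of "(cmod c)\<^sup>2" "\<lambda>x. (cmod (f x))\<^sup>2" X] s
    by (simp add: ell2_norm_def norm_mult power_mult_distrib real_sqrt_mult)
qed

lemma ell2_diff:
  assumes "f \<in> ell2 X" "g \<in> ell2 X"
  shows ell2_diff_closed: "(\<lambda>x. f x - g x) \<in> ell2 X"
    and ell2_norm_diff: "ell2_norm X (\<lambda>x. f x - g x) \<le> ell2_norm X f + ell2_norm X g"
  using ell2_add[OF assms(1) ell2_cmult_closed[OF assms(2), of "-1"]] ell2_norm_cmult[OF assms(2), of "-1"]
  by simp_all

lemma ell2_norm_eq_0: "f \<in> ell2 X \<Longrightarrow> ell2_norm X f = 0 \<longleftrightarrow> f = (\<lambda>_. 0)"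
  using cmod_le_ell2_norm[of f X] by (auto simp: fun_eq_iff ell2_norm_def)

lemma ell2_mask:
  assumes "f \<in> ell2 X" "\<And>x. g x = f x \<or> g x = 0"
  shows ell2_mask_closed: "g \<in> ell2 X" and ell2_norm_mask: "ell2_norm X g \<le> ell2_norm X f"
proof -
  have le: "cmod (g x) \<le> cmod (f x)" for x using assms(2)[of x] by auto
  have "L2_set (\<lambda>x. cmod (g x)) F \<le> ell2_norm X f" if F: "finite F" "F \<subseteq> X" for F
    using L2_set_mono[of F "\<lambda>x. cmod (g x)" "\<lambda>x. cmod (f x)"] le L2_set_le_ell2_norm[OF assms(1) F] by simp
  moreover have "g x = 0" if "x \<notin> X" for x using ell2_support[OF assms(1) that] assms(2)[of x] by auto
  ultimately show "g \<in> ell2 X" "ell2_norm X g \<le> ell2_norm X f" using ell2I[of X g] by blast+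
qed

lemma ell2_finite_support:
  assumes "finite F" "F \<subseteq> X" "\<And>x. x \<notin> F \<Longrightarrow> f x = 0"
  shows "f \<in> ell2 X"
proof -
  have "{x \<in> X. (cmod (f x))\<^sup>2 \<noteq> 0} \<subseteq> F" using assms(3) by auto
  then have "(\<lambda>x. (cmod (f x))\<^sup>2) summable_on X"
    using assms(1) by (intro finite_nonzero_values_imp_summable_on) (auto intro: finite_subset)
  then show ?thesis using assms by (auto simp: ell2_def)
qed

lemma ell2_basis_closed [simp]: "x \<in> X \<Longrightarrow> ell2_basis x \<in> ell2 X"
  by (rule ell2_finite_support[of "{x}"]) (auto simp: ell2_basis_def)

lemma infsum_single:
  fixes f :: "'a \<Rightarrow> 'b :: {comm_monoid_add, t2_space}"
  assumes "\<And>y. y \<in> X \<Longrightarrow> y \<noteq> x \<Longrightarrow> f y = 0" "x \<in> X"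
  shows "infsum f X = f x"
proof -
  have "infsum f X = infsum f {x}" by (rule infsum_cong_neutral) (use assms in auto)
  then show ?thesis by simp
qed

lemma ell2_norm_basis [simp]: "x \<in> X \<Longrightarrow> ell2_norm X (ell2_basis x) = 1"
  unfolding ell2_norm_def by (subst infsum_single[of _ x]) (auto simp: ell2_basis_def)

lemma ell2_inner_abs_summable:
  assumes "f \<in> ell2 X" "g \<in> ell2 X"
  shows "(\<lambda>x. cmod (f x * cnj (g x))) summable_on X"
    and "(\<Sum>\<^sub>\<infinity>x\<in>X. cmod (f x * cnj (g x))) \<le> ell2_norm X f * ell2_norm X g"
proof -
  have le: "(\<Sum>x\<in>F. cmod (f x * cnj (g x))) \<le> ell2_norm X f * ell2_norm X g" if F: "finite F" "F \<subseteq> X" for F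
  proof -
    have "(\<Sum>x\<in>F. cmod (f x * cnj (g x))) = (\<Sum>x\<in>F. \<bar>cmod (f x)\<bar> * \<bar>cmod (g x)\<bar>)"
      by (simp add: norm_mult)
    also have "\<dots> \<le> L2_set (\<lambda>x. cmod (f x)) F * L2_set (\<lambda>x. cmod (g x)) F" by (rule L2_set_mult_ineq)
    also have "\<dots> \<le> ell2_norm X f * ell2_norm X g"
      using F assms by (intro mult_mono L2_set_le_ell2_norm) auto
    finally show ?thesis .
  qed
  show s: "(\<lambda>x. cmod (f x * cnj (g x))) summable_on X"
    by (rule nonneg_bdd_above_summable_on)
      (auto intro!: bdd_aboveI2[where M = "ell2_norm X f * ell2_norm X g"] le)
  show "(\<Sum>\<^sub>\<infinity>x\<in>X. cmod (f x * cnj (g x))) \<le> ell2_norm X f * ell2_norm X g"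
    using infsum_le_finite_sums[OF s] le by blast
qed

lemma ell2_inner_summable: "\<lbrakk>f \<in> ell2 X; g \<in> ell2 X\<rbrakk> \<Longrightarrow> (\<lambda>x. f x * cnj (g x)) summable_on X"
  by (rule Infinite_Sum.abs_summable_summable[OF ell2_inner_abs_summable(1)])

lemma ell2_Cauchy_Schwarz:
  assumes "f \<in> ell2 X" "g \<in> ell2 X"
  shows "cmod (ell2_inner X f g) \<le> ell2_norm X f * ell2_norm X g"
  using ell2_inner_abs_summable[OF assms] norm_infsum_bound[of "\<lambda>x. f x * cnj (g x)" X]
  by (simp add: ell2_inner_def)

lemma ell2_inner_add_left:
  "\<lbrakk>f \<in> ell2 X; g \<in> ell2 X; h \<in> ell2 X\<rbrakk> \<Longrightarrow>
    ell2_inner X (\<lambda>x. f x + g x) h = ell2_inner X f h + ell2_inner X g h"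
  unfolding ell2_inner_def
  by (subst infsum_add[symmetric]) (auto intro: ell2_inner_summable simp: algebra_simps)

lemma ell2_inner_cmult_left:
  "\<lbrakk>f \<in> ell2 X; g \<in> ell2 X\<rbrakk> \<Longrightarrow> ell2_inner X (\<lambda>x. c * f x) g = c * ell2_inner X f g"
  unfolding ell2_inner_def
  by (subst infsum_cmult_right[symmetric]) (auto intro: ell2_inner_summable simp: algebra_simps)

lemma ell2_inner_commute: "cnj (ell2_inner X f g) = ell2_inner X g f"
  unfolding ell2_inner_def by (subst infsum_cnj[symmetric]) (simp add: mult.commute)

lemma ell2_inner_add_right:
  "\<lbrakk>f \<in> ell2 X; g \<in> ell2 X; h \<in> ell2 X\<rbrakk> \<Longrightarrow>
    ell2_inner X h (\<lambda>x. f x + g x) = ell2_inner X h f + ell2_inner X h g"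
  using ell2_inner_add_left[of f X g h] ell2_inner_commute[of X] by (metis complex_cnj_add)

lemma ell2_inner_cmult_right:
  "\<lbrakk>f \<in> ell2 X; g \<in> ell2 X\<rbrakk> \<Longrightarrow> ell2_inner X f (\<lambda>x. c * g x) = cnj c * ell2_inner X f g"
  using ell2_inner_cmult_left[of g X f c] ell2_inner_commute[of X] by (metis complex_cnj_mult)

lemma ell2_inner_self: "f \<in> ell2 X \<Longrightarrow> ell2_inner X f f = of_real ((ell2_norm X f)\<^sup>2)"
proof -
  assume f: "f \<in> ell2 X"
  then have s: "(\<lambda>x. (cmod (f x))\<^sup>2) summable_on X" by (simp add: ell2_def)
  have "ell2_inner X f f = (\<Sum>\<^sub>\<infinity>x\<in>X. of_real ((cmod (f x))\<^sup>2))"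
    by (simp only: ell2_inner_def complex_norm_square)
  also have "\<dots> = of_real (\<Sum>\<^sub>\<infinity>x\<in>X. (cmod (f x))\<^sup>2)" using has_sum_of_real[OF has_sum_infsum[OF s]] by (rule infsumI)
  also have "\<dots> = of_real ((ell2_norm X f)\<^sup>2)"
    by (simp add: ell2_norm_def infsum_nonneg)
  finally show ?thesis .
qed

lemma ell2_inner_basis_right: "\<lbrakk>f \<in> ell2 X; x \<in> X\<rbrakk> \<Longrightarrow> ell2_inner X f (ell2_basis x) = f x"
  unfolding ell2_inner_def by (subst infsum_single[of _ x]) (auto simp: ell2_basis_def)

lemma ell2_inner_basis_left: "\<lbrakk>f \<in> ell2 X; x \<in> X\<rbrakk> \<Longrightarrow> ell2_inner X (ell2_basis x) f = cnj (f x)"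
  using ell2_inner_basis_right[of f X x] ell2_inner_commute[of X f "ell2_basis x"] by simp

lemma ell2_ext_inner:
  assumes "f \<in> ell2 X" "g \<in> ell2 X" "\<And>h. h \<in> ell2 X \<Longrightarrow> ell2_inner X h f = ell2_inner X h g"
  shows "f = g"
proof
  fix x show "f x = g x"
  proof (cases "x \<in> X")
    case True
    then show ?thesis using assms(3)[of "ell2_basis x"] ell2_inner_basis_left[OF _ True] assms
      by (metis complex_cnj_cancel_iff ell2_basis_closed)
  qed (use assms ell2_support in metis)
qed

text \<open>Finite sums of squares come within \<open>e\<^sup>2\<close> of the total, and the sum
  over the complement is the difference.\<close>

lemma ell2_finite_approx:
  assumes f: "f \<in> ell2 X" and e: "e > 0"
  obtains F where "finite F" "F \<subseteq> X" "ell2_norm X (\<lambda>x. f x - (if x \<in> F then f x else 0)) \<le> e"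
proof -
  let ?g = "\<lambda>x. (cmod (f x))\<^sup>2"
  have s: "?g summable_on X" using f by (simp add: ell2_def)
  have "(?g has_sum infsum ?g X) X" using s by (rule has_sum_infsum)
  then have "\<forall>\<^sub>F F in finite_subsets_at_top X. sum ?g F > infsum ?g X - e\<^sup>2"
    unfolding has_sum_def by (rule order_tendstoD(1)) (use e in simp)
  then obtain F where F: "finite F" "F \<subseteq> X" "sum ?g F > infsum ?g X - e\<^sup>2"
    unfolding eventually_finite_subsets_at_top by blast
  have "L2_set (\<lambda>x. cmod (f x - (if x \<in> F then f x else 0))) G \<le> e" if G: "finite G" "G \<subseteq> X" for G
  proof -
    have "(\<Sum>x\<in>G. (cmod (f x - (if x \<in> F then f x else 0)))\<^sup>2) = sum ?g (G - F)"
      using G by (intro sum.mono_neutral_cong_right) auto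
    also have "\<dots> = sum ?g (G \<union> F) - sum ?g F"
      using G F sum.union_disjoint[of "G - F" F ?g] Diff_disjoint[of F G] by (simp add: Un_Diff_cancel2 Int_commute Diff_disjoint)
    also have "\<dots> \<le> infsum ?g X - sum ?g F"
      using G F s by (intro diff_right_mono finite_sum_le_infsum) auto
    also have "\<dots> \<le> e\<^sup>2" using F by simp
    finally show ?thesis using e unfolding L2_set_def by (metis real_sqrt_le_iff real_sqrt_abs abs_of_pos)
  qed
  then have "ell2_norm X (\<lambda>x. f x - (if x \<in> F then f x else 0)) \<le> e"
    using f by (intro ell2I) (auto simp: ell2_support)
  then show thesis using that F by blast
qed

section \<open>Bounded operators, adjoints and the operator norm\<close>

lemma bounded_opsD:
  assumes "T \<in> bounded_ops X"
  shows bounded_ops_closed: "f \<in> ell2 X \<Longrightarrow> T f \<in> ell2 X"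
    and bounded_ops_undefined: "f \<notin> ell2 X \<Longrightarrow> T f = undefined"
    and bounded_ops_add: "\<lbrakk>f \<in> ell2 X; g \<in> ell2 X\<rbrakk> \<Longrightarrow> T (\<lambda>x. f x + g x) = (\<lambda>x. T f x + T g x)"
    and bounded_ops_cmult: "f \<in> ell2 X \<Longrightarrow> T (\<lambda>x. c * f x) = (\<lambda>x. c * T f x)"
  using assms by (auto simp: bounded_ops_def PiE_def extensional_def)

lemma bounded_ops_bound:
  assumes "T \<in> bounded_ops X"
  obtains K where "0 \<le> K" "\<And>f. f \<in> ell2 X \<Longrightarrow> ell2_norm X (T f) \<le> K * ell2_norm X f"
proof -
  obtain K where K: "\<forall>f \<in> ell2 X. ell2_norm X (T f) \<le> K * ell2_norm X f"
    using assms by (auto simp: bounded_ops_def)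
  have "ell2_norm X (T f) \<le> max 0 K * ell2_norm X f" if "f \<in> ell2 X" for f
    using K that mult_right_mono[of K "max 0 K" "ell2_norm X f"] by force
  then show thesis using that[of "max 0 K"] by simp
qed

lemma bounded_opsI:
  assumes "\<And>f. f \<in> ell2 X \<Longrightarrow> T f \<in> ell2 X"
    and "\<And>f. f \<notin> ell2 X \<Longrightarrow> T f = undefined"
    and "\<And>f g. \<lbrakk>f \<in> ell2 X; g \<in> ell2 X\<rbrakk> \<Longrightarrow> T (\<lambda>x. f x + g x) = (\<lambda>x. T f x + T g x)"
    and "\<And>f c. f \<in> ell2 X \<Longrightarrow> T (\<lambda>x. c * f x) = (\<lambda>x. c * T f x)"
    and "\<And>f. f \<in> ell2 X \<Longrightarrow> ell2_norm X (T f) \<le> K * ell2_norm X f"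
  shows "T \<in> bounded_ops X"
  using assms unfolding bounded_ops_def by (auto simp: PiE_def extensional_def intro!: exI[of _ K])

lemma bounded_ops_0: "T \<in> bounded_ops X \<Longrightarrow> T (\<lambda>_. 0) = (\<lambda>_. 0)"
  using bounded_ops_cmult[of T X "\<lambda>_. 0" 0] by simp

lemma bounded_ops_diff:
  assumes "T \<in> bounded_ops X" "f \<in> ell2 X" "g \<in> ell2 X"
  shows "T (\<lambda>x. f x - g x) = (\<lambda>x. T f x - T g x)"
  using bounded_ops_add[OF assms(1,2) ell2_cmult_closed[OF assms(3), of "-1"]]
    bounded_ops_cmult[OF assms(1,3), of "-1"] by simp

lemma op_ext:
  "\<lbrakk>S \<in> bounded_ops X; T \<in> bounded_ops X; \<And>f. f \<in> ell2 X \<Longrightarrow> S f = T f\<rbrakk> \<Longrightarrow> S = T"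
  by (rule ext) (metis bounded_ops_undefined[of S X] bounded_ops_undefined[of T X])

lemma ell2_finite_decomp_op:
  assumes "T \<in> bounded_ops X" "finite F" "F \<subseteq> X"
  shows "T (\<lambda>x. if x \<in> F then a x else 0) = (\<lambda>y. \<Sum>x\<in>F. a x * T (ell2_basis x) y)"
  using assms(2,3)
proof (induction F rule: finite_induct)
  case empty
  then show ?case using bounded_ops_0[OF assms(1)] by simp
next
  case (insert z F)
  have fs: "(\<lambda>x. if x \<in> F then a x else 0) \<in> ell2 X"
    by (rule ell2_finite_support[of F]) (use insert in auto)
  have "(\<lambda>x. if x \<in> insert z F then a x else 0) =
      (\<lambda>x. (a z) * ell2_basis z x + (if x \<in> F then a x else 0))"
    using insert(2) by (auto simp: ell2_basis_def fun_eq_iff)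
  then have "T (\<lambda>x. if x \<in> insert z F then a x else 0) =
     (\<lambda>y. a z * T (ell2_basis z) y + T (\<lambda>x. if x \<in> F then a x else 0) y)"
    using bounded_ops_add[OF assms(1) ell2_cmult_closed[OF ell2_basis_closed] fs] insert
      bounded_ops_cmult[OF assms(1) ell2_basis_closed] by auto
  then show ?case using insert by simp
qed

text \<open>Finitely supported vectors are dense and both operators are bounded. This makes an
  operator prescribed on the basis, such as \<open>boundary_op\<close>, unique.\<close>

lemma op_ext_basis:
  assumes S: "S \<in> bounded_ops X" and T: "T \<in> bounded_ops X"
    and eq: "\<And>x. x \<in> X \<Longrightarrow> S (ell2_basis x) = T (ell2_basis x)"
  shows "S = T"
proof (rule op_ext[OF S T])
  fix f assume f: "f \<in> ell2 X"
  obtain K where K: "0 \<le> K" "\<And>f. f \<in> ell2 X \<Longrightarrow> ell2_norm X (S f) \<le> K * ell2_norm X f"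
    using bounded_ops_bound[OF S] by blast
  obtain K' where K': "0 \<le> K'" "\<And>f. f \<in> ell2 X \<Longrightarrow> ell2_norm X (T f) \<le> K' * ell2_norm X f"
    using bounded_ops_bound[OF T] by blast
  have eps: "cmod (S f y - T f y) \<le> e" if e: "e > 0" for e y
  proof -
    \<comment> \<open>The 1 keeps the denominator positive when both bounds are 0.\<close>
    define d where "d = e / (K + K' + 1)"
    have d: "d > 0" "(K + K') * d \<le> e" using e K K' by (simp_all add: d_def field_simps)
    obtain F where F: "finite F" "F \<subseteq> X" "ell2_norm X (\<lambda>x. f x - (if x \<in> F then f x else 0)) \<le> d"
      using ell2_finite_approx[OF f d(1)] by blast
    let ?g = "\<lambda>x. if x \<in> F then f x else 0" and ?h = "\<lambda>x. f x - (if x \<in> F then f x else 0)"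
    have g: "?g \<in> ell2 X" and h: "?h \<in> ell2 X"
      by (rule ell2_mask_closed[OF f], simp)+
    have "S ?g = T ?g"
      using F eq by (simp add: ell2_finite_decomp_op[OF S] ell2_finite_decomp_op[OF T] subset_iff cong: sum.cong)
    then have "S f y - T f y = S ?h y - T ?h y"
      using bounded_ops_diff[OF S f g] bounded_ops_diff[OF T f g] by simp
    also have "cmod \<dots> \<le> cmod (S ?h y) + cmod (T ?h y)" by (rule norm_triangle_ineq4)
    also have "\<dots> \<le> ell2_norm X (S ?h) + ell2_norm X (T ?h)"
      using h bounded_ops_closed[OF S] bounded_ops_closed[OF T] by (intro add_mono cmod_le_ell2_norm)
    also have "\<dots> \<le> (K + K') * ell2_norm X ?h"
      using K(2)[OF h] K'(2)[OF h] by (simp add: algebra_simps)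
    also have "\<dots> \<le> (K + K') * d" using F(3) K K' by (intro mult_left_mono) auto
    finally show ?thesis using d by simp
  qed
  have "cmod (S f y - T f y) \<le> 0" for y by (rule field_le_epsilon) (simp add: eps)
  then show "S f = T f" by auto
qed

lemma B_ell2_simps [simp]:
  "carrier (B_ell2 X) = bounded_ops X"
  "S \<otimes>\<^bsub>B_ell2 X\<^esub> T = compose (ell2 X) S T"
  "\<zero>\<^bsub>B_ell2 X\<^esub> = restrict (\<lambda>f x. 0) (ell2 X)"
  "S \<oplus>\<^bsub>B_ell2 X\<^esub> T = restrict (\<lambda>f x. S f x + T f x) (ell2 X)"
  "c \<odot>\<^bsub>B_ell2 X\<^esub> T = restrict (\<lambda>f x. c * T f x) (ell2 X)"
  by (simp_all add: B_ell2_def)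

lemma op_zero_closed: "restrict (\<lambda>f x. 0) (ell2 X) \<in> bounded_ops X"
  by (rule bounded_opsI[of _ _ 0]) (auto simp: ell2_add_closed ell2_cmult_closed)

lemma op_add_closed:
  assumes S: "S \<in> bounded_ops X" and T: "T \<in> bounded_ops X"
  shows "restrict (\<lambda>f x. S f x + T f x) (ell2 X) \<in> bounded_ops X"
proof -
  obtain K where K: "0 \<le> K" "\<And>f. f \<in> ell2 X \<Longrightarrow> ell2_norm X (S f) \<le> K * ell2_norm X f"
    using bounded_ops_bound[OF S] by blast
  obtain K' where K': "0 \<le> K'" "\<And>f. f \<in> ell2 X \<Longrightarrow> ell2_norm X (T f) \<le> K' * ell2_norm X f"
    using bounded_ops_bound[OF T] by blast
  show ?thesis
  proof (rule bounded_opsI[of _ _ "K + K'"])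
    fix f assume f: "f \<in> ell2 X"
    show "restrict (\<lambda>f x. S f x + T f x) (ell2 X) f \<in> ell2 X"
      using f S T by (simp add: ell2_add_closed bounded_ops_closed[OF S] bounded_ops_closed[OF T])
    have "ell2_norm X (\<lambda>x. S f x + T f x) \<le> ell2_norm X (S f) + ell2_norm X (T f)"
      using f S T by (intro ell2_norm_add bounded_ops_closed[OF S] bounded_ops_closed[OF T])
    then show "ell2_norm X (restrict (\<lambda>f x. S f x + T f x) (ell2 X) f) \<le> (K + K') * ell2_norm X f"
      using K(2)[OF f] K'(2)[OF f] f by (simp add: algebra_simps)
  next
    fix f g assume f: "f \<in> ell2 X" and g: "g \<in> ell2 X"
    show "restrict (\<lambda>f x. S f x + T f x) (ell2 X) (\<lambda>x. f x + g x) =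
      (\<lambda>x. restrict (\<lambda>f x. S f x + T f x) (ell2 X) f x + restrict (\<lambda>f x. S f x + T f x) (ell2 X) g x)"
      using f g by (simp add: ell2_add_closed bounded_ops_add[OF S] bounded_ops_add[OF T] add_ac)
  next
    fix f c assume f: "f \<in> ell2 X"
    show "restrict (\<lambda>f x. S f x + T f x) (ell2 X) (\<lambda>x. c * f x) =
      (\<lambda>x. c * restrict (\<lambda>f x. S f x + T f x) (ell2 X) f x)"
      using f by (simp add: ell2_cmult_closed bounded_ops_cmult[OF S] bounded_ops_cmult[OF T] distrib_left)
  qed simp
qed

lemma op_cmult_closed:
  assumes T: "T \<in> bounded_ops X"
  shows "restrict (\<lambda>f x. c * T f x) (ell2 X) \<in> bounded_ops X"
proof -
  obtain K where K: "0 \<le> K" "\<And>f. f \<in> ell2 X \<Longrightarrow> ell2_norm X (T f) \<le> K * ell2_norm X f"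
    using bounded_ops_bound[OF T] by blast
  show ?thesis
  proof (rule bounded_opsI[of _ _ "cmod c * K"])
    fix f assume f: "f \<in> ell2 X"
    show "ell2_norm X (restrict (\<lambda>f x. c * T f x) (ell2 X) f) \<le> cmod c * K * ell2_norm X f"
      using K(2)[OF f] f T by (simp add: ell2_norm_cmult bounded_ops_closed[OF T] mult.assoc mult_left_mono)
    show "restrict (\<lambda>f x. c * T f x) (ell2 X) f \<in> ell2 X"
      using f by (simp add: ell2_cmult_closed bounded_ops_closed[OF T])
  next
    fix f g assume f: "f \<in> ell2 X" and g: "g \<in> ell2 X"
    show "restrict (\<lambda>f x. c * T f x) (ell2 X) (\<lambda>x. f x + g x) =
      (\<lambda>x. restrict (\<lambda>f x. c * T f x) (ell2 X) f x + restrict (\<lambda>f x. c * T f x) (ell2 X) g x)"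
      using f g by (simp add: ell2_add_closed bounded_ops_add[OF T] distrib_left)
  next
    fix f d assume f: "f \<in> ell2 X"
    show "restrict (\<lambda>f x. c * T f x) (ell2 X) (\<lambda>x. d * f x) =
      (\<lambda>x. d * restrict (\<lambda>f x. c * T f x) (ell2 X) f x)"
      using f by (simp add: ell2_cmult_closed bounded_ops_cmult[OF T] mult.left_commute)
  qed simp
qed

lemma op_compose_closed:
  assumes S: "S \<in> bounded_ops X" and T: "T \<in> bounded_ops X"
  shows "compose (ell2 X) S T \<in> bounded_ops X"
proof -
  obtain K where K: "0 \<le> K" "\<And>f. f \<in> ell2 X \<Longrightarrow> ell2_norm X (S f) \<le> K * ell2_norm X f"
    using bounded_ops_bound[OF S] by blast
  obtain K' where K': "0 \<le> K'" "\<And>f. f \<in> ell2 X \<Longrightarrow> ell2_norm X (T f) \<le> K' * ell2_norm X f"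
    using bounded_ops_bound[OF T] by blast
  show ?thesis
  proof (rule bounded_opsI[of _ _ "K * K'"])
    fix f assume f: "f \<in> ell2 X"
    have "ell2_norm X (S (T f)) \<le> K * ell2_norm X (T f)" using K f T by (simp add: bounded_ops_closed[OF T])
    also have "\<dots> \<le> K * (K' * ell2_norm X f)" using K K' f by (simp add: mult_left_mono)
    finally show "ell2_norm X (compose (ell2 X) S T f) \<le> K * K' * ell2_norm X f"
      using f by (simp add: compose_eq mult.assoc)
    show "compose (ell2 X) S T f \<in> ell2 X"
      using f by (simp add: compose_eq bounded_ops_closed[OF S] bounded_ops_closed[OF T])
  next
    fix f g assume f: "f \<in> ell2 X" and g: "g \<in> ell2 X"
    show "compose (ell2 X) S T (\<lambda>x. f x + g x) = (\<lambda>x. compose (ell2 X) S T f x + compose (ell2 X) S T g x)"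
      using f g by (simp add: compose_eq ell2_add_closed bounded_ops_closed[OF T] bounded_ops_add[OF T]
          bounded_ops_add[OF S])
  next
    fix f c assume f: "f \<in> ell2 X"
    show "compose (ell2 X) S T (\<lambda>x. c * f x) = (\<lambda>x. c * compose (ell2 X) S T f x)"
      using f by (simp add: compose_eq ell2_cmult_closed bounded_ops_closed[OF T] bounded_ops_cmult[OF T]
          bounded_ops_cmult[OF S])
  qed (simp add: compose_def)
qed

text \<open>The coordinates of the adjoint are forced by the basis vectors. That they form a
  square-summable family is the point; the adjoint relation then extends from finitely supported
  vectors by continuity.\<close>

lemma op_adjoint_ex:
  assumes T: "T \<in> bounded_ops X"
  shows "\<exists>T' \<in> bounded_ops X. \<forall>f \<in> ell2 X. \<forall>g \<in> ell2 X. ell2_inner X (T f) g = ell2_inner X f (T' g)"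
proof -
  obtain K where K: "0 \<le> K" "\<And>f. f \<in> ell2 X \<Longrightarrow> ell2_norm X (T f) \<le> K * ell2_norm X f"
    using bounded_ops_bound[OF T] by blast
  define U where "U g = (\<lambda>x. if x \<in> X then cnj (ell2_inner X (T (ell2_basis x)) g) else 0)" for g
  have fin: "ell2_inner X (T (\<lambda>x. if x \<in> F then a x else 0)) g = (\<Sum>x\<in>F. a x * cnj (U g x))"
    if F: "finite F" "F \<subseteq> X" and g: "g \<in> ell2 X" for F a g
    using F
  proof (induction F rule: finite_induct)
    case empty
    then show ?case using bounded_ops_0[OF T] by (simp add: ell2_inner_def)
  next
    case (insert z F)
    have fs: "(\<lambda>x. if x \<in> F then a x else 0) \<in> ell2 X"
      by (rule ell2_finite_support[of F]) (use insert in auto)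
    have "(\<lambda>x. if x \<in> insert z F then a x else 0) =
        (\<lambda>x. a z * ell2_basis z x + (if x \<in> F then a x else 0))"
      using insert(2) by (auto simp: ell2_basis_def fun_eq_iff)
    then have "T (\<lambda>x. if x \<in> insert z F then a x else 0) =
       (\<lambda>y. a z * T (ell2_basis z) y + T (\<lambda>x. if x \<in> F then a x else 0) y)"
      using bounded_ops_add[OF T ell2_cmult_closed[OF ell2_basis_closed] fs] insert
        bounded_ops_cmult[OF T ell2_basis_closed] by auto
    then show ?case
      using insert g fs T
      by (simp add: ell2_inner_add_left ell2_inner_cmult_left ell2_cmult_closed bounded_ops_closed[OF T] U_def)
  qed
  have U: "U g \<in> ell2 X" "ell2_norm X (U g) \<le> K * ell2_norm X g" if g: "g \<in> ell2 X" for g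
  proof -
    have "L2_set (\<lambda>x. cmod (U g x)) F \<le> K * ell2_norm X g" if F: "finite F" "F \<subseteq> X" for F
    proof -
      \<comment> \<open>Testing \<open>T\<close> on the truncation \<open>?h\<close> of
        \<open>U g\<close> itself gives L^2 \<le> K L times the norm of \<open>g\<close>, and one
        factor L cancels.\<close>
      let ?L = "L2_set (\<lambda>x. cmod (U g x)) F"
      let ?h = "\<lambda>x. if x \<in> F then U g x else 0"
      have h: "?h \<in> ell2 X" by (rule ell2_finite_support[OF F]) simp
      have hn: "ell2_norm X ?h \<le> ?L"
      proof (rule ell2I)
        fix G assume G: "finite G" "G \<subseteq> X"
        have "(\<Sum>x\<in>G. (cmod (if x \<in> F then U g x else 0))\<^sup>2) = (\<Sum>x\<in>G \<inter> F. (cmod (U g x))\<^sup>2)"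
          using G by (intro sum.mono_neutral_cong_right) auto
        also have "\<dots> \<le> (\<Sum>x\<in>F. (cmod (U g x))\<^sup>2)" using F by (intro sum_mono2) auto
        finally show "L2_set (\<lambda>x. cmod (if x \<in> F then U g x else 0)) G \<le> ?L"
          unfolding L2_set_def by simp
      qed (use F in auto)
      have "?L\<^sup>2 = (\<Sum>x\<in>F. (cmod (U g x))\<^sup>2)" by (simp add: L2_set_def sum_nonneg)
      then have "of_real (?L\<^sup>2) = (\<Sum>x\<in>F. U g x * cnj (U g x))" by (simp only: of_real_sum complex_norm_square)
      also have "\<dots> = ell2_inner X (T ?h) g" using fin[OF F g, of "U g"] by simp
      finally have "?L\<^sup>2 = cmod (ell2_inner X (T ?h) g)" by (metis norm_of_real abs_power2)
      also have "\<dots> \<le> ell2_norm X (T ?h) * ell2_norm X g"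
        using h g T by (intro ell2_Cauchy_Schwarz bounded_ops_closed[OF T])
      also have "\<dots> \<le> (K * ?L) * ell2_norm X g"
        using K(2)[OF h] hn K(1) by (intro mult_right_mono) (auto intro: order_trans mult_left_mono)
      finally have "?L * ?L \<le> ?L * (K * ell2_norm X g)" by (simp add: power2_eq_square algebra_simps)
      then show ?thesis using K(1) by (cases "?L = 0") (auto simp: mult_le_cancel_left_pos less_le)
    qed
    then show "U g \<in> ell2 X" "ell2_norm X (U g) \<le> K * ell2_norm X g"
      using ell2I[of X "U g"] by (auto simp: U_def)
  qed
  have adj: "ell2_inner X (T f) g = ell2_inner X f (U g)" if f: "f \<in> ell2 X" and g: "g \<in> ell2 X" for f g
  proof -
    have eps: "cmod (ell2_inner X (T f) g - ell2_inner X f (U g)) \<le> e" if e: "e > 0" for e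
    proof -
      define d where "d = e / (2 * K * ell2_norm X g + 1)"
      define N where "N = 2 * K * ell2_norm X g"
      have N: "0 \<le> N" using K(1) by (simp add: N_def)
      have dN: "d = e / (N + 1)" by (simp add: d_def N_def)
      have "d > 0" unfolding dN using e N by simp
      moreover have "d * (N + 1) = e" unfolding dN using N by simp
      ultimately have "d > 0" "N * d \<le> e" by (simp_all add: distrib_left mult.commute)
      then have d: "d > 0" "2 * K * ell2_norm X g * d \<le> e" by (simp_all add: N_def)
      obtain F where F: "finite F" "F \<subseteq> X" "ell2_norm X (\<lambda>x. f x - (if x \<in> F then f x else 0)) \<le> d"
        using ell2_finite_approx[OF f d(1)] by blast
      let ?g = "\<lambda>x. if x \<in> F then f x else 0" and ?h = "\<lambda>x. f x - (if x \<in> F then f x else 0)"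
      have gh: "?g \<in> ell2 X" and h: "?h \<in> ell2 X"
        by (rule ell2_mask_closed[OF f], simp)+
      have "ell2_inner X ?g (U g) = (\<Sum>x\<in>F. f x * cnj (U g x))"
        unfolding ell2_inner_def
        by (subst infsum_finite[OF F(1), symmetric], rule infsum_cong_neutral) (use F in auto)
      then have "ell2_inner X (T ?g) g = ell2_inner X ?g (U g)" using fin[OF F(1,2) g, of f] by simp
      moreover have "ell2_inner X (T f) g = ell2_inner X (T ?h) g + ell2_inner X (T ?g) g"
        using ell2_inner_add_left[OF bounded_ops_closed[OF T h] bounded_ops_closed[OF T gh] g]
          bounded_ops_add[OF T h gh] by simp
      moreover have "ell2_inner X f (U g) = ell2_inner X ?h (U g) + ell2_inner X ?g (U g)"
        using ell2_inner_add_left[OF h gh U(1)[OF g]] by simp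
      ultimately have "ell2_inner X (T f) g - ell2_inner X f (U g) = ell2_inner X (T ?h) g - ell2_inner X ?h (U g)"
        by simp
      also have "cmod \<dots> \<le> cmod (ell2_inner X (T ?h) g) + cmod (ell2_inner X ?h (U g))" by (rule norm_triangle_ineq4)
      also have "\<dots> \<le> ell2_norm X (T ?h) * ell2_norm X g + ell2_norm X ?h * ell2_norm X (U g)"
        using h g U T by (intro add_mono ell2_Cauchy_Schwarz bounded_ops_closed[OF T])
      also have "\<dots> \<le> (K * ell2_norm X ?h) * ell2_norm X g + ell2_norm X ?h * (K * ell2_norm X g)"
        using K(2)[OF h] U(2)[OF g] by (intro add_mono mult_right_mono mult_left_mono) auto
      also have "\<dots> = 2 * K * ell2_norm X g * ell2_norm X ?h" by (simp add: algebra_simps)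
      also have "\<dots> \<le> 2 * K * ell2_norm X g * d" using F(3) K by (intro mult_left_mono) auto
      finally show ?thesis using d by simp
    qed
    have "cmod (ell2_inner X (T f) g - ell2_inner X f (U g)) \<le> 0"
      by (rule field_le_epsilon) (simp add: eps)
    then show ?thesis by simp
  qed
  have "restrict U (ell2 X) \<in> bounded_ops X"
  proof (rule bounded_opsI[of _ _ K])
    fix f g assume f: "f \<in> ell2 X" and g: "g \<in> ell2 X"
    then have "U (\<lambda>x. f x + g x) = (\<lambda>x. U f x + U g x)"
      by (auto simp: U_def fun_eq_iff ell2_inner_add_right bounded_ops_closed[OF T])
    then show "restrict U (ell2 X) (\<lambda>x. f x + g x) = (\<lambda>x. restrict U (ell2 X) f x + restrict U (ell2 X) g x)"
      using f g by (simp add: ell2_add_closed)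
  next
    fix f c assume f: "f \<in> ell2 X"
    then have "U (\<lambda>x. c * f x) = (\<lambda>x. c * U f x)"
      by (auto simp: U_def fun_eq_iff ell2_inner_cmult_right bounded_ops_closed[OF T])
    then show "restrict U (ell2 X) (\<lambda>x. c * f x) = (\<lambda>x. c * restrict U (ell2 X) f x)"
      using f by (simp add: ell2_cmult_closed)
  qed (use U in auto)
  then show ?thesis using adj by (intro bexI[of _ "restrict U (ell2 X)"]) auto
qed

lemma op_adjoint_unique:
  assumes "S \<in> bounded_ops X" "S' \<in> bounded_ops X"
    "\<And>f g. \<lbrakk>f \<in> ell2 X; g \<in> ell2 X\<rbrakk> \<Longrightarrow> ell2_inner X f (S g) = ell2_inner X f (S' g)"
  shows "S = S'"
  by (rule op_ext[OF assms(1,2)]) (rule ell2_ext_inner, use assms bounded_ops_closed in auto)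

lemma B_ell2_adj:
  assumes T: "T \<in> bounded_ops X"
  shows adj_in: "adj (B_ell2 X) T \<in> bounded_ops X"
    and adj_inner: "\<lbrakk>f \<in> ell2 X; g \<in> ell2 X\<rbrakk> \<Longrightarrow> ell2_inner X (T f) g = ell2_inner X f (adj (B_ell2 X) T g)"
proof -
  let ?P = "\<lambda>T'. T' \<in> bounded_ops X \<and>
       (\<forall>f \<in> ell2 X. \<forall>g \<in> ell2 X. ell2_inner X (T f) g = ell2_inner X f (T' g))"
  have ex1: "\<exists>!T'. ?P T'"
  proof (rule ex_ex1I)
    show "\<exists>T'. ?P T'" using op_adjoint_ex[OF T] by blast
    show "S = S'" if "?P S" "?P S'" for S S'
      using that by (intro op_adjoint_unique[of S X S']) auto
  qed
  have eq: "adj (B_ell2 X) T = The ?P" by (simp add: B_ell2_def)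
  have "?P (adj (B_ell2 X) T)" unfolding eq by (rule theI'[OF ex1])
  then show "adj (B_ell2 X) T \<in> bounded_ops X"
    "\<lbrakk>f \<in> ell2 X; g \<in> ell2 X\<rbrakk> \<Longrightarrow> ell2_inner X (T f) g = ell2_inner X f (adj (B_ell2 X) T g)" by auto
qed

lemma adj_eqI:
  assumes "T \<in> bounded_ops X" "S \<in> bounded_ops X"
    "\<And>f g. \<lbrakk>f \<in> ell2 X; g \<in> ell2 X\<rbrakk> \<Longrightarrow> ell2_inner X (T f) g = ell2_inner X f (S g)"
  shows "adj (B_ell2 X) T = S"
  by (rule op_adjoint_unique[OF adj_in[OF assms(1)] assms(2)])
    (simp add: adj_inner[OF assms(1), symmetric] assms(3))

lemma op_norm_bdd:
  assumes T: "T \<in> bounded_ops X"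
  shows "bdd_above ((\<lambda>f. ell2_norm X (T f)) ` {f \<in> ell2 X. ell2_norm X f \<le> 1})"
proof -
  obtain K where K: "0 \<le> K" "\<And>f. f \<in> ell2 X \<Longrightarrow> ell2_norm X (T f) \<le> K * ell2_norm X f"
    using bounded_ops_bound[OF T] by blast
  show ?thesis
    by (rule bdd_aboveI2[of _ _ K]) (use K in \<open>auto intro: order_trans mult_left_le\<close>)
qed

lemma op_nrm_nonneg: "T \<in> bounded_ops X \<Longrightarrow> 0 \<le> nrm (B_ell2 X) T"
  unfolding B_ell2_def using cSUP_upper2[OF op_norm_bdd, of T X "\<lambda>_. 0" 0] by simp

lemma op_nrm_bound:
  assumes T: "T \<in> bounded_ops X" and f: "f \<in> ell2 X"
  shows "ell2_norm X (T f) \<le> nrm (B_ell2 X) T * ell2_norm X f"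
proof (cases "ell2_norm X f = 0")
  case True
  then have "f = (\<lambda>_. 0)" using ell2_norm_eq_0[OF f] by simp
  then show ?thesis by (simp add: bounded_ops_0[OF T])
next
  case False
  let ?n = "ell2_norm X f"
  have n: "?n > 0" using False ell2_norm_nonneg[of X f] by linarith
  let ?g = "\<lambda>x. of_real (1 / ?n) * f x"
  have g: "?g \<in> ell2 X" "ell2_norm X ?g \<le> 1"
    using f n ell2_norm_cmult[OF f, of "of_real (1 / ?n)"] by (simp_all add: ell2_cmult_closed del: of_real_divide)
  have "ell2_norm X (T ?g) \<le> nrm (B_ell2 X) T"
    using cSUP_upper[OF _ op_norm_bdd[OF T], of ?g] g by (simp add: B_ell2_def)
  moreover have "ell2_norm X (T ?g) = ell2_norm X (T f) / ?n"
    using n by (subst bounded_ops_cmult[OF T f], subst ell2_norm_cmult[OF bounded_ops_closed[OF T f]]) (simp add: norm_divide)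
  ultimately have "ell2_norm X (T f) / ?n \<le> nrm (B_ell2 X) T" by simp
  then show ?thesis using n by (simp only: pos_divide_le_eq)
qed

lemma op_nrm_le:
  assumes "\<And>f. f \<in> ell2 X \<Longrightarrow> ell2_norm X (T f) \<le> c * ell2_norm X f" "0 \<le> c"
  shows "nrm (B_ell2 X) T \<le> c"
proof -
  have "(SUP f \<in> {f \<in> ell2 X. ell2_norm X f \<le> 1}. ell2_norm X (T f)) \<le> c"
  proof (rule cSUP_least)
    show "{f \<in> ell2 X. ell2_norm X f \<le> 1} \<noteq> {}" using ell2_0[of X] by fastforce
    show "ell2_norm X (T f) \<le> c" if "f \<in> {f \<in> ell2 X. ell2_norm X f \<le> 1}" for f
      using assms(1)[of f] that assms(2) mult_left_le[of "ell2_norm X f" c] by simp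
  qed
  then show ?thesis by (simp add: B_ell2_def)
qed

lemma B_ell2_module: "module complex_field (B_ell2 X)"
proof (rule moduleI[OF complex_field_cring])
  show "abelian_group (B_ell2 X)"
  proof (rule abelian_groupI)
    fix T assume T: "T \<in> carrier (B_ell2 X)"
    let ?S = "restrict (\<lambda>f x. (-1) * T f x) (ell2 X)"
    have "?S \<oplus>\<^bsub>B_ell2 X\<^esub> T = \<zero>\<^bsub>B_ell2 X\<^esub>" by (auto simp: fun_eq_iff restrict_def)
    moreover have "?S \<in> carrier (B_ell2 X)" using T op_cmult_closed[of T X "-1"] by simp
    ultimately show "\<exists>S\<in>carrier (B_ell2 X). S \<oplus>\<^bsub>B_ell2 X\<^esub> T = \<zero>\<^bsub>B_ell2 X\<^esub>" by blast
    show "\<zero>\<^bsub>B_ell2 X\<^esub> \<oplus>\<^bsub>B_ell2 X\<^esub> T = T"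
      using T by (auto simp: fun_eq_iff restrict_def bounded_ops_undefined)
  qed ((simp add: op_add_closed op_zero_closed; fail) | (auto simp: fun_eq_iff restrict_def add_ac; fail))+
qed ((simp add: op_cmult_closed; fail) |
     (auto simp: fun_eq_iff restrict_def algebra_simps bounded_ops_undefined; fail))+

lemma B_ell2_minus:
  assumes "S \<in> bounded_ops X" "T \<in> bounded_ops X"
  shows "S \<ominus>\<^bsub>B_ell2 X\<^esub> T = restrict (\<lambda>f x. S f x - T f x) (ell2 X)"
proof -
  interpret module complex_field "B_ell2 X" by (rule B_ell2_module)
  let ?S = "restrict (\<lambda>f x. (-1) * T f x) (ell2 X)"
  have "?S \<oplus>\<^bsub>B_ell2 X\<^esub> T = \<zero>\<^bsub>B_ell2 X\<^esub>" by (auto simp: fun_eq_iff restrict_def)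
  moreover have "?S \<in> carrier (B_ell2 X)" using assms op_cmult_closed[of T X "-1"] by simp
  ultimately have "\<ominus>\<^bsub>B_ell2 X\<^esub> T = ?S" using assms M.minus_equality by simp
  then show ?thesis by (auto simp: a_minus_def fun_eq_iff restrict_def)
qed

text \<open>The squared norm of \<open>T f\<close> is the inner product of \<open>f\<close> with
  T*Tf, and Cauchy-Schwarz bounds it.\<close>

lemma op_nrm_square_le:
  assumes T: "T \<in> bounded_ops X"
  shows "(nrm (B_ell2 X) T)\<^sup>2 \<le> nrm (B_ell2 X) (compose (ell2 X) (adj (B_ell2 X) T) T)"
proof -
  let ?n = "nrm (B_ell2 X)" and ?C = "compose (ell2 X) (adj (B_ell2 X) T) T"
  have C: "?C \<in> bounded_ops X" by (rule op_compose_closed[OF adj_in[OF T] T])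
  have "?n T \<le> sqrt (?n ?C)"
  proof (rule op_nrm_le)
    fix f assume f: "f \<in> ell2 X"
    have Tf: "T f \<in> ell2 X" by (rule bounded_ops_closed[OF T f])
    have "of_real ((ell2_norm X (T f))\<^sup>2) = ell2_inner X f (?C f)"
      using ell2_inner_self[OF Tf] adj_inner[OF T f Tf] f by (simp add: compose_eq)
    then have "(ell2_norm X (T f))\<^sup>2 = cmod (ell2_inner X f (?C f))" by (metis norm_of_real abs_power2)
    also have "\<dots> \<le> ell2_norm X f * ell2_norm X (?C f)"
      by (rule ell2_Cauchy_Schwarz[OF f bounded_ops_closed[OF C f]])
    also have "\<dots> \<le> ell2_norm X f * (?n ?C * ell2_norm X f)"
      using op_nrm_bound[OF C f] by (intro mult_left_mono) auto
    also have "\<dots> = (sqrt (?n ?C) * ell2_norm X f)\<^sup>2"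
      using op_nrm_nonneg[OF C] by (simp add: power2_eq_square)
    finally show "ell2_norm X (T f) \<le> sqrt (?n ?C) * ell2_norm X f"
      by (rule power2_le_imp_le) (use op_nrm_nonneg[OF C] in simp)
  qed (use op_nrm_nonneg[OF C] in simp)
  then have "(?n T)\<^sup>2 \<le> (sqrt (?n ?C))\<^sup>2" using op_nrm_nonneg[OF T] by (intro power_mono) auto
  then show ?thesis using op_nrm_nonneg[OF C] by simp
qed

lemma op_nrm_compose:
  assumes S: "S \<in> bounded_ops X" and T: "T \<in> bounded_ops X"
  shows "nrm (B_ell2 X) (compose (ell2 X) S T) \<le> nrm (B_ell2 X) S * nrm (B_ell2 X) T"
proof (rule op_nrm_le)
  fix f assume f: "f \<in> ell2 X"
  have "ell2_norm X (S (T f)) \<le> nrm (B_ell2 X) S * ell2_norm X (T f)"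
    by (rule op_nrm_bound[OF S bounded_ops_closed[OF T f]])
  also have "\<dots> \<le> nrm (B_ell2 X) S * (nrm (B_ell2 X) T * ell2_norm X f)"
    using op_nrm_bound[OF T f] op_nrm_nonneg[OF S] by (rule mult_left_mono)
  finally show "ell2_norm X (compose (ell2 X) S T f) \<le> nrm (B_ell2 X) S * nrm (B_ell2 X) T * ell2_norm X f"
    using f by (simp add: compose_eq mult.assoc)
qed (use op_nrm_nonneg[OF S] op_nrm_nonneg[OF T] in simp)

lemma adj_adj_op:
  assumes T: "T \<in> bounded_ops X"
  shows "adj (B_ell2 X) (adj (B_ell2 X) T) = T"
proof (rule adj_eqI[OF adj_in[OF T] T])
  fix f g assume "f \<in> ell2 X" "g \<in> ell2 X"
  then show "ell2_inner X (adj (B_ell2 X) T f) g = ell2_inner X f (T g)"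
    using adj_inner[OF T, of g f] ell2_inner_commute[of X "T g" f]
      ell2_inner_commute[of X g "adj (B_ell2 X) T f"] by simp
qed

text \<open>Apply \<open>op_nrm_square_le\<close> to the adjoint, whose own adjoint is
  \<open>T\<close>, and cancel one factor.\<close>

lemma op_nrm_adj_le:
  assumes T: "T \<in> bounded_ops X"
  shows "nrm (B_ell2 X) (adj (B_ell2 X) T) \<le> nrm (B_ell2 X) T"
proof -
  let ?n = "nrm (B_ell2 X)" and ?S = "adj (B_ell2 X) T"
  have S: "?S \<in> bounded_ops X" by (rule adj_in[OF T])
  have "(?n ?S)\<^sup>2 \<le> ?n T * ?n ?S"
    using op_nrm_square_le[OF S] op_nrm_compose[OF T S] by (simp add: adj_adj_op[OF T])
  then show ?thesis
    using op_nrm_nonneg[OF S] op_nrm_nonneg[OF T] by (cases "?n ?S = 0") (auto simp: power2_eq_square)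
qed

text \<open>The limit operator is the coordinatewise limit. The metric axioms are a premise because
  completeness is itself part of being a C*-algebra and must be proved before that is known.\<close>

lemma B_ell2_complete: "Metric_space.mcomplete (carrier (B_ell2 X)) (cstar_dist (B_ell2 X))"
  if metric: "Metric_space (carrier (B_ell2 X)) (cstar_dist (B_ell2 X))"
proof -
  interpret Metric_space "carrier (B_ell2 X)" "cstar_dist (B_ell2 X)" by (rule metric)
  let ?n = "nrm (B_ell2 X)"
  have "\<exists>T. limitin mtopology \<sigma> T sequentially" if "MCauchy \<sigma>" for \<sigma>
  proof -
    have \<sigma>: "\<sigma> n \<in> bounded_ops X" for n using that unfolding MCauchy_def by auto
    define D where "D m n = restrict (\<lambda>f x. \<sigma> m f x - \<sigma> n f x) (ell2 X)" for m n
    have D: "D m n = \<sigma> m \<ominus>\<^bsub>B_ell2 X\<^esub> \<sigma> n" "D m n \<in> bounded_ops X" for m n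
    proof -
      show "D m n = \<sigma> m \<ominus>\<^bsub>B_ell2 X\<^esub> \<sigma> n" by (simp add: D_def B_ell2_minus[OF \<sigma> \<sigma>])
      have "restrict (\<lambda>f x. \<sigma> m f x + restrict (\<lambda>f x. (-1) * \<sigma> n f x) (ell2 X) f x) (ell2 X) \<in> bounded_ops X"
        by (rule op_add_closed[OF \<sigma> op_cmult_closed[OF \<sigma>]])
      also have "restrict (\<lambda>f x. \<sigma> m f x + restrict (\<lambda>f x. (-1) * \<sigma> n f x) (ell2 X) f x) (ell2 X) = D m n"
        by (auto simp: D_def fun_eq_iff restrict_def)
      finally show "D m n \<in> bounded_ops X" .
    qed
    have C: "\<exists>N. \<forall>m\<ge>N. \<forall>n\<ge>N. ?n (D m n) < e" if e: "e > 0" for e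
    proof -
      obtain N where "\<forall>n n'. N \<le> n \<longrightarrow> N \<le> n' \<longrightarrow> cstar_dist (B_ell2 X) (\<sigma> n) (\<sigma> n') < e"
        using \<open>MCauchy \<sigma>\<close> e unfolding MCauchy_def by blast
      then have "\<forall>m\<ge>N. \<forall>n\<ge>N. ?n (D m n) < e" by (simp add: cstar_dist_def \<sigma> D)
      then show ?thesis by blast
    qed
    have Df: "D m n f = (\<lambda>x. \<sigma> m f x - \<sigma> n f x)" if "f \<in> ell2 X" for m n f using that by (simp add: D_def)
    have Dx: "ell2_norm X (\<lambda>x. \<sigma> m f x - \<sigma> n f x) \<le> ?n (D m n) * ell2_norm X f"
      if f: "f \<in> ell2 X" for m n f
      using op_nrm_bound[OF D(2) f, of m n] by (simp add: Df[OF f])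
    have lim: "\<exists>l. (\<lambda>n. \<sigma> n f x) \<longlonglongrightarrow> l" if f: "f \<in> ell2 X" for f x
    proof -
      have "Cauchy (\<lambda>n. \<sigma> n f x)"
      proof (rule CauchyI)
        fix e :: real assume e: "e > 0"
        obtain N where N: "\<forall>m\<ge>N. \<forall>n\<ge>N. ?n (D m n) < e / (ell2_norm X f + 1)"
          using C[of "e / (ell2_norm X f + 1)"] e by (auto simp: add_nonneg_pos)
        have "cmod (\<sigma> m f x - \<sigma> n f x) < e" if "m \<ge> N" "n \<ge> N" for m n
        proof -
          have "cmod (\<sigma> m f x - \<sigma> n f x) \<le> ell2_norm X (\<lambda>x. \<sigma> m f x - \<sigma> n f x)"
            using cmod_le_ell2_norm[OF ell2_diff_closed[OF bounded_ops_closed[OF \<sigma> f] bounded_ops_closed[OF \<sigma> f]]] .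
          also have "\<dots> \<le> ?n (D m n) * ell2_norm X f" by (rule Dx[OF f])
          also have "\<dots> \<le> ?n (D m n) * (ell2_norm X f + 1)"
            using op_nrm_nonneg[OF D(2)] by (intro mult_left_mono) auto
          also have "\<dots> < e / (ell2_norm X f + 1) * (ell2_norm X f + 1)"
            using N that by (intro mult_strict_right_mono) (auto simp: add_nonneg_pos)
          also have "\<dots> = e" using add_nonneg_pos[OF ell2_norm_nonneg[of X f] zero_less_one] by simp
          finally show ?thesis .
        qed
        then show "\<exists>M. \<forall>m\<ge>M. \<forall>n\<ge>M. cmod (\<sigma> m f x - \<sigma> n f x) < e" by blast
      qed
      then show ?thesis using Cauchy_convergent[unfolded convergent_def] by blast
    qed
    define L where "L f x = lim (\<lambda>n. \<sigma> n f x)" for f x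
    have L: "(\<lambda>n. \<sigma> n f x) \<longlonglongrightarrow> L f x" if "f \<in> ell2 X" for f x
      using lim[OF that, of x] unfolding L_def by (metis limI)
    have L_unique: "L f x = l" if "f \<in> ell2 X" "(\<lambda>n. \<sigma> n f x) \<longlonglongrightarrow> l" for f x l
      using LIMSEQ_unique[OF L[OF that(1)] that(2)] .
    \<comment> \<open>The Cauchy estimate holds for finite partial sums with a bound that does not
      depend on the finite set, and finite sums pass to the coordinatewise limit.\<close>
    have close: "(\<lambda>x. L f x - \<sigma> n f x) \<in> ell2 X \<and> ell2_norm X (\<lambda>x. L f x - \<sigma> n f x) \<le> e * ell2_norm X f"
      if f: "f \<in> ell2 X" and N: "\<And>m. m \<ge> N \<Longrightarrow> ?n (D m n) \<le> e" for f n e N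
    proof -
      have supp: "L f x - \<sigma> n f x = 0" if x: "x \<notin> X" for x
      proof -
        have "\<sigma> m f x = 0" for m using ell2_support[OF bounded_ops_closed[OF \<sigma> f] x] .
        then show "L f x - \<sigma> n f x = 0" using L_unique[OF f, of x 0] by simp
      qed
      have "L2_set (\<lambda>x. cmod (L f x - \<sigma> n f x)) F \<le> e * ell2_norm X f" if F: "finite F" "F \<subseteq> X" for F
      proof -
      have "(\<lambda>m. L2_set (\<lambda>x. cmod (\<sigma> m f x - \<sigma> n f x)) F) \<longlonglongrightarrow> L2_set (\<lambda>x. cmod (L f x - \<sigma> n f x)) F"
        unfolding L2_set_def by (intro tendsto_intros L[OF f])
      then show ?thesis
      proof (rule LIMSEQ_le_const2, intro exI[of _ N] allI impI)
        fix m assume m: "N \<le> m"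
        have "L2_set (\<lambda>x. cmod (\<sigma> m f x - \<sigma> n f x)) F \<le> ell2_norm X (\<lambda>x. \<sigma> m f x - \<sigma> n f x)"
          by (rule L2_set_le_ell2_norm[OF ell2_diff_closed[OF bounded_ops_closed[OF \<sigma> f] bounded_ops_closed[OF \<sigma> f]] F])
        also have "\<dots> \<le> ?n (D m n) * ell2_norm X f" by (rule Dx[OF f])
        also have "\<dots> \<le> e * ell2_norm X f" using N[OF m] by (intro mult_right_mono) auto
        finally show "L2_set (\<lambda>x. cmod (\<sigma> m f x - \<sigma> n f x)) F \<le> e * ell2_norm X f" .
      qed
      qed
      from ell2I[OF supp this] show ?thesis by blast
    qed
    let ?T = "restrict L (ell2 X)"
    obtain N1 where N1: "\<forall>m\<ge>N1. \<forall>n\<ge>N1. ?n (D m n) < 1" using C[of 1] by auto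
    have T: "?T \<in> bounded_ops X"
    proof (rule bounded_opsI[of _ _ "1 + ?n (\<sigma> N1)"])
      fix f assume f: "f \<in> ell2 X"
      have c: "(\<lambda>x. L f x - \<sigma> N1 f x) \<in> ell2 X" "ell2_norm X (\<lambda>x. L f x - \<sigma> N1 f x) \<le> 1 * ell2_norm X f"
        using close[OF f, of N1 N1 1] N1 by (auto simp: less_imp_le)
      have s: "\<sigma> N1 f \<in> ell2 X" by (rule bounded_ops_closed[OF \<sigma> f])
      show "?T f \<in> ell2 X" using ell2_add_closed[OF c(1) s] f by simp
      have "ell2_norm X (L f) \<le> ell2_norm X f + ?n (\<sigma> N1) * ell2_norm X f"
        using ell2_norm_add[OF c(1) s] c(2) op_nrm_bound[OF \<sigma> f, of N1] by simp
      then show "ell2_norm X (?T f) \<le> (1 + ?n (\<sigma> N1)) * ell2_norm X f" using f by (simp add: algebra_simps)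
    next
      fix f g assume f: "f \<in> ell2 X" and g: "g \<in> ell2 X"
      have "L (\<lambda>x. f x + g x) x = L f x + L g x" for x
        using L_unique[OF ell2_add_closed[OF f g]] tendsto_add[OF L[OF f] L[OF g]]
        by (simp add: bounded_ops_add[OF \<sigma> f g])
      then show "?T (\<lambda>x. f x + g x) = (\<lambda>x. ?T f x + ?T g x)"
        using f g ell2_add_closed[OF f g] by (simp add: fun_eq_iff)
    next
      fix f c assume f: "f \<in> ell2 X"
      have "L (\<lambda>x. c * f x) x = c * L f x" for x
        using L_unique[OF ell2_cmult_closed[OF f]] tendsto_mult_left[OF L[OF f]]
        by (simp add: bounded_ops_cmult[OF \<sigma> f])
      then show "?T (\<lambda>x. c * f x) = (\<lambda>x. c * ?T f x)"
        using f ell2_cmult_closed[OF f] by (simp add: fun_eq_iff)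
    qed simp
    have "\<forall>\<^sub>F n in sequentially. cstar_dist (B_ell2 X) (\<sigma> n) ?T < e" if e: "e > 0" for e
    proof -
      obtain N where N: "\<forall>m\<ge>N. \<forall>n\<ge>N. ?n (D m n) < e / 2" using C[of "e / 2"] e by auto
      have "cstar_dist (B_ell2 X) (\<sigma> n) ?T < e" if n: "n \<ge> N" for n
      proof -
        have "?n (?T \<ominus>\<^bsub>B_ell2 X\<^esub> \<sigma> n) \<le> e / 2"
        proof (rule op_nrm_le)
          fix f assume f: "f \<in> ell2 X"
          show "ell2_norm X ((?T \<ominus>\<^bsub>B_ell2 X\<^esub> \<sigma> n) f) \<le> e / 2 * ell2_norm X f"
            using close[OF f, of N n "e / 2"] N n f by (simp add: B_ell2_minus[OF T \<sigma>] less_imp_le)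
        qed (use e in simp)
        then have "cstar_dist (B_ell2 X) ?T (\<sigma> n) < e" using e T \<sigma> by (simp add: cstar_dist_def)
        then show ?thesis by (simp add: commute)
      qed
      then show ?thesis by (auto simp: eventually_sequentially)
    qed
    then have "limitin mtopology \<sigma> ?T sequentially"
      using T \<sigma> unfolding limitin_metric by (simp add: eventually_conj_iff)
    then show ?thesis by blast
  qed
  then show ?thesis unfolding mcomplete_def by blast
qed

section \<open>Bounded operators form a C*-algebra\<close>

lemma B_ell2_cstar: "cstar_algebra (B_ell2 X)"
proof -
  interpret module complex_field "B_ell2 X" by (rule B_ell2_module)
  let ?n = "nrm (B_ell2 X)" and ?C = "compose (ell2 X)"
  have C: "?C S T f = S (T f)" if "f \<in> ell2 X" for S T f using that by (simp add: compose_eq)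
  have nz: "?n T = 0 \<longleftrightarrow> T = \<zero>\<^bsub>B_ell2 X\<^esub>" if T: "T \<in> bounded_ops X" for T
  proof
    assume n: "?n T = 0"
    have "T f = (\<lambda>_. 0)" if f: "f \<in> ell2 X" for f
      using op_nrm_bound[OF T f] n ell2_norm_eq_0[OF bounded_ops_closed[OF T f]]
        ell2_norm_nonneg[of X "T f"] by simp
    then show "T = \<zero>\<^bsub>B_ell2 X\<^esub>"
      using bounded_ops_undefined[OF T] by (auto simp: fun_eq_iff restrict_def)
  next
    assume "T = \<zero>\<^bsub>B_ell2 X\<^esub>"
    then have "?n T \<le> 0" by (intro op_nrm_le) auto
    then show "?n T = 0" using op_nrm_nonneg[OF T] by linarith
  qed
  have nadd: "?n (S \<oplus>\<^bsub>B_ell2 X\<^esub> T) \<le> ?n S + ?n T" if S: "S \<in> bounded_ops X" and T: "T \<in> bounded_ops X" for S T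
  proof (rule op_nrm_le)
    fix f assume f: "f \<in> ell2 X"
    have "ell2_norm X (\<lambda>x. S f x + T f x) \<le> ?n S * ell2_norm X f + ?n T * ell2_norm X f"
      using ell2_norm_add[OF bounded_ops_closed[OF S f] bounded_ops_closed[OF T f]]
        op_nrm_bound[OF S f] op_nrm_bound[OF T f] by linarith
    then show "ell2_norm X ((S \<oplus>\<^bsub>B_ell2 X\<^esub> T) f) \<le> (?n S + ?n T) * ell2_norm X f"
      using f by (simp add: algebra_simps)
  qed (use op_nrm_nonneg[OF S] op_nrm_nonneg[OF T] in simp)
  have ncm_le: "?n (c \<odot>\<^bsub>B_ell2 X\<^esub> T) \<le> cmod c * ?n T" if T: "T \<in> bounded_ops X" for c T
  proof (rule op_nrm_le)
    fix f assume f: "f \<in> ell2 X"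
    show "ell2_norm X ((c \<odot>\<^bsub>B_ell2 X\<^esub> T) f) \<le> cmod c * ?n T * ell2_norm X f"
      using f op_nrm_bound[OF T f] ell2_norm_cmult[OF bounded_ops_closed[OF T f], of c]
      by (simp add: mult.assoc mult_left_mono)
  qed (use op_nrm_nonneg[OF T] in simp)
  have ncm: "?n (c \<odot>\<^bsub>B_ell2 X\<^esub> T) = cmod c * ?n T" if T: "T \<in> bounded_ops X" for c T
  proof (cases "c = 0")
    case True
    then have "c \<odot>\<^bsub>B_ell2 X\<^esub> T = \<zero>\<^bsub>B_ell2 X\<^esub>" by simp
    then show ?thesis using True nz[OF op_zero_closed] by simp
  next
    case False
    \<comment> \<open>The inequality for \<open>inverse c\<close> applied to \<open>c T\<close> is
      the missing half of the equality.\<close>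
    have "inverse c \<odot>\<^bsub>B_ell2 X\<^esub> (c \<odot>\<^bsub>B_ell2 X\<^esub> T) = T"
      using False bounded_ops_undefined[OF T] by (auto simp: fun_eq_iff restrict_def)
    then have "?n T \<le> cmod (inverse c) * ?n (c \<odot>\<^bsub>B_ell2 X\<^esub> T)"
      using ncm_le[of "c \<odot>\<^bsub>B_ell2 X\<^esub> T" "inverse c"] op_cmult_closed[OF T, of c] by simp
    then have "cmod c * ?n T \<le> ?n (c \<odot>\<^bsub>B_ell2 X\<^esub> T)"
      using False by (simp add: norm_divide norm_inverse field_simps)
    then show ?thesis using ncm_le[OF T, of c] by simp
  qed
  have cid: "?n (?C (adj (B_ell2 X) T) T) = (?n T)\<^sup>2" if T: "T \<in> bounded_ops X" for T
  proof -
    have "?n (?C (adj (B_ell2 X) T) T) \<le> ?n (adj (B_ell2 X) T) * ?n T"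
      by (rule op_nrm_compose[OF adj_in[OF T] T])
    also have "\<dots> \<le> ?n T * ?n T" by (rule mult_right_mono[OF op_nrm_adj_le[OF T] op_nrm_nonneg[OF T]])
    finally show ?thesis using op_nrm_square_le[OF T] by (simp add: power2_eq_square)
  qed
  have adj_add: "adj (B_ell2 X) (S \<oplus>\<^bsub>B_ell2 X\<^esub> T) = adj (B_ell2 X) S \<oplus>\<^bsub>B_ell2 X\<^esub> adj (B_ell2 X) T"
    if S: "S \<in> bounded_ops X" and T: "T \<in> bounded_ops X" for S T
  proof (rule adj_eqI)
    fix f g assume f: "f \<in> ell2 X" and g: "g \<in> ell2 X"
    show "ell2_inner X ((S \<oplus>\<^bsub>B_ell2 X\<^esub> T) f) g =
        ell2_inner X f ((adj (B_ell2 X) S \<oplus>\<^bsub>B_ell2 X\<^esub> adj (B_ell2 X) T) g)"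
      using f g ell2_inner_add_left[OF bounded_ops_closed[OF S f] bounded_ops_closed[OF T f] g]
        ell2_inner_add_right[OF bounded_ops_closed[OF adj_in[OF S] g] bounded_ops_closed[OF adj_in[OF T] g] f]
        adj_inner[OF S f g] adj_inner[OF T f g] by simp
  qed (use op_add_closed[OF S T] op_add_closed[OF adj_in[OF S] adj_in[OF T]] in simp_all)
  have adj_cm: "adj (B_ell2 X) (c \<odot>\<^bsub>B_ell2 X\<^esub> T) = cnj c \<odot>\<^bsub>B_ell2 X\<^esub> adj (B_ell2 X) T"
    if T: "T \<in> bounded_ops X" for c T
  proof (rule adj_eqI)
    fix f g assume f: "f \<in> ell2 X" and g: "g \<in> ell2 X"
    show "ell2_inner X ((c \<odot>\<^bsub>B_ell2 X\<^esub> T) f) g = ell2_inner X f ((cnj c \<odot>\<^bsub>B_ell2 X\<^esub> adj (B_ell2 X) T) g)"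
      using f g ell2_inner_cmult_left[OF bounded_ops_closed[OF T f] g, of c]
        ell2_inner_cmult_right[OF f bounded_ops_closed[OF adj_in[OF T] g], of "cnj c"]
        adj_inner[OF T f g] by simp
  qed (use op_cmult_closed[OF T, of c] op_cmult_closed[OF adj_in[OF T], of "cnj c"] in simp_all)
  have adj_mult: "adj (B_ell2 X) (?C S T) = ?C (adj (B_ell2 X) T) (adj (B_ell2 X) S)"
    if S: "S \<in> bounded_ops X" and T: "T \<in> bounded_ops X" for S T
  proof (rule adj_eqI)
    fix f g assume f: "f \<in> ell2 X" and g: "g \<in> ell2 X"
    show "ell2_inner X (?C S T f) g = ell2_inner X f (?C (adj (B_ell2 X) T) (adj (B_ell2 X) S) g)"
      using f g adj_inner[OF S bounded_ops_closed[OF T f] g]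
        adj_inner[OF T f bounded_ops_closed[OF adj_in[OF S] g]] by (simp add: C)
  qed (use op_compose_closed[OF S T] op_compose_closed[OF adj_in[OF T] adj_in[OF S]] in simp_all)
  have ce: "?C P Q = restrict R (ell2 X)" if "\<And>f. f \<in> ell2 X \<Longrightarrow> P (Q f) = R f" for P Q R
    using that by (auto simp: compose_def restrict_def fun_eq_iff)
  have assoc: "?C (?C R S) T = ?C R (?C S T)" if T: "T \<in> bounded_ops X" for R S T
    using compose_assoc[of T "ell2 X" "ell2 X" R S] bounded_ops_closed[OF T] by auto
  have distl: "?C (restrict (\<lambda>f x. R f x + S f x) (ell2 X)) T = restrict (\<lambda>f x. ?C R T f x + ?C S T f x) (ell2 X)"
    if T: "T \<in> bounded_ops X" for R S T
    by (rule ce) (simp add: bounded_ops_closed[OF T] C)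
  have distr: "?C T (restrict (\<lambda>f x. R f x + S f x) (ell2 X)) = restrict (\<lambda>f x. ?C T R f x + ?C T S f x) (ell2 X)"
    if R: "R \<in> bounded_ops X" and S: "S \<in> bounded_ops X" and T: "T \<in> bounded_ops X" for R S T
    by (rule ce) (simp add: bounded_ops_add[OF T bounded_ops_closed[OF R] bounded_ops_closed[OF S]] C)
  have cml: "?C (restrict (\<lambda>f x. c * R f x) (ell2 X)) S = restrict (\<lambda>f x. c * ?C R S f x) (ell2 X)"
    if S: "S \<in> bounded_ops X" for R S c
    by (rule ce) (simp add: bounded_ops_closed[OF S] C)
  have cmr: "?C R (restrict (\<lambda>f x. c * S f x) (ell2 X)) = restrict (\<lambda>f x. c * ?C R S f x) (ell2 X)"
    if R: "R \<in> bounded_ops X" and S: "S \<in> bounded_ops X" for R S c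
    by (rule ce) (simp add: bounded_ops_cmult[OF R bounded_ops_closed[OF S]] C)
  have axioms: "cstar_algebra_axioms (B_ell2 X)" if "Metric_space.mcomplete (carrier (B_ell2 X)) (cstar_dist (B_ell2 X))"
  proof (rule cstar_algebra_axioms.intro)
    fix R S T assume "R \<in> carrier (B_ell2 X)" "S \<in> carrier (B_ell2 X)" "T \<in> carrier (B_ell2 X)"
    then have R: "R \<in> bounded_ops X" and S: "S \<in> bounded_ops X" and T: "T \<in> bounded_ops X" by simp_all
    show "(R \<otimes>\<^bsub>B_ell2 X\<^esub> S) \<otimes>\<^bsub>B_ell2 X\<^esub> T = R \<otimes>\<^bsub>B_ell2 X\<^esub> (S \<otimes>\<^bsub>B_ell2 X\<^esub> T)"
      using assoc[OF T] by simp
    show "(R \<oplus>\<^bsub>B_ell2 X\<^esub> S) \<otimes>\<^bsub>B_ell2 X\<^esub> T = R \<otimes>\<^bsub>B_ell2 X\<^esub> T \<oplus>\<^bsub>B_ell2 X\<^esub> S \<otimes>\<^bsub>B_ell2 X\<^esub> T"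
      unfolding B_ell2_simps by (rule distl[OF T])
    show "T \<otimes>\<^bsub>B_ell2 X\<^esub> (R \<oplus>\<^bsub>B_ell2 X\<^esub> S) = T \<otimes>\<^bsub>B_ell2 X\<^esub> R \<oplus>\<^bsub>B_ell2 X\<^esub> T \<otimes>\<^bsub>B_ell2 X\<^esub> S"
      unfolding B_ell2_simps by (rule distr[OF R S T])
  next
    fix S T c assume "S \<in> carrier (B_ell2 X)" "T \<in> carrier (B_ell2 X)"
    then have S: "S \<in> bounded_ops X" and T: "T \<in> bounded_ops X" by simp_all
    show "S \<otimes>\<^bsub>B_ell2 X\<^esub> T \<in> carrier (B_ell2 X)" using op_compose_closed[OF S T] by simp
    show "(c \<odot>\<^bsub>B_ell2 X\<^esub> S) \<otimes>\<^bsub>B_ell2 X\<^esub> T = c \<odot>\<^bsub>B_ell2 X\<^esub> (S \<otimes>\<^bsub>B_ell2 X\<^esub> T)"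
      unfolding B_ell2_simps by (rule cml[OF T])
    show "S \<otimes>\<^bsub>B_ell2 X\<^esub> (c \<odot>\<^bsub>B_ell2 X\<^esub> T) = c \<odot>\<^bsub>B_ell2 X\<^esub> (S \<otimes>\<^bsub>B_ell2 X\<^esub> T)"
      unfolding B_ell2_simps by (rule cmr[OF S T])
    show "adj (B_ell2 X) (S \<oplus>\<^bsub>B_ell2 X\<^esub> T) = adj (B_ell2 X) S \<oplus>\<^bsub>B_ell2 X\<^esub> adj (B_ell2 X) T"
      by (rule adj_add[OF S T])
    show "adj (B_ell2 X) (S \<otimes>\<^bsub>B_ell2 X\<^esub> T) = adj (B_ell2 X) T \<otimes>\<^bsub>B_ell2 X\<^esub> adj (B_ell2 X) S"
      unfolding B_ell2_simps by (rule adj_mult[OF S T])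
    show "?n (S \<oplus>\<^bsub>B_ell2 X\<^esub> T) \<le> ?n S + ?n T" by (rule nadd[OF S T])
    show "?n (S \<otimes>\<^bsub>B_ell2 X\<^esub> T) \<le> ?n S * ?n T" unfolding B_ell2_simps by (rule op_nrm_compose[OF S T])
  next
    fix T c assume "T \<in> carrier (B_ell2 X)"
    then have T: "T \<in> bounded_ops X" by simp
    show "adj (B_ell2 X) T \<in> carrier (B_ell2 X)" using adj_in[OF T] by simp
    show "adj (B_ell2 X) (adj (B_ell2 X) T) = T" by (rule adj_adj_op[OF T])
    show "adj (B_ell2 X) (c \<odot>\<^bsub>B_ell2 X\<^esub> T) = cnj c \<odot>\<^bsub>B_ell2 X\<^esub> adj (B_ell2 X) T" by (rule adj_cm[OF T])
    show "0 \<le> ?n T" by (rule op_nrm_nonneg[OF T])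
    show "?n T = 0 \<longleftrightarrow> T = \<zero>\<^bsub>B_ell2 X\<^esub>" by (rule nz[OF T])
    show "?n (c \<odot>\<^bsub>B_ell2 X\<^esub> T) = cmod c * ?n T" by (rule ncm[OF T])
    show "?n (adj (B_ell2 X) T \<otimes>\<^bsub>B_ell2 X\<^esub> T) = (?n T)\<^sup>2" unfolding B_ell2_simps by (rule cid[OF T])
  qed (rule that)
  \<comment> \<open>The metric axioms are checked by hand, since the general argument for
    C*-algebras presupposes the completeness that is still to be shown.\<close>
  define D where "D S T = restrict (\<lambda>f x. S f x - T f x) (ell2 X)" for S T :: "'a ell2_op"
  have D: "D S T \<in> bounded_ops X" "cstar_dist (B_ell2 X) S T = ?n (D S T)"
    if S: "S \<in> bounded_ops X" and T: "T \<in> bounded_ops X" for S T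
  proof -
    have eq: "D S T = S \<ominus>\<^bsub>B_ell2 X\<^esub> T" unfolding D_def by (rule B_ell2_minus[OF S T, symmetric])
    have "S \<in> carrier (B_ell2 X)" "T \<in> carrier (B_ell2 X)" using S T by simp_all
    then show "D S T \<in> bounded_ops X" unfolding eq by (metis M.minus_closed B_ell2_simps(1))
    show "cstar_dist (B_ell2 X) S T = ?n (D S T)" unfolding eq using S T by (simp add: cstar_dist_def)
  qed
  have "Metric_space (carrier (B_ell2 X)) (cstar_dist (B_ell2 X))"
  proof
    fix S T R
    show "0 \<le> cstar_dist (B_ell2 X) S T"
    proof (cases "S \<in> bounded_ops X \<and> T \<in> bounded_ops X")
      case True
      then show ?thesis using D[of S T] op_nrm_nonneg[of "D S T" X] by simp
    qed (auto simp: cstar_dist_def)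
    show "cstar_dist (B_ell2 X) S T = cstar_dist (B_ell2 X) T S"
    proof (cases "S \<in> bounded_ops X \<and> T \<in> bounded_ops X")
      case True
      have "D S T = (-1) \<odot>\<^bsub>B_ell2 X\<^esub> D T S" by (auto simp: D_def restrict_def fun_eq_iff)
      then have "?n (D S T) = ?n (D T S)" using ncm[of "D T S" "-1"] D[of T S] True by simp
      then show ?thesis using D True by simp
    qed (auto simp: cstar_dist_def)
    assume S: "S \<in> carrier (B_ell2 X)" and T: "T \<in> carrier (B_ell2 X)"
    then have S': "S \<in> bounded_ops X" and T': "T \<in> bounded_ops X" by simp_all
    have "D S T = \<zero>\<^bsub>B_ell2 X\<^esub> \<longleftrightarrow> S = T"
    proof
      assume "D S T = \<zero>\<^bsub>B_ell2 X\<^esub>"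
      then have eqf: "D S T f = \<zero>\<^bsub>B_ell2 X\<^esub> f" for f by simp
      have "S f = T f" if f: "f \<in> ell2 X" for f
      proof
        fix x
        have "(\<lambda>x. S f x - T f x) = (\<lambda>_. 0)" using eqf[of f] f by (simp add: D_def)
        from fun_cong[OF this, of x] show "S f x = T f x" by simp
      qed
      then show "S = T" by (rule op_ext[OF S' T'])
    qed (auto simp: D_def restrict_def fun_eq_iff)
    then show "cstar_dist (B_ell2 X) S T = 0 \<longleftrightarrow> S = T"
      using nz[OF D(1)[OF S' T']] D(2)[OF S' T'] by simp
    assume R: "R \<in> carrier (B_ell2 X)"
    then have R': "R \<in> bounded_ops X" by simp
    have "D S R = D S T \<oplus>\<^bsub>B_ell2 X\<^esub> D T R" by (auto simp: D_def restrict_def fun_eq_iff)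
    then show "cstar_dist (B_ell2 X) S R \<le> cstar_dist (B_ell2 X) S T + cstar_dist (B_ell2 X) T R"
      using nadd[OF D(1)[OF S' T'] D(1)[OF T' R']] D(2)[OF S' T'] D(2)[OF T' R'] D(2)[OF S' R'] by simp
  qed
  then show ?thesis
    by (intro cstar_algebra.intro B_ell2_module axioms B_ell2_complete)
qed

section \<open>Contractivity of homomorphisms\<close>

lemma cstar_homD:
  assumes "\<pi> \<in> cstar_hom A B" "x \<in> carrier A"
  shows hom_closed: "\<pi> x \<in> carrier B"
    and hom_add: "y \<in> carrier A \<Longrightarrow> \<pi> (x \<oplus>\<^bsub>A\<^esub> y) = \<pi> x \<oplus>\<^bsub>B\<^esub> \<pi> y"
    and hom_mult: "y \<in> carrier A \<Longrightarrow> \<pi> (x \<otimes>\<^bsub>A\<^esub> y) = \<pi> x \<otimes>\<^bsub>B\<^esub> \<pi> y"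
    and hom_adj: "\<pi> (adj A x) = adj B (\<pi> x)"
    and hom_smult: "\<pi> (c \<odot>\<^bsub>A\<^esub> x) = c \<odot>\<^bsub>B\<^esub> \<pi> x"
  using assms by (auto simp: cstar_hom_def)

text \<open>If \<open>x\<^sup>* x = 2 b - b\<^sup>2\<close> with \<open>b\<close> selfadjoint, then \<open>\<parallel>\<pi>(x) f\<parallel>\<^sup>2 = \<parallel>f\<parallel>\<^sup>2 - \<parallel>f - \<pi>(b) f\<parallel>\<^sup>2\<close>.\<close>

lemma hom_contractive_lt_1:
  assumes A: "cstar_algebra A" and \<pi>: "\<pi> \<in> cstar_hom A (B_ell2 X)" and x: "x \<in> carrier A" and lt: "nrm A x < 1"
  shows "nrm (B_ell2 X) (\<pi> x) \<le> 1"
proof -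
  interpret cstar_algebra A by (rule A)
  let ?c = "adj A x \<otimes>\<^bsub>A\<^esub> x"
  have "nrm A ?c < 1" using cstar_identity[OF x] lt nrm_nonneg[OF x] by (simp add: power_less_one_iff)
  then obtain b where b: "b \<in> carrier A" "adj A b = b" "?c \<oplus>\<^bsub>A\<^esub> b \<otimes>\<^bsub>A\<^esub> b = 2 \<odot>\<^bsub>A\<^esub> b"
    using sqrt_one_minus[of ?c] x by (auto simp: adj_mult)
  have T: "\<pi> x \<in> bounded_ops X" and U: "\<pi> b \<in> bounded_ops X"
    using hom_closed[OF \<pi>] x b by auto
  have "\<pi> (?c \<oplus>\<^bsub>A\<^esub> b \<otimes>\<^bsub>A\<^esub> b) = \<pi> (2 \<odot>\<^bsub>A\<^esub> b)" using b(3) by simp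
  then have eq: "\<pi> ?c \<oplus>\<^bsub>B_ell2 X\<^esub> (\<pi> b \<otimes>\<^bsub>B_ell2 X\<^esub> \<pi> b) = 2 \<odot>\<^bsub>B_ell2 X\<^esub> \<pi> b"
    using hom_add[OF \<pi>, of ?c "b \<otimes>\<^bsub>A\<^esub> b"] hom_mult[OF \<pi> b(1) b(1)] hom_smult[OF \<pi> b(1), of 2] x b(1) by simp
  have c_eq: "\<pi> ?c = adj (B_ell2 X) (\<pi> x) \<otimes>\<^bsub>B_ell2 X\<^esub> \<pi> x"
    using x by (simp only: hom_mult[OF \<pi>] hom_adj[OF \<pi>] adj_closed)
  have Uadj: "adj (B_ell2 X) (\<pi> b) = \<pi> b" using hom_adj[OF \<pi> b(1)] b(2) by simp
  show ?thesis
  proof (rule op_nrm_le)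
    fix f assume f: "f \<in> ell2 X"
    have Tf: "\<pi> x f \<in> ell2 X" and Uf: "\<pi> b f \<in> ell2 X" and UUf: "\<pi> b (\<pi> b f) \<in> ell2 X"
      using bounded_ops_closed[OF T f] bounded_ops_closed[OF U f] bounded_ops_closed[OF U bounded_ops_closed[OF U f]] .
    have Cf: "adj (B_ell2 X) (\<pi> x) (\<pi> x f) \<in> ell2 X" by (rule bounded_ops_closed[OF adj_in[OF T] Tf])
    let ?a = "ell2_norm X (\<pi> x f)" and ?u = "ell2_norm X (\<pi> b f)" and ?i = "ell2_inner X f (\<pi> b f)"
    have "(\<pi> ?c \<oplus>\<^bsub>B_ell2 X\<^esub> (\<pi> b \<otimes>\<^bsub>B_ell2 X\<^esub> \<pi> b)) f = (2 \<odot>\<^bsub>B_ell2 X\<^esub> \<pi> b) f" using eq by simp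
    then have "(\<lambda>y. adj (B_ell2 X) (\<pi> x) (\<pi> x f) y + \<pi> b (\<pi> b f) y) = (\<lambda>y. 2 * \<pi> b f y)"
      using f by (simp add: c_eq compose_eq)
    then have "ell2_inner X f (\<lambda>y. adj (B_ell2 X) (\<pi> x) (\<pi> x f) y + \<pi> b (\<pi> b f) y) = ell2_inner X f (\<lambda>y. 2 * \<pi> b f y)"
      by simp
    then have "ell2_inner X f (adj (B_ell2 X) (\<pi> x) (\<pi> x f)) + ell2_inner X f (\<pi> b (\<pi> b f)) = 2 * ?i"
      by (simp add: ell2_inner_add_right[OF Cf UUf f] ell2_inner_cmult_right[OF f Uf])
    moreover have "ell2_inner X f (adj (B_ell2 X) (\<pi> x) (\<pi> x f)) = of_real (?a\<^sup>2)"
      using adj_inner[OF T f Tf] ell2_inner_self[OF Tf] by simp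
    moreover have "ell2_inner X f (\<pi> b (\<pi> b f)) = of_real (?u\<^sup>2)"
      using adj_inner[OF U f Uf] ell2_inner_self[OF Uf] by (simp add: Uadj)
    ultimately have "complex_of_real (?a\<^sup>2 + ?u\<^sup>2) = 2 * ?i" by simp
    from arg_cong[OF this, of Re] have "?a\<^sup>2 + ?u\<^sup>2 = Re (2 * ?i)" by (simp only: Re_complex_of_real)
    also have "\<dots> \<le> cmod (2 * ?i)" by (rule complex_Re_le_cmod)
    also have "\<dots> \<le> 2 * (ell2_norm X f * ?u)"
      using ell2_Cauchy_Schwarz[OF f Uf] by (simp add: norm_mult)
    finally have "?a\<^sup>2 \<le> 2 * (ell2_norm X f * ?u) - ?u\<^sup>2" by simp
    \<comment> \<open>Completing the square.\<close>
    also have "\<dots> \<le> (ell2_norm X f)\<^sup>2"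
      using zero_le_power2[of "ell2_norm X f - ?u"] by (simp add: power2_diff)
    finally have "?a \<le> ell2_norm X f" by (rule power2_le_imp_le) simp
    then show "?a \<le> 1 * ell2_norm X f" by simp
  qed simp
qed

text \<open>Rescaling by a number slightly larger than the norm reduces to norm less than 1.\<close>

lemma hom_contractive:
  assumes A: "cstar_algebra A" and \<pi>: "\<pi> \<in> cstar_hom A (B_ell2 X)" and x: "x \<in> carrier A"
  shows "nrm (B_ell2 X) (\<pi> x) \<le> nrm A x"
proof (rule field_le_epsilon)
  interpret cstar_algebra A by (rule A)
  interpret B: cstar_algebra "B_ell2 X" by (rule B_ell2_cstar)
  fix e :: real assume e: "e > 0"
  define r where "r = nrm A x + e"
  have r: "r > 0" "nrm A x < r" using e nrm_nonneg[OF x] by (auto simp: r_def)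
  have "nrm A (of_real (1 / r) \<odot>\<^bsub>A\<^esub> x) < 1" using r x by (simp only: nrm_smult norm_of_real) simp
  then have "nrm (B_ell2 X) (\<pi> (of_real (1 / r) \<odot>\<^bsub>A\<^esub> x)) \<le> 1"
    using x by (intro hom_contractive_lt_1[OF A \<pi>]) auto
  also have "\<pi> (of_real (1 / r) \<odot>\<^bsub>A\<^esub> x) = of_real (1 / r) \<odot>\<^bsub>B_ell2 X\<^esub> \<pi> x" by (rule hom_smult[OF \<pi> x])
  also have "nrm (B_ell2 X) \<dots> = nrm (B_ell2 X) (\<pi> x) / r"
    using r hom_closed[OF \<pi> x] B.nrm_smult[of "\<pi> x" "of_real (1 / r)"] by (simp only: norm_of_real) simp
  finally show "nrm (B_ell2 X) (\<pi> x) \<le> nrm A x + e" using r by (simp add: r_def)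
qed

section \<open>Path actions and their Cuntz-Krieger families\<close>

text \<open>Pushforward along a partial bijection: basis vectors at points of \<open>D\<close> move
  by \<open>h\<close>, the others are killed. The pullback \<open>pinj_adj\<close> will be its
  adjoint.\<close>

definition pinj_op :: "'x set \<Rightarrow> 'x set \<Rightarrow> ('x \<Rightarrow> 'x) \<Rightarrow> 'x ell2_op" where
  "pinj_op X D h = restrict (\<lambda>f y. if y \<in> h ` D then f (inv_into D h y) else 0) (ell2 X)"

definition pinj_adj :: "'x set \<Rightarrow> 'x set \<Rightarrow> ('x \<Rightarrow> 'x) \<Rightarrow> 'x ell2_op" where
  "pinj_adj X D h = restrict (\<lambda>f x. if x \<in> D then f (h x) else 0) (ell2 X)"

locale partial_injection =
  fixes X D :: "'x set" and h :: "'x \<Rightarrow> 'x"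
  assumes inj: "inj_on h D" and D: "D \<subseteq> X" and ran: "h ` D \<subseteq> X"
begin

lemma pinj_op_apply:
  assumes "f \<in> ell2 X"
  shows "x \<in> D \<Longrightarrow> pinj_op X D h f (h x) = f x" "y \<notin> h ` D \<Longrightarrow> pinj_op X D h f y = 0"
  using assms inj by (auto simp: pinj_op_def)

lemma pinj_adj_apply:
  assumes "f \<in> ell2 X"
  shows "pinj_adj X D h f x = (if x \<in> D then f (h x) else 0)"
  using assms by (simp add: pinj_adj_def)

lemma pinj_op_closed: "pinj_op X D h \<in> bounded_ops X"
proof (rule bounded_opsI[of _ _ 1])
  fix f assume f: "f \<in> ell2 X"
  let ?g = "pinj_op X D h f"
  have "L2_set (\<lambda>y. cmod (?g y)) F \<le> ell2_norm X f" if F: "finite F" "F \<subseteq> X" for F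
  proof -
    let ?G = "{x \<in> D. h x \<in> F}"
    have G: "finite ?G" "?G \<subseteq> X"
      using finite_vimage_IntI[OF F(1) inj] D by (auto simp: vimage_def Int_def conj_commute)
    have "(\<Sum>y\<in>F. (cmod (?g y))\<^sup>2) = (\<Sum>y\<in>h ` ?G. (cmod (?g y))\<^sup>2)"
      using F pinj_op_apply(2)[OF f] by (intro sum.mono_neutral_right) fastforce+
    also have "\<dots> = (\<Sum>x\<in>?G. (cmod (f x))\<^sup>2)"
      using inj by (subst sum.reindex) (auto simp: inj_on_def pinj_op_apply(1)[OF f])
    finally have "L2_set (\<lambda>y. cmod (?g y)) F = L2_set (\<lambda>x. cmod (f x)) ?G" by (simp add: L2_set_def)
    then show ?thesis using L2_set_le_ell2_norm[OF f G] by simp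
  qed
  moreover have "?g y = 0" if "y \<notin> X" for y using pinj_op_apply(2)[OF f] ran that by blast
  ultimately show "?g \<in> ell2 X" "ell2_norm X ?g \<le> 1 * ell2_norm X f"
    using ell2I[of X ?g "ell2_norm X f"] by simp_all
next
  fix f g assume "f \<in> ell2 X" "g \<in> ell2 X"
  then show "pinj_op X D h (\<lambda>x. f x + g x) = (\<lambda>x. pinj_op X D h f x + pinj_op X D h g x)"
    by (auto simp: pinj_op_def ell2_add_closed)
next
  fix f c assume "f \<in> ell2 X"
  then show "pinj_op X D h (\<lambda>x. c * f x) = (\<lambda>x. c * pinj_op X D h f x)"
    by (auto simp: pinj_op_def ell2_cmult_closed)
qed (simp add: pinj_op_def)

lemma pinj_adj_closed: "pinj_adj X D h \<in> bounded_ops X"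
proof (rule bounded_opsI[of _ _ 1])
  fix f assume f: "f \<in> ell2 X"
  let ?g = "pinj_adj X D h f"
  have "L2_set (\<lambda>y. cmod (?g y)) F \<le> ell2_norm X f" if F: "finite F" "F \<subseteq> X" for F
  proof -
    let ?G = "h ` (F \<inter> D)"
    have G: "finite ?G" "?G \<subseteq> X" using F ran by auto
    have "(\<Sum>y\<in>F. (cmod (?g y))\<^sup>2) = (\<Sum>y\<in>F \<inter> D. (cmod (f (h y)))\<^sup>2)"
      using F by (intro sum.mono_neutral_cong_right) (auto simp: pinj_adj_apply[OF f])
    also have "\<dots> = (\<Sum>y\<in>?G. (cmod (f y))\<^sup>2)"
      using inj by (subst sum.reindex) (auto simp: inj_on_def)
    finally have "L2_set (\<lambda>y. cmod (?g y)) F = L2_set (\<lambda>x. cmod (f x)) ?G" by (simp add: L2_set_def)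
    then show ?thesis using L2_set_le_ell2_norm[OF f G] by simp
  qed
  moreover have "?g y = 0" if "y \<notin> X" for y using pinj_adj_apply[OF f] D that by auto
  ultimately show "?g \<in> ell2 X" "ell2_norm X ?g \<le> 1 * ell2_norm X f"
    using ell2I[of X ?g "ell2_norm X f"] by simp_all
next
  fix f g assume "f \<in> ell2 X" "g \<in> ell2 X"
  then show "pinj_adj X D h (\<lambda>x. f x + g x) = (\<lambda>x. pinj_adj X D h f x + pinj_adj X D h g x)"
    by (auto simp: pinj_adj_def ell2_add_closed)
next
  fix f c assume "f \<in> ell2 X"
  then show "pinj_adj X D h (\<lambda>x. c * f x) = (\<lambda>x. c * pinj_adj X D h f x)"
    by (auto simp: pinj_adj_def ell2_cmult_closed)
qed (simp add: pinj_adj_def)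

lemma adj_pinj_op: "adj (B_ell2 X) (pinj_op X D h) = pinj_adj X D h"
proof (rule adj_eqI[OF pinj_op_closed pinj_adj_closed])
  fix f g assume f: "f \<in> ell2 X" and g: "g \<in> ell2 X"
  have "ell2_inner X (pinj_op X D h f) g = (\<Sum>\<^sub>\<infinity>y\<in>h ` D. pinj_op X D h f y * cnj (g y))"
    unfolding ell2_inner_def using ran pinj_op_apply(2)[OF f] by (intro infsum_cong_neutral) auto
  also have "\<dots> = (\<Sum>\<^sub>\<infinity>x\<in>D. pinj_op X D h f (h x) * cnj (g (h x)))"
    by (subst infsum_reindex[OF inj]) (simp add: o_def)
  also have "\<dots> = ell2_inner X f (pinj_adj X D h g)"
    unfolding ell2_inner_def using D
    by (intro infsum_cong_neutral) (auto simp: pinj_op_apply(1)[OF f] pinj_adj_apply[OF g])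
  finally show "ell2_inner X (pinj_op X D h f) g = ell2_inner X f (pinj_adj X D h g)" .
qed

lemma pinj_op_basis:
  assumes "x \<in> X"
  shows "pinj_op X D h (ell2_basis x) = (if x \<in> D then ell2_basis (h x) else (\<lambda>_. 0))"
proof
  fix y
  note b = ell2_basis_closed[OF assms]
  show "pinj_op X D h (ell2_basis x) y = (if x \<in> D then ell2_basis (h x) else (\<lambda>_. 0)) y"
  proof (cases "y \<in> h ` D")
    case True
    then obtain z where z: "z \<in> D" "y = h z" by blast
    show ?thesis unfolding z(2) pinj_op_apply(1)[OF b z(1)]
      using inj z(1) by (auto simp: ell2_basis_def inj_on_def)
  qed (use pinj_op_apply(2)[OF b] in \<open>auto simp: ell2_basis_def\<close>)
qed

end

lemma B_ell2_finsum_apply: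
  assumes "finite I" "g \<in> I \<rightarrow> bounded_ops X" "f \<in> ell2 X"
  shows "finsum (B_ell2 X) g I f x = (\<Sum>i\<in>I. g i f x)"
proof -
  interpret cstar_algebra "B_ell2 X" by (rule B_ell2_cstar)
  show ?thesis using assms
  proof (induction I rule: finite_induct)
    case (insert i I)
    then have "finsum (B_ell2 X) g (insert i I) = g i \<oplus>\<^bsub>B_ell2 X\<^esub> finsum (B_ell2 X) g I"
      by (intro M.finsum_insert) auto
    then show ?case using insert by simp
  qed simp
qed

text \<open>By left cancellation a pair is determined by the minimal common extension that it
  completes.\<close>

lemma (in k_graph) MCE_pairs_finite:
  assumes "finitely_aligned \<Lambda>" "\<mu> \<in> \<P>" "\<nu> \<in> \<P>"
  shows "finite {(\<alpha>, \<beta>). \<alpha> \<in> \<P> \<and> \<beta> \<in> \<P> \<and> \<s> \<mu> = \<r> \<alpha> \<and> \<s> \<nu> = \<r> \<beta> \<and>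
     \<mu> \<cdot> \<alpha> = \<nu> \<cdot> \<beta> \<and> \<mu> \<cdot> \<alpha> \<in> \<M> \<mu> \<nu>}" (is "finite ?P")
proof (rule finite_imageD[where f = "\<lambda>(\<alpha>, \<beta>). \<mu> \<cdot> \<alpha>"])
  have "finite (\<M> \<mu> \<nu>)" using assms by (auto simp: finitely_aligned_def)
  then show "finite ((\<lambda>(\<alpha>, \<beta>). \<mu> \<cdot> \<alpha>) ` ?P)" by (rule rev_finite_subset) auto
  show "inj_on (\<lambda>(\<alpha>, \<beta>). \<mu> \<cdot> \<alpha>) ?P"
  proof (rule inj_onI)
    fix p q assume p: "p \<in> ?P" and q: "q \<in> ?P" and eq: "(case p of (\<alpha>, \<beta>) \<Rightarrow> \<mu> \<cdot> \<alpha>) = (case q of (\<alpha>, \<beta>) \<Rightarrow> \<mu> \<cdot> \<alpha>)"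
    obtain \<alpha> \<beta> where ab: "p = (\<alpha>, \<beta>)" "\<alpha> \<in> \<P>" "\<beta> \<in> \<P>" "\<s> \<mu> = \<r> \<alpha>" "\<s> \<nu> = \<r> \<beta>"
      "\<mu> \<cdot> \<alpha> = \<nu> \<cdot> \<beta>" using p by blast
    obtain \<gamma> \<delta> where cd: "q = (\<gamma>, \<delta>)" "\<gamma> \<in> \<P>" "\<delta> \<in> \<P>" "\<s> \<mu> = \<r> \<gamma>" "\<s> \<nu> = \<r> \<delta>"
      "\<mu> \<cdot> \<gamma> = \<nu> \<cdot> \<delta>" using q by blast
    have e: "\<mu> \<cdot> \<alpha> = \<mu> \<cdot> \<gamma>" using eq ab cd by simp
    have "\<alpha> = \<gamma>" by (rule cancel_left[OF assms(2) ab(2) cd(2) ab(4) cd(4) e])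
    moreover have "\<beta> = \<delta>"
      by (rule cancel_left[OF assms(3) ab(3) cd(3) ab(5) cd(5)]) (use e ab(6) cd(6) in simp)
    ultimately show "p = q" using ab(1) cd(1) by simp
  qed
qed

text \<open>What the proof uses of the action of \<open>\<Lambda>\<close> on \<open>\<partial>\<Lambda>\<close>, so that it also applies to \<open>\<partial>\<Lambda> \<times> \<int>\<^sup>k\<close>.
  The defining property of boundary paths is \<open>act_exhaustive\<close>.\<close>

locale path_action = k_graph \<Lambda> for \<Lambda> :: "('l, 'k::finite) kgraph" (structure) +
  fixes X :: "'x set" and act :: "'l \<Rightarrow> 'x \<Rightarrow> 'x" and vtx :: "'x \<Rightarrow> 'l"
  assumes vtx_vertex: "x \<in> X \<Longrightarrow> vtx x \<in> \<V>"
    and act_closed: "\<lbrakk>\<mu> \<in> \<P>; x \<in> X; \<s> \<mu> = vtx x\<rbrakk> \<Longrightarrow> act \<mu> x \<in> X"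
    and vtx_act: "\<lbrakk>\<mu> \<in> \<P>; x \<in> X; \<s> \<mu> = vtx x\<rbrakk> \<Longrightarrow> vtx (act \<mu> x) = \<r> \<mu>"
    and act_vertex: "x \<in> X \<Longrightarrow> act (vtx x) x = x"
    and act_cmp: "\<lbrakk>\<mu> \<in> \<P>; \<nu> \<in> \<P>; \<s> \<mu> = \<r> \<nu>; x \<in> X; \<s> \<nu> = vtx x\<rbrakk>
      \<Longrightarrow> act (\<mu> \<cdot> \<nu>) x = act \<mu> (act \<nu> x)"
    and act_inj: "\<lbrakk>\<mu> \<in> \<P>; x \<in> X; y \<in> X; \<s> \<mu> = vtx x; \<s> \<mu> = vtx y; act \<mu> x = act \<mu> y\<rbrakk>
      \<Longrightarrow> x = y"
    and act_meet: "\<lbrakk>\<mu> \<in> \<P>; \<nu> \<in> \<P>; x \<in> X; y \<in> X; \<s> \<mu> = vtx x; \<s> \<nu> = vtx y; act \<mu> x = act \<nu> y\<rbrakk>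
      \<Longrightarrow> \<exists>\<alpha> \<beta> z. \<alpha> \<in> \<P> \<and> \<beta> \<in> \<P> \<and> \<s> \<mu> = \<r> \<alpha> \<and> \<s> \<nu> = \<r> \<beta> \<and>
        \<mu> \<cdot> \<alpha> = \<nu> \<cdot> \<beta> \<and> \<mu> \<cdot> \<alpha> \<in> \<M> \<mu> \<nu> \<and> z \<in> X \<and> \<s> \<alpha> = vtx z \<and> \<s> \<beta> = vtx z \<and>
        x = act \<alpha> z \<and> y = act \<beta> z"
    and act_exhaustive: "\<lbrakk>x \<in> X; E \<in> \<E> (vtx x)\<rbrakk> \<Longrightarrow> \<exists>\<mu> \<in> E. \<exists>z \<in> X. \<s> \<mu> = vtx z \<and> x = act \<mu> z"
    and vtx_surj: "v \<in> \<V> \<Longrightarrow> \<exists>x \<in> X. vtx x = v"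
begin

section \<open>The Cuntz-Krieger family of a path action\<close>

definition adom :: "'l \<Rightarrow> 'x set" where
  "adom \<mu> = {x \<in> X. \<s> \<mu> = vtx x}"

definition path_op :: "'l \<Rightarrow> 'x ell2_op" where
  "path_op \<mu> = pinj_op X (adom \<mu>) (act \<mu>)"

text \<open>For the action on boundary paths this is the cylinder set of the paths that begin with
  \<open>\<mu>\<close>.\<close>

abbreviation "cyl \<mu> \<equiv> act \<mu> ` adom \<mu>"

lemma adomD: "x \<in> adom \<mu> \<Longrightarrow> x \<in> X" "x \<in> adom \<mu> \<Longrightarrow> \<s> \<mu> = vtx x"
  by (auto simp: adom_def)

lemma partial_injection_act: "\<mu> \<in> \<P> \<Longrightarrow> partial_injection X (adom \<mu>) (act \<mu>)"
  by unfold_locales (auto simp: adom_def act_closed inj_on_def dest: act_inj)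

lemma path_op_closed: "\<mu> \<in> \<P> \<Longrightarrow> path_op \<mu> \<in> bounded_ops X"
  using partial_injection.pinj_op_closed[OF partial_injection_act] by (simp add: path_op_def)

lemma path_op_apply:
  assumes "\<mu> \<in> \<P>" "f \<in> ell2 X"
  shows "x \<in> adom \<mu> \<Longrightarrow> path_op \<mu> f (act \<mu> x) = f x" "y \<notin> cyl \<mu> \<Longrightarrow> path_op \<mu> f y = 0"
  using partial_injection.pinj_op_apply[OF partial_injection_act[OF assms(1)] assms(2)] by (simp_all add: path_op_def)

lemma adj_path_op_closed: "\<mu> \<in> \<P> \<Longrightarrow> adj (B_ell2 X) (path_op \<mu>) \<in> bounded_ops X"
  by (rule adj_in[OF path_op_closed])

lemma adj_path_op_apply:
  assumes "\<mu> \<in> \<P>" "f \<in> ell2 X"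
  shows "adj (B_ell2 X) (path_op \<mu>) f x = (if x \<in> adom \<mu> then f (act \<mu> x) else 0)"
  using partial_injection.pinj_adj_apply[OF partial_injection_act[OF assms(1)] assms(2)]
    partial_injection.adj_pinj_op[OF partial_injection_act[OF assms(1)]] by (simp add: path_op_def)

lemma path_op_basis:
  assumes "\<mu> \<in> \<P>" "x \<in> X"
  shows "path_op \<mu> (ell2_basis x) = (if \<s> \<mu> = vtx x then ell2_basis (act \<mu> x) else (\<lambda>_. 0))"
  using partial_injection.pinj_op_basis[OF partial_injection_act[OF assms(1)] assms(2)] assms
  by (simp add: path_op_def adom_def)

lemma cyl_vertex:
  assumes "v \<in> \<V>"
  shows "cyl v = {x \<in> X. vtx x = v}" "\<And>x. x \<in> adom v \<Longrightarrow> act v x = x" "adom v = {x \<in> X. vtx x = v}"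
proof -
  show d: "adom v = {x \<in> X. vtx x = v}" using vertexD[OF assms] by (auto simp: adom_def)
  show a: "act v x = x" if "x \<in> adom v" for x using that act_vertex[of x] d by auto
  have "cyl v = adom v" using a by (simp add: image_def)
  then show "cyl v = {x \<in> X. vtx x = v}" using d by simp
qed

lemma path_op_vertex_apply:
  assumes "v \<in> \<V>" "f \<in> ell2 X"
  shows "path_op v f y = (if y \<in> X \<and> vtx y = v then f y else 0)"
  using path_op_apply[OF vertexD(1)[OF assms(1)] assms(2)] cyl_vertex[OF assms(1)] by force

lemma cyl_proj_apply:
  assumes "\<mu> \<in> \<P>" "f \<in> ell2 X"
  shows "path_op \<mu> (adj (B_ell2 X) (path_op \<mu>) f) y = (if y \<in> cyl \<mu> then f y else 0)"
  using path_op_apply[OF assms(1) bounded_ops_closed[OF adj_path_op_closed[OF assms(1)] assms(2)]]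
    adj_path_op_apply[OF assms] by auto

text \<open>The product of \<open>path_op \<mu>\<close> with the adjoint of
  \<open>path_op \<nu>\<close> moves the basis vector at \<open>\<nu>x\<close> to the one at
  \<open>\<mu>x\<close>; these are its matrix entries.\<close>

lemma path_op_matrix:
  assumes "\<mu> \<in> \<P>" "\<nu> \<in> \<P>" "f \<in> ell2 X"
  shows "x \<in> adom \<mu> \<Longrightarrow> x \<in> adom \<nu> \<Longrightarrow> path_op \<mu> (adj (B_ell2 X) (path_op \<nu>) f) (act \<mu> x) = f (act \<nu> x)"
    "x \<in> adom \<mu> \<Longrightarrow> x \<notin> adom \<nu> \<Longrightarrow> path_op \<mu> (adj (B_ell2 X) (path_op \<nu>) f) (act \<mu> x) = 0"
    "y \<notin> cyl \<mu> \<Longrightarrow> path_op \<mu> (adj (B_ell2 X) (path_op \<nu>) f) y = 0"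
  using path_op_apply[OF assms(1) bounded_ops_closed[OF adj_path_op_closed[OF assms(2)] assms(3)]]
    adj_path_op_apply[OF assms(2,3)] by auto

text \<open>Evaluated at a point, at most one summand on the right survives, and
  \<open>act_meet\<close> produces it exactly when the left-hand side sees the point.\<close>

lemma CK3_path_op:
  assumes fa: "finitely_aligned \<Lambda>" and \<mu>: "\<mu> \<in> \<P>" and \<nu>: "\<nu> \<in> \<P>"
  shows "adj (B_ell2 X) (path_op \<mu>) \<otimes>\<^bsub>B_ell2 X\<^esub> path_op \<nu> =
        finsum (B_ell2 X) (\<lambda>(\<alpha>, \<beta>). path_op \<alpha> \<otimes>\<^bsub>B_ell2 X\<^esub> adj (B_ell2 X) (path_op \<beta>))
          {(\<alpha>, \<beta>). \<alpha> \<in> \<P> \<and> \<beta> \<in> \<P> \<and> \<s> \<mu> = \<r> \<alpha> \<and> \<s> \<nu> = \<r> \<beta> \<and>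
             \<mu> \<cdot> \<alpha> = \<nu> \<cdot> \<beta> \<and> \<mu> \<cdot> \<alpha> \<in> \<M> \<mu> \<nu>}" (is "?L = finsum _ ?g ?P")
proof (rule op_ext)
  interpret cstar_algebra "B_ell2 X" by (rule B_ell2_cstar)
  have fin: "finite ?P" by (rule MCE_pairs_finite[OF assms])
  have g: "?g \<in> ?P \<rightarrow> bounded_ops X"
    by (auto intro!: op_compose_closed path_op_closed adj_path_op_closed)
  then have "?g \<in> ?P \<rightarrow> carrier (B_ell2 X)" unfolding B_ell2_simps(1) .
  then have "finsum (B_ell2 X) ?g ?P \<in> carrier (B_ell2 X)" by (rule M.finsum_closed)
  then show "finsum (B_ell2 X) ?g ?P \<in> bounded_ops X" unfolding B_ell2_simps(1) .
  show "?L \<in> bounded_ops X"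
    using op_compose_closed[OF adj_path_op_closed[OF \<mu>] path_op_closed[OF \<nu>]] by simp
  fix f assume f: "f \<in> ell2 X"
  show "?L f = finsum (B_ell2 X) ?g ?P f"
  proof
    fix x
    have gf: "(case p of (\<alpha>, \<beta>) \<Rightarrow> path_op \<alpha> \<otimes>\<^bsub>B_ell2 X\<^esub> adj (B_ell2 X) (path_op \<beta>)) f x =
      path_op (fst p) (adj (B_ell2 X) (path_op (snd p)) f) x" for p
      using f by (cases p) (simp add: compose_eq)
    have R: "finsum (B_ell2 X) ?g ?P f x = (\<Sum>p\<in>?P. path_op (fst p) (adj (B_ell2 X) (path_op (snd p)) f) x)"
      using B_ell2_finsum_apply[OF fin g f, of x] by (simp only: gf)
    have L: "?L f x = (if x \<in> adom \<mu> then path_op \<nu> f (act \<mu> x) else 0)"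
      using f adj_path_op_apply[OF \<mu> bounded_ops_closed[OF path_op_closed[OF \<nu>] f]] by (simp add: compose_eq)
    have mem: "x \<in> adom \<mu> \<and> act \<mu> x = act \<nu> (act (snd p) z)" if p: "p \<in> ?P" and z: "z \<in> adom (fst p)" "x = act (fst p) z" for p z
    proof -
      obtain \<alpha> \<beta> where ab: "p = (\<alpha>, \<beta>)" "\<alpha> \<in> \<P>" "\<beta> \<in> \<P>" "\<s> \<mu> = \<r> \<alpha>" "\<s> \<nu> = \<r> \<beta>"
        "\<mu> \<cdot> \<alpha> = \<nu> \<cdot> \<beta>" using p by blast
      have sb: "\<s> \<alpha> = \<s> \<beta>" using src_cmp[OF \<mu> ab(2,4)] src_cmp[OF \<nu> ab(3,5)] ab(6) by simp
      have zX: "z \<in> X" "\<s> \<alpha> = vtx z" using z(1) ab(1) by (auto simp: adom_def)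
      have "act \<mu> (act \<alpha> z) = act \<nu> (act \<beta> z)"
        using act_cmp[OF \<mu> ab(2,4) zX] act_cmp[OF \<nu> ab(3,5) zX(1)] zX(2) sb ab(6) by simp
      moreover have "act \<alpha> z \<in> adom \<mu>"
        using act_closed[OF ab(2) zX] vtx_act[OF ab(2) zX] ab(4) by (simp add: adom_def)
      ultimately show ?thesis using z(2) ab(1) by simp
    qed
    show "?L f x = finsum (B_ell2 X) ?g ?P f x"
    proof (cases "x \<in> adom \<mu> \<and> act \<mu> x \<in> cyl \<nu>")
      case True
      then obtain y where y: "y \<in> adom \<nu>" "act \<mu> x = act \<nu> y" by blast
      have x: "x \<in> X" "\<s> \<mu> = vtx x" and y': "y \<in> X" "\<s> \<nu> = vtx y"
        using True y by (auto simp: adom_def)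
      obtain \<alpha> \<beta> z where z: "\<alpha> \<in> \<P>" "\<beta> \<in> \<P>" "\<s> \<mu> = \<r> \<alpha>" "\<s> \<nu> = \<r> \<beta>"
        "\<mu> \<cdot> \<alpha> = \<nu> \<cdot> \<beta>" "\<mu> \<cdot> \<alpha> \<in> \<M> \<mu> \<nu>" "z \<in> X" "\<s> \<alpha> = vtx z" "\<s> \<beta> = vtx z"
        "x = act \<alpha> z" "y = act \<beta> z"
        using act_meet[OF \<mu> \<nu> x(1) y'(1) x(2) y'(2) y(2)] by blast
      have p: "(\<alpha>, \<beta>) \<in> ?P" using z by simp
      have zd: "z \<in> adom \<alpha>" "z \<in> adom \<beta>" using z by (auto simp: adom_def)
      \<comment> \<open>Two surviving pairs would give two paths through which \<open>x\<close>
        factors. All members of \<open>\<M> \<mu> \<nu>\<close> have one degree, so these two have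
        equal degrees and a common extension, and hence coincide.\<close>
      have "path_op (fst q) (adj (B_ell2 X) (path_op (snd q)) f) x = 0" if q: "q \<in> ?P" "q \<noteq> (\<alpha>, \<beta>)" for q
      proof (rule ccontr)
        assume n0: "path_op (fst q) (adj (B_ell2 X) (path_op (snd q)) f) x \<noteq> 0"
        obtain \<gamma> \<delta> where qq: "q = (\<gamma>, \<delta>)" "\<gamma> \<in> \<P>" "\<delta> \<in> \<P>" "\<s> \<mu> = \<r> \<gamma>" "\<s> \<nu> = \<r> \<delta>"
          "\<mu> \<cdot> \<gamma> = \<nu> \<cdot> \<delta>" "\<mu> \<cdot> \<gamma> \<in> \<M> \<mu> \<nu>" using q by blast
        have "x \<in> cyl \<gamma>" using n0 path_op_matrix(3)[OF qq(2,3) f, of x] qq(1) by auto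
        then obtain w where w: "w \<in> X" "\<s> \<gamma> = vtx w" "x = act \<gamma> w" by (auto simp: adom_def)
        obtain \<alpha>' \<gamma>' where cm: "\<alpha>' \<in> \<P>" "\<gamma>' \<in> \<P>" "\<s> \<alpha> = \<r> \<alpha>'" "\<s> \<gamma> = \<r> \<gamma>'"
          "\<alpha> \<cdot> \<alpha>' = \<gamma> \<cdot> \<gamma>'"
          using act_meet[OF z(1) qq(2) z(7) w(1) z(8) w(2)] z(10) w(3) by auto
        have "\<d> (\<mu> \<cdot> \<alpha>) = \<d> (\<mu> \<cdot> \<gamma>)" using z(6) qq(7) by (simp add: MCE_def)
        then have "\<d> \<alpha> = \<d> \<gamma>" using deg_cmp[OF \<mu> z(1,3)] deg_cmp[OF \<mu> qq(2,4)] by simp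
        then have "\<alpha> = \<gamma>" using factor_unique(1)[OF z(1) cm(1,3) qq(2) cm(2,4,5)] by simp
        moreover then have "\<beta> = \<delta>" using cancel_left[OF \<nu> z(2) qq(3) z(4) qq(5)] z(5) qq(6) by simp
        ultimately show False using q(2) qq(1) by simp
      qed
      then have "(\<Sum>p\<in>?P. path_op (fst p) (adj (B_ell2 X) (path_op (snd p)) f) x) =
          (\<Sum>p\<in>{(\<alpha>, \<beta>)}. path_op (fst p) (adj (B_ell2 X) (path_op (snd p)) f) x)"
        using p fin by (intro sum.mono_neutral_right) auto
      also have "\<dots> = f (act \<beta> z)" using path_op_matrix(1)[OF z(1,2) f zd] z(10) by simp
      finally show ?thesis using R L True y z(11) path_op_apply(1)[OF \<nu> f y(1)] by simp
    next
      case False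
      have "path_op (fst p) (adj (B_ell2 X) (path_op (snd p)) f) x = 0" if p: "p \<in> ?P" for p
      proof (rule ccontr)
        assume n0: "path_op (fst p) (adj (B_ell2 X) (path_op (snd p)) f) x \<noteq> 0"
        obtain \<alpha> \<beta> where ab: "p = (\<alpha>, \<beta>)" "\<alpha> \<in> \<P>" "\<beta> \<in> \<P>" "\<s> \<nu> = \<r> \<beta>" using p by blast
        have "x \<in> cyl \<alpha>" using n0 path_op_matrix(3)[OF ab(2,3) f, of x] ab(1) by auto
        then obtain z where z: "z \<in> adom \<alpha>" "x = act \<alpha> z" by blast
        have zb: "z \<in> adom \<beta>" using n0 path_op_matrix(2)[OF ab(2,3) f z(1)] z(2) ab(1) by auto
        have "act \<beta> z \<in> adom \<nu>"
          using act_closed[OF ab(3)] vtx_act[OF ab(3)] adomD[OF zb] ab(4) by (simp add: adom_def)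
        then show False using mem[OF p, of z] z ab(1) False by auto
      qed
      then have "finsum (B_ell2 X) ?g ?P f x = 0" unfolding R by (intro sum.neutral) blast
      moreover have "?L f x = 0" using False L path_op_apply(2)[OF \<nu> f, of "act \<mu> x"] by auto
      ultimately show ?thesis by simp
    qed
  qed
qed

lemma gap_step:
  assumes v: "v \<in> \<V>" and \<mu>: "\<mu> \<in> \<P>" and G: "G \<in> bounded_ops X"
  defines "H \<equiv> (path_op v \<ominus>\<^bsub>B_ell2 X\<^esub> path_op \<mu> \<otimes>\<^bsub>B_ell2 X\<^esub> adj (B_ell2 X) (path_op \<mu>)) \<otimes>\<^bsub>B_ell2 X\<^esub> G"
  shows "H \<in> bounded_ops X"
    and "f \<in> ell2 X \<Longrightarrow> H f y = (if y \<in> X \<and> vtx y = v then G f y else 0) - (if y \<in> cyl \<mu> then G f y else 0)"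
proof -
  interpret cstar_algebra "B_ell2 X" by (rule B_ell2_cstar)
  let ?p = "compose (ell2 X) (path_op \<mu>) (adj (B_ell2 X) (path_op \<mu>))"
  have tv: "path_op v \<in> bounded_ops X" by (rule path_op_closed[OF vertexD(1)[OF v]])
  have p: "?p \<in> bounded_ops X" by (rule op_compose_closed[OF path_op_closed[OF \<mu>] adj_path_op_closed[OF \<mu>]])
  have q: "path_op v \<ominus>\<^bsub>B_ell2 X\<^esub> ?p \<in> bounded_ops X" using M.minus_closed[of "path_op v" ?p] tv p by simp
  show "H \<in> bounded_ops X" using op_compose_closed[OF q G] by (simp add: H_def)
  assume f: "f \<in> ell2 X"
  have Gf: "G f \<in> ell2 X" by (rule bounded_ops_closed[OF G f])
  have "H f y = (path_op v \<ominus>\<^bsub>B_ell2 X\<^esub> ?p) (G f) y" using f by (simp add: H_def compose_eq)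
  also have "\<dots> = path_op v (G f) y - ?p (G f) y" using Gf by (simp add: B_ell2_minus[OF tv p])
  also have "?p (G f) y = (if y \<in> cyl \<mu> then G f y else 0)"
    using cyl_proj_apply[OF \<mu> Gf, of y] Gf by (simp add: compose_eq)
  finally show "H f y = (if y \<in> X \<and> vtx y = v then G f y else 0) - (if y \<in> cyl \<mu> then G f y else 0)"
    by (simp add: path_op_vertex_apply[OF v Gf])
qed

text \<open>Each factor erases one cylinder. Only the vanishing is recorded, because (CK4) asks for
  nothing else.\<close>

lemma gap_path_op_apply:
  assumes v: "v \<in> \<V>" and es: "set es \<subseteq> \<P>" and f: "f \<in> ell2 X"
  defines "G \<equiv> foldr (\<lambda>\<mu> a. (path_op v \<ominus>\<^bsub>B_ell2 X\<^esub> path_op \<mu> \<otimes>\<^bsub>B_ell2 X\<^esub> adj (B_ell2 X) (path_op \<mu>)) \<otimes>\<^bsub>B_ell2 X\<^esub> a)"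
  shows "G es (path_op v) \<in> bounded_ops X \<and>
    (\<forall>y. y \<notin> X \<or> vtx y \<noteq> v \<or> (\<exists>\<mu>\<in>set es. y \<in> cyl \<mu>) \<longrightarrow> G es (path_op v) f y = 0)"
  using es
proof (induction es)
  case Nil
  then show ?case using path_op_closed[OF vertexD(1)[OF v]] path_op_vertex_apply[OF v f] by (auto simp: G_def)
next
  case (Cons \<mu> es)
  then have \<mu>: "\<mu> \<in> \<P>" and G: "G es (path_op v) \<in> bounded_ops X"
    "\<And>y. y \<notin> X \<or> vtx y \<noteq> v \<or> (\<exists>\<mu>\<in>set es. y \<in> cyl \<mu>) \<Longrightarrow> G es (path_op v) f y = 0" by auto
  let ?H = "(path_op v \<ominus>\<^bsub>B_ell2 X\<^esub> path_op \<mu> \<otimes>\<^bsub>B_ell2 X\<^esub> adj (B_ell2 X) (path_op \<mu>)) \<otimes>\<^bsub>B_ell2 X\<^esub> G es (path_op v)"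
  have eq: "G (\<mu> # es) (path_op v) = ?H" by (simp only: G_def foldr.simps o_apply)
  have "?H f y = 0" if y: "y \<notin> X \<or> vtx y \<noteq> v \<or> (\<exists>\<mu>'\<in>set (\<mu> # es). y \<in> cyl \<mu>')" for y
  proof (cases "G es (path_op v) f y = 0")
    case False
    then have "y \<in> X" "vtx y = v" "\<not> (\<exists>\<mu>\<in>set es. y \<in> cyl \<mu>)" using G(2)[of y] by blast+
    then show ?thesis using y unfolding gap_step(2)[OF v \<mu> G(1) f] by simp
  qed (simp only: gap_step(2)[OF v \<mu> G(1) f], simp)
  then show ?case unfolding eq using gap_step(1)[OF v \<mu> G(1)] by blast
qed

lemma CK_family_path_op:
  assumes fa: "finitely_aligned \<Lambda>"
  shows "CK_family \<Lambda> (B_ell2 X) path_op"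
proof -
  interpret B: cstar_algebra "B_ell2 X" by (rule B_ell2_cstar)
  show ?thesis
  proof (unfold_locales)
    fix \<mu> assume \<mu>: "\<mu> \<in> \<P>"
    show "path_op \<mu> \<in> carrier (B_ell2 X)" using path_op_closed[OF \<mu>] by simp
    show "path_op \<mu> \<otimes>\<^bsub>B_ell2 X\<^esub> adj (B_ell2 X) (path_op \<mu>) \<otimes>\<^bsub>B_ell2 X\<^esub> path_op \<mu> = path_op \<mu>"
    proof (rule op_ext[OF _ path_op_closed[OF \<mu>]])
      show "path_op \<mu> \<otimes>\<^bsub>B_ell2 X\<^esub> adj (B_ell2 X) (path_op \<mu>) \<otimes>\<^bsub>B_ell2 X\<^esub> path_op \<mu> \<in> bounded_ops X"
        using path_op_closed[OF \<mu>] adj_path_op_closed[OF \<mu>] by (simp add: op_compose_closed)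
      fix f assume f: "f \<in> ell2 X"
      have "path_op \<mu> (adj (B_ell2 X) (path_op \<mu>) (path_op \<mu> f)) = path_op \<mu> f"
        using cyl_proj_apply[OF \<mu> bounded_ops_closed[OF path_op_closed[OF \<mu>] f]] path_op_apply(2)[OF \<mu> f]
        by (auto simp: fun_eq_iff)
      then show "(path_op \<mu> \<otimes>\<^bsub>B_ell2 X\<^esub> adj (B_ell2 X) (path_op \<mu>) \<otimes>\<^bsub>B_ell2 X\<^esub> path_op \<mu>) f = path_op \<mu> f"
        using f bounded_ops_closed[OF path_op_closed[OF \<mu>] f] by (simp add: compose_eq)
    qed
  next
    fix v assume v: "v \<in> \<V>"
    note tv = path_op_closed[OF vertexD(1)[OF v]]
    have "adj (B_ell2 X) (path_op v) = path_op v"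
    proof (rule op_ext[OF adj_in[OF tv] tv])
      fix f assume f: "f \<in> ell2 X"
      show "adj (B_ell2 X) (path_op v) f = path_op v f"
        using adj_path_op_apply[OF vertexD(1)[OF v] f] path_op_vertex_apply[OF v f] cyl_vertex[OF v]
        by (auto simp: fun_eq_iff)
    qed
    moreover have "path_op v \<otimes>\<^bsub>B_ell2 X\<^esub> path_op v = path_op v"
    proof (rule op_ext[OF _ tv])
      fix f assume f: "f \<in> ell2 X"
      show "(path_op v \<otimes>\<^bsub>B_ell2 X\<^esub> path_op v) f = path_op v f"
        using f path_op_vertex_apply[OF v f] path_op_vertex_apply[OF v bounded_ops_closed[OF tv f]]
        by (auto simp: fun_eq_iff compose_eq)
    qed (use op_compose_closed[OF tv tv] in simp)
    ultimately show "adj (B_ell2 X) (path_op v) = path_op v \<and> path_op v \<otimes>\<^bsub>B_ell2 X\<^esub> path_op v = path_op v" ..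
    fix w assume w: "w \<in> \<V>" and vw: "v \<noteq> w"
    note tw = path_op_closed[OF vertexD(1)[OF w]]
    show "path_op v \<otimes>\<^bsub>B_ell2 X\<^esub> path_op w = \<zero>\<^bsub>B_ell2 X\<^esub>"
    proof (rule op_ext[where X = X])
      fix f assume f: "f \<in> ell2 X"
      show "(path_op v \<otimes>\<^bsub>B_ell2 X\<^esub> path_op w) f = \<zero>\<^bsub>B_ell2 X\<^esub> f"
        using f vw path_op_vertex_apply[OF w f] path_op_vertex_apply[OF v bounded_ops_closed[OF tw f]]
        by (auto simp: fun_eq_iff compose_eq)
    qed (use op_compose_closed[OF tv tw] op_zero_closed in simp_all)
  next
    fix \<mu> \<nu> assume \<mu>: "\<mu> \<in> \<P>" and \<nu>: "\<nu> \<in> \<P>" and s: "\<s> \<mu> = \<r> \<nu>"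
    have mn: "\<mu> \<cdot> \<nu> \<in> \<P>" using cmp_closed[OF \<mu> \<nu> s] .
    show "path_op \<mu> \<otimes>\<^bsub>B_ell2 X\<^esub> path_op \<nu> = path_op (\<mu> \<cdot> \<nu>)"
    proof (rule op_ext_basis[where X = X])
      fix x assume x: "x \<in> X"
      show "(path_op \<mu> \<otimes>\<^bsub>B_ell2 X\<^esub> path_op \<nu>) (ell2_basis x) = path_op (\<mu> \<cdot> \<nu>) (ell2_basis x)"
      proof (cases "\<s> \<nu> = vtx x")
        case True
        have "\<s> \<mu> = vtx (act \<nu> x)" using vtx_act[OF \<nu> x True] s by simp
        then show ?thesis
          using True x path_op_basis[OF \<mu> act_closed[OF \<nu> x True]] act_cmp[OF \<mu> \<nu> s x True] src_cmp[OF \<mu> \<nu> s]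
          by (simp add: compose_eq path_op_basis[OF \<nu>] path_op_basis[OF mn])
      next
        case False
        then show ?thesis
          using x src_cmp[OF \<mu> \<nu> s] bounded_ops_0[OF path_op_closed[OF \<mu>]]
          by (simp add: compose_eq path_op_basis[OF \<nu>] path_op_basis[OF mn])
      qed
    qed (use op_compose_closed[OF path_op_closed[OF \<mu>] path_op_closed[OF \<nu>]] path_op_closed[OF mn] in simp_all)
  next
    fix \<mu> \<nu> assume \<mu>: "\<mu> \<in> \<P>" and \<nu>: "\<nu> \<in> \<P>"
    show "adj (B_ell2 X) (path_op \<mu>) \<otimes>\<^bsub>B_ell2 X\<^esub> path_op \<nu> =
        finsum (B_ell2 X) (\<lambda>(\<alpha>, \<beta>). path_op \<alpha> \<otimes>\<^bsub>B_ell2 X\<^esub> adj (B_ell2 X) (path_op \<beta>))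
          {(\<alpha>, \<beta>). \<alpha> \<in> \<P> \<and> \<beta> \<in> \<P> \<and> \<s> \<mu> = \<r> \<alpha> \<and> \<s> \<nu> = \<r> \<beta> \<and>
             \<mu> \<cdot> \<alpha> = \<nu> \<cdot> \<beta> \<and> \<mu> \<cdot> \<alpha> \<in> \<M> \<mu> \<nu>}"
      by (rule CK3_path_op[OF fa \<mu> \<nu>])
  next
    fix v E es assume v: "v \<in> \<V>" and E: "E \<in> \<E> v" and es: "distinct es" "set es = E"
    have sub: "set es \<subseteq> \<P>" using E es by (auto simp: FE_def exhaustive_def)
    let ?G = "foldr (\<lambda>\<mu> a. (path_op v \<ominus>\<^bsub>B_ell2 X\<^esub> path_op \<mu> \<otimes>\<^bsub>B_ell2 X\<^esub> adj (B_ell2 X) (path_op \<mu>)) \<otimes>\<^bsub>B_ell2 X\<^esub> a) es (path_op v)"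
    show "?G = \<zero>\<^bsub>B_ell2 X\<^esub>"
    proof (rule op_ext[where X = X])
      show "?G \<in> bounded_ops X" using gap_path_op_apply[OF v sub ell2_0(1)] by blast
      show "\<zero>\<^bsub>B_ell2 X\<^esub> \<in> bounded_ops X" by (simp add: op_zero_closed)
      fix f assume f: "f \<in> ell2 X"
      \<comment> \<open>Exhaustiveness enters here: every point over \<open>v\<close> lies in the
        cylinder of some member of \<open>E\<close>.\<close>
      have "?G f y = 0" for y
      proof (cases "y \<in> X \<and> vtx y = v")
        case True
        then obtain \<mu> z where "\<mu> \<in> E" "z \<in> X" "\<s> \<mu> = vtx z" "y = act \<mu> z"
          using act_exhaustive[of y E] E by auto
        then have "\<exists>\<mu>\<in>set es. y \<in> cyl \<mu>" using es by (auto simp: adom_def)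
        then show ?thesis using gap_path_op_apply[OF v sub f] by blast
      next
        case False
        then show ?thesis using gap_path_op_apply[OF v sub f] by blast
      qed
      then show "?G f = \<zero>\<^bsub>B_ell2 X\<^esub> f" using f by (simp add: fun_eq_iff)
    qed
  qed
qed

lemma path_op_vertex_nonzero:
  assumes "v \<in> \<V>" shows "path_op v \<noteq> \<zero>\<^bsub>B_ell2 X\<^esub>"
proof
  obtain x where x: "x \<in> X" "vtx x = v" using vtx_surj[OF assms] by blast
  assume "path_op v = \<zero>\<^bsub>B_ell2 X\<^esub>"
  then have "path_op v (ell2_basis x) x = 0" using x by simp
  then show False using path_op_vertex_apply[OF assms ell2_basis_closed[OF x(1)], of x] x by (simp add: ell2_basis_def)
qed

end

section \<open>The boundary-path space as a path action\<close>

lemma emb_le_iff: "emb n \<le> m \<longleftrightarrow> (\<forall>i. enat (n i) \<le> m i)"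
  by (simp add: emb_def le_fun_def)

lemma emb_0 [simp]: "emb 0 \<le> m"
  by (simp add: emb_le_iff enat_0)

lemma emb_mono: "\<lbrakk>n \<le> n'; emb n' \<le> m\<rbrakk> \<Longrightarrow> emb n \<le> m"
  unfolding emb_def le_fun_def by (meson enat_ord_simps(1) order_trans)

lemma emb_add: "emb (n + n') = emb n + emb n'"
  by (simp add: emb_def fun_eq_iff)

lemma emb_sup: "emb (sup n n') \<le> m \<longleftrightarrow> emb n \<le> m \<and> emb n' \<le> m"
proof -
  have "enat (max a b) \<le> c \<longleftrightarrow> enat a \<le> c \<and> enat b \<le> c" for a b c by (cases c) auto
  then show ?thesis by (simp add: emb_le_iff sup_nat_def all_conj_distrib)
qed

lemma enat_diff_le: "enat a \<le> m \<Longrightarrow> enat b \<le> m - enat a \<longleftrightarrow> enat (a + b) \<le> m"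
  by (cases m) auto

lemma emb_le_diff: "emb n \<le> m \<Longrightarrow> emb q \<le> m - emb n \<longleftrightarrow> emb (n + q) \<le> m"
  by (auto simp: emb_def le_fun_def enat_diff_le)

lemma enat_add_diff: "(m + enat a) - enat a = m"
  by (cases m) auto

lemma emb_add_diff [simp]: "(m + emb d) - emb d = m"
  by (simp add: fun_eq_iff emb_def enat_add_diff)

lemma emb_diff_add: "emb n \<le> m \<Longrightarrow> (m - emb n) + emb n = m"
proof
  fix i assume "emb n \<le> m"
  then have "enat (n i) \<le> m i" by (simp add: emb_le_iff)
  then show "((m - emb n) + emb n) i = m i" by (cases "m i") (auto simp: emb_def)
qed

lemma emb_diff_diff: "(m - emb n) - emb n' = m - emb (n + n')"
proof
  fix i show "((m - emb n) - emb n') i = (m - emb (n + n')) i"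
    by (cases "m i") (auto simp: emb_def)
qed

lemma emb_le_add: "emb q \<le> m \<Longrightarrow> emb (d + q) \<le> m + emb d"
proof -
  assume a: "emb q \<le> m"
  have "enat (d i + q i) \<le> m i + enat (d i)" for i
  proof -
    have "enat (q i) \<le> m i" using a by (simp add: emb_le_iff)
    then show ?thesis by (cases "m i") auto
  qed
  then show ?thesis by (simp add: emb_def le_fun_def)
qed

lemma emb_le_add_diff: "emb n \<le> m + emb d \<Longrightarrow> emb (n - d) \<le> m"
proof -
  assume a: "emb n \<le> m + emb d"
  have "enat (n i - d i) \<le> m i" for i
  proof -
    have "enat (n i) \<le> m i + enat (d i)" using a by (simp add: emb_def le_fun_def)
    then show ?thesis by (cases "m i") auto
  qed
  then show ?thesis by (simp add: emb_le_iff)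
qed

lemma deg_le_add_diff: "n \<le> d + (n - d)" for n d :: "'k \<Rightarrow> nat"
  by (rule le_funI) simp

lemma fun_le_add_diff: "d \<le> n \<Longrightarrow> d + (n - d) = n" for n d :: "'k \<Rightarrow> nat"
  by (simp add: le_fun_def fun_eq_iff)

lemma fun_le_add_same: "n \<le> n + p" for n p :: "'k \<Rightarrow> nat"
  by (simp add: le_fun_def)

lemma fun_add_mono: "p \<le> q \<Longrightarrow> n + p \<le> n + q" for n p q :: "'k \<Rightarrow> nat"
  by (simp add: le_fun_def)

context k_graph
begin

section \<open>Morphisms from Omega and their initial segments\<close>

lemma gpathsI:
  assumes "\<And>p q. \<not> (p \<le> q \<and> emb q \<le> fst x) \<Longrightarrow> snd x (p, q) = undefined"
    and "\<And>p q. \<lbrakk>p \<le> q; emb q \<le> fst x\<rbrakk> \<Longrightarrow> snd x (p, q) \<in> \<P> \<and> \<d> (snd x (p, q)) = q - p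
      \<and> \<r> (snd x (p, q)) = snd x (p, p) \<and> \<s> (snd x (p, q)) = snd x (q, q)"
    and "\<And>p q l. \<lbrakk>p \<le> q; q \<le> l; emb l \<le> fst x\<rbrakk> \<Longrightarrow> snd x (p, l) = snd x (p, q) \<cdot> snd x (q, l)"
  shows "x \<in> \<G>"
proof -
  have "kgraph_morphism (Omega (fst x)) \<Lambda> (snd x)"
    unfolding kgraph_morphism_def
  proof (intro conjI ballI impI)
    have P: "\<exists>p q. a = (p, q) \<and> p \<le> q \<and> emb q \<le> fst x" if "a \<in> paths (Omega (fst x))" for a
      using that by (auto simp: Omega_def)
    show "snd x \<in> paths (Omega (fst x)) \<rightarrow>\<^sub>E \<P>"
    proof (rule PiE_I)
      fix a assume "a \<in> paths (Omega (fst x))"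
      then show "snd x a \<in> \<P>" using P[of a] assms(2) by blast
    next
      fix a assume a: "a \<notin> paths (Omega (fst x))"
      obtain p q where "a = (p, q)" by (cases a)
      then show "snd x a = undefined" using a assms(1)[of p q] by (simp add: Omega_def)
    qed
    fix a assume "a \<in> paths (Omega (fst x))"
    then obtain p q where pq: "a = (p, q)" "p \<le> q" "emb q \<le> fst x" using P by blast
    show "\<d> (snd x a) = deg (Omega (fst x)) a" "\<r> (snd x a) = snd x (rng (Omega (fst x)) a)"
      "\<s> (snd x a) = snd x (src (Omega (fst x)) a)"
      using assms(2)[OF pq(2,3)] by (simp_all add: Omega_def pq(1))
    fix b assume "b \<in> paths (Omega (fst x))" and ab: "src (Omega (fst x)) a = rng (Omega (fst x)) b"
    then obtain q' l where b: "b = (q', l)" "q' \<le> l" "emb l \<le> fst x" using P by blast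
    have "q' = q" using ab by (simp add: Omega_def pq(1) b(1))
    then show "snd x (cmp (Omega (fst x)) a b) = snd x a \<cdot> snd x b"
      using assms(3)[of p q l] pq b by (simp add: Omega_def)
  qed
  then show ?thesis by (simp add: gpaths_def case_prod_unfold)
qed

lemma gpathsD:
  assumes "x \<in> \<G>"
  shows gpath_undefined: "\<not> (p \<le> q \<and> emb q \<le> fst x) \<Longrightarrow> snd x (p, q) = undefined"
    and gpath_paths: "\<lbrakk>p \<le> q; emb q \<le> fst x\<rbrakk> \<Longrightarrow> snd x (p, q) \<in> \<P>"
    and gpath_deg: "\<lbrakk>p \<le> q; emb q \<le> fst x\<rbrakk> \<Longrightarrow> \<d> (snd x (p, q)) = q - p"
    and gpath_rng: "\<lbrakk>p \<le> q; emb q \<le> fst x\<rbrakk> \<Longrightarrow> \<r> (snd x (p, q)) = snd x (p, p)"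
    and gpath_src: "\<lbrakk>p \<le> q; emb q \<le> fst x\<rbrakk> \<Longrightarrow> \<s> (snd x (p, q)) = snd x (q, q)"
    and gpath_cmp: "\<lbrakk>p \<le> q; q \<le> l; emb l \<le> fst x\<rbrakk> \<Longrightarrow> snd x (p, l) = snd x (p, q) \<cdot> snd x (q, l)"
proof -
  let ?O = "Omega (fst x)"
  have "kgraph_morphism ?O \<Lambda> (snd x)" using assms by (simp add: gpaths_def case_prod_unfold)
  note m = this[unfolded kgraph_morphism_def]
  note M = m[THEN conjunct1] m[THEN conjunct2, THEN conjunct1] m[THEN conjunct2, THEN conjunct2]
  show "\<not> (p \<le> q \<and> emb q \<le> fst x) \<Longrightarrow> snd x (p, q) = undefined"
    by (rule PiE_arb[OF M(1)]) (simp add: Omega_def)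
  have P: "(p, q) \<in> paths ?O" if "p \<le> q" "emb q \<le> fst x" for p q
    using that by (simp add: Omega_def)
  show "snd x (p, q) \<in> \<P>" if "p \<le> q" "emb q \<le> fst x"
    by (rule PiE_mem[OF M(1) P[OF that]])
  show "\<d> (snd x (p, q)) = q - p" "\<r> (snd x (p, q)) = snd x (p, p)" "\<s> (snd x (p, q)) = snd x (q, q)"
    if "p \<le> q" "emb q \<le> fst x"
    using bspec[OF M(2) P[OF that]] by (simp_all add: Omega_def)
  show "snd x (p, l) = snd x (p, q) \<cdot> snd x (q, l)" if "p \<le> q" "q \<le> l" "emb l \<le> fst x"
    using bspec[OF bspec[OF M(3) P[OF that(1) emb_mono[OF that(2,3)]]] P[OF that(2,3)]] by (simp add: Omega_def)
qed

lemma gpath_initial: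
  assumes "x \<in> \<G>" "emb n \<le> fst x"
  shows "snd x (0, n) \<in> \<P>" "\<d> (snd x (0, n)) = n" "\<r> (snd x (0, n)) = gp_rng x"
    "\<s> (snd x (0, n)) = snd x (n, n)"
proof -
  have n: "0 \<le> n" "n - 0 = n" by (auto simp: fun_eq_iff)
  show "snd x (0, n) \<in> \<P>" "\<d> (snd x (0, n)) = n" "\<r> (snd x (0, n)) = gp_rng x"
    "\<s> (snd x (0, n)) = snd x (n, n)"
    using gpath_paths[OF assms(1) n(1) assms(2)] gpath_deg[OF assms(1) n(1) assms(2)]
      gpath_rng[OF assms(1) n(1) assms(2)] gpath_src[OF assms(1) n(1) assms(2)] n(2)
    by (simp_all add: gp_rng_def)
qed

lemma gpath_split:
  assumes "x \<in> \<G>" "emb q \<le> fst x" "p \<le> q"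
  shows "snd x (0, q) = snd x (0, p) \<cdot> snd x (p, q)"
  using gpath_cmp[OF assms(1) _ assms(3,2), of 0] by simp

lemma gpath_initial_prefix:
  assumes "x \<in> \<G>" "emb q \<le> fst x" "p \<le> q"
  shows "(snd x (0, p)) \<preceq> (snd x (0, q))"
  unfolding gpath_split[OF assms]
  using gpath_initial[OF assms(1) emb_mono[OF assms(3,2)]] gpath_paths[OF assms(1,3,2)]
    gpath_rng[OF assms(1,3,2)] by (intro prefix_ofI) auto

text \<open>Left cancellation recovers every segment from the initial ones.\<close>

lemma gpath_eqI:
  assumes x: "x \<in> \<G>" and y: "y \<in> \<G>" and eq: "fst x = fst y"
    and ini: "\<And>n. emb n \<le> fst x \<Longrightarrow> snd x (0, n) = snd y (0, n)"
  shows "x = y"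
proof (rule prod_eqI[OF eq], rule ext)
  fix pq :: "('k \<Rightarrow> nat) \<times> ('k \<Rightarrow> nat)"
  obtain p q where pq: "pq = (p, q)" by (cases pq)
  show "snd x pq = snd y pq"
  proof (cases "p \<le> q \<and> emb q \<le> fst x")
    case True
    then have le: "p \<le> q" "emb q \<le> fst x" "emb q \<le> fst y" "emb p \<le> fst x" "emb p \<le> fst y"
      using eq emb_mono[of p q "fst x"] by auto
    have "snd x (0, p) \<cdot> snd x (p, q) = snd x (0, p) \<cdot> snd y (p, q)"
      using gpath_split[OF x le(2,1)] gpath_split[OF y le(3,1)] ini[OF le(2)] ini[OF le(4)] by simp
    then have "snd x (p, q) = snd y (p, q)"
      using gpath_initial(1,4)[OF x le(4)] gpath_initial(4)[OF y le(5)] gpath_paths[OF x le(1,2)]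
        gpath_paths[OF y le(1,3)] gpath_rng[OF x le(1,2)] gpath_rng[OF y le(1,3)] ini[OF le(4)]
      by (intro cancel_left[of "snd x (0, p)" "snd x (p, q)" "snd y (p, q)"]) simp_all
    then show ?thesis by (simp add: pq)
  next
    case False
    then show ?thesis using gpath_undefined[OF x, of p q] gpath_undefined[OF y, of p q] eq pq by auto
  qed
qed

text \<open>A coherent choice of initial segments is all the data of a morphism: the segment from p
  to q is what \<open>g p\<close> lacks to become \<open>g q\<close>, and functoriality follows by
  cancelling \<open>g p\<close>.\<close>

lemma gpath_ex:
  assumes g: "\<And>n. emb n \<le> m \<Longrightarrow> g n \<in> \<P> \<and> \<d> (g n) = n"
    and pre: "\<And>n n'. \<lbrakk>emb n' \<le> m; n \<le> n'\<rbrakk> \<Longrightarrow> g n \<preceq> g n'"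
  obtains x where "x \<in> \<G>" "fst x = m" "\<And>n. emb n \<le> m \<Longrightarrow> snd x (0, n) = g n"
proof -
  define t where "t p q = (SOME \<beta>. \<beta> \<in> \<P> \<and> \<s> (g p) = \<r> \<beta> \<and> g q = g p \<cdot> \<beta>)" for p q
  have t: "t p q \<in> \<P> \<and> \<s> (g p) = \<r> (t p q) \<and> g q = g p \<cdot> t p q" if "emb q \<le> m" "p \<le> q" for p q
    unfolding t_def by (rule someI_ex) (use pre[OF that] in \<open>auto elim: prefix_ofE\<close>)
  define x where "x = (m, \<lambda>(p, q). if p \<le> q \<and> emb q \<le> m then t p q else undefined)"
  have t1: "t p q \<in> \<P>" and t2: "\<r> (t p q) = \<s> (g p)" and t3: "g q = g p \<cdot> t p q"
    if "emb q \<le> m" "p \<le> q" for p q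
    using t[OF that] by simp_all
  have g1: "g p \<in> \<P>" and g2: "\<d> (g p) = p" if "emb p \<le> m" for p using g[OF that] by simp_all
  have t4: "\<s> (t p q) = \<s> (g q)" and t5: "\<d> (t p q) = q - p"
    if q: "emb q \<le> m" and pq: "p \<le> q" for p q
  proof -
    have p: "emb p \<le> m" by (rule emb_mono[OF pq q])
    show "\<s> (t p q) = \<s> (g q)"
      unfolding t3[OF q pq] using src_cmp[OF g1[OF p] t1[OF q pq]] t2[OF q pq] by simp
    have "\<d> (g q) = \<d> (g p) + \<d> (t p q)"
      unfolding t3[OF q pq] using deg_cmp[OF g1[OF p] t1[OF q pq]] t2[OF q pq] by simp
    then show "\<d> (t p q) = q - p" using g2[OF p] g2[OF q] by (simp add: fun_eq_iff)
  qed
  have tt: "t p p = \<s> (g p)" if p: "emb p \<le> m" for p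
  proof (rule cancel_left[OF g1[OF p] t1[OF p order_refl]])
    show "g p \<cdot> t p p = g p \<cdot> \<s> (g p)" using t3[OF p order_refl] cmp_src_id[OF g1[OF p]] by metis
  qed (use g1[OF p] t2[OF p order_refl] in simp_all)
  have x: "x \<in> \<G>"
  proof (rule gpathsI)
    fix p q assume "p \<le> q" "emb q \<le> fst x"
    then have pq: "p \<le> q" "emb q \<le> m" and p: "emb p \<le> m" by (auto simp: x_def intro: emb_mono)
    show "snd x (p, q) \<in> \<P> \<and> \<d> (snd x (p, q)) = q - p
      \<and> \<r> (snd x (p, q)) = snd x (p, p) \<and> \<s> (snd x (p, q)) = snd x (q, q)"
      using t1[OF pq(2,1)] t2[OF pq(2,1)] t4[OF pq(2,1)] t5[OF pq(2,1)] pq p by (simp add: x_def tt)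
  next
    fix p q l assume "p \<le> q" "q \<le> l" "emb l \<le> fst x"
    then have le: "p \<le> q" "q \<le> l" "p \<le> l" and l: "emb l \<le> m" and q: "emb q \<le> m" and p: "emb p \<le> m"
      by (auto simp: x_def intro: emb_mono)
    have s: "\<s> (t p q) = \<r> (t q l)" using t4[OF q le(1)] t2[OF l le(2)] by simp
    have "g p \<cdot> (t p q \<cdot> t q l) = (g p \<cdot> t p q) \<cdot> t q l"
      by (rule cmp_assoc[symmetric, OF g1[OF p] t1[OF q le(1)] t1[OF l le(2)] t2[OF q le(1), symmetric] s])
    also have "\<dots> = g p \<cdot> t p l"
      unfolding t3[OF q le(1), symmetric] t3[OF l le(2), symmetric] by (rule t3[OF l le(3)])
    finally have eq: "g p \<cdot> (t p q \<cdot> t q l) = g p \<cdot> t p l" .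
    have "t p q \<cdot> t q l = t p l"
      by (rule cancel_left[OF g1[OF p] _ t1[OF l le(3)] _ _ eq])
        (use t1[OF q le(1)] t1[OF l le(2)] t2[OF q le(1)] t2[OF l le(3)] s in simp_all)
    then show "snd x (p, l) = snd x (p, q) \<cdot> snd x (q, l)" using le l q by (simp add: x_def)
  qed (auto simp: x_def)
  moreover have "snd x (0, n) = g n" if n: "emb n \<le> m" for n
  proof -
    have n0: "0 \<le> n" by simp
    have v: "g 0 \<in> \<V>" using deg_0_iff[OF g1, of 0] g2[of 0] by simp
    have "g n = g 0 \<cdot> t 0 n" by (rule t3[OF n n0])
    also have "g 0 = \<r> (t 0 n)" using t2[OF n n0] vertexD(3)[OF v] by simp
    also have "\<r> (t 0 n) \<cdot> t 0 n = t 0 n" by (rule rng_cmp_id[OF t1[OF n n0]])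
    finally have "g n = t 0 n" .
    then show ?thesis using n n0 by (simp add: x_def)
  qed
  ultimately show thesis using that[of x] by (simp add: x_def)
qed

section \<open>Shifting and prepending\<close>

lemma gp_shift_apply:
  assumes "emb n \<le> fst x" "p \<le> q" "emb (n + q) \<le> fst x"
  shows "snd (gp_shift n x) (p, q) = snd x (n + p, n + q)"
  using assms by (simp add: gp_shift_def Omega_def emb_le_diff)

lemma fst_gp_shift [simp]: "fst (gp_shift n x) = fst x - emb n"
  by (simp add: gp_shift_def)

lemma gp_shift_gpaths:
  assumes x: "x \<in> \<G>" and n: "emb n \<le> fst x"
  shows "gp_shift n x \<in> \<G>"
proof (rule gpathsI)
  fix p q :: "'k \<Rightarrow> nat"
  show "snd (gp_shift n x) (p, q) = undefined" if "\<not> (p \<le> q \<and> emb q \<le> fst (gp_shift n x))"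
    using that by (auto simp: gp_shift_def Omega_def)
  have S: "snd (gp_shift n x) (p, q) = snd x (n + p, n + q)" "n + p \<le> n + q" "emb (n + q) \<le> fst x"
    if "p \<le> q" "emb q \<le> fst (gp_shift n x)" for p q
    using that gp_shift_apply[OF n that(1)] emb_le_diff[OF n] fun_add_mono[OF that(1)] by simp_all
  show "snd (gp_shift n x) (p, q) \<in> \<P> \<and> \<d> (snd (gp_shift n x) (p, q)) = q - p
      \<and> \<r> (snd (gp_shift n x) (p, q)) = snd (gp_shift n x) (p, p) \<and>
      \<s> (snd (gp_shift n x) (p, q)) = snd (gp_shift n x) (q, q)"
    if "p \<le> q" "emb q \<le> fst (gp_shift n x)"
    using S[OF that] S(1)[OF order_refl that(2)] S(1)[OF order_refl emb_mono[OF that]]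
      gpath_paths[OF x S(2,3)[OF that]] gpath_deg[OF x S(2,3)[OF that]] gpath_rng[OF x S(2,3)[OF that]]
      gpath_src[OF x S(2,3)[OF that]] by (auto simp: fun_eq_iff)
  fix l
  show "snd (gp_shift n x) (p, l) = snd (gp_shift n x) (p, q) \<cdot> snd (gp_shift n x) (q, l)"
    if "p \<le> q" "q \<le> l" "emb l \<le> fst (gp_shift n x)"
    using S[OF that(1) emb_mono[OF that(2,3)]] S[OF that(2,3)] S[OF order_trans[OF that(1,2)] that(3)]
      gpath_cmp[OF x, of "n + p" "n + q" "n + l"] by simp
qed

lemma gp_shift_0:
  assumes x: "x \<in> \<G>"
  shows "gp_shift 0 x = x"
proof (rule gpath_eqI[OF gp_shift_gpaths[OF x emb_0] x])
  show f: "fst (gp_shift 0 x) = fst x" using emb_diff_add[of 0 "fst x"] by (simp add: emb_def fun_eq_iff)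
  fix n assume "emb n \<le> fst (gp_shift 0 x)"
  then show "snd (gp_shift 0 x) (0, n) = snd x (0, n)"
    using gp_shift_apply[of 0 x 0 n] unfolding f by simp
qed

lemma gp_shift_shift:
  assumes x: "x \<in> \<G>" and n: "emb (n + n') \<le> fst x"
  shows "gp_shift n' (gp_shift n x) = gp_shift (n + n') x"
proof -
  have n1: "emb n \<le> fst x" using n by (rule emb_mono[OF fun_le_add_same])
  have n2: "emb n' \<le> fst (gp_shift n x)" using n n1 by (simp add: emb_le_diff)
  show ?thesis
  proof (rule gpath_eqI[OF gp_shift_gpaths[OF gp_shift_gpaths[OF x n1] n2] gp_shift_gpaths[OF x n]])
    show f: "fst (gp_shift n' (gp_shift n x)) = fst (gp_shift (n + n') x)" by (simp add: emb_diff_diff)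
    fix q assume "emb q \<le> fst (gp_shift n' (gp_shift n x))"
    then have q: "emb (n + n' + q) \<le> fst x" using emb_le_diff[OF n] by (simp add: emb_diff_diff)
    have q': "emb (n' + q) \<le> fst (gp_shift n x)" using q n1 by (simp add: emb_le_diff add.assoc)
    have le: "0 \<le> q" "n' + 0 \<le> n' + q" by (auto simp: fun_le_add_same)
    show "snd (gp_shift n' (gp_shift n x)) (0, q) = snd (gp_shift (n + n') x) (0, q)"
      using gp_shift_apply[OF n2 le(1) q'] gp_shift_apply[OF n1 le(2)] gp_shift_apply[OF n le(1) q] q
      by (simp add: add.assoc)
  qed
qed

text \<open>With truncated subtraction every degree \<open>n\<close> lies below
  \<open>d + (n - d)\<close>, so initial segments of degree at least \<open>d\<close> determine the
  rest.\<close>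

lemma gpath_eq_tail:
  assumes x: "x \<in> \<G>" and y: "y \<in> \<G>" and fx: "fst x = m + emb d" and fy: "fst y = m + emb d"
    and eq: "\<And>p. emb p \<le> m \<Longrightarrow> snd x (0, d + p) = snd y (0, d + p)"
  shows "x = y"
proof (rule gpath_eqI[OF x y])
  show "fst x = fst y" using fx fy by simp
  fix n assume n: "emb n \<le> fst x"
  then have p: "emb (n - d) \<le> m" using fx emb_le_add_diff by metis
  have dx: "emb (d + (n - d)) \<le> fst x" "emb (d + (n - d)) \<le> fst y"
    using emb_le_add[OF p, of d] fx fy by auto
  have "(snd x (0, n)) \<preceq> (snd x (0, d + (n - d)))" "(snd y (0, n)) \<preceq> (snd x (0, d + (n - d)))"
    using gpath_initial_prefix[OF x dx(1) deg_le_add_diff] gpath_initial_prefix[OF y dx(2) deg_le_add_diff] eq[OF p] by auto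
  then show "snd x (0, n) = snd y (0, n)"
    using gpath_initial(2)[OF x n] gpath_initial(2)[OF y, of n] n fx fy by (intro prefix_of_eq) auto
qed

text \<open>Only degrees of the form \<open>\<d> \<mu> + p\<close> have an evident initial segment.
  For any other degree \<open>n\<close> the path belonging to the truncated difference
  \<open>n - \<d> \<mu>\<close> is cut down to degree \<open>n\<close>.\<close>

lemma gp_prepend_ex:
  assumes x: "x \<in> \<G>" and \<mu>: "\<mu> \<in> \<P>" and s: "\<s> \<mu> = gp_rng x"
  obtains y where "y \<in> \<G>" "fst y = fst x + emb (\<d> \<mu>)"
    "\<And>p. emb p \<le> fst x \<Longrightarrow> snd y (0, \<d> \<mu> + p) = \<mu> \<cdot> snd x (0, p)"
proof -
  let ?d = "\<d> \<mu>" and ?m = "fst x + emb (\<d> \<mu>)"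
  define \<omega> where "\<omega> p = \<mu> \<cdot> snd x (0, p)" for p
  have \<omega>: "\<omega> p \<in> \<P>" "\<d> (\<omega> p) = ?d + p" if "emb p \<le> fst x" for p
    using gpath_initial[OF x that] \<mu> s by (auto simp: \<omega>_def deg_cmp)
  have \<omega>_pre: "\<omega> p \<preceq> \<omega> q" if "emb q \<le> fst x" "p \<le> q" for p q
    unfolding \<omega>_def using gpath_initial[OF x that(1)] gpath_initial[OF x emb_mono[OF that(2,1)]] \<mu> s
      gpath_initial_prefix[OF x that] by (subst prefix_of_cmp) auto
  have "\<exists>\<alpha>. \<alpha> \<preceq> (\<omega> (n - ?d)) \<and> \<d> \<alpha> = n" if n: "emb n \<le> ?m" for n
  proof -
    have p: "emb (n - ?d) \<le> fst x" by (rule emb_le_add_diff[OF n])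
    have "n \<le> \<d> (\<omega> (n - ?d))" using \<omega>(2)[OF p] deg_le_add_diff by metis
    from prefix_of_ex[OF \<omega>(1)[OF p] this] show ?thesis by metis
  qed
  note ex = this
  define g where "g n = (SOME \<alpha>. \<alpha> \<preceq> (\<omega> (n - ?d)) \<and> \<d> \<alpha> = n)" for n
  have g: "g n \<preceq> (\<omega> (n - ?d)) \<and> \<d> (g n) = n" if "emb n \<le> ?m" for n
    unfolding g_def by (rule someI_ex[OF ex[OF that]])
  have g1: "g n \<in> \<P> \<and> \<d> (g n) = n" if "emb n \<le> ?m" for n
    using g[OF that] prefix_of_paths by auto
  have g2: "g n \<preceq> g n'" if n': "emb n' \<le> ?m" "n \<le> n'" for n n'
  proof -
    have "n - ?d \<le> n' - ?d" using n'(2) by (simp add: le_fun_def diff_le_mono)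
    then have "(\<omega> (n - ?d)) \<preceq> (\<omega> (n' - ?d))" by (intro \<omega>_pre emb_le_add_diff[OF n'(1)])
    then show ?thesis
      using g[OF n'(1)] g[OF emb_mono[OF n'(2,1)]] n'(2) prefix_of_trans prefix_of_comparable by metis
  qed
  from gpath_ex[of ?m g, OF g1 g2] obtain y where y: "y \<in> \<G>" "fst y = ?m" "\<And>n. emb n \<le> ?m \<Longrightarrow> snd y (0, n) = g n"
    by blast
  have "snd y (0, ?d + p) = \<omega> p" if p: "emb p \<le> fst x" for p
  proof -
    have dp: "emb (?d + p) \<le> ?m" by (rule emb_le_add[OF p])
    have "?d + p - ?d = p" by (simp add: fun_eq_iff)
    then have "(g (?d + p)) \<preceq> \<omega> p" using g[OF dp] by simp
    then have "g (?d + p) = \<omega> p" using g[OF dp] \<omega>(2)[OF p] by (intro prefix_of_same_deg) auto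
    then show ?thesis using y(3)[OF dp] by simp
  qed
  then show thesis using that y by (simp add: \<omega>_def)
qed

text \<open>The path constructed above meets the description in \<open>gp_prepend\<close>, and that
  description forces the initial segments beyond \<open>\<d> \<mu>\<close>, so it has a unique
  solution.\<close>

lemma gp_prepend_props:
  assumes x: "x \<in> \<G>" and \<mu>: "\<mu> \<in> \<P>" and s: "\<s> \<mu> = gp_rng x"
  shows gp_prepend_gpaths: "prepend \<mu> x \<in> \<G>"
    and fst_gp_prepend: "fst (prepend \<mu> x) = fst x + emb (\<d> \<mu>)"
    and gp_prepend_initial: "emb p \<le> fst x \<Longrightarrow> snd (prepend \<mu> x) (0, \<d> \<mu> + p) = \<mu> \<cdot> snd x (0, p)"
    and gp_shift_prepend: "gp_shift (\<d> \<mu>) (prepend \<mu> x) = x"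
proof -
  let ?d = "\<d> \<mu>"
  obtain y where y: "y \<in> \<G>" "fst y = fst x + emb ?d"
    "\<And>p. emb p \<le> fst x \<Longrightarrow> snd y (0, ?d + p) = \<mu> \<cdot> snd x (0, p)"
    using gp_prepend_ex[OF assms] by blast
  have d: "emb ?d \<le> fst y" using emb_le_add[of 0 "fst x" ?d] y(2) by simp
  have ini: "snd y (0, ?d) = \<mu>"
  proof -
    have "snd y (0, ?d + 0) = \<mu> \<cdot> snd x (0, 0)" by (rule y(3)) simp
    then show ?thesis using s \<mu> cmp_src_id[OF \<mu>] by (simp add: gp_rng_def)
  qed
  have shift: "gp_shift ?d y = x"
  proof (rule gpath_eqI[OF gp_shift_gpaths[OF y(1) d] x])
    show f: "fst (gp_shift ?d y) = fst x" using y(2) by simp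
    fix p assume "emb p \<le> fst (gp_shift ?d y)"
    then have p: "emb p \<le> fst x" using f by simp
    have dp: "emb (?d + p) \<le> fst y" using emb_le_add[OF p] y(2) by simp
    have "snd y (0, ?d) \<cdot> snd y (?d, ?d + p) = \<mu> \<cdot> snd x (0, p)"
      using gpath_split[OF y(1) dp fun_le_add_same] y(3)[OF p] by simp
    then have eq: "\<mu> \<cdot> snd y (?d, ?d + p) = \<mu> \<cdot> snd x (0, p)" by (simp only: ini)
    have r1: "\<s> \<mu> = \<r> (snd y (?d, ?d + p))"
      using gpath_rng[OF y(1) fun_le_add_same dp] gpath_initial(4)[OF y(1) d] by (simp only: ini)
    have r2: "\<s> \<mu> = \<r> (snd x (0, p))" using gpath_initial(3)[OF x p] s by simp
    have "snd y (?d, ?d + p) = snd x (0, p)"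
      by (rule cancel_left[OF \<mu> gpath_paths[OF y(1) fun_le_add_same dp] gpath_initial(1)[OF x p] r1 r2 eq])
    then show "snd (gp_shift ?d y) (0, p) = snd x (0, p)"
      using gp_shift_apply[OF d _ dp, of 0] by simp
  qed
  have "prepend \<mu> x = y"
    unfolding gp_prepend_def
  proof (rule the_equality)
    show "y \<in> \<G> \<and> fst y = fst x + emb ?d \<and> snd y (0, ?d) = \<mu> \<and> gp_shift ?d y = x"
      by (intro conjI y(1,2) ini shift)
    fix z assume "z \<in> \<G> \<and> fst z = fst x + emb ?d \<and> snd z (0, ?d) = \<mu> \<and> gp_shift ?d z = x"
    then have z: "z \<in> \<G>" "fst z = fst x + emb ?d" "snd z (0, ?d) = \<mu>" "gp_shift ?d z = x" by blast+
    show "z = y"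
    proof (rule gpath_eq_tail[of z y "fst x" ?d])
      fix p assume p: "emb p \<le> fst x"
      have dz: "emb ?d \<le> fst z" "emb (?d + p) \<le> fst z" using d emb_le_add[OF p] z(2) y(2) by simp_all
      have z1: "snd z (0, ?d + p) = \<mu> \<cdot> snd z (?d, ?d + p)"
        using gpath_split[OF z(1) dz(2) fun_le_add_same] z(3) by simp
      have z2: "snd z (?d, ?d + p) = snd x (0, p)"
        using gp_shift_apply[OF dz(1) _ dz(2), of 0] z(4) by simp
      show "snd z (0, ?d + p) = snd y (0, ?d + p)" by (simp only: z1 z2 y(3)[OF p])
    qed (use z(1,2) y(1,2) in simp_all)
  qed
  then show "prepend \<mu> x \<in> \<G>" "fst (prepend \<mu> x) = fst x + emb ?d"
    "emb p \<le> fst x \<Longrightarrow> snd (prepend \<mu> x) (0, ?d + p) = \<mu> \<cdot> snd x (0, p)"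
    "gp_shift ?d (prepend \<mu> x) = x"
    using y shift by simp_all
qed

lemma gp_rng_prepend:
  assumes x: "x \<in> \<G>" and \<mu>: "\<mu> \<in> \<P>" and s: "\<s> \<mu> = gp_rng x"
  shows "gp_rng (prepend \<mu> x) = \<r> \<mu>"
proof -
  let ?y = "prepend \<mu> x"
  have "emb (\<d> \<mu>) \<le> fst ?y" using fst_gp_prepend[OF assms] emb_le_add[of 0 "fst x"] by simp
  then have "\<r> (snd ?y (0, \<d> \<mu>)) = gp_rng ?y" by (rule gpath_initial(3)[OF gp_prepend_gpaths[OF assms]])
  moreover have "snd ?y (0, \<d> \<mu> + 0) = \<mu> \<cdot> snd x (0, 0)" by (rule gp_prepend_initial[OF assms]) simp
  then have "snd ?y (0, \<d> \<mu>) = \<mu>" using s \<mu> cmp_src_id[OF \<mu>] by (simp add: gp_rng_def)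
  ultimately show ?thesis by simp
qed

lemma gp_rng_shift: "\<lbrakk>x \<in> \<G>; emb n \<le> fst x\<rbrakk> \<Longrightarrow> gp_rng (gp_shift n x) = snd x (n, n)"
  using gp_shift_apply[of n x 0 0] by (simp add: gp_rng_def)

lemma gp_prepend_shift:
  assumes x: "x \<in> \<G>" and n: "emb n \<le> fst x"
  shows "prepend (snd x (0, n)) (gp_shift n x) = x"
proof -
  note i = gpath_initial[OF x n]
  have s: "\<s> (snd x (0, n)) = gp_rng (gp_shift n x)" using i gp_rng_shift[OF x n] by simp
  note P = gp_prepend_props[OF gp_shift_gpaths[OF x n] i(1) s]
  show ?thesis
  proof (rule gpath_eq_tail[OF P(1) x, of "fst x - emb n" n])
    show "fst (prepend (snd x (0, n)) (gp_shift n x)) = fst x - emb n + emb n" using P(2) i by simp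
    show "fst x = fst x - emb n + emb n" using emb_diff_add[OF n] by simp
    fix p assume p: "emb p \<le> fst x - emb n"
    then have np: "emb (n + p) \<le> fst x" using emb_le_diff[OF n] by simp
    have "snd (gp_shift n x) (0, p) = snd x (n, n + p)" using gp_shift_apply[OF n _ np, of 0] by simp
    then show "snd (prepend (snd x (0, n)) (gp_shift n x)) (0, n + p) = snd x (0, n + p)"
      using P(3)[of p] p i gpath_split[OF x np fun_le_add_same] by simp
  qed
qed

section \<open>Boundary paths under shifting and prepending\<close>

lemma boundary_gpath: "x \<in> \<B> \<Longrightarrow> x \<in> \<G>"
  by (simp add: boundary_def)

lemma boundaryD:
  assumes "x \<in> \<B>" "emb n \<le> fst x" "E \<in> \<E> (snd x (n, n))"
  obtains p where "emb (n + p) \<le> fst x" "snd x (n, n + p) \<in> E"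
  using assms emb_le_diff[OF assms(2)] unfolding boundary_def by blast

lemma boundaryI:
  assumes "x \<in> \<G>"
    and "\<And>n E. \<lbrakk>emb n \<le> fst x; E \<in> \<E> (snd x (n, n))\<rbrakk> \<Longrightarrow> \<exists>p. emb (n + p) \<le> fst x \<and> snd x (n, n + p) \<in> E"
  shows "x \<in> \<B>"
  using assms emb_le_diff unfolding boundary_def by blast

lemma boundary_shift:
  assumes x: "x \<in> \<B>" and n: "emb n \<le> fst x"
  shows "gp_shift n x \<in> \<B>"
proof (rule boundaryI[OF gp_shift_gpaths[OF boundary_gpath[OF x] n]])
  fix n' E assume n': "emb n' \<le> fst (gp_shift n x)" and E: "E \<in> \<E> (snd (gp_shift n x) (n', n'))"
  have nn: "emb (n + n') \<le> fst x" using n' emb_le_diff[OF n] by simp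
  have "E \<in> \<E> (snd x (n + n', n + n'))" using E gp_shift_apply[OF n order_refl nn] by simp
  then obtain p where p: "emb (n + n' + p) \<le> fst x" "snd x (n + n', n + n' + p) \<in> E"
    using boundaryD[OF x nn] by blast
  have p1: "emb (n + (n' + p)) \<le> fst x" using p(1) by (simp add: add.assoc)
  have "emb (n' + p) \<le> fst (gp_shift n x)" using p1 emb_le_diff[OF n] by simp
  moreover have "snd (gp_shift n x) (n', n' + p) \<in> E"
    using gp_shift_apply[OF n fun_le_add_same p1] p(2) by (simp add: add.assoc)
  ultimately show "\<exists>p. emb (n' + p) \<le> fst (gp_shift n x) \<and> snd (gp_shift n x) (n', n' + p) \<in> E" by blast
qed

text \<open>What must be appended to \<open>\<nu>\<close> to reach a minimal common extension with a
  member of \<open>E\<close>. It transports exhaustive sets from the range of \<open>\<nu>\<close>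
  to its source.\<close>

definition Ext :: "'l \<Rightarrow> 'l set \<Rightarrow> 'l set" where
  "Ext \<nu> E = {\<alpha> \<in> \<P>. \<s> \<nu> = \<r> \<alpha> \<and> (\<exists>\<mu> \<in> E. \<nu> \<cdot> \<alpha> \<in> \<M> \<nu> \<mu>)}"

lemma Ext_finite:
  assumes "finitely_aligned \<Lambda>" "\<nu> \<in> \<P>" "finite E" "E \<subseteq> \<P>"
  shows "finite (Ext \<nu> E)"
proof (rule finite_imageD[where f = "\<lambda>\<alpha>. \<nu> \<cdot> \<alpha>"])
  have "finite (\<Union>\<mu>\<in>E. \<M> \<nu> \<mu>)" using assms by (auto simp: finitely_aligned_def)
  then show "finite ((\<lambda>\<alpha>. \<nu> \<cdot> \<alpha>) ` Ext \<nu> E)" by (rule rev_finite_subset) (auto simp: Ext_def)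
  show "inj_on (\<lambda>\<alpha>. \<nu> \<cdot> \<alpha>) (Ext \<nu> E)"
    by (rule inj_onI) (auto simp: Ext_def intro: cancel_left[OF assms(2)])
qed

text \<open>Inside \<open>\<omega>\<close> sits a minimal common extension of \<open>\<nu>\<close>
  and \<open>\<mu>\<close>. After cancelling \<open>\<nu>\<close> its remainder and
  \<open>\<tau>\<close> are initial segments of one path.\<close>

lemma Ext_meets:
  assumes \<nu>: "\<nu> \<in> \<P>" and \<mu>: "\<mu> \<in> E" and \<tau>: "\<tau> \<in> \<P>" "\<s> \<nu> = \<r> \<tau>"
    and \<omega>: "\<nu> \<cdot> \<tau> \<preceq> \<omega>" "\<mu> \<preceq> \<omega>"
  shows "\<exists>\<alpha> \<in> Ext \<nu> E. \<M> \<tau> \<alpha> \<noteq> {}"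
proof -
  have \<nu>\<omega>: "\<nu> \<preceq> \<omega>" by (rule prefix_of_trans[OF prefix_ofI[OF \<nu> \<tau>] \<omega>(1)])
  obtain \<eta> where \<eta>: "\<eta> \<in> \<M> \<nu> \<mu>" "\<eta> \<preceq> \<omega>" by (rule MCE_common_extension[OF \<nu>\<omega> \<omega>(2)])
  have "\<nu> \<preceq> \<eta>" using \<eta>(1) MCE_iff[OF \<nu> prefix_of_paths(1)[OF \<omega>(2)]] by simp
  then obtain \<alpha> where a: "\<alpha> \<in> \<P>" "\<s> \<nu> = \<r> \<alpha>" "\<eta> = \<nu> \<cdot> \<alpha>" by (auto elim: prefix_ofE)
  obtain \<gamma> where g: "\<gamma> \<in> \<P>" "\<s> \<nu> = \<r> \<gamma>" "\<omega> = \<nu> \<cdot> \<gamma>" using \<nu>\<omega> by (auto elim: prefix_ofE)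
  have "\<tau> \<preceq> \<gamma>" "\<alpha> \<preceq> \<gamma>"
    using \<omega>(1) \<eta>(2) prefix_of_cmp[OF \<nu> \<tau>(1) g(1) \<tau>(2) g(2)] prefix_of_cmp[OF \<nu> a(1) g(1) a(2) g(2)]
    by (simp_all add: g(3) a(3))
  then have "\<M> \<tau> \<alpha> \<noteq> {}" using MCE_empty_iff[OF \<tau>(1) a(1)] by blast
  moreover have "\<alpha> \<in> Ext \<nu> E" using a \<eta>(1) \<mu> by (auto simp: Ext_def)
  ultimately show ?thesis by blast
qed

lemma Ext_FE:
  assumes fa: "finitely_aligned \<Lambda>" and \<nu>: "\<nu> \<in> \<P>" and E: "E \<in> \<E> (\<r> \<nu>)"
  shows "Ext \<nu> E \<in> \<E> (\<s> \<nu>)"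
proof -
  have E': "finite E" "E \<subseteq> \<P>" using E by (auto simp: FE_def exhaustive_def)
  have "\<exists>\<alpha> \<in> Ext \<nu> E. \<M> \<tau> \<alpha> \<noteq> {}" if \<tau>: "\<tau> \<in> \<P>" "\<r> \<tau> = \<s> \<nu>" for \<tau>
  proof -
    have nt: "\<nu> \<cdot> \<tau> \<in> \<P>" "\<r> (\<nu> \<cdot> \<tau>) = \<r> \<nu>" using \<nu> \<tau> by simp_all
    then obtain \<mu> where \<mu>: "\<mu> \<in> E" "\<M> (\<nu> \<cdot> \<tau>) \<mu> \<noteq> {}" using E unfolding FE_def exhaustive_def by blast
    then obtain \<omega> where "\<nu> \<cdot> \<tau> \<preceq> \<omega>" "\<mu> \<preceq> \<omega>"
      using MCE_empty_iff[OF nt(1), of \<mu>] E' by blast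
    then show ?thesis using Ext_meets[OF \<nu> \<mu>(1) \<tau>(1)] \<tau>(2) by simp
  qed
  then show ?thesis using Ext_finite[OF fa \<nu> E'] by (auto simp: FE_def exhaustive_def Ext_def)
qed

text \<open>A test set at a degree \<open>n\<close> not above \<open>d\<close> is replaced by its
  \<open>Ext\<close> along the segment from \<open>n\<close> to the join of \<open>n\<close> and
  \<open>d\<close>. There the shifted path meets it, and the member of \<open>E\<close> can be read
  off as an initial segment. This is what makes prepending preserve boundary paths.\<close>

lemma gpath_cofinal_boundary:
  assumes fa: "finitely_aligned \<Lambda>" and y: "y \<in> \<G>" and d: "emb d \<le> fst y" and b: "gp_shift d y \<in> \<B>"
  shows "y \<in> \<B>"
proof (rule boundaryI[OF y])
  fix n E assume n: "emb n \<le> fst y" and E: "E \<in> \<E> (snd y (n, n))"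
  define N where "N = sup n d"
  have N: "emb N \<le> fst y" "n \<le> N" "d \<le> N" using n d by (simp_all add: N_def emb_sup)
  obtain k where k: "N = d + k" using fun_le_add_diff[OF N(3)] by metis
  let ?\<nu> = "snd y (n, N)"
  have \<nu>: "?\<nu> \<in> \<P>" "\<r> ?\<nu> = snd y (n, n)" "\<s> ?\<nu> = snd y (N, N)"
    using gpath_paths[OF y N(2,1)] gpath_rng[OF y N(2,1)] gpath_src[OF y N(2,1)] .
  have F: "Ext ?\<nu> E \<in> \<E> (snd y (N, N))" using Ext_FE[OF fa \<nu>(1)] E \<nu> by simp
  have dk: "emb (d + k) \<le> fst y" using N(1) k by simp
  have "emb k \<le> fst (gp_shift d y)" using dk emb_le_diff[OF d] by simp
  moreover have "snd (gp_shift d y) (k, k) = snd y (N, N)" using gp_shift_apply[OF d order_refl dk] k by simp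
  ultimately obtain p where p: "emb (k + p) \<le> fst (gp_shift d y)" "snd (gp_shift d y) (k, k + p) \<in> Ext ?\<nu> E"
    using boundaryD[OF b, of k "Ext ?\<nu> E"] F by auto
  have dkp: "emb (d + (k + p)) \<le> fst y" using p(1) emb_le_diff[OF d] by simp
  have "snd (gp_shift d y) (k, k + p) = snd y (N, N + p)"
    using gp_shift_apply[OF d fun_le_add_same dkp] k by (simp add: add.assoc)
  then have \<alpha>: "snd y (N, N + p) \<in> Ext ?\<nu> E" using p(2) by simp
  have Np: "emb (N + p) \<le> fst y" using dkp k by (simp add: add.assoc)
  have nNp: "n \<le> N + p" using N(2) fun_le_add_same order_trans by blast
  have split: "snd y (n, N + p) = ?\<nu> \<cdot> snd y (N, N + p)" by (rule gpath_cmp[OF y N(2) fun_le_add_same Np])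
  obtain \<mu> where \<mu>: "\<mu> \<in> E" "snd y (n, N + p) \<in> \<M> ?\<nu> \<mu>" using \<alpha> split by (auto simp: Ext_def)
  have \<mu>p: "\<mu> \<in> \<P>" using \<mu>(1) E by (auto simp: FE_def exhaustive_def)
  have pre: "\<mu> \<preceq> (snd y (n, N + p))" using \<mu>(2) MCE_iff[OF \<nu>(1) \<mu>p] by simp
  have "\<d> \<mu> \<le> N + p - n" using prefix_of_deg[OF pre] gpath_deg[OF y nNp Np] by simp
  then have nm: "n + \<d> \<mu> \<le> N + p"
    using fun_le_add_diff[OF nNp] fun_add_mono by metis
  have nm': "emb (n + \<d> \<mu>) \<le> fst y" by (rule emb_mono[OF nm Np])
  have "snd y (n, N + p) = snd y (n, n + \<d> \<mu>) \<cdot> snd y (n + \<d> \<mu>, N + p)"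
    by (rule gpath_cmp[OF y fun_le_add_same nm Np])
  then have "(snd y (n, n + \<d> \<mu>)) \<preceq> (snd y (n, N + p))"
    using prefix_ofI[OF gpath_paths[OF y fun_le_add_same nm'] gpath_paths[OF y nm Np]]
      gpath_src[OF y fun_le_add_same nm'] gpath_rng[OF y nm Np] by simp
  moreover have "\<d> (snd y (n, n + \<d> \<mu>)) = \<d> \<mu>"
    using gpath_deg[OF y fun_le_add_same nm'] by (simp add: fun_eq_iff)
  ultimately have "\<mu> = snd y (n, n + \<d> \<mu>)" using prefix_of_eq[OF pre] by simp
  then show "\<exists>p. emb (n + p) \<le> fst y \<and> snd y (n, n + p) \<in> E" using \<mu>(1) nm' by auto
qed

lemma boundary_prepend:
  assumes fa: "finitely_aligned \<Lambda>" and x: "x \<in> \<B>" and \<mu>: "\<mu> \<in> \<P>" and s: "\<s> \<mu> = gp_rng x"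
  shows "prepend \<mu> x \<in> \<B>"
proof (rule gpath_cofinal_boundary[OF fa])
  note P = gp_prepend_props[OF boundary_gpath[OF x] \<mu> s]
  show "prepend \<mu> x \<in> \<G>" by (rule P(1))
  show "emb (\<d> \<mu>) \<le> fst (prepend \<mu> x)" using emb_le_add[of 0 "fst x" "\<d> \<mu>"] P(2) by simp
  show "gp_shift (\<d> \<mu>) (prepend \<mu> x) \<in> \<B>" using P(4) x by simp
qed

lemma gp_prepend_vertex:
  assumes x: "x \<in> \<G>"
  shows "prepend (gp_rng x) x = x"
  using gp_prepend_shift[OF x emb_0] gp_shift_0[OF x] by (simp add: gp_rng_def)

lemma gp_rng_vertex: "x \<in> \<G> \<Longrightarrow> gp_rng x \<in> \<V>"
  using gpath_initial(1,2)[of x 0] deg_0_iff by (simp add: gp_rng_def)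

lemma gp_prepend_cmp:
  assumes x: "x \<in> \<G>" and \<mu>: "\<mu> \<in> \<P>" and \<nu>: "\<nu> \<in> \<P>"
    and s: "\<s> \<mu> = \<r> \<nu>" and s': "\<s> \<nu> = gp_rng x"
  shows "prepend (\<mu> \<cdot> \<nu>) x = prepend \<mu> (prepend \<nu> x)"
proof -
  have mn: "\<mu> \<cdot> \<nu> \<in> \<P>" "\<s> (\<mu> \<cdot> \<nu>) = gp_rng x" "\<d> (\<mu> \<cdot> \<nu>) = \<d> \<mu> + \<d> \<nu>"
    using \<mu> \<nu> s s' deg_cmp by simp_all
  note P = gp_prepend_props[OF x mn(1,2)]
  note Q = gp_prepend_props[OF x \<nu> s']
  have sQ: "\<s> \<mu> = gp_rng (prepend \<nu> x)" using gp_rng_prepend[OF x \<nu> s'] s by simp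
  note R = gp_prepend_props[OF Q(1) \<mu> sQ]
  show ?thesis
  proof (rule gpath_eq_tail[OF P(1) R(1), of "fst x" "\<d> \<mu> + \<d> \<nu>"])
    show "fst (prepend (\<mu> \<cdot> \<nu>) x) = fst x + emb (\<d> \<mu> + \<d> \<nu>)" using P(2) mn by simp
    show "fst (prepend \<mu> (prepend \<nu> x)) = fst x + emb (\<d> \<mu> + \<d> \<nu>)"
      using R(2) Q(2) by (simp add: emb_add add_ac)
    fix p assume p: "emb p \<le> fst x"
    have p': "emb (\<d> \<nu> + p) \<le> fst (prepend \<nu> x)" using emb_le_add[OF p] Q(2) by simp
    have sp: "\<s> \<nu> = \<r> (snd x (0, p))" using gpath_initial(3)[OF x p] s' by simp
    have "snd (prepend \<mu> (prepend \<nu> x)) (0, \<d> \<mu> + (\<d> \<nu> + p)) = \<mu> \<cdot> (\<nu> \<cdot> snd x (0, p))"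
      using R(3)[OF p'] Q(3)[OF p] by simp
    moreover have "snd (prepend (\<mu> \<cdot> \<nu>) x) (0, \<d> \<mu> + \<d> \<nu> + p) = (\<mu> \<cdot> \<nu>) \<cdot> snd x (0, p)"
      using P(3)[OF p] mn(3) by simp
    moreover have "(\<mu> \<cdot> \<nu>) \<cdot> snd x (0, p) = \<mu> \<cdot> (\<nu> \<cdot> snd x (0, p))"
      by (rule cmp_assoc[OF \<mu> \<nu> gpath_initial(1)[OF x p] s sp])
    ultimately show "snd (prepend (\<mu> \<cdot> \<nu>) x) (0, \<d> \<mu> + \<d> \<nu> + p) =
        snd (prepend \<mu> (prepend \<nu> x)) (0, \<d> \<mu> + \<d> \<nu> + p)"
      by (simp add: add.assoc)
  qed
qed

lemma gp_prepend_prefix: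
  assumes x: "x \<in> \<G>" and \<mu>: "\<mu> \<in> \<P>" and s: "\<s> \<mu> = gp_rng x"
  shows "emb (\<d> \<mu>) \<le> fst (prepend \<mu> x)" "snd (prepend \<mu> x) (0, \<d> \<mu>) = \<mu>"
proof -
  note P = gp_prepend_props[OF assms]
  show "emb (\<d> \<mu>) \<le> fst (prepend \<mu> x)" using emb_le_add[of 0 "fst x" "\<d> \<mu>"] P(2) by simp
  have "snd (prepend \<mu> x) (0, \<d> \<mu> + 0) = \<mu> \<cdot> snd x (0, 0)" by (rule P(3)) simp
  then show "snd (prepend \<mu> x) (0, \<d> \<mu>) = \<mu>" using s \<mu> cmp_src_id[OF \<mu>] by (simp add: gp_rng_def)
qed

text \<open>Cut the common path at the join of \<open>\<d> \<mu>\<close> and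
  \<open>\<d> \<nu>\<close>: the two remainders are \<open>\<alpha>\<close> and
  \<open>\<beta>\<close>, and what follows the cut is the common tail.\<close>

lemma gp_prepend_meet:
  assumes x: "x \<in> \<G>" and y: "y \<in> \<G>" and \<mu>: "\<mu> \<in> \<P>" and \<nu>: "\<nu> \<in> \<P>"
    and s: "\<s> \<mu> = gp_rng x" and s': "\<s> \<nu> = gp_rng y" and eq: "prepend \<mu> x = prepend \<nu> y"
  obtains \<alpha> \<beta> n n' where "\<alpha> \<in> \<P>" "\<beta> \<in> \<P>" "\<s> \<mu> = \<r> \<alpha>" "\<s> \<nu> = \<r> \<beta>"
    "\<mu> \<cdot> \<alpha> = \<nu> \<cdot> \<beta>" "\<mu> \<cdot> \<alpha> \<in> \<M> \<mu> \<nu>" "emb n \<le> fst x" "emb n' \<le> fst y" "\<alpha> = snd x (0, n)" "\<beta> = snd y (0, n')"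
    "gp_shift n x = gp_shift n' y"
proof -
  define w where "w = prepend \<mu> x"
  define N where "N = sup (\<d> \<mu>) (\<d> \<nu>)"
  note P = gp_prepend_props[OF x \<mu> s, folded w_def]
  note Q = gp_prepend_props[OF y \<nu> s', folded eq, folded w_def]
  note p = gp_prepend_prefix[OF x \<mu> s, folded w_def]
  note q = gp_prepend_prefix[OF y \<nu> s', folded eq, folded w_def]
  have N: "emb N \<le> fst w" "\<d> \<mu> \<le> N" "\<d> \<nu> \<le> N" using p(1) q(1) by (simp_all add: N_def emb_sup)
  let ?n = "N - \<d> \<mu>" and ?n' = "N - \<d> \<nu>"
  have nN: "\<d> \<mu> + ?n = N" "\<d> \<nu> + ?n' = N" using fun_le_add_diff N(2,3) by blast+
  have n: "emb ?n \<le> fst x" using N(1) emb_le_add_diff unfolding P(2) by blast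
  have n': "emb ?n' \<le> fst y" using N(1) emb_le_add_diff unfolding Q(2) by blast
  have e1: "snd w (0, N) = \<mu> \<cdot> snd x (0, ?n)" using P(3)[OF n] nN by simp
  have e2: "snd w (0, N) = \<nu> \<cdot> snd y (0, ?n')" using Q(3)[OF n'] nN by simp
  show thesis
  proof (rule that[of "snd x (0, ?n)" "snd y (0, ?n')" ?n ?n'])
    show "snd x (0, ?n) \<in> \<P>" "snd y (0, ?n') \<in> \<P>" using gpath_initial(1) x y n n' by blast+
    show "\<s> \<mu> = \<r> (snd x (0, ?n))" "\<s> \<nu> = \<r> (snd y (0, ?n'))"
      using gpath_initial(3)[OF x n] gpath_initial(3)[OF y n'] s s' by simp_all
    show "\<mu> \<cdot> snd x (0, ?n) = \<nu> \<cdot> snd y (0, ?n')" using e1 e2 by simp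
    have "\<mu> \<preceq> (snd w (0, N))" "\<nu> \<preceq> (snd w (0, N))"
      using gpath_initial_prefix[OF P(1) N(1,2)] gpath_initial_prefix[OF P(1) N(1,3)] p(2) q(2) by simp_all
    then have "snd w (0, N) \<in> \<M> \<mu> \<nu>"
      using MCE_iff[OF \<mu> \<nu>] gpath_initial(2)[OF P(1) N(1)] by (simp add: N_def)
    then show "\<mu> \<cdot> snd x (0, ?n) \<in> \<M> \<mu> \<nu>" using e1 by simp
    show "emb ?n \<le> fst x" "emb ?n' \<le> fst y" by (rule n, rule n')
    have "gp_shift ?n x = gp_shift N w" using gp_shift_shift[OF P(1), of "\<d> \<mu>" ?n] P(4) N(1) nN by simp
    moreover have "gp_shift ?n' y = gp_shift N w" using gp_shift_shift[OF P(1), of "\<d> \<nu>" ?n'] Q(4) N(1) nN by simp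
    ultimately show "gp_shift ?n x = gp_shift ?n' y" by simp
  qed simp_all
qed

text \<open>Rasiowa--Sikorski: a chain of paths meeting the countably many dense sets given by a degree \<open>n\<close> and a
  finite set \<open>E\<close> converges to a boundary path.\<close>

lemma boundary_dense:
  assumes \<mu>: "\<mu> \<in> \<P>"
  shows "\<exists>\<nu>. \<mu> \<preceq> \<nu> \<and> (\<forall>\<alpha>. \<alpha> \<preceq> \<nu> \<and> \<d> \<alpha> = n \<and> E \<in> \<E> (\<s> \<alpha>) \<longrightarrow>
      (\<exists>\<beta> \<in> E. \<alpha> \<cdot> \<beta> \<preceq> \<nu>)) \<and>
    ((\<exists>\<omega>. \<nu> \<preceq> \<omega> \<and> n \<le> \<d> \<omega>) \<longrightarrow> n \<le> \<d> \<nu>)"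
proof (cases "\<exists>\<omega>. \<mu> \<preceq> \<omega> \<and> n \<le> \<d> \<omega>")
  case False
  \<comment> \<open>If no extension reaches degree \<open>n\<close>, then \<open>\<mu>\<close>
    itself has no initial segment of that degree, and both clauses hold vacuously for it.\<close>
  have "\<not> (\<alpha> \<preceq> \<mu> \<and> \<d> \<alpha> = n)" for \<alpha>
    using False prefix_of_deg[of \<alpha> \<mu>] prefix_of_refl[OF \<mu>] by blast
  then show ?thesis using False prefix_of_refl[OF \<mu>] by blast
next
  case True
  then obtain \<omega> where \<omega>: "\<mu> \<preceq> \<omega>" "n \<le> \<d> \<omega>" by blast
  note \<omega>p = prefix_of_paths(2)[OF \<omega>(1)]
  obtain \<alpha> where \<alpha>: "\<alpha> \<preceq> \<omega>" "\<d> \<alpha> = n" using prefix_of_ex[OF \<omega>p \<omega>(2)] by blast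
  have uniq: "\<alpha>' = \<alpha>" if "\<omega> \<preceq> \<nu>" "\<alpha>' \<preceq> \<nu>" "\<d> \<alpha>' = n" for \<alpha>' \<nu>
    using prefix_of_eq[OF that(2) prefix_of_trans[OF \<alpha>(1) that(1)]] that(3) \<alpha>(2) by simp
  show ?thesis
  proof (cases "E \<in> \<E> (\<s> \<alpha>)")
    case False
    then have "\<forall>\<alpha>'. \<alpha>' \<preceq> \<omega> \<and> \<d> \<alpha>' = n \<and> E \<in> \<E> (\<s> \<alpha>') \<longrightarrow> (\<exists>\<beta> \<in> E. \<alpha>' \<cdot> \<beta> \<preceq> \<omega>)"
      using uniq[OF prefix_of_refl[OF \<omega>p]] by blast
    then show ?thesis using \<omega> by blast
  next
    case True
    obtain \<gamma> where \<gamma>: "\<alpha> \<in> \<P>" "\<gamma> \<in> \<P>" "\<s> \<alpha> = \<r> \<gamma>" "\<omega> = \<alpha> \<cdot> \<gamma>" using \<alpha>(1) by (rule prefix_ofE)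
    have "\<exists>\<beta>\<in>E. \<M> \<gamma> \<beta> \<noteq> {}" using True \<gamma>(2,3) unfolding FE_def exhaustive_def by simp
    then obtain \<beta> where \<beta>: "\<beta> \<in> E" "\<M> \<gamma> \<beta> \<noteq> {}" by blast
    have \<beta>p: "\<beta> \<in> \<P>" "\<r> \<beta> = \<s> \<alpha>" using True \<beta>(1) by (auto simp: FE_def exhaustive_def)
    obtain \<delta> where \<delta>: "\<gamma> \<preceq> \<delta>" "\<beta> \<preceq> \<delta>" using \<beta>(2) MCE_empty_iff[OF \<gamma>(2) \<beta>p(1)] by blast
    have \<delta>p: "\<delta> \<in> \<P>" "\<s> \<alpha> = \<r> \<delta>" using prefix_of_paths(2)[OF \<delta>(1)] prefix_of_rng[OF \<delta>(1)] \<gamma>(3) by simp_all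
    have pre: "\<omega> \<preceq> \<alpha> \<cdot> \<delta>" "\<alpha> \<cdot> \<beta> \<preceq> \<alpha> \<cdot> \<delta>"
      using prefix_of_cmp[OF \<gamma>(1) \<gamma>(2) \<delta>p(1) \<gamma>(3) \<delta>p(2)] prefix_of_cmp[OF \<gamma>(1) \<beta>p(1) \<delta>p(1) \<beta>p(2)[symmetric] \<delta>p(2)]
        \<delta> \<gamma>(4) by simp_all
    have "\<forall>\<alpha>'. \<alpha>' \<preceq> \<alpha> \<cdot> \<delta> \<and> \<d> \<alpha>' = n \<and> E \<in> \<E> (\<s> \<alpha>') \<longrightarrow> (\<exists>\<beta> \<in> E. \<alpha>' \<cdot> \<beta> \<preceq> \<alpha> \<cdot> \<delta>)"
      using uniq[OF pre(1)] pre(2) \<beta>(1) by blast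
    moreover have "n \<le> \<d> (\<alpha> \<cdot> \<delta>)" using \<omega>(2) prefix_of_deg[OF pre(1)] by (rule order_trans)
    ultimately show ?thesis using prefix_of_trans[OF \<omega>(1) pre(1)] by blast
  qed
qed

text \<open>If all values stayed below \<open>a\<close>, then \<open>a - 1\<close> would be an upper
  bound.\<close>

lemma enat_SUP_attained:
  assumes "enat a \<le> (SUP i. enat (f i))"
  shows "\<exists>i. a \<le> f (i :: nat)"
proof (rule ccontr)
  assume "\<not> ?thesis"
  then have lt: "f i < a" for i by (simp add: not_le)
  have "a > 0" using lt[of 0] by simp
  have "f i \<le> a - 1" for i using lt[of i] by simp
  then have "(SUP i. enat (f i)) \<le> enat (a - 1)" by (intro SUP_least) simp
  then have "enat a \<le> enat (a - 1)" using assms order_trans by blast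
  then show False using \<open>a > 0\<close> by simp
qed

text \<open>The degree of the limit is the coordinatewise supremum, possibly infinite, and every
  finite degree below it is reached at some stage of the chain.\<close>

lemma chain_limit:
  assumes c: "\<And>i. c i \<preceq> (c (Suc i))"
  obtains x where "x \<in> \<G>" "\<And>i. emb (\<d> (c i)) \<le> fst x" "\<And>i. snd x (0, \<d> (c i)) = c i"
    "\<And>n. emb n \<le> fst x \<Longrightarrow> \<exists>i. n \<le> \<d> (c i)"
proof -
  have pre: "c i \<preceq> c j" if "i \<le> j" for i j
    using that
  proof (induction rule: dec_induct)
    case base
    show ?case by (rule prefix_of_refl[OF prefix_of_paths(1)[OF c]])
  next
    case (step j)
    show ?case by (rule prefix_of_trans[OF step.IH c])
  qed
  define m where "m = (\<lambda>j. SUP i. enat (\<d> (c i) j))"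
  have ex: "\<exists>i. n \<le> \<d> (c i)" if n: "emb n \<le> m" for n
  proof -
    have "\<exists>i. n j \<le> \<d> (c i) j" for j
      by (rule enat_SUP_attained) (use n in \<open>simp add: emb_le_iff m_def\<close>)
    then obtain I where I: "\<And>j. n j \<le> \<d> (c (I j)) j" by metis
    \<comment> \<open>There are finitely many coordinates, so one stage serves all of them.\<close>
    define M where "M = Max (I ` UNIV)"
    have "n j \<le> \<d> (c M) j" for j
    proof -
      have "I j \<le> M" by (simp add: M_def)
      then have "\<d> (c (I j)) j \<le> \<d> (c M) j" using prefix_of_deg[OF pre] by (simp add: le_fun_def)
      then show ?thesis using I[of j] by simp
    qed
    then show ?thesis by (auto simp: le_fun_def)
  qed
  define g where "g n = (SOME \<alpha>. \<d> \<alpha> = n \<and> (\<exists>i. \<alpha> \<preceq> c i))" for n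
  have g: "\<d> (g n) = n" "\<exists>i. g n \<preceq> c i" if n: "emb n \<le> m" for n
  proof -
    obtain i where i: "n \<le> \<d> (c i)" using ex[OF n] by blast
    obtain \<alpha> where "\<alpha> \<preceq> c i" "\<d> \<alpha> = n" by (rule prefix_of_ex[OF prefix_of_paths(1)[OF c] i])
    then have "\<exists>\<alpha>. \<d> \<alpha> = n \<and> (\<exists>i. \<alpha> \<preceq> c i)" by blast
    from someI_ex[OF this] show "\<d> (g n) = n" "\<exists>i. g n \<preceq> c i" unfolding g_def by blast+
  qed
  have common: "\<exists>k. \<alpha> \<preceq> c k \<and> \<beta> \<preceq> c k"
    if "\<alpha> \<preceq> c i" "\<beta> \<preceq> c j" for \<alpha> \<beta> i j
    using prefix_of_trans[OF that(1) pre[of i "max i j"]] prefix_of_trans[OF that(2) pre[of j "max i j"]] by auto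
  have gA: "g n \<in> \<P> \<and> \<d> (g n) = n" if "emb n \<le> m" for n using g[OF that] prefix_of_paths(1) by blast
  have gB: "g n \<preceq> g n'" if n': "emb n' \<le> m" and nn: "n \<le> n'" for n n'
  proof -
    have n: "emb n \<le> m" by (rule emb_mono[OF nn n'])
    obtain i j where "g n \<preceq> c i" "g n' \<preceq> c j"
      using g(2)[OF n] g(2)[OF n'] by blast
    then obtain k where "g n \<preceq> c k" "g n' \<preceq> c k" using common by blast
    then show ?thesis using prefix_of_comparable[of "g n" "c k" "g n'"] g(1)[OF n] g(1)[OF n'] nn by simp
  qed
  obtain x where x: "x \<in> \<G>" "fst x = m" "\<And>n. emb n \<le> m \<Longrightarrow> snd x (0, n) = g n"
    using gpath_ex[of m g, OF gA gB] by blast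
  have le: "emb (\<d> (c i)) \<le> m" for i by (auto simp: emb_le_iff m_def intro: SUP_upper)
  have "snd x (0, \<d> (c i)) = c i" for i
  proof -
    obtain k where "(g (\<d> (c i))) \<preceq> c k" "c i \<preceq> c k"
      using g(2)[OF le[of i]] common[OF _ pre[OF order_refl, of i]] by blast
    then show ?thesis using prefix_of_eq[of _ "c k" "c i"] g(1)[OF le[of i]] x(3)[OF le[of i]] by simp
  qed
  then show thesis using that[OF x(1)] x(2) le ex by simp
qed

lemma boundary_ex:
  assumes v: "v \<in> \<V>"
  shows "\<exists>x \<in> \<B>. gp_rng x = v"
proof -
  \<comment> \<open>The requirements: a degree at which to test, and a finite set. Countability of
    the paths makes the list countable, so each requirement is met at some stage.\<close>
  define T :: "(('k \<Rightarrow> nat) \<times> 'l set) set" where "T = UNIV \<times> {E. finite E \<and> E \<subseteq> \<P>}"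
  have "countable T" "T \<noteq> {}"
    unfolding T_def using countable_Collect_finite_subset[OF countable_paths] by auto
  then have T: "range (from_nat_into T) = T" by (rule range_from_nat_into[rotated])
  define good where "good \<mu> \<nu> i \<longleftrightarrow> (case from_nat_into T i of (n, E) \<Rightarrow>
    \<mu> \<preceq> \<nu> \<and> (\<forall>\<alpha>. \<alpha> \<preceq> \<nu> \<and> \<d> \<alpha> = n \<and> E \<in> \<E> (\<s> \<alpha>) \<longrightarrow>
      (\<exists>\<beta> \<in> E. \<alpha> \<cdot> \<beta> \<preceq> \<nu>)) \<and>
    ((\<exists>\<omega>. \<nu> \<preceq> \<omega> \<and> n \<le> \<d> \<omega>) \<longrightarrow> n \<le> \<d> \<nu>))" for \<mu> \<nu> i
  have good_ex: "\<exists>\<nu>. good \<mu> \<nu> i" if "\<mu> \<in> \<P>" for \<mu> i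
    using boundary_dense[OF that] unfolding good_def by (cases "from_nat_into T i") simp
  define c where "c = rec_nat v (\<lambda>i \<mu>. SOME \<nu>. good \<mu> \<nu> i)"
  have c0: "c 0 = v" and cS: "c (Suc i) = (SOME \<nu>. good (c i) \<nu> i)" for i by (simp_all add: c_def)
  have cp: "c i \<in> \<P>" for i
  proof (induction i)
    case 0
    then show ?case using vertexD(1)[OF v] c0 by simp
  next
    case (Suc i)
    have "good (c i) (c (Suc i)) i" unfolding cS by (rule someI_ex[OF good_ex[OF Suc]])
    then have "c i \<preceq> (c (Suc i))" by (simp add: good_def split: prod.splits)
    then show ?case by (rule prefix_of_paths(2))
  qed
  have c_good: "good (c i) (c (Suc i)) i" for i unfolding cS by (rule someI_ex[OF good_ex[OF cp]])
  have cpre: "c i \<preceq> (c (Suc i))" for i using c_good[of i] by (simp add: good_def split: prod.splits)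
  obtain x where x: "x \<in> \<G>" "\<And>i. emb (\<d> (c i)) \<le> fst x" "\<And>i. snd x (0, \<d> (c i)) = c i"
    "\<And>n. emb n \<le> fst x \<Longrightarrow> \<exists>i. n \<le> \<d> (c i)" using chain_limit[of c, OF cpre] by blast
  have "x \<in> \<B>"
  proof (rule boundaryI[OF x(1)])
    fix n E assume n: "emb n \<le> fst x" and E: "E \<in> \<E> (snd x (n, n))"
    have "(n, E) \<in> T" using E by (auto simp: T_def FE_def exhaustive_def)
    then obtain i where i: "from_nat_into T i = (n, E)" using T by (metis imageE)
    obtain j where j: "n \<le> \<d> (c j)" using x(4)[OF n] by blast
    \<comment> \<open>Stage \<open>Suc i\<close> deals with \<open>(n, E)\<close> but might be
      shorter than \<open>n\<close>. The piece of \<open>x\<close> up to \<open>?N\<close> extends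
      it and reaches degree \<open>n\<close>, so the last clause of \<open>good\<close> shows that
      the stage had already reached it.\<close>
    let ?N = "sup (\<d> (c j)) (\<d> (c (Suc i)))"
    have N: "emb ?N \<le> fst x" using x(2) by (simp add: emb_sup)
    have "(snd x (0, \<d> (c (Suc i)))) \<preceq> (snd x (0, ?N))" by (rule gpath_initial_prefix[OF x(1) N]) simp
    then have "(c (Suc i)) \<preceq> (snd x (0, ?N))" by (simp only: x(3))
    moreover have "n \<le> \<d> (snd x (0, ?N))" using gpath_initial(2)[OF x(1) N] j by (simp add: le_supI1)
    ultimately have ni: "n \<le> \<d> (c (Suc i))" using c_good[of i] unfolding good_def i by auto
    have "(snd x (0, n)) \<preceq> (snd x (0, \<d> (c (Suc i))))" by (rule gpath_initial_prefix[OF x(1) x(2) ni])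
    then have "(snd x (0, n)) \<preceq> (c (Suc i))" by (simp only: x(3))
    moreover note ini = gpath_initial[OF x(1) n]
    ultimately obtain \<beta> where \<beta>: "\<beta> \<in> E" "(snd x (0, n) \<cdot> \<beta>) \<preceq> (c (Suc i))"
      using c_good[of i] E unfolding good_def i by auto
    have \<beta>p: "\<beta> \<in> \<P>" "\<s> (snd x (0, n)) = \<r> \<beta>" using E \<beta>(1) ini by (auto simp: FE_def exhaustive_def)
    have d: "\<d> (snd x (0, n) \<cdot> \<beta>) = n + \<d> \<beta>" using deg_cmp[OF ini(1) \<beta>p] ini(2) by simp
    have le: "n + \<d> \<beta> \<le> \<d> (c (Suc i))" using prefix_of_deg[OF \<beta>(2)] d by simp
    have nb: "emb (n + \<d> \<beta>) \<le> fst x" by (rule emb_mono[OF le x(2)])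
    have "(snd x (0, n + \<d> \<beta>)) \<preceq> (snd x (0, \<d> (c (Suc i))))" by (rule gpath_initial_prefix[OF x(1) x(2) le])
    then have "(snd x (0, n + \<d> \<beta>)) \<preceq> (c (Suc i))" by (simp only: x(3))
    then have "snd x (0, n + \<d> \<beta>) = snd x (0, n) \<cdot> \<beta>"
      using prefix_of_eq[OF _ \<beta>(2)] gpath_initial(2)[OF x(1) nb] d by simp
    then have eq: "snd x (0, n) \<cdot> snd x (n, n + \<d> \<beta>) = snd x (0, n) \<cdot> \<beta>"
      using gpath_split[OF x(1) nb fun_le_add_same] by simp
    have "snd x (n, n + \<d> \<beta>) = \<beta>"
      by (rule cancel_left[OF ini(1) gpath_paths[OF x(1) fun_le_add_same nb] \<beta>p(1) _ \<beta>p(2) eq])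
        (use gpath_rng[OF x(1) fun_le_add_same nb] ini(4) in simp)
    then show "\<exists>p. emb (n + p) \<le> fst x \<and> snd x (n, n + p) \<in> E" using nb \<beta>(1) by auto
  qed
  moreover have "gp_rng x = v"
    using x(3)[of 0] c0 vertexD(4)[OF v] by (simp add: gp_rng_def)
  ultimately show ?thesis by blast
qed

lemma boundary_path_action:
  assumes fa: "finitely_aligned \<Lambda>"
  shows "path_action \<Lambda> \<B> prepend gp_rng"
proof
  fix x assume x: "x \<in> \<B>"
  note gx = boundary_gpath[OF x]
  show "gp_rng x \<in> \<V>" by (rule gp_rng_vertex[OF gx])
  show "prepend (gp_rng x) x = x" by (rule gp_prepend_vertex[OF gx])
  show "\<exists>\<mu>\<in>E. \<exists>z\<in>\<B>. \<s> \<mu> = gp_rng z \<and> x = prepend \<mu> z" if E: "E \<in> \<E> (gp_rng x)" for E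
  proof -
    obtain p where p: "emb (0 + p) \<le> fst x" "snd x (0, 0 + p) \<in> E"
      by (rule boundaryD[OF x emb_0]) (use E in \<open>auto simp: gp_rng_def\<close>)
    then have p': "emb p \<le> fst x" "snd x (0, p) \<in> E" by simp_all
    have "\<s> (snd x (0, p)) = gp_rng (gp_shift p x)" using gpath_initial(4)[OF gx p'(1)] gp_rng_shift[OF gx p'(1)] by simp
    then show ?thesis using boundary_shift[OF x p'(1)] gp_prepend_shift[OF gx p'(1)] p'(2) by metis
  qed
  fix \<mu> assume \<mu>: "\<mu> \<in> \<P>"
  show "prepend \<mu> x \<in> \<B>" if "\<s> \<mu> = gp_rng x" by (rule boundary_prepend[OF fa x \<mu> that])
  show "gp_rng (prepend \<mu> x) = \<r> \<mu>" if "\<s> \<mu> = gp_rng x" by (rule gp_rng_prepend[OF gx \<mu> that])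
  fix \<nu> assume \<nu>: "\<nu> \<in> \<P>"
  show "prepend (\<mu> \<cdot> \<nu>) x = prepend \<mu> (prepend \<nu> x)"
    if "\<s> \<mu> = \<r> \<nu>" "\<s> \<nu> = gp_rng x" by (rule gp_prepend_cmp[OF gx \<mu> \<nu> that])
  fix y assume y: "y \<in> \<B>"
  note gy = boundary_gpath[OF y]
  show "x = y" if "\<s> \<mu> = gp_rng x" "\<s> \<mu> = gp_rng y" "prepend \<mu> x = prepend \<mu> y"
    using arg_cong[OF that(3), of "gp_shift (\<d> \<mu>)"]
    unfolding gp_shift_prepend[OF gx \<mu> that(1)] gp_shift_prepend[OF gy \<mu> that(2)] .
  assume s: "\<s> \<mu> = gp_rng x" "\<s> \<nu> = gp_rng y" and eq: "prepend \<mu> x = prepend \<nu> y"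
  obtain \<alpha> \<beta> n n' where *: "\<alpha> \<in> \<P>" "\<beta> \<in> \<P>" "\<s> \<mu> = \<r> \<alpha>" "\<s> \<nu> = \<r> \<beta>"
    "\<mu> \<cdot> \<alpha> = \<nu> \<cdot> \<beta>" "\<mu> \<cdot> \<alpha> \<in> \<M> \<mu> \<nu>" "emb n \<le> fst x" "emb n' \<le> fst y" "\<alpha> = snd x (0, n)" "\<beta> = snd y (0, n')"
    "gp_shift n x = gp_shift n' y"
    by (rule gp_prepend_meet[OF gx gy \<mu> \<nu> s eq])
  let ?z = "gp_shift n x"
  have Z: "\<s> \<alpha> = gp_rng ?z" "\<s> \<beta> = gp_rng ?z"
    using gpath_initial(4)[OF gx *(7)] gp_rng_shift[OF gx *(7)] gpath_initial(4)[OF gy *(8)] gp_rng_shift[OF gy *(8)]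
    by (simp_all only: *(9,10,11))
  have Zx: "prepend \<alpha> ?z = x" unfolding *(9) by (rule gp_prepend_shift[OF gx *(7)])
  have Zy: "prepend \<beta> ?z = y" unfolding *(10,11) by (rule gp_prepend_shift[OF gy *(8)])
  show "\<exists>\<alpha> \<beta> z. \<alpha> \<in> \<P> \<and> \<beta> \<in> \<P> \<and> \<s> \<mu> = \<r> \<alpha> \<and> \<s> \<nu> = \<r> \<beta> \<and>
      \<mu> \<cdot> \<alpha> = \<nu> \<cdot> \<beta> \<and> \<mu> \<cdot> \<alpha> \<in> \<M> \<mu> \<nu> \<and> z \<in> \<B> \<and> \<s> \<alpha> = gp_rng z \<and> \<s> \<beta> = gp_rng z \<and>
      x = prepend \<alpha> z \<and> y = prepend \<beta> z"
    by (intro exI[of _ \<alpha>] exI[of _ \<beta>] exI[of _ ?z] conjI)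
      (rule *(1) *(2) *(3) *(4) *(5) *(6) boundary_shift[OF x *(7)] Z Zx[symmetric] Zy[symmetric])+
next
  fix v assume "v \<in> \<V>"
  then show "\<exists>x\<in>\<B>. gp_rng x = v" by (rule boundary_ex)
qed

end

section \<open>Graded path actions\<close>

text \<open>Degrees as integers, so that the generator with range path \<open>\<mu>\<close> and
  source path \<open>\<nu>\<close> has a degree, the difference of the two.\<close>

definition ideg :: "('l, 'k) kgraph \<Rightarrow> 'l \<Rightarrow> 'k \<Rightarrow> int" where
  "ideg \<Lambda> \<mu> = (\<lambda>i. int (deg \<Lambda> \<mu> i))"

lemma ideg_eq_iff: "ideg \<Lambda> \<mu> = ideg \<Lambda> \<nu> \<longleftrightarrow> deg \<Lambda> \<mu> = deg \<Lambda> \<nu>"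
  by (simp add: ideg_def fun_eq_iff)

abbreviation (in k_graph) "\<D> \<equiv> ideg \<Lambda>"

locale graded_path_action = path_action \<Lambda> X act vtx
  for \<Lambda> :: "('l, 'k::finite) kgraph" (structure) and X :: "'x set" and act vtx +
  fixes gr :: "'x \<Rightarrow> 'k \<Rightarrow> int"
  assumes gr_act: "\<lbrakk>\<mu> \<in> \<P>; x \<in> X; \<s> \<mu> = vtx x\<rbrakk> \<Longrightarrow> gr (act \<mu> x) = gr x + \<D> \<mu>"

lemma (in k_graph) ideg_cmp:
  "\<lbrakk>\<mu> \<in> \<P>; \<nu> \<in> \<P>; \<s> \<mu> = \<r> \<nu>\<rbrakk> \<Longrightarrow> \<D> (\<mu> \<cdot> \<nu>) = \<D> \<mu> + \<D> \<nu>"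
  by (simp add: ideg_def deg_cmp fun_eq_iff)

lemma (in k_graph) ideg_vertex: "v \<in> \<V> \<Longrightarrow> \<D> v = 0"
  using vertexD(4) by (simp add: ideg_def fun_eq_iff)

text \<open>The skew product of an action with \<open>\<int>\<^sup>k\<close>, transported along an injection \<open>e\<close> so as to live on a
  prescribed type.\<close>

lemma (in path_action) graded_product:
  fixes e :: "'x \<times> ('k \<Rightarrow> int) \<Rightarrow> 'y"
  assumes e: "inj e"
  defines "d \<equiv> inv_into UNIV e"
  shows "graded_path_action \<Lambda> (e ` (X \<times> UNIV)) (\<lambda>\<mu> u. e (act \<mu> (fst (d u)), snd (d u) + \<D> \<mu>))
    (\<lambda>u. vtx (fst (d u))) (\<lambda>u. snd (d u))"
proof -
  have de [simp]: "d (e p) = p" for p using e by (simp add: d_def)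
  have ee: "e p = e q \<longleftrightarrow> p = q" for p q using e by (auto dest: injD)
  show ?thesis
  proof
    fix u assume "u \<in> e ` (X \<times> UNIV)"
    then obtain x g where u: "u = e (x, g)" "x \<in> X" by auto
    show "vtx (fst (d u)) \<in> \<V>" using vtx_vertex u by simp
    show "e (act (vtx (fst (d u))) (fst (d u)), snd (d u) + \<D> (vtx (fst (d u)))) = u"
      using u act_vertex[OF u(2)] ideg_vertex[OF vtx_vertex[OF u(2)]] by simp
    show "\<exists>\<mu>\<in>E. \<exists>z\<in>e ` (X \<times> UNIV). \<s> \<mu> = vtx (fst (d z)) \<and> u = e (act \<mu> (fst (d z)), snd (d z) + \<D> \<mu>)"
      if E: "E \<in> \<E> (vtx (fst (d u)))" for E
    proof -
      have "\<exists>\<mu>\<in>E. \<exists>z\<in>X. \<s> \<mu> = vtx z \<and> x = act \<mu> z" using act_exhaustive[OF u(2)] E u(1) by simp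
      then obtain \<mu> z where z: "\<mu> \<in> E" "z \<in> X" "\<s> \<mu> = vtx z" "x = act \<mu> z" by blast
      show ?thesis
      proof (intro bexI[OF _ z(1)] bexI[of _ "e (z, g - \<D> \<mu>)"] conjI)
        show "\<s> \<mu> = vtx (fst (d (e (z, g - \<D> \<mu>))))" using z(3) by simp
        show "u = e (act \<mu> (fst (d (e (z, g - \<D> \<mu>)))), snd (d (e (z, g - \<D> \<mu>))) + \<D> \<mu>)"
          unfolding u(1) z(4) by simp
      qed (use z(2) in simp)
    qed
    fix \<mu> assume \<mu>: "\<mu> \<in> \<P>"
    show "e (act \<mu> (fst (d u)), snd (d u) + \<D> \<mu>) \<in> e ` (X \<times> UNIV)" if "\<s> \<mu> = vtx (fst (d u))"
      using act_closed[OF \<mu> u(2)] that u(1) by simp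
    show "vtx (fst (d (e (act \<mu> (fst (d u)), snd (d u) + \<D> \<mu>)))) = \<r> \<mu>" if "\<s> \<mu> = vtx (fst (d u))"
      using vtx_act[OF \<mu> u(2)] that u(1) by simp
    show "snd (d (e (act \<mu> (fst (d u)), snd (d u) + \<D> \<mu>))) = snd (d u) + \<D> \<mu>" by simp
    fix \<nu> assume \<nu>: "\<nu> \<in> \<P>"
    show "e (act (\<mu> \<cdot> \<nu>) (fst (d u)), snd (d u) + \<D> (\<mu> \<cdot> \<nu>)) =
        e (act \<mu> (fst (d (e (act \<nu> (fst (d u)), snd (d u) + \<D> \<nu>)))),
          snd (d (e (act \<nu> (fst (d u)), snd (d u) + \<D> \<nu>))) + \<D> \<mu>)"
      if "\<s> \<mu> = \<r> \<nu>" "\<s> \<nu> = vtx (fst (d u))"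
      using act_cmp[OF \<mu> \<nu> that(1) u(2)] that u(1) ideg_cmp[OF \<mu> \<nu> that(1)] by (simp add: add_ac)
    fix w assume "w \<in> e ` (X \<times> UNIV)"
    then obtain y h where w: "w = e (y, h)" "y \<in> X" by auto
    show "u = w" if "\<s> \<mu> = vtx (fst (d u))" "\<s> \<mu> = vtx (fst (d w))"
      "e (act \<mu> (fst (d u)), snd (d u) + \<D> \<mu>) = e (act \<mu> (fst (d w)), snd (d w) + \<D> \<mu>)"
      using act_inj[OF \<mu> u(2) w(2)] that unfolding u(1) w(1) by (simp add: ee)
    assume "\<s> \<mu> = vtx (fst (d u))" "\<s> \<nu> = vtx (fst (d w))"
      "e (act \<mu> (fst (d u)), snd (d u) + \<D> \<mu>) = e (act \<nu> (fst (d w)), snd (d w) + \<D> \<nu>)"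
    then have s: "\<s> \<mu> = vtx x" "\<s> \<nu> = vtx y" and a: "act \<mu> x = act \<nu> y" and g: "g + \<D> \<mu> = h + \<D> \<nu>"
      unfolding u(1) w(1) by (simp_all add: ee)
    obtain \<alpha> \<beta> z where *: "\<alpha> \<in> \<P>" "\<beta> \<in> \<P>" "\<s> \<mu> = \<r> \<alpha>" "\<s> \<nu> = \<r> \<beta>"
        "\<mu> \<cdot> \<alpha> = \<nu> \<cdot> \<beta>" "\<mu> \<cdot> \<alpha> \<in> \<M> \<mu> \<nu>" "z \<in> X" "\<s> \<alpha> = vtx z" "\<s> \<beta> = vtx z" "x = act \<alpha> z" "y = act \<beta> z"
      using act_meet[OF \<mu> \<nu> u(2) w(2) s a] by blast
    \<comment> \<open>The two factorisations of the minimal common extension have the same total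
      degree; hence a single grade for the common tail \<open>z\<close> fits both points.\<close>
    have d: "\<D> \<mu> + \<D> \<alpha> = \<D> \<nu> + \<D> \<beta>"
      using ideg_cmp[OF \<mu> *(1,3)] ideg_cmp[OF \<nu> *(2,4)] *(5) by simp
    have h: "h = g - \<D> \<alpha> + \<D> \<beta>"
    proof
      fix i show "h i = (g - \<D> \<alpha> + \<D> \<beta>) i" using fun_cong[OF d, of i] fun_cong[OF g, of i] by simp
    qed
    let ?z = "e (z, g - \<D> \<alpha>)"
    have "?z \<in> e ` (X \<times> UNIV)" "\<s> \<alpha> = vtx (fst (d ?z))" "\<s> \<beta> = vtx (fst (d ?z))"
      "e (act \<alpha> (fst (d ?z)), snd (d ?z) + \<D> \<alpha>) = u" "e (act \<beta> (fst (d ?z)), snd (d ?z) + \<D> \<beta>) = w"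
      using *(7,8,9) unfolding u(1) w(1) *(10,11) h by simp_all
    then show "\<exists>\<alpha> \<beta> z. \<alpha> \<in> \<P> \<and> \<beta> \<in> \<P> \<and> \<s> \<mu> = \<r> \<alpha> \<and> \<s> \<nu> = \<r> \<beta> \<and>
        \<mu> \<cdot> \<alpha> = \<nu> \<cdot> \<beta> \<and> \<mu> \<cdot> \<alpha> \<in> \<M> \<mu> \<nu> \<and> z \<in> e ` (X \<times> UNIV) \<and>
        \<s> \<alpha> = vtx (fst (d z)) \<and> \<s> \<beta> = vtx (fst (d z)) \<and>
        u = e (act \<alpha> (fst (d z)), snd (d z) + \<D> \<alpha>) \<and> w = e (act \<beta> (fst (d z)), snd (d z) + \<D> \<beta>)"
      using *(1-6) by (intro exI[of _ \<alpha>] exI[of _ \<beta>] exI[of _ ?z] conjI) (blast | (rule sym, assumption))+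
  next
    fix v assume "v \<in> \<V>"
    then obtain x where "x \<in> X" "vtx x = v" using vtx_surj by blast
    then show "\<exists>u\<in>e ` (X \<times> UNIV). vtx (fst (d u)) = v" by (intro bexI[of _ "e (x, 0)"]) auto
  qed
qed

text \<open>The universal property is only available for operators on families of morphisms \<open>\<Omega>\<^sub>k\<^sub>,\<^sub>m \<rightarrow> \<Lambda>\<close>, hence
  \<open>\<partial>\<Lambda> \<times> \<int>\<^sup>k\<close> has to be coded in that type: degree and grading are countable.\<close>

definition gpath_code :: "('l, 'k::finite) gpath \<times> ('k \<Rightarrow> int) \<Rightarrow> ('l, 'k) gpath" where
  "gpath_code = (\<lambda>(x, g). (\<lambda>_. enat (to_nat (fst x, g)), snd x))"

lemma inj_gpath_code: "inj gpath_code"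
  by (auto simp: inj_def gpath_code_def fun_eq_iff prod_eq_iff)

section \<open>Calculus of Cuntz-Krieger families\<close>

text \<open>The linear span, built up one term at a time: properties preserved by linear
  combinations are proved by induction without choosing coefficient functions.\<close>

inductive_set lin :: "'a cstar \<Rightarrow> 'a set \<Rightarrow> 'a set" for A :: "'a cstar" and G :: "'a set" where
  lin_zero: "\<zero>\<^bsub>A\<^esub> \<in> lin A G"
| lin_step: "\<lbrakk>g \<in> G; x \<in> lin A G\<rbrakk> \<Longrightarrow> (c \<odot>\<^bsub>A\<^esub> g) \<oplus>\<^bsub>A\<^esub> x \<in> lin A G"

lemma lin_mono: "\<lbrakk>x \<in> lin A G; G \<subseteq> H\<rbrakk> \<Longrightarrow> x \<in> lin A H"
  by (induction rule: lin.induct) (auto intro: lin.intros)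

lemma lin_finite_support: "x \<in> lin A G \<Longrightarrow> \<exists>F. finite F \<and> F \<subseteq> G \<and> x \<in> lin A F"
proof (induction rule: lin.induct)
  case lin_zero
  show ?case by (rule exI[of _ "{}"]) (auto intro: lin.lin_zero)
next
  case (lin_step g x c)
  then obtain F where F: "finite F" "F \<subseteq> G" "x \<in> lin A F" by blast
  have "x \<in> lin A (insert g F)" using F(3) by (rule lin_mono) blast
  then have "(c \<odot>\<^bsub>A\<^esub> g) \<oplus>\<^bsub>A\<^esub> x \<in> lin A (insert g F)" by (rule lin.lin_step[rotated]) simp
  then show ?case using F lin_step(1) by (intro exI[of _ "insert g F"]) auto
qed

context cstar_algebra
begin

lemma lin_closed: "\<lbrakk>x \<in> lin A G; G \<subseteq> carrier A\<rbrakk> \<Longrightarrow> x \<in> carrier A"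
  by (induction rule: lin.induct) auto

lemma lin_base: "\<lbrakk>g \<in> G; G \<subseteq> carrier A\<rbrakk> \<Longrightarrow> g \<in> lin A G"
  using lin_step[OF _ lin_zero, of g G A 1] by (auto simp: subset_iff)

lemma lin_add: "\<lbrakk>x \<in> lin A G; y \<in> lin A G; G \<subseteq> carrier A\<rbrakk> \<Longrightarrow> x \<oplus> y \<in> lin A G"
proof (induction rule: lin.induct)
  case lin_zero
  then show ?case using lin_closed by simp
next
  case (lin_step g x c)
  have "g \<in> carrier A" "x \<in> carrier A" "y \<in> carrier A" using lin_step lin_closed by auto
  then have "((c \<odot> g) \<oplus> x) \<oplus> y = (c \<odot> g) \<oplus> (x \<oplus> y)" by (simp add: M.a_assoc)
  then show ?case using lin.lin_step[OF lin_step(1) lin_step.IH[OF lin_step.prems], of c] by simp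
qed

lemma lin_smult: "\<lbrakk>x \<in> lin A G; G \<subseteq> carrier A\<rbrakk> \<Longrightarrow> c \<odot> x \<in> lin A G"
proof (induction rule: lin.induct)
  case lin_zero
  then show ?case by (simp add: lin.lin_zero)
next
  case (lin_step g x d)
  have "g \<in> carrier A" "x \<in> carrier A" using lin_step lin_closed by auto
  then have "c \<odot> ((d \<odot> g) \<oplus> x) = ((c * d) \<odot> g) \<oplus> (c \<odot> x)" by (simp add: smult_add_right)
  then show ?case using lin.lin_step[OF lin_step(1) lin_step.IH[OF lin_step.prems], of "c * d"] by simp
qed

lemma lin_finsum:
  "\<lbrakk>finite I; \<And>i. i \<in> I \<Longrightarrow> f i \<in> lin A G; G \<subseteq> carrier A\<rbrakk> \<Longrightarrow> finsum A f I \<in> lin A G"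
proof (induction I rule: finite_induct)
  case empty
  then show ?case by (simp add: lin.lin_zero)
next
  case (insert i I)
  have "f \<in> I \<rightarrow> carrier A" "f i \<in> carrier A" using insert lin_closed by auto
  then show ?case using insert lin_add by (simp add: M.finsum_insert)
qed

lemma lin_mult:
  assumes "x \<in> lin A G" "y \<in> lin A H" "G \<subseteq> carrier A" "H \<subseteq> carrier A" "K \<subseteq> carrier A"
    and gh: "\<And>g h. \<lbrakk>g \<in> G; h \<in> H\<rbrakk> \<Longrightarrow> g \<otimes> h \<in> lin A K"
  shows "x \<otimes> y \<in> lin A K"
  using assms(1)
proof (induction rule: lin.induct)
  case lin_zero
  then show ?case using lin_closed[OF assms(2,4)] by (simp add: lin.lin_zero)
next
  case (lin_step g x c)
  have yc: "y \<in> carrier A" by (rule lin_closed[OF assms(2,4)])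
  have gc: "g \<in> carrier A" and xc: "x \<in> carrier A" using lin_step lin_closed assms(3) by auto
  have "g \<otimes> y \<in> lin A K" using assms(2)
  proof (induction rule: lin.induct)
    case lin_zero
    then show ?case using gc by (simp add: lin.lin_zero)
  next
    case (lin_step h y d)
    have "h \<in> carrier A" "y \<in> carrier A" using lin_step lin_closed assms(4) by auto
    then have "g \<otimes> ((d \<odot> h) \<oplus> y) = d \<odot> (g \<otimes> h) \<oplus> g \<otimes> y" using gc by (simp add: mult_r_distr smult_mult_r)
    then show ?case using lin_step gh[OF \<open>g \<in> G\<close>] lin_smult lin_add assms(5) by simp
  qed
  moreover have "((c \<odot> g) \<oplus> x) \<otimes> y = c \<odot> (g \<otimes> y) \<oplus> x \<otimes> y"
    using gc xc yc by (simp add: mult_l_distr smult_mult_l)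
  ultimately show ?case using lin_step lin_smult lin_add assms(5) by simp
qed

lemma lin_adj:
  assumes "x \<in> lin A G" "G \<subseteq> carrier A" "H \<subseteq> carrier A" "\<And>g. g \<in> G \<Longrightarrow> adj A g \<in> lin A H"
  shows "adj A x \<in> lin A H"
  using assms(1)
proof (induction rule: lin.induct)
  case lin_zero
  then show ?case by (simp add: lin.lin_zero)
next
  case (lin_step g x c)
  have "g \<in> carrier A" "x \<in> carrier A" using lin_step lin_closed assms(2) by auto
  then have "adj A ((c \<odot> g) \<oplus> x) = cnj c \<odot> adj A g \<oplus> adj A x" by (simp add: adj_add adj_smult)
  then show ?case using lin_step assms(3,4) lin_smult lin_add by simp
qed

end

locale ck_kgraph = CK_family \<Lambda> A t + k_graph \<Lambda>
  for \<Lambda> :: "('l, 'k::finite) kgraph" and A :: "'a cstar" (structure) and t :: "'l \<Rightarrow> 'a" +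
  assumes fa: "finitely_aligned \<Lambda>"
begin

section \<open>Products of generators and range projections\<close>

abbreviation comp (infixr \<open>\<star>\<close> 75) where "\<mu> \<star> \<nu> \<equiv> \<mu> \<cdot>\<^bsub>\<Lambda>\<^esub> \<nu>"
abbreviation "st \<mu> \<equiv> adj A (t \<mu>)"
abbreviation "pr \<mu> \<equiv> t \<mu> \<otimes> st \<mu>"

lemma t_closed [simp, intro]: "\<mu> \<in> \<P> \<Longrightarrow> t \<mu> \<in> carrier A"
  by (rule in_carrier)

lemma t_cmp: "\<lbrakk>\<mu> \<in> \<P>; \<nu> \<in> \<P>; \<s> \<mu> = \<r> \<nu>\<rbrakk> \<Longrightarrow> t (\<mu> \<star> \<nu>) = t \<mu> \<otimes> t \<nu>"
  using CK2 by simp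

lemma st_cmp: "\<lbrakk>\<mu> \<in> \<P>; \<nu> \<in> \<P>; \<s> \<mu> = \<r> \<nu>\<rbrakk> \<Longrightarrow> st (\<mu> \<star> \<nu>) = st \<nu> \<otimes> st \<mu>"
  using t_cmp by (simp add: adj_mult)

lemma t_vertex: "v \<in> \<V> \<Longrightarrow> st v = t v" "v \<in> \<V> \<Longrightarrow> t v \<otimes> t v = t v"
  using CK1_projection by auto

lemma t_src [simp]: "\<mu> \<in> \<P> \<Longrightarrow> t \<mu> \<otimes> t (\<s> \<mu>) = t \<mu>"
  using CK2[of \<mu> "\<s> \<mu>"] by simp

lemma t_rng [simp]: "\<mu> \<in> \<P> \<Longrightarrow> t (\<r> \<mu>) \<otimes> t \<mu> = t \<mu>"
  using CK2[of "\<r> \<mu>" \<mu>] by simp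

lemma st_src [simp]: assumes "\<mu> \<in> \<P>" shows "t (\<s> \<mu>) \<otimes> st \<mu> = st \<mu>"
proof -
  have "adj A (t \<mu> \<otimes> t (\<s> \<mu>)) = t (\<s> \<mu>) \<otimes> st \<mu>"
    using assms t_vertex(1)[of "\<s> \<mu>"] by (simp add: adj_mult del: t_src)
  then show ?thesis using assms by simp
qed

lemma st_rng [simp]: assumes "\<mu> \<in> \<P>" shows "st \<mu> \<otimes> t (\<r> \<mu>) = st \<mu>"
proof -
  have "adj A (t (\<r> \<mu>) \<otimes> t \<mu>) = st \<mu> \<otimes> t (\<r> \<mu>)"
    using assms t_vertex(1)[of "\<r> \<mu>"] by (simp add: adj_mult del: t_rng)
  then show ?thesis using assms by simp
qed

definition mce_pairs :: "'l \<Rightarrow> 'l \<Rightarrow> ('l \<times> 'l) set" where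
  "mce_pairs \<mu> \<nu> = {(\<alpha>, \<beta>). \<alpha> \<in> \<P> \<and> \<beta> \<in> \<P> \<and> \<s> \<mu> = \<r> \<alpha> \<and> \<s> \<nu> = \<r> \<beta> \<and>
             \<mu> \<star> \<alpha> = \<nu> \<star> \<beta> \<and> \<mu> \<star> \<alpha> \<in> \<M> \<mu> \<nu>}"

lemma CK3': "\<lbrakk>\<mu> \<in> \<P>; \<nu> \<in> \<P>\<rbrakk> \<Longrightarrow> st \<mu> \<otimes> t \<nu> = finsum A (\<lambda>(\<alpha>, \<beta>). t \<alpha> \<otimes> st \<beta>) (mce_pairs \<mu> \<nu>)"
  unfolding mce_pairs_def by (rule CK3)

lemma mce_pairsD:
  assumes "(\<alpha>, \<beta>) \<in> mce_pairs \<mu> \<nu>" "\<mu> \<in> \<P>" "\<nu> \<in> \<P>"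
  shows "\<alpha> \<in> \<P>" "\<beta> \<in> \<P>" "\<s> \<mu> = \<r> \<alpha>" "\<s> \<nu> = \<r> \<beta>"
    "\<mu> \<star> \<alpha> = \<nu> \<star> \<beta>" "\<mu> \<star> \<alpha> \<in> \<M> \<mu> \<nu>" "\<s> \<alpha> = \<s> \<beta>"
proof -
  show *: "\<alpha> \<in> \<P>" "\<beta> \<in> \<P>" "\<s> \<mu> = \<r> \<alpha>" "\<s> \<nu> = \<r> \<beta>"
    "\<mu> \<star> \<alpha> = \<nu> \<star> \<beta>" "\<mu> \<star> \<alpha> \<in> \<M> \<mu> \<nu>" using assms(1) by (auto simp: mce_pairs_def)
  show "\<s> \<alpha> = \<s> \<beta>" using src_cmp[OF assms(2) *(1,3)] src_cmp[OF assms(3) *(2,4)] *(5) by simp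
qed

lemma mce_pairs_finite: "\<lbrakk>\<mu> \<in> \<P>; \<nu> \<in> \<P>\<rbrakk> \<Longrightarrow> finite (mce_pairs \<mu> \<nu>)"
  unfolding mce_pairs_def by (rule MCE_pairs_finite[OF fa])

lemma mce_pairs_fun: "(\<lambda>(\<alpha>, \<beta>). t \<alpha> \<otimes> st \<beta>) \<in> mce_pairs \<mu> \<nu> \<rightarrow> carrier A"
  by (auto simp: mce_pairs_def)

lemma mce_pairs_empty: "\<M> \<mu> \<nu> = {} \<Longrightarrow> mce_pairs \<mu> \<nu> = {}"
  by (auto simp: mce_pairs_def)

lemma st_t_disjoint: "\<lbrakk>\<mu> \<in> \<P>; \<nu> \<in> \<P>; \<M> \<mu> \<nu> = {}\<rbrakk> \<Longrightarrow> st \<mu> \<otimes> t \<nu> = \<zero>"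
  using CK3'[of \<mu> \<nu>] mce_pairs_empty[of \<mu> \<nu>] by simp

text \<open>The only minimal common extension of \<open>\<mu>\<close> with itself is
  \<open>\<mu>\<close>, so the sum in (CK3) reduces to the pair of identities at its source.\<close>

lemma st_t [simp]: assumes "\<mu> \<in> \<P>" shows "st \<mu> \<otimes> t \<mu> = t (\<s> \<mu>)"
proof -
  have "mce_pairs \<mu> \<mu> = {(\<s> \<mu>, \<s> \<mu>)}"
  proof -
    have "\<alpha> = \<s> \<mu> \<and> \<beta> = \<s> \<mu>" if "(\<alpha>, \<beta>) \<in> mce_pairs \<mu> \<mu>" for \<alpha> \<beta>
    proof -
      note * = mce_pairsD[OF that assms assms]
      have "\<mu> \<star> \<alpha> = \<mu>" using *(6) MCE_prefix[OF prefix_of_refl[OF assms]] by simp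
      then have "\<mu> \<star> \<alpha> = \<mu> \<star> \<s> \<mu>" "\<mu> \<star> \<beta> = \<mu> \<star> \<s> \<mu>"
        using *(5) cmp_src_id[OF assms] by simp_all
      then show ?thesis using cancel_left[OF assms *(1) src_closed[OF assms] *(3)]
          cancel_left[OF assms *(2) src_closed[OF assms] *(4)] assms by simp
    qed
    moreover have "(\<s> \<mu>, \<s> \<mu>) \<in> mce_pairs \<mu> \<mu>"
      using assms MCE_prefix[OF prefix_of_refl[OF assms]] by (simp add: mce_pairs_def)
    ultimately have "\<And>p. p \<in> mce_pairs \<mu> \<mu> \<longleftrightarrow> p = (\<s> \<mu>, \<s> \<mu>)" by fast
    then show ?thesis by blast
  qed
  then show ?thesis using CK3'[OF assms assms] t_vertex[of "\<s> \<mu>"] assms by simp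
qed

lemma st_t_prefix:
  assumes "\<mu> \<in> \<P>" "\<alpha> \<in> \<P>" "\<s> \<mu> = \<r> \<alpha>"
  shows "st \<mu> \<otimes> t (\<mu> \<star> \<alpha>) = t \<alpha>" "st (\<mu> \<star> \<alpha>) \<otimes> t \<mu> = st \<alpha>"
proof -
  show a: "st \<mu> \<otimes> t (\<mu> \<star> \<alpha>) = t \<alpha>"
    using assms t_rng[OF assms(2)] by (simp add: t_cmp mult_assoc[symmetric])
  show "st (\<mu> \<star> \<alpha>) \<otimes> t \<mu> = st \<alpha>"
    using arg_cong[OF a, of "adj A"] assms by (simp add: adj_mult)
qed

lemma pr_props:
  assumes "\<mu> \<in> \<P>"
  shows "pr \<mu> \<in> carrier A" "adj A (pr \<mu>) = pr \<mu>" "pr \<mu> \<otimes> pr \<mu> = pr \<mu>" "pr \<mu> \<otimes> t \<mu> = t \<mu>" "st \<mu> \<otimes> pr \<mu> = st \<mu>"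
proof -
  show c: "pr \<mu> \<in> carrier A" "adj A (pr \<mu>) = pr \<mu>" using assms by (simp_all add: adj_mult)
  show p: "pr \<mu> \<otimes> t \<mu> = t \<mu>" using assms by (simp add: mult_assoc)
  show "st \<mu> \<otimes> pr \<mu> = st \<mu>" using assms by (simp add: mult_assoc[symmetric])
  have "pr \<mu> \<otimes> pr \<mu> = (pr \<mu> \<otimes> t \<mu>) \<otimes> st \<mu>"
    by (rule mult_assoc[symmetric]) (use assms c in auto)
  then show "pr \<mu> \<otimes> pr \<mu> = pr \<mu>" using p by simp
qed

lemma nrm_vertex_le: "v \<in> \<V> \<Longrightarrow> nrm A (t v) \<le> 1"
  using nrm_projection[of "t v"] t_vertex vertexD(1) by simp

lemma nrm_t_le: assumes "\<mu> \<in> \<P>" shows "nrm A (t \<mu>) \<le> 1" "nrm A (st \<mu>) \<le> 1"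
proof -
  have "(nrm A (t \<mu>))\<^sup>2 \<le> 1" using cstar_identity[of "t \<mu>"] nrm_vertex_le[of "\<s> \<mu>"] assms by simp
  then show "nrm A (t \<mu>) \<le> 1" using nrm_nonneg[of "t \<mu>"] assms by (simp add: power_le_one_iff)
  then show "nrm A (st \<mu>) \<le> 1" using assms by simp
qed

text \<open>Multiply (CK3) by \<open>t \<mu>\<close> on the left and by \<open>st \<nu>\<close> on
  the right: each pair turns into the range projection of the extension that it completes. As the
  result is symmetric, range projections commute.\<close>

lemma pr_mult:
  assumes \<mu>: "\<mu> \<in> \<P>" and \<nu>: "\<nu> \<in> \<P>"
  shows "pr \<mu> \<otimes> pr \<nu> = finsum A pr (\<M> \<mu> \<nu>)"
proof -
  let ?P = "mce_pairs \<mu> \<nu>"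
  have fin: "finite ?P" by (rule mce_pairs_finite[OF assms])
  have "pr \<mu> \<otimes> pr \<nu> = (t \<mu> \<otimes> (st \<mu> \<otimes> t \<nu>)) \<otimes> st \<nu>" using assms by (simp add: mult_assoc)
  also have "\<dots> = finsum A (\<lambda>p. (t \<mu> \<otimes> (case p of (\<alpha>, \<beta>) \<Rightarrow> t \<alpha> \<otimes> st \<beta>)) \<otimes> st \<nu>) ?P"
    unfolding CK3'[OF assms] using assms fin mce_pairs_fun[of \<mu> \<nu>]
    by (subst mult_finsum_right) (auto intro!: mult_finsum_left simp: mce_pairs_def)
  also have "\<dots> = finsum A (\<lambda>p. pr (\<mu> \<star> fst p)) ?P"
  proof (rule M.finsum_cong')
    fix p assume p: "p \<in> ?P"
    obtain \<alpha> \<beta> where ab: "p = (\<alpha>, \<beta>)" by (cases p)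
    note * = mce_pairsD[OF p[unfolded ab] assms]
    have "(t \<mu> \<otimes> (t \<alpha> \<otimes> st \<beta>)) \<otimes> st \<nu> = (t \<mu> \<otimes> t \<alpha>) \<otimes> (st \<beta> \<otimes> st \<nu>)"
      using assms * by (simp add: mult_assoc)
    also have "\<dots> = t (\<mu> \<star> \<alpha>) \<otimes> st (\<nu> \<star> \<beta>)" using t_cmp[OF \<mu> *(1,3)] st_cmp[OF \<nu> *(2,4)] by simp
    finally show "(t \<mu> \<otimes> (case p of (\<alpha>, \<beta>) \<Rightarrow> t \<alpha> \<otimes> st \<beta>)) \<otimes> st \<nu> = pr (\<mu> \<star> fst p)"
      using *(5) ab by simp
  qed (auto simp: mce_pairs_def MCE_def)
  also have "\<dots> = finsum A pr ((\<lambda>p. \<mu> \<star> fst p) ` ?P)"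
  proof (rule M.finsum_reindex[symmetric])
    show "inj_on (\<lambda>p. \<mu> \<star> fst p) ?P"
    proof (rule inj_onI)
      fix p q assume p: "p \<in> ?P" and q: "q \<in> ?P" and eq: "\<mu> \<star> fst p = \<mu> \<star> fst q"
      obtain \<alpha> \<beta> where ab: "p = (\<alpha>, \<beta>)" by (cases p)
      obtain \<gamma> \<delta> where cd: "q = (\<gamma>, \<delta>)" by (cases q)
      note * = mce_pairsD[OF p[unfolded ab] assms] and ** = mce_pairsD[OF q[unfolded cd] assms]
      have e: "\<mu> \<star> \<alpha> = \<mu> \<star> \<gamma>" using eq ab cd by simp
      have "\<alpha> = \<gamma>" by (rule cancel_left[OF \<mu> *(1) **(1) *(3) **(3) e])
      moreover have "\<beta> = \<delta>" by (rule cancel_left[OF \<nu> *(2) **(2) *(4) **(4)]) (use e *(5) **(5) in simp)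
      ultimately show "p = q" using ab cd by simp
    qed
  qed (auto simp: mce_pairs_def MCE_def)
  also have "(\<lambda>p. \<mu> \<star> fst p) ` ?P = \<M> \<mu> \<nu>"
  proof (intro subset_antisym subsetI)
    fix \<omega> assume w: "\<omega> \<in> \<M> \<mu> \<nu>"
    then have "\<mu> \<preceq> \<omega>" "\<nu> \<preceq> \<omega>" using MCE_iff[OF assms] by auto
    then obtain \<alpha> \<beta> where "\<alpha> \<in> \<P>" "\<s> \<mu> = \<r> \<alpha>" "\<omega> = \<mu> \<star> \<alpha>" "\<beta> \<in> \<P>" "\<s> \<nu> = \<r> \<beta>" "\<omega> = \<nu> \<star> \<beta>"
      by (auto elim!: prefix_ofE)
    then have "(\<alpha>, \<beta>) \<in> ?P" "\<omega> = \<mu> \<star> fst (\<alpha>, \<beta>)" using w by (auto simp: mce_pairs_def)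
    then show "\<omega> \<in> (\<lambda>p. \<mu> \<star> fst p) ` ?P" by blast
  qed (auto simp: mce_pairs_def)
  finally show ?thesis .
qed

lemma pr_commute: "\<lbrakk>\<mu> \<in> \<P>; \<nu> \<in> \<P>\<rbrakk> \<Longrightarrow> pr \<mu> \<otimes> pr \<nu> = pr \<nu> \<otimes> pr \<mu>"
  using pr_mult[of \<mu> \<nu>] pr_mult[of \<nu> \<mu>] MCE_commute[of \<mu> \<nu>] by simp

text \<open>(CK3) is applied to the two inner factors. The target set \<open>K\<close> is left open
  so that one computation serves the finite core algebras and the homogeneous subspaces.\<close>

lemma gen_mult:
  assumes \<mu>: "\<mu> \<in> \<P>" and \<nu>: "\<nu> \<in> \<P>" and \<sigma>: "\<sigma> \<in> \<P>" and \<tau>: "\<tau> \<in> \<P>"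
    and s: "\<s> \<mu> = \<s> \<nu>" "\<s> \<sigma> = \<s> \<tau>"
    and K: "\<And>\<alpha> \<beta>. (\<alpha>, \<beta>) \<in> mce_pairs \<nu> \<sigma> \<Longrightarrow> t (\<mu> \<star> \<alpha>) \<otimes> st (\<tau> \<star> \<beta>) \<in> lin A K" "K \<subseteq> carrier A"
  shows "(t \<mu> \<otimes> st \<nu>) \<otimes> (t \<sigma> \<otimes> st \<tau>) \<in> lin A K"
proof -
  let ?P = "mce_pairs \<nu> \<sigma>"
  have fin: "finite ?P" by (rule mce_pairs_finite[OF \<nu> \<sigma>])
  have "(t \<mu> \<otimes> st \<nu>) \<otimes> (t \<sigma> \<otimes> st \<tau>) = (t \<mu> \<otimes> (st \<nu> \<otimes> t \<sigma>)) \<otimes> st \<tau>"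
    using \<mu> \<nu> \<sigma> \<tau> by (simp add: mult_assoc)
  also have "\<dots> = finsum A (\<lambda>p. (t \<mu> \<otimes> (case p of (\<alpha>, \<beta>) \<Rightarrow> t \<alpha> \<otimes> st \<beta>)) \<otimes> st \<tau>) ?P"
    unfolding CK3'[OF \<nu> \<sigma>] using \<mu> \<tau> fin mce_pairs_fun[of \<nu> \<sigma>]
    by (subst mult_finsum_right) (auto intro!: mult_finsum_left simp: mce_pairs_def)
  also have "\<dots> \<in> lin A K"
  proof (rule lin_finsum[OF fin _ K(2)])
    fix p assume p: "p \<in> ?P"
    obtain \<alpha> \<beta> where ab: "p = (\<alpha>, \<beta>)" by (cases p)
    note * = mce_pairsD[OF p[unfolded ab] \<nu> \<sigma>]
    have ss: "\<s> \<mu> = \<r> \<alpha>" "\<s> \<tau> = \<r> \<beta>" using s *(3,4) by simp_all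
    have "(t \<mu> \<otimes> (t \<alpha> \<otimes> st \<beta>)) \<otimes> st \<tau> = (t \<mu> \<otimes> t \<alpha>) \<otimes> (st \<beta> \<otimes> st \<tau>)"
      using \<mu> \<tau> *(1,2) by (simp add: mult_assoc)
    also have "\<dots> = t (\<mu> \<star> \<alpha>) \<otimes> st (\<tau> \<star> \<beta>)" using t_cmp[OF \<mu> *(1) ss(1)] st_cmp[OF \<tau> *(2) ss(2)] by simp
    finally show "(t \<mu> \<otimes> (case p of (\<alpha>, \<beta>) \<Rightarrow> t \<alpha> \<otimes> st \<beta>)) \<otimes> st \<tau> \<in> lin A K"
      using K(1) p ab by simp
  qed
  finally show ?thesis .
qed

text \<open>Written exactly as the product in (CK4), so that (CK4) applies to it after
  unfolding.\<close>

definition gap :: "'l \<Rightarrow> 'l list \<Rightarrow> 'a" where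
  "gap v es = foldr (\<lambda>\<mu> a. (t v \<ominus> t \<mu> \<otimes> st \<mu>) \<otimes> a) es (t v)"

lemma gap_Nil [simp]: "gap v [] = t v"
  and gap_Cons: "gap v (\<mu> # es) = (t v \<ominus> pr \<mu>) \<otimes> gap v es"
  by (simp_all add: gap_def)

lemma vertex_minus_pr:
  assumes v: "v \<in> \<V>" and \<alpha>: "\<alpha> \<in> \<P>" "\<r> \<alpha> = v"
  shows "t v \<ominus> pr \<alpha> \<in> carrier A" "nrm A (t v \<ominus> pr \<alpha>) \<le> 1"
    "t v \<otimes> pr \<alpha> = pr \<alpha>" "pr \<alpha> \<otimes> t v = pr \<alpha>"
    "pr \<alpha> \<otimes> (t v \<ominus> pr \<alpha>) = \<zero>" "(t v \<ominus> pr \<alpha>) \<otimes> pr \<alpha> = \<zero>"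
    "t v \<otimes> (t v \<ominus> pr \<alpha>) = t v \<ominus> pr \<alpha>"
proof -
  note tv = vertexD(1)[OF v] t_vertex[OF v]
  note p = pr_props[OF \<alpha>(1)]
  show c: "t v \<ominus> pr \<alpha> \<in> carrier A" using tv(1) p(1) by simp
  have tt: "t v \<otimes> t \<alpha> = t \<alpha>" "st \<alpha> \<otimes> t v = st \<alpha>" using t_rng[OF \<alpha>(1)] st_rng[OF \<alpha>(1)] \<alpha>(2) by simp_all
  show l: "t v \<otimes> pr \<alpha> = pr \<alpha>" using tt(1) tv(1) \<alpha> by (simp add: mult_assoc[symmetric])
  show r: "pr \<alpha> \<otimes> t v = pr \<alpha>" using tt(2) tv(1) \<alpha> by (simp add: mult_assoc)
  show a: "pr \<alpha> \<otimes> (t v \<ominus> pr \<alpha>) = \<zero>" using mult_minus_right[OF _ p(1) p(1), of "t v"] tv(1) r p(3) p(1) by simp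
  show b: "(t v \<ominus> pr \<alpha>) \<otimes> pr \<alpha> = \<zero>" using mult_minus_left[OF _ p(1) p(1), of "t v"] tv(1) l p(3) p(1) by simp
  show d: "t v \<otimes> (t v \<ominus> pr \<alpha>) = t v \<ominus> pr \<alpha>" using mult_minus_right[of "t v" "pr \<alpha>" "t v"] tv p(1) l by simp
  have "(t v \<ominus> pr \<alpha>) \<otimes> (t v \<ominus> pr \<alpha>) = t v \<ominus> pr \<alpha>"
    using mult_minus_left[of "t v" "pr \<alpha>" "t v \<ominus> pr \<alpha>"] tv(1) p(1) c a d by simp
  moreover have "adj A (t v \<ominus> pr \<alpha>) = t v \<ominus> pr \<alpha>" using adj_minus[of "t v" "pr \<alpha>"] tv p(1,2) by simp
  ultimately show "nrm A (t v \<ominus> pr \<alpha>) \<le> 1" using nrm_projection c by blast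
qed

context
  fixes v es
  assumes v: "v \<in> \<V>" and es: "set es \<subseteq> {\<alpha> \<in> \<P>. \<r> \<alpha> = v}"
begin

lemma gap_closed: "gap v es \<in> carrier A"
  using es by (induction es) (use v vertexD(1) vertex_minus_pr(1)[OF v] in \<open>auto simp: gap_Cons\<close>)

lemma nrm_gap: "nrm A (gap v es) \<le> 1"
  using es
proof (induction es)
  case Nil
  then show ?case using nrm_vertex_le[OF v] by simp
next
  case (Cons \<mu> es)
  then have m: "\<mu> \<in> \<P>" "\<r> \<mu> = v" "set es \<subseteq> {\<alpha> \<in> \<P>. \<r> \<alpha> = v}" by auto
  have "gap v es \<in> carrier A" using ck_kgraph.gap_closed[OF ck_kgraph_axioms v m(3)] .
  then show ?case
    using nrm_mult_le_left[OF vertex_minus_pr(1)[OF v m(1,2)] _ vertex_minus_pr(2)[OF v m(1,2)]] Cons.IH[OF m(3)]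
    by (simp add: gap_Cons) (meson order_trans)
qed

end

text \<open>Since \<open>r\<close> annihilates every range projection of the list, each factor of
  the gap acts on it as \<open>t v\<close>.\<close>

lemma gap_absorb_left:
  assumes v: "v \<in> \<V>" and es: "set es \<subseteq> {\<alpha> \<in> \<P>. \<r> \<alpha> = v}"
    and r: "r \<in> carrier A" "\<And>\<alpha>. \<alpha> \<in> set es \<Longrightarrow> r \<otimes> pr \<alpha> = \<zero>"
  shows "r \<otimes> gap v es = r \<otimes> t v"
  using es r(2)
proof (induction es)
  case (Cons \<mu> es)
  then have m: "\<mu> \<in> \<P>" "\<r> \<mu> = v" "set es \<subseteq> {\<alpha> \<in> \<P>. \<r> \<alpha> = v}" "r \<otimes> pr \<mu> = \<zero>" by auto
  note g = gap_closed[OF v m(3)]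
  have tv: "t v \<in> carrier A" using vertexD(1)[OF v] by simp
  have "r \<otimes> gap v (\<mu> # es) = (r \<otimes> (t v \<ominus> pr \<mu>)) \<otimes> gap v es"
    unfolding gap_Cons by (rule mult_assoc[symmetric, OF r(1) vertex_minus_pr(1)[OF v m(1,2)] g])
  also have "r \<otimes> (t v \<ominus> pr \<mu>) = r \<otimes> t v"
    using mult_minus_right[OF tv pr_props(1)[OF m(1)] r(1)] m(4) tv r(1) by simp
  also have "(r \<otimes> t v) \<otimes> gap v es = r \<otimes> (t v \<otimes> gap v es)" by (rule mult_assoc[OF r(1) tv g])
  also have "t v \<otimes> gap v es = gap v es"
  proof (cases es)
    case Nil
    then show ?thesis using t_vertex[OF v] by simp
  next
    case (Cons \<nu> fs)
    have n: "\<nu> \<in> \<P>" "\<r> \<nu> = v" "set fs \<subseteq> {\<alpha> \<in> \<P>. \<r> \<alpha> = v}" using m(3) Cons by auto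
    show ?thesis unfolding Cons gap_Cons
      using mult_assoc[OF tv vertex_minus_pr(1)[OF v n(1,2)] gap_closed[OF v n(3)]] vertex_minus_pr(7)[OF v n(1,2)] by simp
  qed
  also have "r \<otimes> gap v es = r \<otimes> t v" using Cons.IH[OF m(3)] Cons.prems(2) by simp
  finally show ?case .
qed simp

lemma gap_commute:
  assumes v: "v \<in> \<V>" and es: "set es \<subseteq> {\<alpha> \<in> \<P>. \<r> \<alpha> = v}"
    and \<beta>: "\<beta> \<in> \<P>" "\<r> \<beta> = v"
  shows "pr \<beta> \<otimes> gap v es = gap v es \<otimes> pr \<beta>"
  using es
proof (induction es)
  case Nil
  then show ?case using vertex_minus_pr(3,4)[OF v \<beta>] by simp
next
  case (Cons \<mu> es)
  then have m: "\<mu> \<in> \<P>" "\<r> \<mu> = v" "set es \<subseteq> {\<alpha> \<in> \<P>. \<r> \<alpha> = v}" by auto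
  note g = gap_closed[OF v m(3)]
  note x = vertex_minus_pr(1)[OF v m(1,2)] and b = pr_props(1)[OF \<beta>(1)]
  have tv: "t v \<in> carrier A" using vertexD(1)[OF v] by simp
  have "pr \<beta> \<otimes> (t v \<ominus> pr \<mu>) = (t v \<ominus> pr \<mu>) \<otimes> pr \<beta>"
    using mult_minus_right[OF tv pr_props(1)[OF m(1)] b] mult_minus_left[OF tv pr_props(1)[OF m(1)] b]
      pr_commute[OF \<beta>(1) m(1)] vertex_minus_pr(3,4)[OF v \<beta>] by simp
  then show ?case
    unfolding gap_Cons using mult_assoc[OF b x g] mult_assoc[OF x b g] mult_assoc[OF x g b] Cons.IH[OF m(3)] by simp
qed

text \<open>The factor belonging to \<open>\<beta>\<close> annihilates \<open>pr \<beta>\<close>,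
  which can be moved there because range projections commute.\<close>

lemma gap_kill:
  assumes v: "v \<in> \<V>" and es: "set es \<subseteq> {\<alpha> \<in> \<P>. \<r> \<alpha> = v}" and \<beta>: "\<beta> \<in> set es"
  shows "pr \<beta> \<otimes> gap v es = \<zero>" "gap v es \<otimes> t \<beta> = \<zero>" "st \<beta> \<otimes> gap v es = \<zero>"
proof -
  have b: "\<beta> \<in> \<P>" "\<r> \<beta> = v" using es \<beta> by auto
  note bc = pr_props(1)[OF b(1)]
  show k: "pr \<beta> \<otimes> gap v es = \<zero>"
    using es \<beta>
  proof (induction es)
    case (Cons \<mu> es)
    then have m: "\<mu> \<in> \<P>" "\<r> \<mu> = v" "set es \<subseteq> {\<alpha> \<in> \<P>. \<r> \<alpha> = v}" by auto
    note g = gap_closed[OF v m(3)]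
    note x = vertex_minus_pr(1)[OF v m(1,2)]
    have tv: "t v \<in> carrier A" using vertexD(1)[OF v] by simp
    show ?case
    proof (cases "\<beta> = \<mu>")
      case True
      then show ?thesis unfolding gap_Cons
        using mult_assoc[OF bc x g] vertex_minus_pr(5)[OF v m(1,2)] g by simp
    next
      case False
      then have IH: "pr \<beta> \<otimes> gap v es = \<zero>" using Cons.IH[OF m(3)] Cons.prems(2) by simp
      have "pr \<beta> \<otimes> (t v \<ominus> pr \<mu>) = (t v \<ominus> pr \<mu>) \<otimes> pr \<beta>"
        using mult_minus_right[OF tv pr_props(1)[OF m(1)] bc] mult_minus_left[OF tv pr_props(1)[OF m(1)] bc]
          pr_commute[OF b(1) m(1)] vertex_minus_pr(3,4)[OF v b] by simp
      then show ?thesis unfolding gap_Cons using mult_assoc[OF bc x g] mult_assoc[OF x bc g] IH x by simp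
    qed
  qed simp
  note g = gap_closed[OF v es]
  have t: "t \<beta> \<in> carrier A" "st \<beta> \<in> carrier A" using b by simp_all
  have "gap v es \<otimes> t \<beta> = gap v es \<otimes> (pr \<beta> \<otimes> t \<beta>)" using pr_props(4)[OF b(1)] by simp
  also have "\<dots> = (gap v es \<otimes> pr \<beta>) \<otimes> t \<beta>" by (rule mult_assoc[symmetric, OF g bc t(1)])
  finally show "gap v es \<otimes> t \<beta> = \<zero>" using k gap_commute[OF v es b] t by simp
  have "st \<beta> \<otimes> gap v es = (st \<beta> \<otimes> pr \<beta>) \<otimes> gap v es" using pr_props(5)[OF b(1)] by simp
  also have "\<dots> = st \<beta> \<otimes> (pr \<beta> \<otimes> gap v es)" by (rule mult_assoc[OF t(2) bc g])
  finally show "st \<beta> \<otimes> gap v es = \<zero>" using k t by simp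
qed

end

section \<open>Finiteness of the closure of a set of paths\<close>

context k_graph
begin

text \<open>The closure under which generators of equal degree and source span an algebra: in a
  product the inner paths contribute minimal common extensions, which \<open>mce\<close> supplies,
  and \<open>swap\<close> carries the appended tails over to the outer paths.\<close>

inductive_set Pi_closure :: "'l set \<Rightarrow> 'l set" for F where
  base: "\<mu> \<in> F \<Longrightarrow> \<mu> \<in> Pi_closure F"
| mce: "\<lbrakk>\<mu> \<in> Pi_closure F; \<nu> \<in> Pi_closure F; \<omega> \<in> \<M> \<mu> \<nu>\<rbrakk> \<Longrightarrow> \<omega> \<in> Pi_closure F"
| swap: "\<lbrakk>\<mu> \<in> Pi_closure F; \<nu> \<in> Pi_closure F; \<nu> \<cdot> \<alpha> \<in> Pi_closure F; \<alpha> \<in> \<P>; \<s> \<nu> = \<r> \<alpha>;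
    \<s> \<mu> = \<s> \<nu>; \<d> \<mu> = \<d> \<nu>\<rbrakk> \<Longrightarrow> \<mu> \<cdot> \<alpha> \<in> Pi_closure F"

lemma Pi_closure_paths: "\<lbrakk>\<omega> \<in> Pi_closure F; F \<subseteq> \<P>\<rbrakk> \<Longrightarrow> \<omega> \<in> \<P>"
  by (induction rule: Pi_closure.induct) (auto simp: MCE_def)

text \<open>\<open>mce\<close> takes joins of degrees and \<open>swap\<close> keeps the degree, so
  the closure stays in a finite box of degrees and finiteness can be shown for one degree at a
  time.\<close>

lemma Pi_closure_deg:
  assumes "\<omega> \<in> Pi_closure F" "F \<subseteq> \<P>" "\<And>\<mu>. \<mu> \<in> F \<Longrightarrow> \<d> \<mu> \<le> N"
  shows "\<d> \<omega> \<le> N"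
  using assms(1)
proof (induction rule: Pi_closure.induct)
  case (mce \<mu> \<nu> \<omega>)
  then have "\<d> \<omega> = sup (\<d> \<mu>) (\<d> \<nu>)" by (simp add: MCE_def)
  then show ?case using mce.IH by (metis le_sup_iff)
next
  case (swap \<mu> \<nu> \<alpha>)
  have "\<mu> \<in> \<P>" "\<nu> \<in> \<P>" using swap Pi_closure_paths assms(2) by blast+
  then have "\<d> (\<mu> \<cdot> \<alpha>) = \<d> (\<nu> \<cdot> \<alpha>)" using swap by (simp add: deg_cmp)
  then show ?case using swap by simp
qed (use assms(3) in blast)

lemma finite_le_degrees: "finite {e :: 'k \<Rightarrow> nat. e \<le> d}"
proof -
  have "{e. e \<le> d} = PiE UNIV (\<lambda>i. {..d i})" by (auto simp: le_fun_def PiE_def)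
  then show ?thesis by (simp add: finite_PiE)
qed

text \<open>Writing \<open>Pi\<close> for the closure, a path of degree \<open>d\<close> in \<open>Pi\<close> is either in the set \<open>S\<close> of base points and
  of minimal common extensions of two elements of \<open>Pi\<close> of smaller degree, or is obtained from an element of \<open>S\<close>
  by a single replacement of an initial segment.\<close>

lemma Pi_closure_finite_deg:
  assumes fa: "finitely_aligned \<Lambda>" and F: "finite F" "F \<subseteq> \<P>"
  shows "finite {\<omega> \<in> Pi_closure F. \<d> \<omega> = d}"
proof (induction d rule: measure_induct_rule[of "\<lambda>d. \<Sum>i\<in>UNIV. d i"])
  case (less d)
  let ?Pi = "Pi_closure F"
  define L where "L = {\<mu> \<in> ?Pi. \<d> \<mu> \<le> d \<and> \<d> \<mu> \<noteq> d}"
  have Pp: "\<mu> \<in> \<P>" if "\<mu> \<in> ?Pi" for \<mu> using Pi_closure_paths[OF that F(2)] .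
  have "finite {\<omega> \<in> ?Pi. \<d> \<omega> = e}" if e: "e \<le> d" "e \<noteq> d" for e
  proof (rule less)
    obtain i where "e i \<noteq> d i" using e(2) by auto
    then have "e i < d i" using e(1) by (simp add: le_fun_def less_le)
    then show "(\<Sum>i\<in>UNIV. e i) < (\<Sum>i\<in>UNIV. d i)" using e(1) by (intro sum_strict_mono_ex1) (auto simp: le_fun_def)
  qed
  then have "finite (\<Union>e\<in>{e. e \<le> d} - {d}. {\<omega> \<in> ?Pi. \<d> \<omega> = e})" using finite_le_degrees by auto
  moreover have "L \<subseteq> (\<Union>e\<in>{e. e \<le> d} - {d}. {\<omega> \<in> ?Pi. \<d> \<omega> = e})" by (auto simp: L_def)
  ultimately have L: "finite L" by (rule rev_finite_subset)
  define S where "S = {\<omega> \<in> F \<union> (\<Union>\<mu>\<in>L. \<Union>\<nu>\<in>L. \<M> \<mu> \<nu>). \<d> \<omega> = d}"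
  have fm: "finite (\<M> \<mu> \<nu>)" if "\<mu> \<in> L" "\<nu> \<in> L" for \<mu> \<nu>
    using that Pp fa by (simp add: L_def finitely_aligned_def)
  have "finite (F \<union> (\<Union>\<mu>\<in>L. \<Union>\<nu>\<in>L. \<M> \<mu> \<nu>))"
    using F(1) L fm by (intro finite_UnI finite_UN_I)
  then have S: "finite S" by (rule rev_finite_subset) (auto simp: S_def)
  have Sp: "\<omega> \<in> \<P>" if "\<omega> \<in> S" for \<omega> using that F(2) by (auto simp: S_def MCE_def)
  \<comment> \<open>The remainder of \<open>\<omega>\<close> after its initial segment of degree
    \<open>e\<close>.\<close>
  define tail where "tail \<omega> e = (SOME \<beta>. \<exists>\<alpha> \<in> \<P>. \<beta> \<in> \<P> \<and> \<s> \<alpha> = \<r> \<beta> \<and> \<omega> = \<alpha> \<cdot> \<beta> \<and> \<d> \<alpha> = e)" for \<omega> e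
  have tail: "tail (\<alpha> \<cdot> \<beta>) (\<d> \<alpha>) = \<beta>" if "\<alpha> \<in> \<P>" "\<beta> \<in> \<P>" "\<s> \<alpha> = \<r> \<beta>" for \<alpha> \<beta>
    unfolding tail_def
  proof (rule some_equality)
    fix \<gamma> assume "\<exists>\<alpha>' \<in> \<P>. \<gamma> \<in> \<P> \<and> \<s> \<alpha>' = \<r> \<gamma> \<and> \<alpha> \<cdot> \<beta> = \<alpha>' \<cdot> \<gamma> \<and> \<d> \<alpha>' = \<d> \<alpha>"
    then show "\<gamma> = \<beta>" using factor_unique(2)[OF that] by metis
  qed (use that in blast)
  define W where "W = S \<union> (\<lambda>(\<mu>, \<omega>). \<mu> \<cdot> tail \<omega> (\<d> \<mu>)) ` {(\<mu>, \<omega>) \<in> L \<times> S. \<s> \<mu> = \<r> (tail \<omega> (\<d> \<mu>))}"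
  have "finite {(\<mu>, \<omega>) \<in> L \<times> S. \<s> \<mu> = \<r> (tail \<omega> (\<d> \<mu>))}"
    by (rule finite_subset[OF _ finite_cartesian_product[OF L S]]) auto
  then have W: "finite W" using S by (simp add: W_def)
  have WI: "\<mu> \<cdot> \<beta> \<in> W" if "\<mu> \<in> L" "\<omega>' \<cdot> \<beta> \<in> S" "\<d> \<omega>' = \<d> \<mu>" "\<omega>' \<in> \<P>" "\<beta> \<in> \<P>" "\<s> \<omega>' = \<r> \<beta>"
      "\<s> \<mu> = \<r> \<beta>"
    for \<mu> \<omega>' \<beta>
  proof -
    have "(\<mu>, \<omega>' \<cdot> \<beta>) \<in> {(\<mu>, \<omega>) \<in> L \<times> S. \<s> \<mu> = \<r> (tail \<omega> (\<d> \<mu>))}"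
      "\<mu> \<cdot> \<beta> = (\<lambda>(\<mu>, \<omega>). \<mu> \<cdot> tail \<omega> (\<d> \<mu>)) (\<mu>, \<omega>' \<cdot> \<beta>)"
      using that tail[OF that(4-6)] by simp_all
    then show ?thesis unfolding W_def by blast
  qed
  have WE: "\<omega> \<in> S \<or> (\<exists>\<mu> \<omega>' \<beta>. \<omega> = \<mu> \<cdot> \<beta> \<and> \<mu> \<in> L \<and> \<omega>' \<cdot> \<beta> \<in> S \<and> \<d> \<omega>' = \<d> \<mu> \<and> \<omega>' \<in> \<P> \<and> \<beta> \<in> \<P> \<and> \<s> \<omega>' = \<r> \<beta> \<and> \<s> \<mu> = \<r> \<beta>)"
    if "\<omega> \<in> W" for \<omega>
  proof (cases "\<omega> \<in> S")
    case False
    then obtain \<mu> \<eta> where *: "\<mu> \<in> L" "\<eta> \<in> S" "\<omega> = \<mu> \<cdot> tail \<eta> (\<d> \<mu>)"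
      "\<s> \<mu> = \<r> (tail \<eta> (\<d> \<mu>))" using \<open>\<omega> \<in> W\<close> by (auto simp: W_def)
    have "\<d> \<mu> \<le> \<d> \<eta>" using *(1,2) by (simp add: L_def S_def)
    then obtain \<omega>' \<beta> where f: "\<omega>' \<in> \<P>" "\<beta> \<in> \<P>" "\<s> \<omega>' = \<r> \<beta>" "\<d> \<omega>' = \<d> \<mu>" "\<eta> = \<omega>' \<cdot> \<beta>"
      using factor_ex[OF Sp[OF *(2)]] by metis
    have "tail \<eta> (\<d> \<mu>) = \<beta>" using tail[OF f(1-3)] f(4,5) by simp
    then have "\<omega> = \<mu> \<cdot> \<beta>" "\<s> \<mu> = \<r> \<beta>" using *(3,4) by simp_all
    moreover have "\<omega>' \<cdot> \<beta> \<in> S" using *(2) f(5) by simp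
    ultimately show ?thesis using *(1) f(1-4) by blast
  qed simp
  have "\<omega> \<in> W" if "\<omega> \<in> ?Pi" "\<d> \<omega> = d" for \<omega>
    using that
  proof (induction rule: Pi_closure.induct)
    case (base \<mu>)
    then show ?case by (simp add: W_def S_def)
  next
    case (mce \<mu> \<nu> \<omega>)
    have pre: "\<mu> \<preceq> \<omega>" "\<nu> \<preceq> \<omega>"
      using mce.hyps(3) MCE_iff[OF Pp[OF mce.hyps(1)] Pp[OF mce.hyps(2)]] by blast+
    note le = prefix_of_deg[OF pre(1), unfolded mce.prems] prefix_of_deg[OF pre(2), unfolded mce.prems]
    consider "\<d> \<mu> = d" | "\<d> \<nu> = d" | "\<d> \<mu> \<noteq> d" "\<d> \<nu> \<noteq> d" by blast
    then show ?case
    proof cases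
      case 1
      then have "\<mu> = \<omega>" using prefix_of_same_deg[OF pre(1)] mce.prems by metis
      then show ?thesis using mce.IH(1)[OF 1] by metis
    next
      case 2
      then have "\<nu> = \<omega>" using prefix_of_same_deg[OF pre(2)] mce.prems by metis
      then show ?thesis using mce.IH(2)[OF 2] by metis
    next
      case 3
      then have "\<mu> \<in> L" "\<nu> \<in> L" using mce.hyps(1,2) le by (simp_all add: L_def)
      then have "\<omega> \<in> S" unfolding S_def using mce.hyps(3) mce.prems by blast
      then show ?thesis unfolding W_def by blast
    qed
  next
    case (swap \<mu> \<nu> \<alpha>)
    have p: "\<mu> \<in> \<P>" "\<nu> \<in> \<P>" using swap.hyps(1,2) Pp by blast+
    have s: "\<s> \<mu> = \<r> \<alpha>" using swap.hyps by simp
    have dd: "\<d> (\<nu> \<cdot> \<alpha>) = d"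
      using deg_cmp[OF p(2) swap.hyps(4,5)] deg_cmp[OF p(1) swap.hyps(4) s] swap.hyps(7) swap.prems by simp
    have IH: "\<nu> \<cdot> \<alpha> \<in> W" using swap.IH(3) dd by simp
    have le: "\<d> \<mu> \<le> d" using prefix_of_deg[OF prefix_ofI[OF p(1) swap.hyps(4) s]] swap.prems by simp
    show ?case
    proof (cases "\<d> \<mu> = d")
      case True
      then have "\<mu> = \<mu> \<cdot> \<alpha>" using prefix_of_same_deg[OF prefix_ofI[OF p(1) swap.hyps(4) s]] swap.prems by simp
      then show ?thesis using swap.IH(1) True by simp
    next
      case False
      then have mL: "\<mu> \<in> L" "\<nu> \<in> L" using swap.hyps(1,2,7) le by (simp_all add: L_def)
      show ?thesis
      proof (cases "\<nu> \<cdot> \<alpha> \<in> S")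
        case True
        then show ?thesis using WI[OF mL(1) True] swap.hyps p by simp
      next
        case False
        \<comment> \<open>Two successive replacements must be merged into one. Compare the cut
          points \<open>\<nu>\<close> and \<open>\<mu>1\<close> through a minimal common extension
          \<open>\<eta>\<close> inside the path. If \<open>\<eta>\<close> were the whole path, that
          path would lie in \<open>S\<close>. Otherwise both replacements can be cut at
          \<open>\<eta>\<close>: the head \<open>\<mu> \<cdot> \<gamma>\<close> has smaller degree
          and lies in the closure, and a single replacement in front of \<open>\<delta>\<close>
          suffices.\<close>
        then obtain \<mu>1 \<omega>1 \<alpha>1 where o: "\<nu> \<cdot> \<alpha> = \<mu>1 \<cdot> \<alpha>1" "\<mu>1 \<in> L" "\<omega>1 \<cdot> \<alpha>1 \<in> S" "\<d> \<omega>1 = \<d> \<mu>1" "\<omega>1 \<in> \<P>"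
          "\<alpha>1 \<in> \<P>" "\<s> \<omega>1 = \<r> \<alpha>1" "\<s> \<mu>1 = \<r> \<alpha>1" using WE[OF IH] by blast
        have m1p: "\<mu>1 \<in> \<P>" using o(2) Pp by (simp add: L_def)
        have m1: "\<mu>1 \<in> ?Pi" "\<d> \<mu>1 \<noteq> d" using o(2) by (simp_all add: L_def)
        have pre: "\<nu> \<preceq> \<nu> \<cdot> \<alpha>" "\<mu>1 \<preceq> \<nu> \<cdot> \<alpha>"
          using prefix_ofI[OF p(2) swap.hyps(4,5)] prefix_ofI[OF m1p o(6,8)] o(1) by simp_all
        obtain \<eta> where \<eta>: "\<eta> \<in> \<M> \<nu> \<mu>1" "\<eta> \<preceq> \<nu> \<cdot> \<alpha>"
          by (rule MCE_common_extension[OF pre])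
        note \<eta>' = \<eta>(1)[unfolded MCE_iff[OF p(2) m1p]]
        have \<eta>d: "\<d> \<eta> \<noteq> d"
        proof
          assume "\<d> \<eta> = d"
          then have "\<eta> = \<nu> \<cdot> \<alpha>" using prefix_of_same_deg[OF \<eta>(2)] dd by simp
          then have "\<nu> \<cdot> \<alpha> \<in> S" using \<eta>(1) mL(2) o(2) dd by (auto simp: S_def)
          then show False using False by simp
        qed
        have \<eta>Pi: "\<eta> \<in> ?Pi" by (rule Pi_closure.mce[OF swap.hyps(2) m1(1) \<eta>(1)])
        obtain \<gamma> where g: "\<gamma> \<in> \<P>" "\<s> \<nu> = \<r> \<gamma>" "\<eta> = \<nu> \<cdot> \<gamma>" using \<eta>' by (auto elim: prefix_ofE)
        obtain \<gamma>1 where g1: "\<gamma>1 \<in> \<P>" "\<s> \<mu>1 = \<r> \<gamma>1" "\<eta> = \<mu>1 \<cdot> \<gamma>1" using \<eta>' by (auto elim: prefix_ofE)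
        obtain \<delta> where dl: "\<delta> \<in> \<P>" "\<s> \<eta> = \<r> \<delta>" "\<nu> \<cdot> \<alpha> = \<eta> \<cdot> \<delta>" using \<eta>(2) by (auto elim: prefix_ofE)
        have sd: "\<s> \<gamma> = \<r> \<delta>" "\<s> \<gamma>1 = \<r> \<delta>"
          using src_cmp[OF p(2) g(1,2)] src_cmp[OF m1p g1(1,2)] dl(2) g(3) g1(3) by simp_all
        have "\<nu> \<cdot> \<alpha> = \<nu> \<cdot> (\<gamma> \<cdot> \<delta>)" unfolding dl(3) g(3) by (rule cmp_assoc[OF p(2) g(1) dl(1) g(2) sd(1)])
        then have \<alpha>: "\<alpha> = \<gamma> \<cdot> \<delta>"
          by (intro cancel_left[OF p(2) swap.hyps(4) cmp_closed[OF g(1) dl(1) sd(1)] swap.hyps(5)])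
            (use g sd dl in simp_all)
        have "\<mu>1 \<cdot> \<alpha>1 = \<mu>1 \<cdot> (\<gamma>1 \<cdot> \<delta>)"
          unfolding o(1)[symmetric] dl(3) g1(3) by (rule cmp_assoc[OF m1p g1(1) dl(1) g1(2) sd(2)])
        then have \<alpha>1: "\<alpha>1 = \<gamma>1 \<cdot> \<delta>"
          by (intro cancel_left[OF m1p o(6) cmp_closed[OF g1(1) dl(1) sd(2)] o(8)])
            (use g1 sd dl in simp_all)
        have s\<mu>: "\<s> \<mu> = \<r> \<gamma>" and s\<omega>: "\<s> \<omega>1 = \<r> \<gamma>1"
          using swap.hyps(6) g(2) o(7) \<alpha>1 rng_cmp[OF g1(1) dl(1) sd(2)] by simp_all
        have "\<mu> \<cdot> \<gamma> \<in> ?Pi"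
          by (rule Pi_closure.swap[OF swap.hyps(1,2) _ g(1,2) swap.hyps(6,7)]) (use \<eta>Pi g(3) in simp)
        moreover have dmg: "\<d> (\<mu> \<cdot> \<gamma>) = \<d> \<eta>"
          using deg_cmp[OF p(1) g(1) s\<mu>] deg_cmp[OF p(2) g(1,2)] swap.hyps(7) g(3) by simp
        moreover have "\<d> \<eta> \<le> d" using prefix_of_deg[OF \<eta>(2)] dd by simp
        ultimately have "\<mu> \<cdot> \<gamma> \<in> L" using \<eta>d by (simp add: L_def)
        moreover have "(\<omega>1 \<cdot> \<gamma>1) \<cdot> \<delta> \<in> S"
          using o(3) \<alpha>1 cmp_assoc[OF o(5) g1(1) dl(1) s\<omega> sd(2)] by simp
        moreover have "\<d> (\<omega>1 \<cdot> \<gamma>1) = \<d> (\<mu> \<cdot> \<gamma>)"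
          using deg_cmp[OF o(5) g1(1) s\<omega>] deg_cmp[OF m1p g1(1,2)] o(4) g1(3) dmg by simp
        ultimately have "(\<mu> \<cdot> \<gamma>) \<cdot> \<delta> \<in> W"
          using cmp_closed[OF o(5) g1(1) s\<omega>] dl(1) src_cmp[OF o(5) g1(1) s\<omega>] src_cmp[OF p(1) g(1) s\<mu>] sd
          by (intro WI) simp_all
        then show ?thesis using cmp_assoc[OF p(1) g(1) dl(1) s\<mu> sd(1)] \<alpha> by simp
      qed
    qed
  qed
  then have "{\<omega> \<in> ?Pi. \<d> \<omega> = d} \<subseteq> W" by blast
  then show ?case using W by (rule finite_subset)
qed

lemma Pi_closure_finite:
  assumes fa: "finitely_aligned \<Lambda>" and F: "finite F" "F \<subseteq> \<P>"
  shows "finite (Pi_closure F)"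
proof -
  define N where "N = (\<lambda>i. \<Sum>\<mu>\<in>F. \<d> \<mu> i)"
  have "\<d> \<mu> \<le> N" if "\<mu> \<in> F" for \<mu>
    unfolding N_def by (rule le_funI) (use F(1) that in \<open>auto intro: member_le_sum\<close>)
  then have sub: "Pi_closure F \<subseteq> (\<Union>d\<in>{d. d \<le> N}. {\<omega> \<in> Pi_closure F. \<d> \<omega> = d})"
    using Pi_closure_deg[OF _ F(2), of _ N] by auto
  have "finite (\<Union>d\<in>{d. d \<le> N}. {\<omega> \<in> Pi_closure F. \<d> \<omega> = d})"
    by (intro finite_UN_I finite_le_degrees Pi_closure_finite_deg[OF assms])
  then show ?thesis by (rule finite_subset[OF sub])
qed

end

section \<open>Finite subalgebras of the core\<close>

context ck_kgraph
begin

lemma deg_0_eq_src: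
  assumes "\<gamma> \<in> \<P>" "\<s> \<mu> = \<r> \<gamma>" "\<d> \<gamma> = 0" shows "\<gamma> = \<s> \<mu>"
  using vertexD(2)[of \<gamma>] assms by (simp add: vertices_def)

lemma gap_absorb_vertex:
  assumes v: "v \<in> \<V>" and es: "set es \<subseteq> {\<alpha> \<in> \<P>. \<r> \<alpha> = v}"
  shows "gap v es \<otimes> t v = gap v es"
  using es
proof (induction es)
  case Nil
  then show ?case using t_vertex[OF v] by simp
next
  case (Cons \<mu> es)
  then have m: "\<mu> \<in> \<P>" "\<r> \<mu> = v" "set es \<subseteq> {\<alpha> \<in> \<P>. \<r> \<alpha> = v}" by auto
  have tv: "t v \<in> carrier A" using vertexD(1)[OF v] by simp
  show ?case
    unfolding gap_Cons mult_assoc[OF vertex_minus_pr(1)[OF v m(1,2)] gap_closed[OF v m(3)] tv] Cons.IH[OF m(3)] ..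
qed

text \<open>The gap annihilates each \<open>pr \<alpha>\<close> of its own list, so a second copy of
  it acts as \<open>t v\<close>.\<close>

lemma gap_idem:
  assumes v: "v \<in> \<V>" and es: "set es \<subseteq> {\<alpha> \<in> \<P>. \<r> \<alpha> = v}"
  shows "gap v es \<otimes> gap v es = gap v es"
proof -
  have "gap v es \<otimes> pr \<alpha> = \<zero>" if a: "\<alpha> \<in> set es" for \<alpha>
  proof -
    have p: "\<alpha> \<in> \<P>" using a es by auto
    have "gap v es \<otimes> pr \<alpha> = (gap v es \<otimes> t \<alpha>) \<otimes> st \<alpha>"
      using mult_assoc[OF gap_closed[OF v es] t_closed[OF p] adj_closed[OF t_closed[OF p]]] by simp
    then show ?thesis using gap_kill(2)[OF v es a] p by simp
  qed
  then show ?thesis using gap_absorb_left[OF v es gap_closed[OF v es]] gap_absorb_vertex[OF v es] by simp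
qed

definition core_gens :: "'l set \<Rightarrow> 'a set" where
  "core_gens P = {t \<mu> \<otimes> st \<nu> |\<mu> \<nu>. \<mu> \<in> P \<and> \<nu> \<in> P \<and> \<d> \<mu> = \<d> \<nu> \<and> \<s> \<mu> = \<s> \<nu>}"

end

text \<open>The closure properties of \<open>Pi_closure F\<close>, detached from its
  construction.\<close>

locale core_paths = ck_kgraph \<Lambda> A t
  for \<Lambda> :: "('l, 'k::finite) kgraph" and A :: "'a cstar" (structure) and t :: "'l \<Rightarrow> 'a" +
  fixes P :: "'l set"
  assumes P_finite: "finite P" and P_paths: "\<mu> \<in> P \<Longrightarrow> \<mu> \<in> \<P>"
    and P_mce: "\<lbrakk>\<mu> \<in> P; \<nu> \<in> P; \<omega> \<in> \<M> \<mu> \<nu>\<rbrakk> \<Longrightarrow> \<omega> \<in> P"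
    and P_swap: "\<lbrakk>\<mu> \<in> P; \<nu> \<in> P; \<nu> \<star> \<alpha> \<in> P; \<alpha> \<in> \<P>; \<s> \<nu> = \<r> \<alpha>;
      \<s> \<mu> = \<s> \<nu>; \<d> \<mu> = \<d> \<nu>\<rbrakk> \<Longrightarrow> \<mu> \<star> \<alpha> \<in> P"
begin

text \<open>The proper continuations of \<open>\<xi>\<close> inside \<open>P\<close>; a nonzero
  degree excludes \<open>\<xi>\<close> itself.\<close>

definition exts :: "'l \<Rightarrow> 'l set" where
  "exts \<xi> = {\<alpha> \<in> \<P>. \<s> \<xi> = \<r> \<alpha> \<and> \<xi> \<star> \<alpha> \<in> P \<and> \<d> \<alpha> \<noteq> 0}"

definition enum :: "'l \<Rightarrow> 'l list" where
  "enum \<xi> = (SOME es. set es = exts \<xi> \<and> distinct es)"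

text \<open>For such \<open>w\<close> the element \<open>w t\<^sub>\<xi>\<^sup>*\<close> multiplies \<open>t\<^sub>\<mu>\<close>, \<open>\<mu> \<in> P\<close>, as if \<open>\<xi>\<close> were an infinite path: the result
  is \<open>w t\<^sub>\<alpha>\<^sup>*\<close> if \<open>\<xi> = \<mu>\<alpha>\<close>, and \<open>0\<close> if \<open>\<mu>\<close> is not an initial segment of \<open>\<xi>\<close>.\<close>

definition defect :: "'l \<Rightarrow> 'a \<Rightarrow> bool" where
  "defect \<xi> w \<longleftrightarrow> w \<in> carrier A \<and> w \<otimes> t (\<s> \<xi>) = w \<and> (\<forall>\<gamma> \<in> exts \<xi>. w \<otimes> t \<gamma> = \<zero>)"

text \<open>\<open>half \<xi> \<otimes> st \<xi>\<close> is the part of the range of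
  \<open>t \<xi>\<close> that no longer path of \<open>P\<close> beginning with \<open>\<xi>\<close>
  covers.\<close>

definition half :: "'l \<Rightarrow> 'a" where
  "half \<xi> = t \<xi> \<otimes> gap (\<s> \<xi>) (enum \<xi>)"

lemma exts_finite: assumes "\<xi> \<in> P" shows "finite (exts \<xi>)"
proof (rule inj_on_finite[OF _ _ P_finite])
  show "inj_on (\<lambda>\<alpha>. \<xi> \<star> \<alpha>) (exts \<xi>)"
  proof (rule inj_onI)
    fix \<alpha> \<beta> assume "\<alpha> \<in> exts \<xi>" "\<beta> \<in> exts \<xi>" "\<xi> \<star> \<alpha> = \<xi> \<star> \<beta>"
    then show "\<alpha> = \<beta>" using cancel_left[OF P_paths[OF assms], of \<alpha> \<beta>] by (simp add: exts_def)
  qed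
qed (auto simp: exts_def)

lemma enum: assumes "\<xi> \<in> P" shows "set (enum \<xi>) = exts \<xi>" "distinct (enum \<xi>)"
  using someI_ex[OF finite_distinct_list[OF exts_finite[OF assms]]] by (simp_all add: enum_def)

lemma enum_sub: "\<xi> \<in> P \<Longrightarrow> set (enum \<xi>) \<subseteq> {\<alpha> \<in> \<P>. \<r> \<alpha> = \<s> \<xi>}"
  using enum by (auto simp: exts_def)

lemma src_P: "\<xi> \<in> P \<Longrightarrow> \<s> \<xi> \<in> \<V>"
  using P_paths by simp

lemma half_closed: "\<xi> \<in> P \<Longrightarrow> half \<xi> \<in> carrier A"
  using gap_closed[OF src_P enum_sub] P_paths by (simp add: half_def)

lemma nrm_half: assumes "\<xi> \<in> P" shows "nrm A (half \<xi>) \<le> 1"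
  using nrm_mult_le_left[OF t_closed[OF P_paths[OF assms]] gap_closed[OF src_P enum_sub] nrm_t_le(1)[OF P_paths[OF assms]]]
    nrm_gap[OF src_P enum_sub] assms by (simp add: half_def) (meson order_trans)

lemma defect_half: assumes "\<xi> \<in> P" shows "defect \<xi> (half \<xi>)"
proof -
  note p = P_paths[OF assms] and g = gap_closed[OF src_P[OF assms] enum_sub[OF assms]]
  have "half \<xi> \<otimes> t (\<s> \<xi>) = half \<xi>"
    unfolding half_def using mult_assoc[OF t_closed[OF p] g t_closed[OF src_closed[OF p]]]
      gap_absorb_vertex[OF src_P[OF assms] enum_sub[OF assms]] by simp
  moreover have "half \<xi> \<otimes> t \<gamma> = \<zero>" if c: "\<gamma> \<in> exts \<xi>" for \<gamma>
  proof -
    have "\<gamma> \<in> \<P>" "\<gamma> \<in> set (enum \<xi>)" using c enum(1)[OF assms] by (simp_all add: exts_def)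
    then show ?thesis
      unfolding half_def using mult_assoc[OF t_closed[OF p] g t_closed[of \<gamma>]] p
        gap_kill(2)[OF src_P[OF assms] enum_sub[OF assms], of \<gamma>] by simp
  qed
  ultimately show ?thesis using half_closed[OF assms] by (simp add: defect_def)
qed

lemma exts_mce:
  assumes "\<xi> \<in> P" "\<mu> \<in> P" "(\<gamma>, \<delta>) \<in> mce_pairs \<xi> \<mu>" "\<d> \<gamma> \<noteq> 0"
  shows "\<gamma> \<in> exts \<xi>"
  using mce_pairsD[OF assms(3) P_paths[OF assms(1)] P_paths[OF assms(2)]] P_mce[OF assms(1,2)] assms(4)
  by (simp add: exts_def)

lemma defectD:
  assumes "defect \<xi> w"
  shows "w \<in> carrier A" "w \<otimes> t (\<s> \<xi>) = w" "\<gamma> \<in> exts \<xi> \<Longrightarrow> w \<otimes> t \<gamma> = \<zero>"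
  using assms by (auto simp: defect_def)

lemma defect_prefix:
  assumes "defect \<xi> w" "\<mu> \<in> \<P>" "\<alpha> \<in> \<P>" "\<s> \<mu> = \<r> \<alpha>" "\<xi> = \<mu> \<star> \<alpha>"
  shows "w \<otimes> st \<xi> \<otimes> t \<mu> = w \<otimes> st \<alpha>"
  using st_t_prefix(2)[OF assms(2-4)] mult_assoc[of w "st \<xi>" "t \<mu>"] defectD(1)[OF assms(1)] assms(2-) by simp

text \<open>Expand by (CK3). A pair with trivial \<open>\<gamma>\<close> would make
  \<open>\<mu>\<close> an initial segment of \<open>\<xi>\<close>; every other
  \<open>\<gamma>\<close> lies in \<open>exts \<xi>\<close> and is annihilated by
  \<open>w\<close>.\<close>

lemma defect_not_prefix:
  assumes w: "defect \<xi> w" and P: "\<xi> \<in> P" "\<mu> \<in> P" and n: "\<not> \<mu> \<preceq> \<xi>"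
  shows "w \<otimes> st \<xi> \<otimes> t \<mu> = \<zero>"
proof -
  note l = P_paths[OF P(1)] and m = P_paths[OF P(2)] and wc = defectD(1)[OF w]
  have "w \<otimes> st \<xi> \<otimes> t \<mu> = w \<otimes> (st \<xi> \<otimes> t \<mu>)" using mult_assoc wc l m by simp
  also have "\<dots> = finsum A (\<lambda>p. w \<otimes> (case p of (\<gamma>, \<delta>) \<Rightarrow> t \<gamma> \<otimes> st \<delta>)) (mce_pairs \<xi> \<mu>)"
    unfolding CK3'[OF l m] by (rule mult_finsum_right[OF mce_pairs_finite[OF l m] mce_pairs_fun wc])
  also have "\<dots> = finsum A (\<lambda>p. \<zero>) (mce_pairs \<xi> \<mu>)"
  proof (rule M.finsum_cong')
    fix p assume p: "p \<in> mce_pairs \<xi> \<mu>"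
    obtain \<gamma> \<delta> where gd: "p = (\<gamma>, \<delta>)" by (cases p)
    note * = mce_pairsD[OF p[unfolded gd] l m]
    have "\<d> \<gamma> \<noteq> 0"
    proof
      assume "\<d> \<gamma> = 0"
      then have "\<gamma> = \<s> \<xi>" by (rule deg_0_eq_src[OF *(1,3)])
      then have "\<xi> = \<mu> \<star> \<delta>" using *(5) l by simp
      then show False using n prefix_ofI[OF m *(2,4)] by simp
    qed
    then have "w \<otimes> t \<gamma> = \<zero>" using defectD(3)[OF w] exts_mce[OF P] p gd by simp
    then show "w \<otimes> (case p of (\<gamma>, \<delta>) \<Rightarrow> t \<gamma> \<otimes> st \<delta>) = \<zero>"
      using mult_assoc[of w "t \<gamma>" "st \<delta>"] wc *(1,2) gd by simp
  qed auto
  finally show ?thesis by simp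
qed

text \<open>The uncovered parts, taken over all of \<open>P\<close>, are meant to exhaust the ranges
  of the \<open>t \<mu>\<close>, so that their sum is a unit for the finite algebra.\<close>

definition support :: "'a" where
  "support = finsum A (\<lambda>\<xi>. half \<xi> \<otimes> st \<xi>) P"

lemma support_fun: "(\<lambda>\<xi>. half \<xi> \<otimes> st \<xi>) \<in> P \<rightarrow> carrier A"
  using half_closed P_paths by auto

lemma support_closed: "support \<in> carrier A"
  unfolding support_def by (rule M.finsum_closed[OF support_fun])

text \<open>Induction on the number of extensions inside \<open>P\<close>, longest paths first: the
  claim for proper continuations of \<open>\<mu>\<close> reduces the claim for \<open>\<mu>\<close>
  to its uncovered part.\<close>

lemma support_t:
  assumes "\<mu> \<in> P" shows "support \<otimes> t \<mu> = t \<mu>"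
  using assms
proof (induction \<mu> rule: measure_induct_rule[of "\<lambda>\<mu>. card {\<xi> \<in> P. \<mu> \<preceq> \<xi>}"])
  case (less \<mu>)
  note m = P_paths[OF less.prems]
  let ?v = "\<s> \<mu>" and ?g = "gap (\<s> \<mu>) (enum \<mu>)"
  note v = src_P[OF less.prems] and es = enum_sub[OF less.prems]
  note g = gap_closed[OF v es]
  define r where "r = support \<otimes> t \<mu> \<ominus> t \<mu>"
  have c: "support \<otimes> t \<mu> \<in> carrier A" "t \<mu> \<in> carrier A" using support_closed m by auto
  have r: "r \<in> carrier A" using c by (simp add: r_def)
  have ra: "r \<otimes> pr \<alpha> = \<zero>" if "\<alpha> \<in> set (enum \<mu>)" for \<alpha>
  proof -
    have a: "\<alpha> \<in> \<P>" "\<s> \<mu> = \<r> \<alpha>" "\<mu> \<star> \<alpha> \<in> P" "\<d> \<alpha> \<noteq> 0"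
      using that enum(1)[OF less.prems] by (simp_all add: exts_def)
    note pa = prefix_ofI[OF m a(1,2)]
    have "\<not> \<mu> \<star> \<alpha> \<preceq> \<mu>"
    proof
      assume "\<mu> \<star> \<alpha> \<preceq> \<mu>"
      then have "\<d> (\<mu> \<star> \<alpha>) \<le> \<d> \<mu>" by (rule prefix_of_deg)
      then show False using a(4) deg_cmp[OF m a(1,2)] by (simp add: le_fun_def fun_eq_iff)
    qed
    then have "{\<xi> \<in> P. \<mu> \<star> \<alpha> \<preceq> \<xi>} \<subset> {\<xi> \<in> P. \<mu> \<preceq> \<xi>}"
      using prefix_of_trans[OF pa] prefix_of_refl[OF m] less.prems by blast
    then have "card {\<xi> \<in> P. \<mu> \<star> \<alpha> \<preceq> \<xi>} < card {\<xi> \<in> P. \<mu> \<preceq> \<xi>}"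
      by (rule psubset_card_mono[rotated]) (use P_finite in simp)
    from less.IH[OF this a(3)] have e: "support \<otimes> (t \<mu> \<otimes> t \<alpha>) = t \<mu> \<otimes> t \<alpha>" by (simp add: t_cmp[OF m a(1,2)])
    have "r \<otimes> t \<alpha> = support \<otimes> (t \<mu> \<otimes> t \<alpha>) \<ominus> t \<mu> \<otimes> t \<alpha>"
      unfolding r_def using mult_minus_left[OF c t_closed[OF a(1)]] mult_assoc[OF support_closed c(2) t_closed[OF a(1)]] by simp
    also have "\<dots> = \<zero>" unfolding e using c(2) a(1) by simp
    finally have "r \<otimes> t \<alpha> = \<zero>" .
    then show ?thesis using mult_assoc[OF r t_closed[OF a(1)] adj_closed[OF t_closed[OF a(1)]]] a(1) by simp
  qed
  have rv: "r \<otimes> t ?v = r"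
    unfolding r_def using mult_minus_left[OF c, of "t ?v"] mult_assoc[OF support_closed c(2), of "t ?v"] m by simp
  \<comment> \<open>The error \<open>r\<close> vanishes on all proper continuations, so the gap may
    be inserted. In the sum for \<open>support\<close> times \<open>half \<mu>\<close> only the term
    of \<open>\<mu>\<close> survives: other paths not beginning with \<open>\<mu>\<close> give 0 by
    \<open>defect_not_prefix\<close>, and proper continuations are removed by the gap.\<close>
  then have "r = r \<otimes> ?g" using gap_absorb_left[OF v es r ra] by simp
  also have "\<dots> = (support \<otimes> t \<mu>) \<otimes> ?g \<ominus> half \<mu>"
    unfolding r_def half_def by (rule mult_minus_left[OF c g])
  also have "(support \<otimes> t \<mu>) \<otimes> ?g = support \<otimes> half \<mu>"
    unfolding half_def by (rule mult_assoc[OF support_closed c(2) g])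
  also have "\<dots> = finsum A (\<lambda>\<xi>. half \<xi> \<otimes> st \<xi> \<otimes> half \<mu>) P"
    unfolding support_def by (rule mult_finsum_left[OF P_finite support_fun half_closed[OF less.prems]])
  also have "\<dots> = finsum A (\<lambda>\<xi>. if \<mu> = \<xi> then half \<xi> else \<zero>) P"
  proof (rule M.finsum_cong')
    fix \<xi> assume l: "\<xi> \<in> P"
    note lp = P_paths[OF l]
    have h: "half \<xi> \<otimes> st \<xi> \<in> carrier A" using support_fun l by auto
    have *: "half \<xi> \<otimes> st \<xi> \<otimes> half \<mu> = (half \<xi> \<otimes> st \<xi> \<otimes> t \<mu>) \<otimes> ?g"
      unfolding half_def[of \<mu>] by (rule mult_assoc[symmetric, OF h c(2) g])
    show "half \<xi> \<otimes> st \<xi> \<otimes> half \<mu> = (if \<mu> = \<xi> then half \<xi> else \<zero>)"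
    proof (cases "\<mu> \<preceq> \<xi>")
      case True
      then obtain \<alpha> where a: "\<alpha> \<in> \<P>" "\<s> \<mu> = \<r> \<alpha>" "\<xi> = \<mu> \<star> \<alpha>" by (auto elim: prefix_ofE)
      have e: "half \<xi> \<otimes> st \<xi> \<otimes> half \<mu> = half \<xi> \<otimes> (st \<alpha> \<otimes> ?g)"
        unfolding * defect_prefix[OF defect_half[OF l] m a]
        by (rule mult_assoc[OF half_closed[OF l] _ g]) (use a in simp)
      show ?thesis
      proof (cases "\<d> \<alpha> = 0")
        case True
        then have "\<alpha> = \<s> \<mu>" by (rule deg_0_eq_src[OF a(1,2)])
        then have "\<xi> = \<mu>" "st \<alpha> = t ?v" unfolding a(3) using cmp_src_id[OF m] t_vertex(1)[OF v] by simp_all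
        then have "half \<xi> \<otimes> st \<xi> \<otimes> half \<mu> = half \<mu> \<otimes> (t ?v \<otimes> ?g)" using e by simp
        also have "\<dots> = half \<mu> \<otimes> t ?v \<otimes> ?g"
          by (rule mult_assoc[symmetric, OF half_closed[OF less.prems] t_closed[OF src_closed[OF m]] g])
        also have "\<dots> = half \<mu> \<otimes> ?g" using defectD(2)[OF defect_half[OF less.prems]] by simp
        also have "\<dots> = half \<mu>"
          unfolding half_def mult_assoc[OF c(2) g g] gap_idem[OF v es] ..
        finally show ?thesis using \<open>\<xi> = \<mu>\<close> by simp
      next
        case False
        then have "\<alpha> \<in> set (enum \<mu>)" using a l enum(1)[OF less.prems] by (simp add: exts_def)
        then have "st \<alpha> \<otimes> ?g = \<zero>" by (rule gap_kill(3)[OF v es])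
        moreover have "\<mu> \<noteq> \<xi>"
          using False deg_cmp[OF m a(1,2)] a(3) by (auto simp: fun_eq_iff)
        ultimately show ?thesis using e half_closed[OF l] by simp
      qed
    next
      case False
      then have "\<mu> \<noteq> \<xi>" using prefix_of_refl[OF m] by auto
      then show ?thesis unfolding * defect_not_prefix[OF defect_half[OF l] l less.prems False] using g by simp
    qed
  qed (use half_closed in auto)
  also have "\<dots> = half \<mu>" using M.finsum_singleton[OF less.prems P_finite, of half] half_closed by auto
  finally have "r = \<zero>" using half_closed[OF less.prems] by simp
  then show ?case unfolding r_def using minus_eq_zero_iff[OF c] by simp
qed

lemma core_gens_closed: "core_gens P \<subseteq> carrier A"
  using P_paths by (auto simp: core_gens_def)

text \<open>The scalar \<open>c\<close> does not depend on \<open>w\<close> and \<open>z\<close>: gap projections (\<open>half\<close>) bound the norm of \<open>b\<close> by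
  the scalars, and adjoints of paths avoiding \<open>exts \<xi>\<close> recover each scalar from \<open>b\<close> as a multiple of a
  vertex projection.\<close>

lemma core_entry:
  assumes b: "b \<in> lin A (core_gens P)" and P: "\<xi> \<in> P" "\<kappa> \<in> P"
  shows "\<exists>c. (\<d> \<xi> = \<d> \<kappa> \<and> \<s> \<xi> = \<s> \<kappa> \<or> c = 0) \<and>
    (\<forall>w z. defect \<xi> w \<longrightarrow> defect \<kappa> z \<longrightarrow> w \<otimes> st \<xi> \<otimes> b \<otimes> (t \<kappa> \<otimes> adj A z) = c \<odot> (w \<otimes> adj A z))"
  using b
proof (induction rule: lin.induct)
  case lin_zero
  show ?case
  proof (rule exI[of _ 0], intro conjI allI impI)
    fix w z assume "defect \<xi> w" "defect \<kappa> z"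
    then have "w \<in> carrier A" "z \<in> carrier A" by (simp_all add: defect_def)
    then show "w \<otimes> st \<xi> \<otimes> \<zero> \<otimes> (t \<kappa> \<otimes> adj A z) = 0 \<odot> (w \<otimes> adj A z)"
      using P_paths[OF P(1)] P_paths[OF P(2)] by simp
  qed simp
next
  case (lin_step a b c)
  note l = P_paths[OF P(1)] and k = P_paths[OF P(2)]
  have bc: "b \<in> carrier A" by (rule lin_closed[OF lin_step.hyps(2) core_gens_closed])
  obtain \<mu> \<nu> where a: "a = t \<mu> \<otimes> st \<nu>" and mn: "\<mu> \<in> P" "\<nu> \<in> P" "\<d> \<mu> = \<d> \<nu>" "\<s> \<mu> = \<s> \<nu>"
    using lin_step.hyps(1) by (auto simp: core_gens_def)
  note m = P_paths[OF mn(1)] and n = P_paths[OF mn(2)]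
  have ac: "a \<in> carrier A" using a m n by simp
  obtain d where d: "\<d> \<xi> = \<d> \<kappa> \<and> \<s> \<xi> = \<s> \<kappa> \<or> d = 0"
    "\<And>w z. \<lbrakk>defect \<xi> w; defect \<kappa> z\<rbrakk> \<Longrightarrow> w \<otimes> st \<xi> \<otimes> b \<otimes> (t \<kappa> \<otimes> adj A z) = d \<odot> (w \<otimes> adj A z)"
    using lin_step.IH by (elim exE conjE) (rule that, assumption, simp)
  have "\<exists>f. (\<d> \<xi> = \<d> \<kappa> \<and> \<s> \<xi> = \<s> \<kappa> \<or> f = 0) \<and>
    (\<forall>w z. defect \<xi> w \<longrightarrow> defect \<kappa> z \<longrightarrow> w \<otimes> st \<xi> \<otimes> a \<otimes> (t \<kappa> \<otimes> adj A z) = f \<odot> (w \<otimes> adj A z))"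
  proof -
    have split: "w \<otimes> st \<xi> \<otimes> a \<otimes> (t \<kappa> \<otimes> adj A z) = (w \<otimes> st \<xi> \<otimes> t \<mu>) \<otimes> adj A (z \<otimes> st \<kappa> \<otimes> t \<nu>)"
      if "defect \<xi> w" "defect \<kappa> z" for w z
      using defectD(1)[OF that(1)] defectD(1)[OF that(2)] l k m n unfolding a
      by (simp add: adj_mult mult_assoc)
    have zero: ?thesis if "\<And>w z. \<lbrakk>defect \<xi> w; defect \<kappa> z\<rbrakk> \<Longrightarrow> (w \<otimes> st \<xi> \<otimes> t \<mu>) \<otimes> adj A (z \<otimes> st \<kappa> \<otimes> t \<nu>) = \<zero>"
    proof (rule exI[of _ 0], intro conjI allI impI)
      fix w z assume wz: "defect \<xi> w" "defect \<kappa> z"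
      show "w \<otimes> st \<xi> \<otimes> a \<otimes> (t \<kappa> \<otimes> adj A z) = 0 \<odot> (w \<otimes> adj A z)"
        unfolding split[OF wz] that[OF wz] using defectD(1)[OF wz(1)] defectD(1)[OF wz(2)] by simp
    qed simp
    show ?thesis
    proof (cases "\<mu> \<preceq> \<xi> \<and> \<nu> \<preceq> \<kappa>")
      case False
      show ?thesis
      proof (rule zero)
        fix w z assume wz: "defect \<xi> w" "defect \<kappa> z"
        then have c: "w \<in> carrier A" "z \<in> carrier A" using defectD(1) by auto
        show "(w \<otimes> st \<xi> \<otimes> t \<mu>) \<otimes> adj A (z \<otimes> st \<kappa> \<otimes> t \<nu>) = \<zero>"
          using defect_not_prefix[OF wz(1) P(1) mn(1)] defect_not_prefix[OF wz(2) P(2) mn(2)] False c l k m n by auto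
      qed
    next
      case True
      obtain \<alpha> where \<alpha>: "\<alpha> \<in> \<P>" "\<s> \<mu> = \<r> \<alpha>" "\<xi> = \<mu> \<star> \<alpha>" using True by (auto elim: prefix_ofE)
      obtain \<beta> where \<beta>: "\<beta> \<in> \<P>" "\<s> \<nu> = \<r> \<beta>" "\<kappa> = \<nu> \<star> \<beta>" using True by (auto elim: prefix_ofE)
      have e: "(w \<otimes> st \<xi> \<otimes> t \<mu>) \<otimes> adj A (z \<otimes> st \<kappa> \<otimes> t \<nu>) = w \<otimes> (st \<alpha> \<otimes> t \<beta>) \<otimes> adj A z"
        if wz: "defect \<xi> w" "defect \<kappa> z" for w z
        unfolding defect_prefix[OF wz(1) m \<alpha>] defect_prefix[OF wz(2) n \<beta>]
        using defectD(1)[OF wz(1)] defectD(1)[OF wz(2)] \<alpha>(1) \<beta>(1) by (simp add: adj_mult mult_assoc)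
      show ?thesis
      proof (cases "\<alpha> = \<beta>")
        case True
        have s: "\<s> \<alpha> = \<s> \<xi>" "\<s> \<alpha> = \<s> \<kappa>" "\<d> \<xi> = \<d> \<kappa>"
          using src_cmp[OF m \<alpha>(1,2)] src_cmp[OF n \<beta>(1,2)] deg_cmp[OF m \<alpha>(1,2)] deg_cmp[OF n \<beta>(1,2)] \<alpha>(3) \<beta>(3) True mn(3)
          by simp_all
        have "w \<otimes> (st \<alpha> \<otimes> t \<beta>) \<otimes> adj A z = w \<otimes> adj A z" if "defect \<xi> w" for w z
          unfolding True[symmetric] st_t[OF \<alpha>(1)] s(1) defectD(2)[OF that] ..
        then have "w \<otimes> st \<xi> \<otimes> a \<otimes> (t \<kappa> \<otimes> adj A z) = 1 \<odot> (w \<otimes> adj A z)" if "defect \<xi> w" "defect \<kappa> z" for w z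
          unfolding split[OF that] e[OF that] using that(1) defectD(1)[OF that(1)] defectD(1)[OF that(2)] by simp
        then show ?thesis using s by (intro exI[of _ 1]) simp
      next
        case False
        show ?thesis
        proof (rule zero)
          fix w z assume wz: "defect \<xi> w" "defect \<kappa> z"
          note c = defectD(1)[OF wz(1)] defectD(1)[OF wz(2)]
          \<comment> \<open>Every common extension of \<open>\<alpha>\<close> and
            \<open>\<beta>\<close> yields continuations of \<open>\<xi>\<close> and
            \<open>\<kappa>\<close> in \<open>P\<close>: pass from \<open>\<mu>\<close> to
            \<open>\<nu>\<close> by a swap, take the minimal common extension there, and swap back.
            Since \<open>\<alpha>\<close> and \<open>\<beta>\<close> differ, one of the two
            continuations is proper, and \<open>w\<close> or \<open>z\<close> annihilates
            it.\<close>
          have "w \<otimes> (st \<alpha> \<otimes> t \<beta>) \<otimes> adj A z =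
              finsum A (\<lambda>p. w \<otimes> (case p of (\<gamma>, \<delta>) \<Rightarrow> t \<gamma> \<otimes> st \<delta>) \<otimes> adj A z) (mce_pairs \<alpha> \<beta>)"
            unfolding CK3'[OF \<alpha>(1) \<beta>(1)] using c mce_pairs_finite[OF \<alpha>(1) \<beta>(1)] mce_pairs_fun[of \<alpha> \<beta>]
            by (subst mult_finsum_right) (auto intro!: mult_finsum_left simp: mce_pairs_def)
          also have "\<dots> = finsum A (\<lambda>p. \<zero>) (mce_pairs \<alpha> \<beta>)"
          proof (rule M.finsum_cong')
            fix p assume p: "p \<in> mce_pairs \<alpha> \<beta>"
            obtain \<gamma> \<delta> where gd: "p = (\<gamma>, \<delta>)" by (cases p)
            note * = mce_pairsD[OF p[unfolded gd] \<alpha>(1) \<beta>(1)]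
            have na: "\<s> \<nu> = \<r> \<alpha>" and mb: "\<s> \<mu> = \<r> \<beta>" using \<alpha>(2) \<beta>(2) mn(4) by simp_all
            have naP: "\<nu> \<star> \<alpha> \<in> P" by (rule P_swap[OF mn(2,1) _ \<alpha>(1,2)]) (use P(1) \<alpha>(3) mn in simp_all)
            have bP: "\<nu> \<star> \<beta> \<in> P" using P(2) \<beta>(3) by simp
            have "\<nu> \<star> (\<alpha> \<star> \<gamma>) \<in> \<M> (\<nu> \<star> \<alpha>) (\<nu> \<star> \<beta>)"
            proof -
              have pw: "\<alpha> \<star> \<gamma> \<in> \<P>" "\<s> \<nu> = \<r> (\<alpha> \<star> \<gamma>)"
                using *(1,3) \<alpha>(1) na by simp_all
              have mm: "\<alpha> \<preceq> \<alpha> \<star> \<gamma>" "\<beta> \<preceq> \<alpha> \<star> \<gamma>"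
                "\<d> (\<alpha> \<star> \<gamma>) = sup (\<d> \<alpha>) (\<d> \<beta>)"
                using *(6) MCE_iff[OF \<alpha>(1) \<beta>(1)] by (auto simp: MCE_def)
              have "\<nu> \<star> \<alpha> \<preceq> (\<nu> \<star> (\<alpha> \<star> \<gamma>))" "\<nu> \<star> \<beta> \<preceq> (\<nu> \<star> (\<alpha> \<star> \<gamma>))"
                using prefix_of_cmp[OF n \<alpha>(1) pw(1) na pw(2)] prefix_of_cmp[OF n \<beta>(1) pw(1) \<beta>(2) pw(2)] mm by simp_all
              moreover have "\<d> (\<nu> \<star> (\<alpha> \<star> \<gamma>)) = sup (\<d> (\<nu> \<star> \<alpha>)) (\<d> (\<nu> \<star> \<beta>))"
                unfolding deg_cmp[OF n pw] mm(3) deg_cmp[OF n \<alpha>(1) na] deg_cmp[OF n \<beta>(1,2)]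
                by (rule ext) (simp add: sup_nat_def)
              ultimately show ?thesis
                using MCE_iff[OF cmp_closed[OF n \<alpha>(1) na] cmp_closed[OF n \<beta>(1,2)]] by (simp add: MCE_def)
            qed
            then have w1: "\<nu> \<star> (\<alpha> \<star> \<gamma>) \<in> P" by (rule P_mce[OF naP bP])
            have agp: "\<alpha> \<star> \<gamma> \<in> \<P>" "\<s> \<nu> = \<r> (\<alpha> \<star> \<gamma>)" using *(1,3) \<alpha>(1) na by simp_all
            have w2: "\<mu> \<star> (\<alpha> \<star> \<gamma>) \<in> P" by (rule P_swap[OF mn(1,2) w1 agp mn(4,3)])
            have lg: "\<xi> \<star> \<gamma> \<in> P" "\<s> \<xi> = \<r> \<gamma>"
              using w2 cmp_assoc[OF m \<alpha>(1) *(1) \<alpha>(2) *(3)] src_cmp[OF m \<alpha>(1,2)] *(3) \<alpha>(3) by simp_all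
            have kd: "\<kappa> \<star> \<delta> \<in> P" "\<s> \<kappa> = \<r> \<delta>"
              using w1 *(5) cmp_assoc[OF n \<beta>(1) *(2) \<beta>(2) *(4)] src_cmp[OF n \<beta>(1,2)] *(4) \<beta>(3) by simp_all
            have "\<d> \<gamma> \<noteq> 0 \<or> \<d> \<delta> \<noteq> 0"
            proof (rule ccontr)
              assume "\<not> ?thesis"
              then have "\<gamma> = \<s> \<alpha>" "\<delta> = \<s> \<beta>" using deg_0_eq_src[OF *(1,3)] deg_0_eq_src[OF *(2,4)] by simp_all
              then show False using *(5) \<alpha>(1) \<beta>(1) False by simp
            qed
            then consider "\<gamma> \<in> exts \<xi>" | "\<delta> \<in> exts \<kappa>" using lg kd *(1,2) by (auto simp: exts_def)
            then show "w \<otimes> (case p of (\<gamma>, \<delta>) \<Rightarrow> t \<gamma> \<otimes> st \<delta>) \<otimes> adj A z = \<zero>"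
            proof cases
              case 1
              have "w \<otimes> (t \<gamma> \<otimes> st \<delta>) = \<zero>"
                using mult_assoc[of w "t \<gamma>" "st \<delta>"] defectD(3)[OF wz(1) 1] c *(1,2) by simp
              then show ?thesis using gd c by simp
            next
              case 2
              have "w \<otimes> (t \<gamma> \<otimes> st \<delta>) \<otimes> adj A z = w \<otimes> t \<gamma> \<otimes> adj A (z \<otimes> t \<delta>)"
                using c *(1,2) by (simp add: adj_mult mult_assoc)
              then show ?thesis using gd c defectD(3)[OF wz(2) 2] *(1) by simp
            qed
          qed auto
          finally show "(w \<otimes> st \<xi> \<otimes> t \<mu>) \<otimes> adj A (z \<otimes> st \<kappa> \<otimes> t \<nu>) = \<zero>" unfolding e[OF wz] by simp
        qed
      qed
    qed
  qed
  then obtain f where f: "\<d> \<xi> = \<d> \<kappa> \<and> \<s> \<xi> = \<s> \<kappa> \<or> f = 0"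
    "\<And>w z. \<lbrakk>defect \<xi> w; defect \<kappa> z\<rbrakk> \<Longrightarrow> w \<otimes> st \<xi> \<otimes> a \<otimes> (t \<kappa> \<otimes> adj A z) = f \<odot> (w \<otimes> adj A z)"
    by (elim exE conjE) (rule that, assumption, simp)
  show ?case
  proof (rule exI[of _ "c * f + d"], intro conjI allI impI)
    fix w z assume wz: "defect \<xi> w" "defect \<kappa> z"
    define p q where "p = w \<otimes> st \<xi>" and "q = t \<kappa> \<otimes> adj A z"
    have pq: "p \<in> carrier A" "q \<in> carrier A" "w \<otimes> adj A z \<in> carrier A"
      using defectD(1)[OF wz(1)] defectD(1)[OF wz(2)] l k by (simp_all add: p_def q_def)
    have "p \<otimes> ((c \<odot> a) \<oplus> b) \<otimes> q = c \<odot> (p \<otimes> a \<otimes> q) \<oplus> p \<otimes> b \<otimes> q"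
      using pq ac bc by (simp add: mult_r_distr mult_l_distr smult_mult_r smult_mult_l)
    also have "\<dots> = (c * f + d) \<odot> (w \<otimes> adj A z)"
      using f(2)[OF wz] d(2)[OF wz] pq(3) by (simp add: p_def q_def smult_add_left)
    finally show "w \<otimes> st \<xi> \<otimes> ((c \<odot> a) \<oplus> b) \<otimes> (t \<kappa> \<otimes> adj A z) = (c * f + d) \<odot> (w \<otimes> adj A z)"
      unfolding p_def q_def .
  qed (use d(1) f(1) in auto)
qed

lemma exts_swap_subset:
  assumes "\<mu> \<in> P" "\<nu> \<in> P" "\<d> \<mu> = \<d> \<nu>" "\<s> \<mu> = \<s> \<nu>"
  shows "exts \<nu> \<subseteq> exts \<mu>"
proof
  fix \<alpha> assume "\<alpha> \<in> exts \<nu>"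
  then have a: "\<alpha> \<in> \<P>" "\<s> \<nu> = \<r> \<alpha>" "\<nu> \<star> \<alpha> \<in> P" "\<d> \<alpha> \<noteq> 0" by (simp_all add: exts_def)
  show "\<alpha> \<in> exts \<mu>"
    using P_swap[OF assms(1,2) a(3,1,2) assms(4,3)] a assms(4) by (simp add: exts_def)
qed

lemma support_core:
  assumes "b \<in> lin A (core_gens P)" shows "support \<otimes> b = b"
  using assms
proof (induction rule: lin.induct)
  case lin_zero
  show ?case using support_closed by simp
next
  case (lin_step a b c)
  have bc: "b \<in> carrier A" by (rule lin_closed[OF lin_step.hyps(2) core_gens_closed])
  obtain \<mu> \<nu> where a: "a = t \<mu> \<otimes> st \<nu>" and mn: "\<mu> \<in> P" "\<nu> \<in> P"
    using lin_step.hyps(1) by (auto simp: core_gens_def)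
  have ac: "a \<in> carrier A" using a mn P_paths by simp
  have "support \<otimes> a = a"
    unfolding a using mult_assoc[OF support_closed, of "t \<mu>" "st \<nu>"] mn P_paths support_t[OF mn(1)] by simp
  moreover have "support \<otimes> ((c \<odot> a) \<oplus> b) = c \<odot> (support \<otimes> a) \<oplus> support \<otimes> b"
    using ac bc support_closed by (simp add: mult_r_distr smult_mult_r)
  ultimately show ?case using lin_step.IH by simp
qed

lemma core_adj: assumes "b \<in> lin A (core_gens P)" shows "adj A b \<in> lin A (core_gens P)"
proof (rule lin_adj[OF assms core_gens_closed core_gens_closed])
  fix g assume "g \<in> core_gens P"
  then obtain \<mu> \<nu> where g: "g = t \<mu> \<otimes> st \<nu>" "\<mu> \<in> P" "\<nu> \<in> P" "\<d> \<mu> = \<d> \<nu>" "\<s> \<mu> = \<s> \<nu>"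
    by (auto simp: core_gens_def)
  have "adj A g = t \<nu> \<otimes> st \<mu>" using g(2,3) P_paths by (simp add: g(1) adj_mult)
  then have "adj A g \<in> core_gens P" unfolding core_gens_def using g by force
  then show "adj A g \<in> lin A (core_gens P)" by (rule lin_base[OF _ core_gens_closed])
qed

text \<open>\<open>P_mce\<close> puts the extensions of the inner paths into \<open>P\<close>, and
  \<open>P_swap\<close> transfers their tails to the outer paths.\<close>

lemma core_mult:
  assumes "b \<in> lin A (core_gens P)" "c \<in> lin A (core_gens P)" shows "b \<otimes> c \<in> lin A (core_gens P)"
proof (rule lin_mult[OF assms core_gens_closed core_gens_closed core_gens_closed])
  fix g h assume gh: "g \<in> core_gens P" "h \<in> core_gens P"
  obtain \<mu> \<nu> where g: "g = t \<mu> \<otimes> st \<nu>" "\<mu> \<in> P" "\<nu> \<in> P" "\<d> \<mu> = \<d> \<nu>" "\<s> \<mu> = \<s> \<nu>"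
    using gh(1) by (auto simp: core_gens_def)
  obtain \<sigma> \<tau> where h: "h = t \<sigma> \<otimes> st \<tau>" "\<sigma> \<in> P" "\<tau> \<in> P" "\<d> \<sigma> = \<d> \<tau>" "\<s> \<sigma> = \<s> \<tau>"
    using gh(2) by (auto simp: core_gens_def)
  note p = P_paths[OF g(2)] P_paths[OF g(3)] P_paths[OF h(2)] P_paths[OF h(3)]
  show "g \<otimes> h \<in> lin A (core_gens P)" unfolding g(1) h(1)
  proof (rule gen_mult[OF p g(5) h(5) _ core_gens_closed])
    fix \<alpha> \<beta> assume ab: "(\<alpha>, \<beta>) \<in> mce_pairs \<nu> \<sigma>"
    note * = mce_pairsD[OF ab p(2,3)]
    have w: "\<nu> \<star> \<alpha> \<in> P" "\<sigma> \<star> \<beta> \<in> P" using P_mce[OF g(3) h(2) *(6)] *(5) by simp_all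
    have m: "\<s> \<mu> = \<r> \<alpha>" "\<s> \<tau> = \<r> \<beta>" using g(5) h(5) *(3,4) by simp_all
    have P1: "\<mu> \<star> \<alpha> \<in> P" by (rule P_swap[OF g(2,3) w(1) *(1,3) g(5,4)])
    have P2: "\<tau> \<star> \<beta> \<in> P" by (rule P_swap[OF h(3,2) w(2) *(2,4) h(5)[symmetric] h(4)[symmetric]])
    have "\<d> (\<mu> \<star> \<alpha>) = \<d> (\<tau> \<star> \<beta>)"
      using deg_cmp[OF p(1) *(1) m(1)] deg_cmp[OF p(2) *(1,3)] deg_cmp[OF p(3) *(2,4)] deg_cmp[OF p(4) *(2) m(2)]
        *(5) g(4) h(4) by simp
    moreover have "\<s> (\<mu> \<star> \<alpha>) = \<s> (\<tau> \<star> \<beta>)"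
      using src_cmp[OF p(1) *(1) m(1)] src_cmp[OF p(4) *(2) m(2)] *(7) by simp
    ultimately have "t (\<mu> \<star> \<alpha>) \<otimes> st (\<tau> \<star> \<beta>) \<in> core_gens P" unfolding core_gens_def using P1 P2 by blast
    then show "t (\<mu> \<star> \<alpha>) \<otimes> st (\<tau> \<star> \<beta>) \<in> lin A (core_gens P)" by (rule lin_base[OF _ core_gens_closed])
  qed
qed

end

text \<open>Covers both the graded representation and the boundary-path representation.\<close>

locale kgraph_rep = ck_kgraph \<Lambda> A t + B: cstar_algebra B
  for \<Lambda> :: "('l, 'k::finite) kgraph" and A :: "'a cstar" (structure) and t :: "'l \<Rightarrow> 'a" and B :: "'b cstar" +
  fixes \<rho> :: "'a \<Rightarrow> 'b"
  assumes hom: "\<rho> \<in> cstar_hom A B"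
    and contractive: "x \<in> carrier A \<Longrightarrow> nrm B (\<rho> x) \<le> nrm A x"
    and vertex_nonzero: "v \<in> \<V> \<Longrightarrow> \<rho> (t v) \<noteq> \<zero>\<^bsub>B\<^esub>"
begin

lemma rho_closed [simp, intro]: "x \<in> carrier A \<Longrightarrow> \<rho> x \<in> carrier B"
  using cstar_homD(1)[OF hom] .

lemma nrm_rho_vertex: assumes v: "v \<in> \<V>" shows "nrm B (\<rho> (t v)) = 1"
proof (rule B.nrm_projection_eq_1)
  have c: "t v \<in> carrier A" using vertexD(1)[OF v] by simp
  show "\<rho> (t v) \<in> carrier B" using c by simp
  show "adj B (\<rho> (t v)) = \<rho> (t v)" using cstar_homD(4)[OF hom c] t_vertex(1)[OF v] by metis
  show "\<rho> (t v) \<otimes>\<^bsub>B\<^esub> \<rho> (t v) = \<rho> (t v)" using cstar_homD(3)[OF hom c c] t_vertex(2)[OF v] by metis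
qed (rule vertex_nonzero[OF v])

end

section \<open>Norm bounds on a finite core algebra\<close>

locale core_rep = core_paths \<Lambda> A t P + kgraph_rep \<Lambda> A t B \<rho>
  for \<Lambda> :: "('l, 'k::finite) kgraph" and A :: "'a cstar" (structure) and t :: "'l \<Rightarrow> 'a" and P
    and B :: "'b cstar" and \<rho>
begin

text \<open>If \<open>exts \<xi>\<close> is exhaustive, (CK4) makes the gap, and with it the entry,
  vanish. Otherwise a path avoiding \<open>exts \<xi>\<close> turns the scalar of the entry into a
  multiple of a vertex projection; \<open>\<rho>\<close> maps the latter to an element of norm 1, so
  the scalar is bounded by the norm of \<open>\<rho> b\<close>.\<close>

lemma entry_bound:
  assumes b: "b \<in> lin A (core_gens P)" and P: "\<xi> \<in> P" "\<kappa> \<in> P"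
  shows "nrm A (half \<xi> \<otimes> st \<xi> \<otimes> b \<otimes> (t \<kappa> \<otimes> adj A (half \<kappa>))) \<le> nrm B (\<rho> b)"
proof -
  have bc: "b \<in> carrier A" by (rule lin_closed[OF b core_gens_closed])
  note l = P_paths[OF P(1)] and k = P_paths[OF P(2)]
  have nn: "0 \<le> nrm B (\<rho> b)" using B.nrm_nonneg bc by simp
  define h where "h = half \<xi> \<otimes> adj A (half \<kappa>)"
  have hc: "h \<in> carrier A" using half_closed P by (simp add: h_def)
  have h1: "nrm A h \<le> 1"
    using nrm_mult_le_left[OF half_closed[OF P(1)] adj_closed[OF half_closed[OF P(2)]] nrm_half[OF P(1)]]
      nrm_half[OF P(2)] half_closed[OF P(2)] by (simp add: h_def)
  obtain c where c: "\<d> \<xi> = \<d> \<kappa> \<and> \<s> \<xi> = \<s> \<kappa> \<or> c = 0"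
    "\<And>w z. \<lbrakk>defect \<xi> w; defect \<kappa> z\<rbrakk> \<Longrightarrow> w \<otimes> st \<xi> \<otimes> b \<otimes> (t \<kappa> \<otimes> adj A z) = c \<odot> (w \<otimes> adj A z)"
    using core_entry[OF b P] by (elim exE conjE) (rule that, assumption, simp)
  have T: "half \<xi> \<otimes> st \<xi> \<otimes> b \<otimes> (t \<kappa> \<otimes> adj A (half \<kappa>)) = c \<odot> h"
    unfolding h_def by (rule c(2)[OF defect_half[OF P(1)] defect_half[OF P(2)]])
  show ?thesis
  proof (cases "c = 0")
    case True
    then show ?thesis unfolding T using nn hc nrm_eq_0[OF M.zero_closed] by simp
  next
    case False
    then have ds: "\<d> \<xi> = \<d> \<kappa>" "\<s> \<xi> = \<s> \<kappa>" using c(1) by simp_all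
    show ?thesis
    proof (cases "exhaustive \<Lambda> (\<s> \<xi>) (exts \<xi>)")
      case True
      then have "exts \<xi> \<in> \<E> (\<s> \<xi>)" using exts_finite[OF P(1)] by (simp add: FE_def)
      then have "gap (\<s> \<xi>) (enum \<xi>) = \<zero>"
        unfolding gap_def by (rule CK4[OF src_P[OF P(1)] _ enum(2,1)[OF P(1)]])
      then have "h = \<zero>" unfolding h_def half_def[of \<xi>] using l half_closed[OF P(2)] by simp
      then show ?thesis unfolding T using nn nrm_eq_0[OF M.zero_closed] by simp
    next
      case False
      then obtain \<tau> where \<tau>: "\<tau> \<in> \<P>" "\<r> \<tau> = \<s> \<xi>" "\<And>\<nu>. \<nu> \<in> exts \<xi> \<Longrightarrow> \<M> \<tau> \<nu> = {}"
        by (auto simp: exhaustive_def exts_def)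
      have "st \<tau> \<otimes> t \<gamma> = \<zero>" if "\<gamma> \<in> exts \<xi>" for \<gamma>
        using st_t_disjoint[OF \<tau>(1) _ \<tau>(3)[OF that]] that by (simp add: exts_def)
      moreover have "st \<tau> \<otimes> t (\<s> \<xi>) = st \<tau>" using st_rng[OF \<tau>(1)] \<tau>(2) by simp
      \<comment> \<open>A nonzero scalar means equal degrees and sources, so a swap puts
        \<open>exts \<kappa>\<close> inside \<open>exts \<xi>\<close> and one path
        \<open>\<tau>\<close> avoids both.\<close>
      ultimately have d: "defect \<xi> (st \<tau>)" "defect \<kappa> (st \<tau>)"
        using exts_swap_subset[OF P ds] ds(2) \<tau>(1) by (auto simp: defect_def)
      define p q where "p = st \<tau> \<otimes> st \<xi>" and "q = t \<kappa> \<otimes> t \<tau>"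
      have pc: "p \<in> carrier A" "q \<in> carrier A" using l k \<tau>(1) by (simp_all add: p_def q_def)
      have "nrm A p \<le> nrm A (st \<xi>)" "nrm A q \<le> nrm A (t \<tau>)"
        unfolding p_def q_def
        using nrm_mult_le_left[OF adj_closed[OF t_closed[OF \<tau>(1)]] adj_closed[OF t_closed[OF l]] nrm_t_le(2)[OF \<tau>(1)]]
          nrm_mult_le_left[OF t_closed[OF k] t_closed[OF \<tau>(1)] nrm_t_le(1)[OF k]] by simp_all
      then have pn: "nrm A p \<le> 1" "nrm A q \<le> 1"
        using nrm_t_le(2)[OF l] nrm_t_le(1)[OF \<tau>(1)] by linarith+
      have rp: "nrm B (\<rho> p) \<le> 1" "nrm B (\<rho> q) \<le> 1"
        using contractive[OF pc(1)] contractive[OF pc(2)] pn by linarith+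
      have "p \<otimes> b \<otimes> q = c \<odot> t (\<s> \<tau>)"
        using c(2)[OF d] \<tau>(1) by (simp add: p_def q_def)
      then have "c \<odot>\<^bsub>B\<^esub> \<rho> (t (\<s> \<tau>)) = \<rho> (p \<otimes> b \<otimes> q)"
        using cstar_homD(5)[OF hom, of "t (\<s> \<tau>)" c] \<tau>(1) by simp
      also have "\<dots> = \<rho> p \<otimes>\<^bsub>B\<^esub> \<rho> b \<otimes>\<^bsub>B\<^esub> \<rho> q"
        using cstar_homD(3)[OF hom, of "p \<otimes> b" q] cstar_homD(3)[OF hom, of p b] pc bc by simp
      finally have e: "c \<odot>\<^bsub>B\<^esub> \<rho> (t (\<s> \<tau>)) = \<rho> p \<otimes>\<^bsub>B\<^esub> \<rho> b \<otimes>\<^bsub>B\<^esub> \<rho> q" .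
      have "cmod c = nrm B (c \<odot>\<^bsub>B\<^esub> \<rho> (t (\<s> \<tau>)))"
        using B.nrm_smult[of "\<rho> (t (\<s> \<tau>))" c] nrm_rho_vertex[of "\<s> \<tau>"] \<tau>(1) by simp
      also have "\<dots> \<le> nrm B (\<rho> p \<otimes>\<^bsub>B\<^esub> \<rho> b)"
        unfolding e by (rule B.nrm_mult_le_right) (use pc bc rp in auto)
      also have "\<dots> \<le> nrm B (\<rho> b)" by (rule B.nrm_mult_le_left) (use pc bc rp in auto)
      finally have "cmod c \<le> nrm B (\<rho> b)" .
      moreover have "nrm A (c \<odot> h) \<le> cmod c" using nrm_smult[OF hc, of c] h1 by (simp add: mult_left_le)
      ultimately show ?thesis unfolding T by linarith
    qed
  qed
qed

text \<open>\<open>support\<close> is a left unit and its adjoint a right unit for \<open>b\<close>;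
  this cuts \<open>b\<close> into one entry for each pair of paths in \<open>P\<close>.\<close>

lemma core_bound:
  assumes b: "b \<in> lin A (core_gens P)"
  shows "nrm A b \<le> (real (card P))\<^sup>2 * nrm B (\<rho> b)"
proof -
  have bc: "b \<in> carrier A" by (rule lin_closed[OF b core_gens_closed])
  let ?f = "\<lambda>\<xi>. half \<xi> \<otimes> st \<xi>"
  have fc: "?f \<xi> \<in> carrier A" if "\<xi> \<in> P" for \<xi> using support_fun that by auto
  have adj_f: "adj A (?f \<kappa>) = t \<kappa> \<otimes> adj A (half \<kappa>)" if "\<kappa> \<in> P" for \<kappa>
    using half_closed[OF that] P_paths[OF that] by (simp add: adj_mult)
  have l: "b = finsum A (\<lambda>\<xi>. ?f \<xi> \<otimes> b) P"
    using support_core[OF b] mult_finsum_left[OF P_finite support_fun bc] unfolding support_def by (rule trans[OF sym])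
  have "adj A (support \<otimes> adj A b) = b" using support_core[OF core_adj[OF b]] bc by simp
  then have "b \<otimes> adj A support = b" using support_closed bc by (simp add: adj_mult)
  then have r: "b = b \<otimes> finsum A (\<lambda>\<kappa>. adj A (?f \<kappa>)) P"
    unfolding support_def adj_finsum[OF P_finite support_fun] by (rule sym)
  have r': "?f \<xi> \<otimes> b = finsum A (\<lambda>\<kappa>. ?f \<xi> \<otimes> b \<otimes> adj A (?f \<kappa>)) P" if "\<xi> \<in> P" for \<xi>
  proof -
    have F: "(\<lambda>\<kappa>. adj A (?f \<kappa>)) \<in> P \<rightarrow> carrier A" using fc by blast
    have "?f \<xi> \<otimes> b = ?f \<xi> \<otimes> (b \<otimes> finsum A (\<lambda>\<kappa>. adj A (?f \<kappa>)) P)"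
      by (rule arg_cong[OF r])
    also have "\<dots> = (?f \<xi> \<otimes> b) \<otimes> finsum A (\<lambda>\<kappa>. adj A (?f \<kappa>)) P"
      by (rule mult_assoc[symmetric, OF fc[OF that] bc M.finsum_closed[OF F]])
    also have "\<dots> = finsum A (\<lambda>\<kappa>. ?f \<xi> \<otimes> b \<otimes> adj A (?f \<kappa>)) P"
      by (rule mult_finsum_right[OF P_finite F]) (use fc[OF that] bc in blast)
    finally show ?thesis .
  qed
  have "nrm A (?f \<xi> \<otimes> b) \<le> real (card P) * nrm B (\<rho> b)" if x: "\<xi> \<in> P" for \<xi>
  proof -
    have "nrm A (?f \<xi> \<otimes> b) = nrm A (finsum A (\<lambda>\<kappa>. ?f \<xi> \<otimes> b \<otimes> adj A (?f \<kappa>)) P)"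
      by (rule arg_cong[OF r'[OF x]])
    also have "\<dots> \<le> (\<Sum>\<kappa>\<in>P. nrm A (?f \<xi> \<otimes> b \<otimes> adj A (?f \<kappa>)))"
      by (rule nrm_finsum[OF P_finite]) (use fc bc x in blast)
    also have "\<dots> \<le> real (card P) * nrm B (\<rho> b)"
      by (rule sum_bounded_above) (use entry_bound[OF b x] adj_f in simp)
    finally show ?thesis .
  qed
  then have "(\<Sum>\<xi>\<in>P. nrm A (?f \<xi> \<otimes> b)) \<le> real (card P) * (real (card P) * nrm B (\<rho> b))"
    by (rule sum_bounded_above)
  moreover have "nrm A (finsum A (\<lambda>\<xi>. ?f \<xi> \<otimes> b) P) \<le> (\<Sum>\<xi>\<in>P. nrm A (?f \<xi> \<otimes> b))"
    by (rule nrm_finsum[OF P_finite]) (use fc bc in blast)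
  moreover have "nrm A b = nrm A (finsum A (\<lambda>\<xi>. ?f \<xi> \<otimes> b) P)" by (rule arg_cong[OF l])
  ultimately show ?thesis by (simp add: power2_eq_square mult.assoc)
qed

end

section \<open>Isometry of representations\<close>

text \<open>If u > w, take logarithms of the ratio and divide by \<open>2 ^ j\<close>: the
  right-hand side is of order \<open>j / 2 ^ j\<close> and tends to 0, while \<open>ln r\<close> is
  positive.\<close>

lemma growth_le:
  fixes u w C :: real
  assumes u: "0 \<le> u" and w: "0 \<le> w"
    and le: "\<And>j. u ^ (2 ^ j) \<le> C * (2 ^ j + 1) ^ K * w ^ (2 ^ j)"
  shows "u \<le> w"
proof (rule ccontr)
  assume "\<not> u \<le> w"
  then have uw: "w < u" by simp
  have w0: "0 < w"
  proof (rule ccontr)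
    assume "\<not> 0 < w"
    then have "w = 0" using w by simp
    then show False using le[of 0] uw by simp
  qed
  define r where "r = u / w"
  have r: "1 < r" using uw w0 by (simp add: r_def)
  have le': "r ^ (2 ^ j) \<le> C * (2 ^ j + 1) ^ K" for j
    using le[of j] w0 by (simp add: r_def power_divide divide_le_eq)
  have "0 < C * 2 ^ K" using le'[of 0] r by simp
  then have C: "0 < C" by (simp add: zero_less_mult_iff)
  have ln_le: "ln r \<le> (ln C + real K * ln 2) * (1 / 2) ^ j + real K * ln 2 * (real j * (1 / 2) ^ j)" for j
  proof -
    have "2 ^ j * ln r = ln (r ^ (2 ^ j))" using r by (simp add: ln_realpow)
    also have "\<dots> \<le> ln (C * (2 ^ j + 1) ^ K)"
    proof -
      have "0 < r ^ (2 ^ j)" using r by simp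
      then show ?thesis using le'[of j] by (subst ln_le_cancel_iff) linarith+
    qed
    also have "\<dots> = ln C + real K * ln (2 ^ j + 1)"
    proof -
      have "(0::real) < 2 ^ j + 1" by (simp add: add_pos_pos)
      then show ?thesis using C by (simp add: ln_mult ln_realpow)
    qed
    also have "\<dots> \<le> ln C + real K * (real (Suc j) * ln 2)"
    proof -
      have "ln (2 ^ j + 1) \<le> ln ((2::real) ^ Suc j)"
        by (subst ln_le_cancel_iff) (auto simp: add_pos_pos)
      also have "\<dots> = real (Suc j) * ln 2" by (subst ln_realpow) auto
      finally show ?thesis by (simp add: mult_left_mono)
    qed
    finally have "ln r \<le> (ln C + real K * (real (Suc j) * ln 2)) / 2 ^ j"
      by (simp add: le_divide_eq mult.commute)
    also have "\<dots> = (ln C + real K * ln 2) * (1 / 2) ^ j + real K * ln 2 * (real j * (1 / 2) ^ j)"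
      by (simp add: field_simps power_one_over)
    finally show ?thesis .
  qed
  have "(\<lambda>j. (ln C + real K * ln 2) * (1 / 2) ^ j + real K * ln 2 * (real j * (1 / 2) ^ j)) \<longlonglongrightarrow>
      (ln C + real K * ln 2) * 0 + real K * ln 2 * 0"
    using powser_times_n_limit_0[of "1 / 2 :: real"]
    by (intro tendsto_intros LIMSEQ_realpow_zero) auto
  then have "ln r \<le> (ln C + real K * ln 2) * 0 + real K * ln 2 * 0"
    by (rule LIMSEQ_le_const) (use ln_le in auto)
  then show False using r by simp
qed

text \<open>Repeated squaring, because the C*-identity evaluates norms of selfadjoint elements along
  the exponents \<open>2 ^ j\<close>.\<close>

primrec sq_pow :: "'a cstar \<Rightarrow> nat \<Rightarrow> 'a \<Rightarrow> 'a" where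
  "sq_pow A 0 x = x"
| "sq_pow A (Suc j) x = sq_pow A j x \<otimes>\<^bsub>A\<^esub> sq_pow A j x"

lemma (in cstar_algebra) sq_pow:
  assumes "x \<in> carrier A" "adj A x = x"
  shows "sq_pow A j x \<in> carrier A \<and> adj A (sq_pow A j x) = sq_pow A j x \<and> nrm A (sq_pow A j x) = nrm A x ^ (2 ^ j)"
proof (induction j)
  case (Suc j)
  have "nrm A (sq_pow A (Suc j) x) = (nrm A (sq_pow A j x))\<^sup>2"
    using cstar_identity[of "sq_pow A j x"] Suc by simp
  also have "\<dots> = nrm A x ^ (2 ^ Suc j)" using Suc by (simp add: power_even_eq)
  finally show ?case using Suc by (simp add: adj_mult)
qed (use assms in simp)

section \<open>Homogeneous generators\<close>

context ck_kgraph
begin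

text \<open>In the universal algebra their closed span is the spectral subspace of degree
  \<open>g\<close> of the gauge action.\<close>

definition hom_gens :: "('k \<Rightarrow> int) \<Rightarrow> 'a set" where
  "hom_gens g = {t \<mu> \<otimes> st \<nu> |\<mu> \<nu>. \<mu> \<in> \<P> \<and> \<nu> \<in> \<P> \<and> \<s> \<mu> = \<s> \<nu> \<and> \<D> \<mu> = g + \<D> \<nu>}"

lemma hom_gensE:
  assumes "a \<in> hom_gens g"
  obtains \<mu> \<nu> where "a = t \<mu> \<otimes> st \<nu>" "\<mu> \<in> \<P>" "\<nu> \<in> \<P>" "\<s> \<mu> = \<s> \<nu>" "\<D> \<mu> = g + \<D> \<nu>"
  using assms by (auto simp: hom_gens_def)

lemma hom_gens_closed: "hom_gens g \<subseteq> carrier A" "(\<Union>g\<in>G. hom_gens g) \<subseteq> carrier A"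
  by (auto simp: hom_gens_def)

lemma hom_gens_mult:
  assumes a: "a \<in> hom_gens g" and b: "b \<in> hom_gens h"
  shows "a \<otimes> b \<in> lin A (hom_gens (g + h))"
proof -
  obtain \<mu> \<nu> where a': "a = t \<mu> \<otimes> st \<nu>" "\<mu> \<in> \<P>" "\<nu> \<in> \<P>" "\<s> \<mu> = \<s> \<nu>" "\<D> \<mu> = g + \<D> \<nu>"
    using a by (rule hom_gensE)
  obtain \<sigma> \<tau> where b': "b = t \<sigma> \<otimes> st \<tau>" "\<sigma> \<in> \<P>" "\<tau> \<in> \<P>" "\<s> \<sigma> = \<s> \<tau>" "\<D> \<sigma> = h + \<D> \<tau>"
    using b by (rule hom_gensE)
  show ?thesis unfolding a'(1) b'(1)
  proof (rule gen_mult[OF a'(2,3) b'(2,3) a'(4) b'(4) _ hom_gens_closed(1)])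
    fix \<alpha> \<beta> assume ab: "(\<alpha>, \<beta>) \<in> mce_pairs \<nu> \<sigma>"
    note * = mce_pairsD[OF ab a'(3) b'(2)]
    have m: "\<s> \<mu> = \<r> \<alpha>" "\<s> \<tau> = \<r> \<beta>" using a'(4) b'(4) *(3,4) by simp_all
    have d: "\<D> \<nu> + \<D> \<alpha> = \<D> \<sigma> + \<D> \<beta>"
      using ideg_cmp[OF a'(3) *(1,3)] ideg_cmp[OF b'(2) *(2,4)] *(5) by simp
    have "\<D> (\<mu> \<star> \<alpha>) = (g + h) + \<D> (\<tau> \<star> \<beta>)"
    proof
      fix i show "\<D> (\<mu> \<star> \<alpha>) i = ((g + h) + \<D> (\<tau> \<star> \<beta>)) i"
        using fun_cong[OF d, of i] fun_cong[OF a'(5), of i] fun_cong[OF b'(5), of i]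
        by (simp add: ideg_cmp[OF a'(2) *(1) m(1)] ideg_cmp[OF b'(3) *(2) m(2)])
    qed
    moreover have "\<s> (\<mu> \<star> \<alpha>) = \<s> (\<tau> \<star> \<beta>)"
      using src_cmp[OF a'(2) *(1) m(1)] src_cmp[OF b'(3) *(2) m(2)] *(7) by simp
    ultimately have "t (\<mu> \<star> \<alpha>) \<otimes> st (\<tau> \<star> \<beta>) \<in> hom_gens (g + h)"
      unfolding hom_gens_def using cmp_closed[OF a'(2) *(1) m(1)] cmp_closed[OF b'(3) *(2) m(2)] by blast
    then show "t (\<mu> \<star> \<alpha>) \<otimes> st (\<tau> \<star> \<beta>) \<in> lin A (hom_gens (g + h))" by (rule lin_base[OF _ hom_gens_closed(1)])
  qed
qed

lemma hom_gens_adj: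
  assumes "a \<in> hom_gens g" shows "adj A a \<in> hom_gens (- g)"
proof -
  obtain \<mu> \<nu> where a: "a = t \<mu> \<otimes> st \<nu>" "\<mu> \<in> \<P>" "\<nu> \<in> \<P>" "\<s> \<mu> = \<s> \<nu>" "\<D> \<mu> = g + \<D> \<nu>"
    using assms by (rule hom_gensE)
  have "adj A a = t \<nu> \<otimes> st \<mu>" using a(2,3) by (simp add: a(1) adj_mult)
  moreover have "\<D> \<nu> = - g + \<D> \<mu>" using a(5) by simp
  ultimately show ?thesis unfolding hom_gens_def using a(2-4) by force
qed

text \<open>Finitely many generators of degree 0 involve finitely many paths, and the closure of
  these is still finite.\<close>

lemma core_gens_ex:
  assumes "finite H" "H \<subseteq> hom_gens 0"
  obtains P where "core_paths \<Lambda> A t P" "H \<subseteq> core_gens P"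
proof -
  let ?S = "{(\<mu>, \<nu>). \<mu> \<in> \<P> \<and> \<nu> \<in> \<P> \<and> \<s> \<mu> = \<s> \<nu> \<and> \<d> \<mu> = \<d> \<nu>}"
  let ?f = "\<lambda>(\<mu>, \<nu>). t \<mu> \<otimes> st \<nu>"
  have sub: "H \<subseteq> ?f ` ?S"
  proof
    fix a assume "a \<in> H"
    then have "a \<in> hom_gens 0" using assms(2) by blast
    then obtain \<mu> \<nu> where a: "a = t \<mu> \<otimes> st \<nu>" "\<mu> \<in> \<P>" "\<nu> \<in> \<P>" "\<s> \<mu> = \<s> \<nu>" "\<D> \<mu> = 0 + \<D> \<nu>"
      by (rule hom_gensE)
    then have "(\<mu>, \<nu>) \<in> ?S" "a = ?f (\<mu>, \<nu>)" using ideg_eq_iff[of \<Lambda> \<mu> \<nu>] by simp_all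
    then show "a \<in> ?f ` ?S" by blast
  qed
  obtain C where C: "C \<subseteq> ?S" "finite C" "H = ?f ` C" using finite_subset_image[OF assms(1) sub] by blast
  define F where "F = fst ` C \<union> snd ` C"
  have "fst p \<in> \<P> \<and> snd p \<in> \<P>" if "p \<in> C" for p
    using subsetD[OF C(1) that] by (cases p) simp
  then have F: "finite F" "F \<subseteq> \<P>" using C(2) unfolding F_def by auto
  have "core_paths \<Lambda> A t (Pi_closure F)"
  proof (rule core_paths.intro[OF ck_kgraph_axioms], unfold_locales)
    show "finite (Pi_closure F)" by (rule Pi_closure_finite[OF fa F])
    show "\<mu> \<in> \<P>" if "\<mu> \<in> Pi_closure F" for \<mu> by (rule Pi_closure_paths[OF that F(2)])
  qed (rule Pi_closure.mce Pi_closure.swap; assumption)+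
  moreover have "H \<subseteq> core_gens (Pi_closure F)"
  proof
    fix a assume "a \<in> H"
    then obtain p where p: "p \<in> C" "a = ?f p" using C(3) by blast
    obtain \<mu> \<nu> where mn: "p = (\<mu>, \<nu>)" by (cases p)
    have "\<mu> \<in> F" "\<nu> \<in> F" using p(1) mn by (force simp: F_def)+
    then have "\<mu> \<in> Pi_closure F" "\<nu> \<in> Pi_closure F" by (simp_all add: Pi_closure.base)
    then show "a \<in> core_gens (Pi_closure F)" using p mn subsetD[OF C(1) p(1)] unfolding core_gens_def by auto
  qed
  ultimately show ?thesis by (rule that)
qed

end

context kgraph_rep
begin

lemma rho_sq_pow: "x \<in> carrier A \<Longrightarrow> sq_pow A j x \<in> carrier A \<and> \<rho> (sq_pow A j x) = sq_pow B j (\<rho> x)"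
proof (induction j)
  case (Suc j)
  then show ?case using cstar_homD(3)[OF hom, of "sq_pow A j x" "sq_pow A j x"] by simp
qed simp

text \<open>By \<open>\<parallel>y\<^sup>n\<parallel> = \<parallel>y\<parallel>\<^sup>n\<close> for \<open>y = x\<^sup>* x\<close> and \<open>n = 2\<^sup>j\<close>, a constant that is polynomial in \<open>n\<close> disappears
  as \<open>n \<rightarrow> \<infinity>\<close>.\<close>

lemma growth_isometry:
  assumes x: "x \<in> carrier A"
    and le: "\<And>j. nrm A (sq_pow A j (adj A x \<otimes> x)) \<le> C * (2 ^ j + 1) ^ K * nrm B (\<rho> (sq_pow A j (adj A x \<otimes> x)))"
  shows "nrm A x \<le> nrm B (\<rho> x)"
proof -
  let ?y = "adj A x \<otimes> x"
  have y: "?y \<in> carrier A" "adj A ?y = ?y" using x by (simp_all add: adj_mult)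
  have ry: "\<rho> ?y = adj B (\<rho> x) \<otimes>\<^bsub>B\<^esub> \<rho> x"
    using cstar_homD(3)[OF hom, of "adj A x" x] cstar_homD(4)[OF hom, of x] x by simp
  have ry': "\<rho> ?y \<in> carrier B" "adj B (\<rho> ?y) = \<rho> ?y"
    unfolding ry using x by (simp_all add: B.adj_mult)
  have "nrm A ?y \<le> nrm B (\<rho> ?y)"
  proof (rule growth_le)
    show "nrm A ?y ^ 2 ^ j \<le> C * (2 ^ j + 1) ^ K * nrm B (\<rho> ?y) ^ 2 ^ j" for j
      using le[of j] sq_pow[OF y, of j] B.sq_pow[OF ry', of j] rho_sq_pow[OF y(1), of j] by simp
  qed (use nrm_nonneg[OF y(1)] B.nrm_nonneg[OF ry'(1)] in simp_all)
  then have "(nrm A x)\<^sup>2 \<le> (nrm B (\<rho> x))\<^sup>2"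
    using cstar_identity[OF x] B.cstar_identity[OF rho_closed[OF x]] unfolding ry by simp
  then show ?thesis by (rule power2_le_imp_le) (use B.nrm_nonneg x in simp)
qed

text \<open>All powers stay in one finite core algebra, so the constant in \<open>core_bound\<close>
  does not depend on the exponent; hence \<open>K = 0\<close>.\<close>

lemma core_isometry:
  assumes x: "x \<in> carrier A" and y: "adj A x \<otimes> x \<in> lin A (hom_gens 0)"
  shows "nrm A x \<le> nrm B (\<rho> x)"
proof -
  obtain H where H: "finite H" "H \<subseteq> hom_gens 0" "adj A x \<otimes> x \<in> lin A H" using lin_finite_support[OF y] by blast
  obtain P where P: "core_paths \<Lambda> A t P" "H \<subseteq> core_gens P" using core_gens_ex[OF H(1,2)] .
  interpret core_rep \<Lambda> A t P B \<rho> by (rule core_rep.intro[OF P(1) kgraph_rep_axioms])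
  have "sq_pow A j (adj A x \<otimes> x) \<in> lin A (core_gens P)" for j
    by (induction j) (use lin_mono[OF H(3) P(2)] core_mult in auto)
  then show ?thesis
    by (intro growth_isometry[OF x, where K = 0 and C = "(real (card P))\<^sup>2"]) (simp add: core_bound)
qed

text \<open>If \<open>x\<close> has degree \<open>g\<close>, then x*x has degree 0.\<close>

lemma homogeneous_isometry:
  assumes "x \<in> lin A (hom_gens g)" shows "nrm A x \<le> nrm B (\<rho> x)"
proof (rule core_isometry)
  show "x \<in> carrier A" by (rule lin_closed[OF assms hom_gens_closed(1)])
  have "adj A x \<in> lin A (hom_gens (- g))"
    by (rule lin_adj[OF assms hom_gens_closed(1) hom_gens_closed(1)]) (rule lin_base[OF hom_gens_adj hom_gens_closed(1)])
  then show "adj A x \<otimes> x \<in> lin A (hom_gens 0)"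
    by (rule lin_mult[OF _ assms hom_gens_closed(1) hom_gens_closed(1) hom_gens_closed(1)])
      (use hom_gens_mult[of _ "- g" _ g] in simp)
qed

lemma rho_zero_minus:
  shows rho_zero: "\<rho> \<zero> = \<zero>\<^bsub>B\<^esub>"
    and rho_minus: "\<lbrakk>x \<in> carrier A; y \<in> carrier A\<rbrakk> \<Longrightarrow> \<rho> (x \<ominus> y) = \<rho> x \<ominus>\<^bsub>B\<^esub> \<rho> y"
proof -
  have "\<rho> (0 \<odot> \<zero>) = 0 \<odot>\<^bsub>B\<^esub> \<rho> \<zero>" by (rule cstar_homD(5)[OF hom M.zero_closed])
  then show "\<rho> \<zero> = \<zero>\<^bsub>B\<^esub>" using B.smult_0[OF rho_closed[OF M.zero_closed]] by simp
  assume x: "x \<in> carrier A" and y: "y \<in> carrier A"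
  show "\<rho> (x \<ominus> y) = \<rho> x \<ominus>\<^bsub>B\<^esub> \<rho> y"
    unfolding minus_smult[OF x y] B.minus_smult[OF rho_closed[OF x] rho_closed[OF y]]
      cstar_homD(2)[OF hom x smult_carrier[OF y]] cstar_homD(5)[OF hom y] ..
qed

lemma kernel_ideal: "cstar_ideal A {x \<in> carrier A. \<rho> x = \<zero>\<^bsub>B\<^esub>}" (is "cstar_ideal A ?K")
  unfolding cstar_ideal_def
proof (intro conjI ballI allI)
  show "?K \<subseteq> carrier A" by blast
  show "\<zero> \<in> ?K" using rho_zero by simp
  show "cstar_closed A ?K"
    unfolding closed_iff
  proof (intro conjI ballI impI)
    show "?K \<subseteq> carrier A" by blast
    fix x assume x: "x \<in> carrier A" and lim: "\<forall>e>0. \<exists>c\<in>?K. nrm A (x \<ominus> c) < e"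
    have "nrm B (\<rho> x) \<le> 0"
    proof (rule field_le_epsilon)
      fix e :: real assume "e > 0"
      then obtain c where c: "c \<in> carrier A" "\<rho> c = \<zero>\<^bsub>B\<^esub>" "nrm A (x \<ominus> c) < e" using lim by blast
      have "\<rho> (x \<ominus> c) = \<rho> x" unfolding rho_minus[OF x c(1)] c(2) using x by simp
      then show "nrm B (\<rho> x) \<le> 0 + e" using contractive[of "x \<ominus> c"] c(1,3) x by simp
    qed
    then have "nrm B (\<rho> x) = 0" using B.nrm_nonneg[OF rho_closed[OF x]] by simp
    then show "x \<in> ?K" using B.nrm_eq_0[OF rho_closed[OF x]] x by simp
  qed
  fix x assume x: "x \<in> ?K"
  show "x \<oplus> y \<in> ?K" if "y \<in> ?K" for y using x that cstar_homD(2)[OF hom, of x y] by simp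
  show "c \<odot> x \<in> ?K" for c using x cstar_homD(5)[OF hom, of x c] by simp
  show "a \<otimes> x \<in> ?K" if "a \<in> carrier A" for a using x that cstar_homD(3)[OF hom, of a x] by simp
  show "x \<otimes> a \<in> ?K" if "a \<in> carrier A" for a using x that cstar_homD(3)[OF hom, of x a] by simp
qed

end

section \<open>Homogeneous components seen through the grading\<close>

definition mask :: "('x \<Rightarrow> bool) \<Rightarrow> ('x \<Rightarrow> complex) \<Rightarrow> 'x \<Rightarrow> complex" where
  "mask Q f = (\<lambda>x. if Q x then f x else 0)"

lemma mask_closed: "f \<in> ell2 X \<Longrightarrow> mask Q f \<in> ell2 X"
  by (rule ell2_mask_closed) (auto simp: mask_def)

text \<open>Bessel's inequality for the mutually orthogonal subspaces of fixed grade.\<close>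

lemma sum_norm_mask_le:
  assumes f: "f \<in> ell2 X" and H: "finite H"
  shows "(\<Sum>h\<in>H. (ell2_norm X (mask (\<lambda>x. gr x = h) f))\<^sup>2) \<le> (ell2_norm X f)\<^sup>2"
proof -
  have s: "(\<lambda>x. (cmod (mask (\<lambda>x. gr x = h) f x))\<^sup>2) summable_on X" for h
    using mask_closed[OF f] by (auto simp: ell2_def)
  have hs: "((\<lambda>x. \<Sum>h\<in>H. (cmod (mask (\<lambda>x. gr x = h) f x))\<^sup>2) has_sum
      (\<Sum>h\<in>H. \<Sum>\<^sub>\<infinity>x\<in>X. (cmod (mask (\<lambda>x. gr x = h) f x))\<^sup>2)) X"
    using H by (induction H rule: finite_induct) (simp_all add: has_sum_add has_sum_infsum[OF s])
  have "(\<Sum>h\<in>H. (ell2_norm X (mask (\<lambda>x. gr x = h) f))\<^sup>2) =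
      (\<Sum>h\<in>H. \<Sum>\<^sub>\<infinity>x\<in>X. (cmod (mask (\<lambda>x. gr x = h) f x))\<^sup>2)"
    by (simp add: ell2_norm_def infsum_nonneg)
  also have "\<dots> = (\<Sum>\<^sub>\<infinity>x\<in>X. \<Sum>h\<in>H. (cmod (mask (\<lambda>x. gr x = h) f x))\<^sup>2)"
    by (rule infsumI[OF hs, symmetric])
  also have "\<dots> \<le> (\<Sum>\<^sub>\<infinity>x\<in>X. (cmod (f x))\<^sup>2)"
  proof (rule infsum_mono)
    show "(\<lambda>x. \<Sum>h\<in>H. (cmod (mask (\<lambda>x. gr x = h) f x))\<^sup>2) summable_on X"
      using hs by (rule has_sum_imp_summable)
    show "(\<lambda>x. (cmod (f x))\<^sup>2) summable_on X" using f by (simp add: ell2_def)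
    fix x
    have "(\<Sum>h\<in>H. (cmod (mask (\<lambda>x. gr x = h) f x))\<^sup>2) = (\<Sum>h\<in>H. if gr x = h then (cmod (f x))\<^sup>2 else 0)"
      by (rule sum.cong) (auto simp: mask_def)
    also have "\<dots> \<le> (cmod (f x))\<^sup>2" using H by (simp add: sum.delta)
    finally show "(\<Sum>h\<in>H. (cmod (mask (\<lambda>x. gr x = h) f x))\<^sup>2) \<le> (cmod (f x))\<^sup>2" .
  qed
  also have "\<dots> = (ell2_norm X f)\<^sup>2" by (simp add: ell2_norm_def infsum_nonneg)
  finally show ?thesis .
qed

locale graded_rep = graded_path_action \<Lambda> X act vtx gr + kgraph_rep \<Lambda> A t "B_ell2 X" \<rho>
  for \<Lambda> :: "('l, 'k::finite) kgraph" and X :: "'x set" and act vtx gr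
    and A :: "'a cstar" (structure) and t :: "'l \<Rightarrow> 'a" and \<rho> +
  assumes rho_t: "\<mu> \<in> \<P> \<Longrightarrow> \<rho> (t \<mu>) = path_op \<mu>"
begin

lemma rho_op: "x \<in> carrier A \<Longrightarrow> \<rho> x \<in> bounded_ops X"
  using rho_closed by simp

lemma rho_apply:
  assumes "x \<in> carrier A" "y \<in> carrier A" "f \<in> ell2 X"
  shows "\<rho> (x \<oplus> y) f z = \<rho> x f z + \<rho> y f z" "\<rho> (c \<odot> x) f z = c * \<rho> x f z"
    "\<rho> (x \<otimes> y) f = \<rho> x (\<rho> y f)" "\<rho> \<zero> f z = 0"
  using cstar_homD(2,3)[OF hom assms(1,2)] cstar_homD(5)[OF hom assms(1)] rho_zero assms(3)
  by (simp_all add: compose_eq)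

lemma rho_gen_apply:
  assumes "\<mu> \<in> \<P>" "\<nu> \<in> \<P>" "f \<in> ell2 X"
  shows "\<rho> (t \<mu> \<otimes> st \<nu>) f = path_op \<mu> (adj (B_ell2 X) (path_op \<nu>) f)"
  using rho_apply(3)[OF t_closed[OF assms(1)] adj_closed[OF t_closed[OF assms(2)]] assms(3)]
    cstar_homD(4)[OF hom t_closed[OF assms(2)]] rho_t assms by simp

lemma rho_finsum_apply:
  assumes "finite I" "F \<in> I \<rightarrow> carrier A" "f \<in> ell2 X"
  shows "\<rho> (finsum A F I) f z = (\<Sum>i\<in>I. \<rho> (F i) f z)"
  using assms(1,2)
proof (induction I rule: finite_induct)
  case empty
  then show ?case using rho_apply(4)[OF M.zero_closed M.zero_closed assms(3)] by simp
next
  case (insert i I)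
  then have c: "F \<in> I \<rightarrow> carrier A" "F i \<in> carrier A" by auto
  show ?case
    using insert rho_apply(1)[OF c(2) M.finsum_closed[OF c(1)] assms(3)] c by (simp add: M.finsum_insert)
qed

text \<open>A generator moves \<open>\<nu>x\<close> to \<open>\<mu>x\<close>, which raises the grade
  by \<open>\<D> \<mu> - \<D> \<nu> = g\<close>.\<close>

lemma homogeneous_apply:
  assumes "x \<in> lin A (hom_gens g)" "f \<in> ell2 X"
  shows "\<rho> x (mask (\<lambda>z. gr z = h) f) y = (if gr y = h + g then \<rho> x f y else 0)"
  using assms(1)
proof (induction rule: lin.induct)
  case lin_zero
  then show ?case
    using rho_apply(4)[OF M.zero_closed M.zero_closed assms(2)]
      rho_apply(4)[OF M.zero_closed M.zero_closed mask_closed[OF assms(2)]] by simp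
next
  case (lin_step a b c)
  note f = assms(2) and mf = mask_closed[OF assms(2), of "\<lambda>z. gr z = h"]
  have ab: "a \<in> carrier A" "b \<in> carrier A" "c \<odot> a \<in> carrier A"
    using lin_step.hyps lin_closed[OF _ hom_gens_closed(1)] hom_gens_closed(1) by blast+
  obtain \<mu> \<nu> where a: "a = t \<mu> \<otimes> st \<nu>" "\<mu> \<in> \<P>" "\<nu> \<in> \<P>" "\<s> \<mu> = \<s> \<nu>" "\<D> \<mu> = g + \<D> \<nu>"
    using lin_step.hyps(1) by (rule hom_gensE)
  have "\<rho> a (mask (\<lambda>z. gr z = h) f) y = (if gr y = h + g then \<rho> a f y else 0)"
  proof (cases "y \<in> cyl \<mu>")
    case True
    then obtain x where x: "x \<in> adom \<mu>" "y = act \<mu> x" by blast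
    then have xn: "x \<in> adom \<nu>" using a(4) by (simp add: adom_def)
    note xX = adomD(1)[OF x(1)]
    have gy: "gr y = gr x + \<D> \<mu>" unfolding x(2) by (rule gr_act[OF a(2) xX adomD(2)[OF x(1)]])
    have gn: "gr (act \<nu> x) = gr x + \<D> \<nu>" by (rule gr_act[OF a(3) xX adomD(2)[OF xn]])
    have "gr (act \<nu> x) = h \<longleftrightarrow> gr y = h + g"
      unfolding gy gn a(5) by (auto simp: fun_eq_iff algebra_simps)
    then show ?thesis
      unfolding a(1) rho_gen_apply[OF a(2,3) f] rho_gen_apply[OF a(2,3) mf] x(2)
        path_op_matrix(1)[OF a(2,3) f x(1) xn] path_op_matrix(1)[OF a(2,3) mf x(1) xn]
      by (simp add: mask_def)
  next
    case False
    then show ?thesis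
      unfolding a(1) rho_gen_apply[OF a(2,3) f] rho_gen_apply[OF a(2,3) mf]
      using path_op_matrix(3)[OF a(2,3) f False] path_op_matrix(3)[OF a(2,3) mf False] by simp
  qed
  then have a': "\<rho> a (mask (\<lambda>z. gr z = h) f) y = (if Q then \<rho> a f y else 0)" if "Q = (gr y = h + g)" for Q
    using that by simp
  have b': "\<rho> b (mask (\<lambda>z. gr z = h) f) y = (if Q then \<rho> b f y else 0)" if "Q = (gr y = h + g)" for Q
    unfolding that by (rule lin_step.IH)
  have "\<rho> ((c \<odot> a) \<oplus> b) (mask (\<lambda>z. gr z = h) f) y = (if Q then \<rho> ((c \<odot> a) \<oplus> b) f y else 0)"
    if "Q = (gr y = h + g)" for Q
    unfolding rho_apply(1)[OF ab(3,2) f] rho_apply(1)[OF ab(3,2) mf]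
      rho_apply(2)[OF ab(1,1) f] rho_apply(2)[OF ab(1,1) mf] a'[OF that] b'[OF that] by simp
  then show ?case by blast
qed

text \<open>The substitute for averaging over the gauge action: at a point \<open>y\<close> the
  component of degree \<open>g\<close> is found by feeding the whole operator only the part of
  \<open>f\<close> of grade \<open>gr y - g\<close>. Grouping the points by grade, the squares add
  up by Bessel's inequality.\<close>

lemma component_bound:
  assumes G: "finite G" and x: "\<And>g. g \<in> G \<Longrightarrow> x g \<in> lin A (hom_gens g)" and g: "g \<in> G"
  shows "nrm (B_ell2 X) (\<rho> (x g)) \<le> nrm (B_ell2 X) (\<rho> (finsum A x G))"
proof (rule op_nrm_le)
  let ?T = "\<rho> (finsum A x G)" and ?N = "nrm (B_ell2 X) (\<rho> (finsum A x G))"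
  have xc: "x \<in> G \<rightarrow> carrier A" using x lin_closed[OF _ hom_gens_closed(1)] by blast
  have T: "?T \<in> bounded_ops X" by (rule rho_op[OF M.finsum_closed[OF xc]])
  show N: "0 \<le> ?N" by (rule op_nrm_nonneg[OF T])
  have xg: "\<rho> (x g) \<in> bounded_ops X" using rho_op xc g by blast
  fix f assume f: "f \<in> ell2 X"
  let ?m = "\<lambda>h. mask (\<lambda>z. gr z = h) f"
  have Tm: "?T (?m (gr y - g)) y = \<rho> (x g) f y" for y
  proof -
    have "?T (?m (gr y - g)) y = (\<Sum>g'\<in>G. \<rho> (x g') (?m (gr y - g)) y)"
      by (rule rho_finsum_apply[OF G xc mask_closed[OF f]])
    also have "\<dots> = (\<Sum>g'\<in>G. if g' = g then \<rho> (x g) f y else 0)"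
    proof (rule sum.cong[OF refl])
      fix g' assume g': "g' \<in> G"
      have "gr y = gr y - g + g' \<longleftrightarrow> g' = g" by (auto simp: fun_eq_iff)
      then show "\<rho> (x g') (?m (gr y - g)) y = (if g' = g then \<rho> (x g) f y else 0)"
        using homogeneous_apply[OF x[OF g'] f, of "gr y - g" y] by simp
    qed
    also have "\<dots> = \<rho> (x g) f y" using G g by simp
    finally show ?thesis .
  qed
  have "L2_set (\<lambda>y. cmod (\<rho> (x g) f y)) Y \<le> ?N * ell2_norm X f" if Y: "finite Y" "Y \<subseteq> X" for Y
  proof -
    let ?k = "\<lambda>y. gr y - g"
    have "(\<Sum>y\<in>Y. (cmod (\<rho> (x g) f y))\<^sup>2) = (\<Sum>h\<in>?k ` Y. \<Sum>y\<in>{y \<in> Y. ?k y = h}. (cmod (\<rho> (x g) f y))\<^sup>2)"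
      by (rule sum.image_gen[OF Y(1)])
    also have "\<dots> \<le> (\<Sum>h\<in>?k ` Y. ?N\<^sup>2 * (ell2_norm X (?m h))\<^sup>2)"
    proof (rule sum_mono)
      fix h
      let ?Y = "{y \<in> Y. ?k y = h}"
      have "L2_set (\<lambda>y. cmod (?T (?m h) y)) ?Y \<le> ell2_norm X (?T (?m h))"
        by (rule L2_set_le_ell2_norm[OF bounded_ops_closed[OF T mask_closed[OF f]]]) (use Y in auto)
      also have "\<dots> \<le> ?N * ell2_norm X (?m h)" by (rule op_nrm_bound[OF T mask_closed[OF f]])
      finally have "(L2_set (\<lambda>y. cmod (?T (?m h) y)) ?Y)\<^sup>2 \<le> (?N * ell2_norm X (?m h))\<^sup>2"
        by (rule power_mono) (rule L2_set_nonneg)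
      moreover have "(L2_set (\<lambda>y. cmod (?T (?m h) y)) ?Y)\<^sup>2 = (\<Sum>y\<in>?Y. (cmod (?T (?m h) y))\<^sup>2)"
        by (simp add: L2_set_def sum_nonneg)
      moreover have "(\<Sum>y\<in>?Y. (cmod (?T (?m h) y))\<^sup>2) = (\<Sum>y\<in>?Y. (cmod (\<rho> (x g) f y))\<^sup>2)"
      proof (rule sum.cong[OF refl])
        fix y assume "y \<in> ?Y"
        then have "?k y = h" by simp
        then show "(cmod (?T (?m h) y))\<^sup>2 = (cmod (\<rho> (x g) f y))\<^sup>2" using Tm[of y] by simp
      qed
      ultimately show "(\<Sum>y\<in>?Y. (cmod (\<rho> (x g) f y))\<^sup>2) \<le> ?N\<^sup>2 * (ell2_norm X (?m h))\<^sup>2"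
        by (simp add: power_mult_distrib)
    qed
    also have "\<dots> = ?N\<^sup>2 * (\<Sum>h\<in>?k ` Y. (ell2_norm X (?m h))\<^sup>2)" by (rule sum_distrib_left[symmetric])
    also have "\<dots> \<le> ?N\<^sup>2 * (ell2_norm X f)\<^sup>2"
      by (rule mult_left_mono[OF sum_norm_mask_le[OF f]]) (use Y in auto)
    finally have "(\<Sum>y\<in>Y. (cmod (\<rho> (x g) f y))\<^sup>2) \<le> (?N * ell2_norm X f)\<^sup>2" by (simp add: power_mult_distrib)
    then show ?thesis unfolding L2_set_def by (rule real_le_lsqrt[rotated 1]) (use N in auto)
  qed
  then show "ell2_norm X (\<rho> (x g) f) \<le> ?N * ell2_norm X f"
    using ell2_support[OF bounded_ops_closed[OF xg f]] by (intro ell2I(2)) blast+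
qed

end

section \<open>Boxes of degrees and the dense span of the generators\<close>

definition degree_box :: "nat \<Rightarrow> ('k \<Rightarrow> int) set" where
  "degree_box R = {g. \<forall>i. \<bar>g i\<bar> \<le> int R}"

lemma degree_box_finite_card:
  "finite (degree_box R :: ('k::finite \<Rightarrow> int) set)" "card (degree_box R :: ('k::finite \<Rightarrow> int) set) = (2 * R + 1) ^ CARD('k)"
proof -
  have *: "(degree_box R :: ('k \<Rightarrow> int) set) = PiE UNIV (\<lambda>_. {- int R..int R})"
    by (auto simp: degree_box_def PiE_iff abs_le_iff minus_le_iff)
  show "finite (degree_box R :: ('k::finite \<Rightarrow> int) set)" unfolding * by (rule finite_PiE) auto
  show "card (degree_box R :: ('k::finite \<Rightarrow> int) set) = (2 * R + 1) ^ CARD('k)"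
  proof -
    have c: "card {- int R..int R} = 2 * R + 1" unfolding card_atLeastAtMost_int by linarith
    show ?thesis unfolding * by (subst card_PiE) (simp_all add: c del: card_atLeastAtMost_int)
  qed
qed

text \<open>The closure of \<open>S\<close> is again closed under the operations, so it qualifies in
  the definition of a generating set.\<close>

lemma (in cstar_algebra) dense_span:
  assumes gen: "cstar_generates A G" and S: "S \<subseteq> carrier A" "G \<subseteq> S" "\<zero> \<in> S"
    and ops: "\<And>x y. \<lbrakk>x \<in> S; y \<in> S\<rbrakk> \<Longrightarrow> x \<oplus> y \<in> S" "\<And>x y. \<lbrakk>x \<in> S; y \<in> S\<rbrakk> \<Longrightarrow> x \<otimes> y \<in> S"
      "\<And>x. x \<in> S \<Longrightarrow> adj A x \<in> S" "\<And>x c. x \<in> S \<Longrightarrow> c \<odot> x \<in> S"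
    and x: "x \<in> carrier A" and e: "e > 0"
  shows "\<exists>y\<in>S. nrm A (x \<ominus> y) < e"
proof -
  define C where "C = {x \<in> carrier A. \<forall>e>0. \<exists>y\<in>S. nrm A (x \<ominus> y) < e}"
  \<comment> \<open>Approximation up to a constant factor is enough after rescaling
    \<open>e\<close>; dividing by \<open>K + 1\<close> also covers \<open>K = 0\<close>.\<close>
  have CI: "x \<in> C" if xc: "x \<in> carrier A" and app: "\<And>e. e > 0 \<Longrightarrow> \<exists>y\<in>S. nrm A (x \<ominus> y) \<le> K * e" and K: "0 \<le> K" for x K
    unfolding C_def
  proof (intro CollectI conjI allI impI xc)
    fix e :: real assume e: "e > 0"
    have "0 < e / (K + 1)" using e K by simp
    then obtain y where y: "y \<in> S" "nrm A (x \<ominus> y) \<le> K * (e / (K + 1))" using app by blast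
    have "K * (e / (K + 1)) < e" using e K by (simp add: field_simps)
    then show "\<exists>y\<in>S. nrm A (x \<ominus> y) < e" using y by (intro bexI[OF _ y(1)]) linarith
  qed
  have CE: "\<exists>y\<in>S. y \<in> carrier A \<and> nrm A (x \<ominus> y) < e" if "x \<in> C" "e > 0" for x e
    using that S(1) unfolding C_def by blast
  have Cc: "x \<in> carrier A" if "x \<in> C" for x using that by (simp add: C_def)
  have SC: "S \<subseteq> C"
  proof
    fix x assume x: "x \<in> S"
    then have xc: "x \<in> carrier A" using S(1) by blast
    show "x \<in> C"
    proof (rule CI[of x 0])
      show "\<exists>y\<in>S. nrm A (x \<ominus> y) \<le> 0 * e" for e
        using nrm_eq_0[OF M.zero_closed] xc by (intro bexI[OF _ x]) simp
    qed (use xc in simp_all)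
  qed
  have cl: "cstar_closed A C"
    unfolding closed_iff
  proof (intro conjI ballI impI)
    show "C \<subseteq> carrier A" using Cc by blast
    fix x assume x: "x \<in> carrier A" and lim: "\<forall>e>0. \<exists>c\<in>C. nrm A (x \<ominus> c) < e"
    show "x \<in> C"
    proof (rule CI[OF x, of 2])
      fix e :: real assume "e > 0"
      then obtain c where c: "c \<in> C" "nrm A (x \<ominus> c) < e" using lim by blast
      obtain y where y: "y \<in> S" "y \<in> carrier A" "nrm A (c \<ominus> y) < e" using CE[OF c(1) \<open>e > 0\<close>] by blast
      show "\<exists>y\<in>S. nrm A (x \<ominus> y) \<le> 2 * e"
        using nrm_triangle_minus[OF x Cc[OF c(1)] y(2)] c(2) y(3) by (intro bexI[OF _ y(1)]) linarith
    qed simp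
  qed
  have am: "x \<oplus> y \<in> C \<and> x \<otimes> y \<in> C" if xy: "x \<in> C" "y \<in> C" for x y
  proof
    note c = Cc[OF xy(1)] Cc[OF xy(2)]
    show "x \<oplus> y \<in> C"
    proof (rule CI[of _ 2])
      fix e :: real assume e: "e > 0"
      obtain u where u: "u \<in> S" "u \<in> carrier A" "nrm A (x \<ominus> u) < e" using CE[OF xy(1) e] by blast
      obtain v where v: "v \<in> S" "v \<in> carrier A" "nrm A (y \<ominus> v) < e" using CE[OF xy(2) e] by blast
      have "(x \<oplus> y) \<ominus> (u \<oplus> v) = (x \<ominus> u) \<oplus> (y \<ominus> v)"
        using c u(2) v(2) by (simp add: minus_smult smult_add_right M.a_ac)
      then have "nrm A ((x \<oplus> y) \<ominus> (u \<oplus> v)) \<le> 2 * e"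
        using nrm_add[of "x \<ominus> u" "y \<ominus> v"] c u(2,3) v(2,3) by simp
      then show "\<exists>w\<in>S. nrm A ((x \<oplus> y) \<ominus> w) \<le> 2 * e" using ops(1)[OF u(1) v(1)] by blast
    qed (use c in simp_all)
    \<comment> \<open>Products are approximated in two steps, first with the right factor already in
      \<open>S\<close>; each constant then depends on one fixed element, and no bound on the
      approximants is needed.\<close>
    have p: "x \<otimes> u \<in> C" if "u \<in> S" for u
    proof (rule CI[of _ "nrm A u"])
      have uc: "u \<in> carrier A" using that S(1) by blast
      fix e :: real assume e: "e > 0"
      obtain w where w: "w \<in> S" "w \<in> carrier A" "nrm A (x \<ominus> w) < e" using CE[OF xy(1) e] by blast
      have "nrm A (x \<otimes> u \<ominus> w \<otimes> u) \<le> nrm A (x \<ominus> w) * nrm A u"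
        using mult_minus_left[OF c(1) w(2) uc] nrm_mult[of "x \<ominus> w" u] c(1) w(2) uc by simp
      also have "\<dots> \<le> nrm A u * e" using mult_right_mono[OF less_imp_le[OF w(3)] nrm_nonneg[OF uc]] by (simp only: mult.commute)
      finally show "\<exists>y\<in>S. nrm A (x \<otimes> u \<ominus> y) \<le> nrm A u * e" using ops(2)[OF w(1) that] by blast
    qed (use that S(1) c nrm_nonneg in auto)
    show "x \<otimes> y \<in> C"
    proof (rule CI[of _ "nrm A x + 1"])
      fix e :: real assume e: "e > 0"
      obtain u where u: "u \<in> S" "u \<in> carrier A" "nrm A (y \<ominus> u) < e" using CE[OF xy(2) e] by blast
      obtain w where w: "w \<in> S" "w \<in> carrier A" "nrm A (x \<otimes> u \<ominus> w) < e" using CE[OF p[OF u(1)] e] by blast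
      have "nrm A (x \<otimes> y \<ominus> x \<otimes> u) \<le> nrm A x * nrm A (y \<ominus> u)"
        using mult_minus_right[OF c(2) u(2) c(1)] nrm_mult[of x "y \<ominus> u"] c u(2) by simp
      also have "\<dots> \<le> nrm A x * e" using u(3) nrm_nonneg[OF c(1)] by (simp add: mult_left_mono)
      finally have "nrm A (x \<otimes> y \<ominus> w) \<le> (nrm A x + 1) * e"
        using nrm_triangle_minus[of "x \<otimes> y" "x \<otimes> u" w] c u(2) w(2,3) by (simp add: distrib_right)
      then show "\<exists>w\<in>S. nrm A (x \<otimes> y \<ominus> w) \<le> (nrm A x + 1) * e" using w(1) by blast
    qed (use c nrm_nonneg[OF c(1)] in simp_all)
  qed
  have ac: "adj A x \<in> C \<and> (\<forall>c. c \<odot> x \<in> C)" if x: "x \<in> C" for x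
  proof (intro conjI allI)
    note xc = Cc[OF x]
    show "adj A x \<in> C"
    proof (rule CI[of _ 1])
      fix e :: real assume e: "e > 0"
      obtain u where u: "u \<in> S" "u \<in> carrier A" "nrm A (x \<ominus> u) < e" using CE[OF x e] by blast
      have "nrm A (adj A x \<ominus> adj A u) = nrm A (x \<ominus> u)"
        using adj_minus[OF xc u(2)] nrm_adj[of "x \<ominus> u"] xc u(2) by simp
      then show "\<exists>y\<in>S. nrm A (adj A x \<ominus> y) \<le> 1 * e" using u(3) ops(3)[OF u(1)] by (intro bexI[of _ "adj A u"]) simp_all
    qed (use xc in simp_all)
    fix c
    show "c \<odot> x \<in> C"
    proof (rule CI[of _ "cmod c"])
      fix e :: real assume e: "e > 0"
      obtain u where u: "u \<in> S" "u \<in> carrier A" "nrm A (x \<ominus> u) < e" using CE[OF x e] by blast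
      have "nrm A (c \<odot> x \<ominus> c \<odot> u) = cmod c * nrm A (x \<ominus> u)"
        using smult_minus_right[OF xc u(2), of c] nrm_smult[of "x \<ominus> u" c] xc u(2) by simp
      also have "\<dots> \<le> cmod c * e" using u(3) by (simp add: mult_left_mono)
      finally show "\<exists>y\<in>S. nrm A (c \<odot> x \<ominus> y) \<le> cmod c * e" using ops(4)[OF u(1)] by blast
    qed (use xc in simp_all)
  qed
  have "C = carrier A"
  proof (rule gen[unfolded cstar_generates_def, THEN conjunct2, THEN spec, THEN mp], intro conjI)
    show "G \<subseteq> C" "C \<subseteq> carrier A" "\<zero> \<in> C" using SC S(2,3) Cc by blast+
    show "\<forall>x\<in>C. \<forall>y\<in>C. x \<oplus> y \<in> C \<and> x \<otimes> y \<in> C" by (intro ballI am)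
    show "\<forall>x\<in>C. adj A x \<in> C \<and> (\<forall>c. c \<odot> x \<in> C)" by (intro ballI ac)
  qed (rule cl)
  then have "x \<in> C" using x by simp
  then show ?thesis using e by (simp add: C_def)
qed

context ck_kgraph
begin

abbreviation "ck_span \<equiv> lin A (\<Union>g. hom_gens g)"
abbreviation "span_box R \<equiv> lin A (\<Union>g\<in>degree_box R. hom_gens g)"

lemma span_decomp:
  assumes "x \<in> lin A (\<Union>g\<in>G. hom_gens g)" and G: "finite G"
  shows "\<exists>f. (\<forall>g\<in>G. f g \<in> lin A (hom_gens g)) \<and> x = finsum A f G"
  using assms(1)
proof (induction rule: lin.induct)
  case lin_zero
  show ?case by (rule exI[of _ "\<lambda>_. \<zero>"]) (simp add: lin.lin_zero)
next
  case (lin_step a x c)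
  obtain f where f: "\<forall>g\<in>G. f g \<in> lin A (hom_gens g)" "x = finsum A f G" using lin_step.IH by blast
  obtain g where g: "g \<in> G" "a \<in> hom_gens g" using lin_step.hyps(1) by blast
  have ca: "c \<odot> a \<in> lin A (hom_gens g)" by (rule lin_smult[OF lin_base[OF g(2) hom_gens_closed(1)] hom_gens_closed(1)])
  have cac: "c \<odot> a \<in> carrier A" by (rule lin_closed[OF ca hom_gens_closed(1)])
  have fc: "f \<in> G \<rightarrow> carrier A"
  proof
    fix h assume "h \<in> G"
    then have "f h \<in> lin A (hom_gens h)" using f(1) by blast
    then show "f h \<in> carrier A" by (rule lin_closed[OF _ hom_gens_closed(1)])
  qed
  let ?d = "\<lambda>h. if g = h then c \<odot> a else \<zero>"
  have "finsum A (\<lambda>h. ?d h \<oplus> f h) G = finsum A ?d G \<oplus> finsum A f G"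
    by (rule M.finsum_addf) (use cac fc in auto)
  also have "finsum A ?d G = c \<odot> a" using M.finsum_singleton[OF g(1) G, of "\<lambda>_. c \<odot> a"] cac by simp
  finally have "(c \<odot> a) \<oplus> x = finsum A (\<lambda>h. ?d h \<oplus> f h) G" using f(2) by simp
  moreover have "?d h \<oplus> f h \<in> lin A (hom_gens h)" if h: "h \<in> G" for h
  proof -
    have "?d h \<in> lin A (hom_gens h)" using ca lin.lin_zero[of A "hom_gens h"] by (cases "g = h") simp_all
    moreover have "f h \<in> lin A (hom_gens h)" using f(1) h by blast
    ultimately show ?thesis by (rule lin_add[OF _ _ hom_gens_closed(1)])
  qed
  ultimately show ?case by (intro exI[of _ "\<lambda>h. ?d h \<oplus> f h"] conjI ballI)
qed

text \<open>Degrees of generators add in products, so the radius of the box grows only linearly with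
  the exponent of a power.\<close>

lemma span_box_mult:
  assumes "x \<in> span_box R" "y \<in> span_box S" shows "x \<otimes> y \<in> span_box (R + S)"
proof (rule lin_mult[OF assms hom_gens_closed(2) hom_gens_closed(2) hom_gens_closed(2)])
  fix a b assume "a \<in> (\<Union>g\<in>degree_box R. hom_gens g)" "b \<in> (\<Union>g\<in>degree_box S. hom_gens g)"
  then obtain g h where g: "g \<in> degree_box R" "a \<in> hom_gens g" and h: "h \<in> degree_box S" "b \<in> hom_gens h" by blast
  have "\<bar>(g + h) i\<bar> \<le> int (R + S)" for i
  proof -
    have "\<bar>g i\<bar> \<le> int R" "\<bar>h i\<bar> \<le> int S" using g(1) h(1) by (auto simp: degree_box_def)
    then show ?thesis by simp
  qed
  then have "g + h \<in> degree_box (R + S)" unfolding degree_box_def by blast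
  then have "hom_gens (g + h) \<subseteq> (\<Union>g\<in>degree_box (R + S). hom_gens g)" by blast
  then show "a \<otimes> b \<in> span_box (R + S)" by (rule lin_mono[OF hom_gens_mult[OF g(2) h(2)]])
qed

lemma span_box_ex: assumes "x \<in> ck_span" shows "\<exists>R. x \<in> span_box R"
  using assms
proof (induction rule: lin.induct)
  case lin_zero
  show ?case by (rule exI) (rule lin.lin_zero)
next
  case (lin_step a x c)
  obtain R where R: "x \<in> span_box R" using lin_step.IH by blast
  obtain g where g: "a \<in> hom_gens g" using lin_step.hyps(1) by blast
  define S where "S = R + (\<Sum>i\<in>UNIV. nat \<bar>g i\<bar>)"
  have "\<bar>g i\<bar> \<le> int S" for i
  proof -
    have "nat \<bar>g i\<bar> \<le> (\<Sum>i\<in>UNIV. nat \<bar>g i\<bar>)" by (rule member_le_sum) auto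
    then show ?thesis unfolding S_def by linarith
  qed
  then have "g \<in> degree_box S" by (simp add: degree_box_def)
  then have "a \<in> (\<Union>g\<in>degree_box S. hom_gens g)" using g by blast
  moreover have "x \<in> span_box S"
  proof (rule lin_mono[OF R])
    have "degree_box R \<subseteq> (degree_box S :: ('k \<Rightarrow> int) set)"
    proof
      fix g :: "'k \<Rightarrow> int" assume "g \<in> degree_box R"
      then have "\<bar>g i\<bar> \<le> int R" for i by (simp add: degree_box_def)
      moreover have "int R \<le> int S" by (simp add: S_def)
      ultimately have "\<bar>g i\<bar> \<le> int S" for i by (rule order_trans)
      then show "g \<in> degree_box S" by (simp add: degree_box_def)
    qed
    then show "(\<Union>g\<in>degree_box R. hom_gens g) \<subseteq> (\<Union>g\<in>degree_box S. hom_gens g)" by blast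
  qed
  ultimately have "(c \<odot> a) \<oplus> x \<in> span_box S" by (rule lin.lin_step)
  then show ?case by blast
qed

lemma span_closed: "x \<in> ck_span \<Longrightarrow> x \<in> carrier A"
  by (rule lin_closed[OF _ hom_gens_closed(2)])

lemma span_mult: assumes "x \<in> ck_span" "y \<in> ck_span" shows "x \<otimes> y \<in> ck_span"
proof (rule lin_mult[OF assms hom_gens_closed(2) hom_gens_closed(2) hom_gens_closed(2)])
  fix a b assume "a \<in> (\<Union>g. hom_gens g)" "b \<in> (\<Union>g. hom_gens g)"
  then obtain g h where "a \<in> hom_gens g" "b \<in> hom_gens h" by blast
  then show "a \<otimes> b \<in> ck_span" by (intro lin_mono[OF hom_gens_mult]) blast+
qed

lemma span_adj: assumes "x \<in> ck_span" shows "adj A x \<in> ck_span"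
proof (rule lin_adj[OF assms hom_gens_closed(2) hom_gens_closed(2)])
  fix a assume "a \<in> (\<Union>g. hom_gens g)"
  then obtain g where "a \<in> hom_gens g" by blast
  then show "adj A a \<in> ck_span" by (intro lin_base[OF _ hom_gens_closed(2)]) (use hom_gens_adj in blast)
qed

lemma t_in_span: assumes "\<mu> \<in> \<P>" shows "t \<mu> \<in> ck_span"
proof -
  have s: "\<s> \<mu> \<in> \<V>" using assms by simp
  have "t \<mu> = t \<mu> \<otimes> st (\<s> \<mu>)" using t_vertex(1)[OF s] assms by simp
  then have "t \<mu> \<in> hom_gens (\<D> \<mu>)"
    unfolding hom_gens_def using vertexD[OF s] ideg_vertex[OF s] assms
    by (intro CollectI exI[of _ \<mu>] exI[of _ "\<s> \<mu>"] conjI) simp_all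
  then show ?thesis by (intro lin_base[OF _ hom_gens_closed(2)]) blast
qed

lemma span_dense:
  assumes "cstar_generates A (t ` \<P>)" "x \<in> carrier A" "e > 0"
  shows "\<exists>y\<in>ck_span. nrm A (x \<ominus> y) < e"
proof (rule dense_span[OF assms(1) _ _ _ _ _ _ _ assms(2,3)])
  show "\<zero> \<in> ck_span" by (rule lin.lin_zero)
  show "t ` \<P> \<subseteq> ck_span" using t_in_span by blast
qed (blast intro: span_closed lin_add[OF _ _ hom_gens_closed(2)] span_mult span_adj lin_smult[OF _ hom_gens_closed(2)])+

end

section \<open>Isometry on the whole algebra\<close>

context graded_rep
begin

text \<open>The triangle inequality over the components: each is isometrically represented by
  \<open>homogeneous_isometry\<close> and dominated by \<open>component_bound\<close>.\<close>

lemma box_bound: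
  assumes "x \<in> span_box R"
  shows "nrm A x \<le> real ((2 * R + 1) ^ CARD('k)) * nrm (B_ell2 X) (\<rho> x)"
proof -
  obtain f where f: "\<forall>g\<in>degree_box R. f g \<in> lin A (hom_gens g)" "x = finsum A f (degree_box R)"
    using span_decomp[OF assms degree_box_finite_card(1)] by blast
  have fc: "f \<in> degree_box R \<rightarrow> carrier A" using f(1) lin_closed[OF _ hom_gens_closed(1)] by blast
  have "nrm A x \<le> (\<Sum>g\<in>degree_box R. nrm A (f g))" unfolding f(2) by (rule nrm_finsum[OF degree_box_finite_card(1) fc])
  also have "\<dots> \<le> real (card (degree_box R :: ('k \<Rightarrow> int) set)) * nrm (B_ell2 X) (\<rho> x)"
  proof (rule sum_bounded_above)
    fix g :: "'k \<Rightarrow> int" assume g: "g \<in> degree_box R"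
    have "nrm A (f g) \<le> nrm (B_ell2 X) (\<rho> (f g))" using homogeneous_isometry f(1) g by blast
    also have "\<dots> \<le> nrm (B_ell2 X) (\<rho> x)"
      unfolding f(2) by (rule component_bound[OF degree_box_finite_card(1) _ g]) (use f(1) in blast)
    finally show "nrm A (f g) \<le> nrm (B_ell2 X) (\<rho> x)" .
  qed
  finally show ?thesis unfolding degree_box_finite_card(2) .
qed

lemma span_isometry:
  assumes x: "x \<in> ck_span" shows "nrm A x \<le> nrm (B_ell2 X) (\<rho> x)"
proof -
  obtain R where R: "adj A x \<otimes> x \<in> span_box R" using span_box_ex[OF span_mult[OF span_adj[OF x] x]] by blast
  \<comment> \<open>Squaring doubles the radius, so the number of degrees involved is polynomial in
    \<open>2 ^ j\<close>.\<close>
  have sq: "sq_pow A j (adj A x \<otimes> x) \<in> span_box (R * 2 ^ j)" for j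
  proof (induction j)
    case (Suc j)
    have e: "R * 2 ^ Suc j = R * 2 ^ j + R * 2 ^ j" by simp
    show ?case unfolding e sq_pow.simps(2) by (rule span_box_mult[OF Suc Suc])
  qed (use R in simp)
  show ?thesis
  proof (rule growth_isometry[OF span_closed[OF x], where K = "CARD('k)" and C = "real ((2 * R + 1) ^ CARD('k))"])
    fix j
    let ?n = "nrm (B_ell2 X) (\<rho> (sq_pow A j (adj A x \<otimes> x)))"
    have n: "0 \<le> ?n"
      by (rule B.nrm_nonneg[OF rho_closed[OF lin_closed[OF sq hom_gens_closed(2)]]])
    \<comment> \<open>Splits off the dependence on \<open>j\<close> in the shape that
      \<open>growth_isometry\<close> expects, with the rank as exponent.\<close>
    have "2 * (R * 2 ^ j) + 1 \<le> (2 * R + 1) * (2 ^ j + 1)" by (simp add: algebra_simps)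
    then have "(2 * (R * 2 ^ j) + 1) ^ CARD('k) \<le> ((2 * R + 1) * (2 ^ j + 1)) ^ CARD('k)" by (rule power_mono) simp
    then have "real ((2 * (R * 2 ^ j) + 1) ^ CARD('k)) \<le> real (((2 * R + 1) * (2 ^ j + 1)) ^ CARD('k))"
      by (rule of_nat_mono)
    also have "\<dots> = real ((2 * R + 1) ^ CARD('k)) * (2 ^ j + 1) ^ CARD('k)"
      by (simp only: power_mult_distrib of_nat_mult of_nat_power of_nat_add of_nat_1 of_nat_numeral)
    finally show "nrm A (sq_pow A j (adj A x \<otimes> x)) \<le> real ((2 * R + 1) ^ CARD('k)) * (2 ^ j + 1) ^ CARD('k) * ?n"
      by (rule order_trans[OF box_bound[OF sq[of j]] mult_right_mono[OF _ n]])
  qed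
qed

lemma isometry:
  assumes gen: "cstar_generates A (t ` \<P>)" and x: "x \<in> carrier A"
  shows "nrm A x \<le> nrm (B_ell2 X) (\<rho> x)"
proof (rule field_le_epsilon)
  fix e :: real assume "e > 0"
  then have "e / 2 > 0" by simp
  then obtain y where y: "y \<in> ck_span" "nrm A (x \<ominus> y) < e / 2" using span_dense[OF gen x] by blast
  note yc = span_closed[OF y(1)]
  have "nrm (B_ell2 X) (\<rho> y) \<le> nrm (B_ell2 X) (\<rho> x) + nrm (B_ell2 X) (\<rho> (y \<ominus> x))"
    unfolding rho_minus[OF yc x] by (rule B.nrm_diff_le[OF rho_closed[OF yc] rho_closed[OF x]])
  moreover have "nrm (B_ell2 X) (\<rho> (y \<ominus> x)) \<le> nrm A (x \<ominus> y)"
    unfolding nrm_minus_commute[OF x yc] by (rule contractive) (use x yc in simp)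
  moreover have "nrm A x \<le> nrm A y + nrm A (x \<ominus> y)" by (rule nrm_diff_le[OF x yc])
  ultimately show "nrm A x \<le> nrm (B_ell2 X) (\<rho> x) + e" using span_isometry[OF y(1)] y(2) by linarith
qed

end

section \<open>Aperiodicity and cylinder sets\<close>

text \<open>Test with multiples of a single coordinate vector: an extended natural number is
  determined by the finite numbers below it.\<close>

lemma emb_le_ext:
  assumes "\<And>n. emb n \<le> m \<longleftrightarrow> emb n \<le> m'" shows "m = m'"
proof
  fix i
  have emb_single: "emb (\<lambda>j. if j = i then k else 0) \<le> u \<longleftrightarrow> enat k \<le> u i" for k and u :: "'a \<Rightarrow> enat"
    by (auto simp: emb_le_iff zero_enat_def[symmetric])
  have k: "enat k \<le> m i \<longleftrightarrow> enat k \<le> m' i" for k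
    using assms[of "\<lambda>j. if j = i then k else 0"] unfolding emb_single .
  have "u \<le> w" if "\<And>k. enat k \<le> u \<Longrightarrow> enat k \<le> w" for u w :: enat
  proof (cases u)
    case infinity
    have "w = \<infinity>"
    proof (cases w)
      case (enat j)
      then show ?thesis using that[of "Suc j"] infinity by simp
    qed
    then show ?thesis by simp
  qed (use that in simp)
  then show "m i = m' i" using k by (meson antisym)
qed

text \<open>To lie in the cylinder of a path is to have it as initial segment, so paths in the same
  cylinders have the same degree and the same initial segments.\<close>

lemma (in k_graph) boundary_eqI:
  assumes x: "x \<in> \<B>" and y: "y \<in> \<B>"
    and xy: "\<And>\<mu> z. \<lbrakk>\<mu> \<in> \<P>; z \<in> \<B>; \<s> \<mu> = gp_rng z; x = prepend \<mu> z\<rbrakk>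
      \<Longrightarrow> \<exists>w \<in> \<B>. \<s> \<mu> = gp_rng w \<and> y = prepend \<mu> w"
    and yx: "\<And>\<mu> z. \<lbrakk>\<mu> \<in> \<P>; z \<in> \<B>; \<s> \<mu> = gp_rng z; y = prepend \<mu> z\<rbrakk>
      \<Longrightarrow> \<exists>w \<in> \<B>. \<s> \<mu> = gp_rng w \<and> x = prepend \<mu> w"
  shows "x = y"
proof -
  have ini: "emb n \<le> fst v \<and> snd v (0, n) = snd u (0, n)"
    if u: "u \<in> \<B>" and n: "emb n \<le> fst u"
      and uv: "\<And>\<mu> z. \<lbrakk>\<mu> \<in> \<P>; z \<in> \<B>; \<s> \<mu> = gp_rng z; u = prepend \<mu> z\<rbrakk>
        \<Longrightarrow> \<exists>w \<in> \<B>. \<s> \<mu> = gp_rng w \<and> v = prepend \<mu> w" for u v n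
  proof -
    note g = boundary_gpath[OF u]
    let ?\<mu> = "snd u (0, n)"
    note i = gpath_initial[OF g n]
    obtain w where w: "w \<in> \<B>" "\<s> ?\<mu> = gp_rng w" "v = prepend ?\<mu> w"
      using uv[OF i(1) boundary_shift[OF u n] _ gp_prepend_shift[OF g n, symmetric]] i(4) gp_rng_shift[OF g n] by auto
    show ?thesis
      using gp_prepend_prefix[OF boundary_gpath[OF w(1)] i(1) w(2)] unfolding w(3)[symmetric] i(2) by blast
  qed
  have 1: "emb n \<le> fst y \<and> snd y (0, n) = snd x (0, n)" if "emb n \<le> fst x" for n
    by (rule ini[OF x that]) (rule xy)
  have 2: "emb n \<le> fst x \<and> snd x (0, n) = snd y (0, n)" if "emb n \<le> fst y" for n
    by (rule ini[OF y that]) (rule yx)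
  have "fst x = fst y" by (rule emb_le_ext) (use 1 2 in blast)
  then show ?thesis
    by (rule gpath_eqI[OF boundary_gpath[OF x] boundary_gpath[OF y]]) (use 1 in simp)
qed

text \<open>The pairs are treated one after the other. Right cancellation keeps an untreated pair
  distinct after both members are lengthened by the same path, and pairs already separated stay
  separated.\<close>

lemma (in k_graph) aperiodic_finite:
  assumes ap: "aperiodic \<Lambda>" and v: "v \<in> \<V>" and D: "finite D"
    and D': "\<And>\<alpha> \<beta>. (\<alpha>, \<beta>) \<in> D \<Longrightarrow> \<alpha> \<in> \<P> \<and> \<beta> \<in> \<P> \<and> \<alpha> \<noteq> \<beta> \<and> \<s> \<alpha> = v \<and> \<s> \<beta> = v"
  shows "\<exists>\<tau> \<in> \<P>. \<r> \<tau> = v \<and> (\<forall>(\<alpha>, \<beta>) \<in> D. \<M> (\<alpha> \<cdot> \<tau>) (\<beta> \<cdot> \<tau>) = {})"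
  using D D'
proof (induction D rule: finite_induct)
  case empty
  show ?case using vertexD[OF v] by (intro bexI[of _ v]) auto
next
  case (insert p D)
  obtain \<tau> where \<tau>: "\<tau> \<in> \<P>" "\<r> \<tau> = v" "\<forall>(\<alpha>, \<beta>) \<in> D. \<M> (\<alpha> \<cdot> \<tau>) (\<beta> \<cdot> \<tau>) = {}"
    using insert.IH insert.prems by blast
  obtain \<alpha> \<beta> where p: "p = (\<alpha>, \<beta>)" by (cases p)
  have ab: "\<alpha> \<in> \<P>" "\<beta> \<in> \<P>" "\<alpha> \<noteq> \<beta>" "\<s> \<alpha> = \<r> \<tau>" "\<s> \<beta> = \<r> \<tau>"
    using insert.prems[of \<alpha> \<beta>] p \<tau>(2) by simp_all
  have "\<alpha> \<cdot> \<tau> \<noteq> \<beta> \<cdot> \<tau>" using cancel_right[OF ab(1,2) \<tau>(1) ab(4,5)] ab(3) by blast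
  moreover have "\<s> (\<alpha> \<cdot> \<tau>) = \<s> (\<beta> \<cdot> \<tau>)" using src_cmp[OF ab(1) \<tau>(1) ab(4)] src_cmp[OF ab(2) \<tau>(1) ab(5)] by simp
  ultimately obtain \<sigma> where s: "\<sigma> \<in> \<P>" "\<r> \<sigma> = \<s> (\<alpha> \<cdot> \<tau>)" "\<M> ((\<alpha> \<cdot> \<tau>) \<cdot> \<sigma>) ((\<beta> \<cdot> \<tau>) \<cdot> \<sigma>) = {}"
    using ap cmp_closed[OF ab(1) \<tau>(1) ab(4)] cmp_closed[OF ab(2) \<tau>(1) ab(5)] unfolding aperiodic_def by blast
  have ts: "\<s> \<tau> = \<r> \<sigma>" using s(2) src_cmp[OF ab(1) \<tau>(1) ab(4)] by simp
  have as: "(\<gamma> \<cdot> \<tau>) \<cdot> \<sigma> = \<gamma> \<cdot> (\<tau> \<cdot> \<sigma>)" "\<gamma> \<cdot> \<tau> \<preceq> (\<gamma> \<cdot> (\<tau> \<cdot> \<sigma>))"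
    if g: "\<gamma> \<in> \<P>" "\<s> \<gamma> = v" for \<gamma>
  proof -
    have gt: "\<s> \<gamma> = \<r> \<tau>" using g(2) \<tau>(2) by simp
    show a: "(\<gamma> \<cdot> \<tau>) \<cdot> \<sigma> = \<gamma> \<cdot> (\<tau> \<cdot> \<sigma>)" by (rule cmp_assoc[OF g(1) \<tau>(1) s(1) gt ts])
    show "\<gamma> \<cdot> \<tau> \<preceq> (\<gamma> \<cdot> (\<tau> \<cdot> \<sigma>))"
      unfolding a[symmetric] using prefix_ofI[OF cmp_closed[OF g(1) \<tau>(1) gt] s(1)] src_cmp[OF g(1) \<tau>(1) gt] ts by simp
  qed
  show ?case
  proof (intro bexI[of _ "\<tau> \<cdot> \<sigma>"] conjI ballI)
    show "\<tau> \<cdot> \<sigma> \<in> \<P>" "\<r> (\<tau> \<cdot> \<sigma>) = v" using \<tau> s(1) ts by simp_all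
    fix q assume q: "q \<in> insert p D"
    obtain \<gamma> \<delta> where qe: "q = (\<gamma>, \<delta>)" by (cases q)
    have gd: "\<gamma> \<in> \<P>" "\<delta> \<in> \<P>" "\<s> \<gamma> = v" "\<s> \<delta> = v"
      using insert.prems[of \<gamma> \<delta>] q qe by simp_all
    have "\<M> (\<gamma> \<cdot> (\<tau> \<cdot> \<sigma>)) (\<delta> \<cdot> (\<tau> \<cdot> \<sigma>)) = {}"
    proof (cases "q = p")
      case True
      then show ?thesis using s(3) p qe as(1)[OF gd(1,3)] as(1)[OF gd(2,4)] by simp
    next
      case False
      then have "\<M> (\<gamma> \<cdot> \<tau>) (\<delta> \<cdot> \<tau>) = {}" using \<tau>(3) q qe by auto
      then show ?thesis by (rule MCE_empty_mono[OF _ as(2)[OF gd(1,3)] as(2)[OF gd(2,4)]])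
    qed
    then show "case q of (\<alpha>, \<beta>) \<Rightarrow> \<M> (\<alpha> \<cdot> (\<tau> \<cdot> \<sigma>)) (\<beta> \<cdot> (\<tau> \<cdot> \<sigma>)) = {}" using qe by simp
  qed
qed

context path_action
begin

lemma cylI: "\<lbrakk>z \<in> X; \<s> \<mu> = vtx z\<rbrakk> \<Longrightarrow> act \<mu> z \<in> cyl \<mu>"
  by (auto simp: adom_def)

lemma cylE:
  assumes "y \<in> cyl \<mu>" obtains z where "z \<in> X" "\<s> \<mu> = vtx z" "y = act \<mu> z"
  using assms by (auto simp: adom_def)

text \<open>If the sets \<open>Ext \<mu> {\<nu>}\<close> together were exhaustive, \<open>z\<close>
  would begin with one of their members, which would put \<open>\<mu>z\<close> into the cylinder of
  \<open>\<nu>\<close>. So some path \<open>\<tau>\<close> meets none of them.\<close>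

lemma avoid_cylinders:
  assumes fa: "finitely_aligned \<Lambda>" and z: "z \<in> X" and J: "finite J"
    and J': "\<And>\<mu> \<nu>. (\<mu>, \<nu>) \<in> J \<Longrightarrow> \<mu> \<in> \<P> \<and> \<nu> \<in> \<P> \<and> \<s> \<mu> = vtx z \<and> act \<mu> z \<notin> cyl \<nu>"
  shows "\<exists>\<tau> \<in> \<P>. \<r> \<tau> = vtx z \<and> (\<forall>(\<mu>, \<nu>) \<in> J. \<M> (\<mu> \<cdot> \<tau>) \<nu> = {})"
proof -
  define E where "E = (\<Union>p\<in>J. Ext (fst p) {snd p})"
  have fin: "finite E"
    unfolding E_def
  proof (intro finite_UN_I[OF J])
    fix p assume "p \<in> J"
    then show "finite (Ext (fst p) {snd p})" using J'[of "fst p" "snd p"] by (intro Ext_finite[OF fa]) auto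
  qed
  have "E \<notin> \<E> (vtx z)"
  proof
    assume "E \<in> \<E> (vtx z)"
    then obtain \<alpha> w where a: "\<alpha> \<in> E" "w \<in> X" "\<s> \<alpha> = vtx w" "z = act \<alpha> w" using act_exhaustive[OF z] by blast
    obtain \<mu> \<nu> where mn: "(\<mu>, \<nu>) \<in> J" "\<alpha> \<in> Ext \<mu> {\<nu>}" using a(1) by (auto simp: E_def)
    note j = J'[OF mn(1)]
    have e: "\<alpha> \<in> \<P>" "\<s> \<mu> = \<r> \<alpha>" "\<mu> \<cdot> \<alpha> \<in> \<M> \<mu> \<nu>" using mn(2) by (auto simp: Ext_def)
    have "\<nu> \<preceq> \<mu> \<cdot> \<alpha>" using e(3) MCE_iff[of \<mu> \<nu>] j by blast
    then obtain \<beta> where b: "\<beta> \<in> \<P>" "\<s> \<nu> = \<r> \<beta>" "\<mu> \<cdot> \<alpha> = \<nu> \<cdot> \<beta>" by (rule prefix_ofE)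
    have n: "\<nu> \<in> \<P>" and m: "\<mu> \<in> \<P>" using j by simp_all
    have bw: "\<s> \<beta> = vtx w" using src_cmp[OF m e(1,2)] src_cmp[OF n b(1,2)] b(3) a(3) by simp
    have "act \<mu> z = act (\<mu> \<cdot> \<alpha>) w" using act_cmp[OF m e(1,2) a(2,3)] a(4) by simp
    also have "\<dots> = act \<nu> (act \<beta> w)" unfolding b(3) by (rule act_cmp[OF n b(1,2) a(2) bw])
    also have "\<dots> \<in> cyl \<nu>" by (rule cylI[OF act_closed[OF b(1) a(2) bw]]) (simp add: vtx_act[OF b(1) a(2) bw] b(2))
    finally show False using j by simp
  qed
  moreover have "E \<subseteq> {\<mu> \<in> \<P>. \<r> \<mu> = vtx z}"
  proof
    fix \<alpha> assume "\<alpha> \<in> E"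
    then obtain \<mu> \<nu> where mn: "(\<mu>, \<nu>) \<in> J" "\<alpha> \<in> Ext \<mu> {\<nu>}" by (auto simp: E_def)
    then show "\<alpha> \<in> {\<mu> \<in> \<P>. \<r> \<mu> = vtx z}" using J'[OF mn(1)] by (simp add: Ext_def)
  qed
  ultimately obtain \<tau> where \<tau>: "\<tau> \<in> \<P>" "\<r> \<tau> = vtx z" "\<And>\<alpha>. \<alpha> \<in> E \<Longrightarrow> \<M> \<tau> \<alpha> = {}"
    using fin by (auto simp: FE_def exhaustive_def)
  have "\<M> (\<mu> \<cdot> \<tau>) \<nu> = {}" if mn: "(\<mu>, \<nu>) \<in> J" for \<mu> \<nu>
  proof (rule ccontr)
    note j = J'[OF mn]
    have s: "\<s> \<mu> = \<r> \<tau>" and m: "\<mu> \<in> \<P>" and n: "\<nu> \<in> \<P>" using j \<tau>(2) by simp_all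
    assume "\<M> (\<mu> \<cdot> \<tau>) \<nu> \<noteq> {}"
    then obtain \<omega> where "\<mu> \<cdot> \<tau> \<preceq> \<omega>" "\<nu> \<preceq> \<omega>"
      using MCE_empty_iff[OF cmp_closed[OF m \<tau>(1) s] n] by blast
    then obtain \<alpha> where "\<alpha> \<in> Ext \<mu> {\<nu>}" "\<M> \<tau> \<alpha> \<noteq> {}" using Ext_meets[OF m singletonI \<tau>(1) s] by blast
    then show False using \<tau>(3)[of \<alpha>] mn by (force simp: E_def)
  qed
  then show ?thesis using \<tau>(1,2) by blast
qed

text \<open>An initial piece of \<open>w\<close> can be moved onto the ends of \<open>p\<close> and
  \<open>q\<close> without changing either point. Both paths must receive the same piece, as they
  share the tail \<open>w\<close>.\<close>

lemma refine_cylinders: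
  assumes N: "finite N" "N \<subseteq> \<P>"
    and 0: "p0 \<in> \<P>" "q0 \<in> \<P>" "w0 \<in> X" "\<s> p0 = vtx w0" "\<s> q0 = vtx w0"
  shows "\<exists>p q w. p \<in> \<P> \<and> q \<in> \<P> \<and> w \<in> X \<and> \<s> p = vtx w \<and> \<s> q = vtx w \<and>
    act p w = act p0 w0 \<and> act q w = act q0 w0 \<and> (\<forall>\<mu>\<in>N. act p0 w0 \<in> cyl \<mu> \<longrightarrow> \<mu> \<preceq> p) \<and>
    (\<forall>\<mu>\<in>N. act q0 w0 \<in> cyl \<mu> \<longrightarrow> \<mu> \<preceq> q)"
proof -
  have step: "\<exists>\<alpha> w'. \<alpha> \<in> \<P> \<and> \<s> p = \<r> \<alpha> \<and> w' \<in> X \<and> \<s> \<alpha> = vtx w' \<and> w = act \<alpha> w' \<and>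
      (act p w \<in> cyl \<mu> \<longrightarrow> \<mu> \<preceq> p \<cdot> \<alpha>)"
    if p: "p \<in> \<P>" "w \<in> X" "\<s> p = vtx w" and m: "\<mu> \<in> \<P>" for p w \<mu>
  proof (cases "act p w \<in> cyl \<mu>")
    case True
    then obtain z where z: "z \<in> X" "\<s> \<mu> = vtx z" "act p w = act \<mu> z" by (rule cylE)
    obtain \<alpha> \<beta> w' where a: "\<alpha> \<in> \<P>" "\<beta> \<in> \<P>" "\<s> p = \<r> \<alpha>" "\<s> \<mu> = \<r> \<beta>" "p \<cdot> \<alpha> = \<mu> \<cdot> \<beta>"
      "w' \<in> X" "\<s> \<alpha> = vtx w'" "w = act \<alpha> w'"
      using act_meet[OF p(1) m p(2) z(1) p(3) z(2,3)] by blast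
    have "\<mu> \<preceq> p \<cdot> \<alpha>" unfolding a(5) by (rule prefix_ofI[OF m a(2,4)])
    then show ?thesis using a by blast
  next
    case False
    have "vtx w \<in> \<V>" by (rule vtx_vertex[OF p(2)])
    then show ?thesis using vertexD[of "vtx w"] act_vertex[OF p(2)] p False by (intro exI[of _ "vtx w"] exI[of _ w]) simp
  qed
  have move: "p \<cdot> \<alpha> \<in> \<P> \<and> \<s> (p \<cdot> \<alpha>) = vtx w' \<and> act (p \<cdot> \<alpha>) w' = act p w \<and> p \<preceq> p \<cdot> \<alpha>"
    if "p \<in> \<P>" "\<s> p = vtx w" "\<alpha> \<in> \<P>" "\<s> p = \<r> \<alpha>" "w' \<in> X" "\<s> \<alpha> = vtx w'" "w = act \<alpha> w'"
    for p w \<alpha> w'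
    using that act_cmp[OF that(1,3,4,5,6)] prefix_ofI[OF that(1,3,4)] by simp
  show ?thesis
    using N
  proof (induction N rule: finite_induct)
    case empty
    then show ?case using 0 by blast
  next
    case (insert \<mu> N)
    then have m: "\<mu> \<in> \<P>" "N \<subseteq> \<P>" by auto
    obtain p q w where IH: "p \<in> \<P>" "q \<in> \<P>" "w \<in> X" "\<s> p = vtx w" "\<s> q = vtx w"
      "act p w = act p0 w0" "act q w = act q0 w0" "\<forall>\<mu>\<in>N. act p0 w0 \<in> cyl \<mu> \<longrightarrow> \<mu> \<preceq> p"
      "\<forall>\<mu>\<in>N. act q0 w0 \<in> cyl \<mu> \<longrightarrow> \<mu> \<preceq> q"
      using insert.IH[OF m(2)] by (elim exE conjE) (rule that)
    \<comment> \<open>The first move lets \<open>p\<close> absorb \<open>\<mu>\<close> and drags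
      \<open>q\<close> along; the second does the same for \<open>q\<close>.\<close>
    obtain \<alpha> u where a: "\<alpha> \<in> \<P>" "\<s> p = \<r> \<alpha>" "u \<in> X" "\<s> \<alpha> = vtx u" "w = act \<alpha> u"
      "act p w \<in> cyl \<mu> \<longrightarrow> \<mu> \<preceq> p \<cdot> \<alpha>"
      using step[OF IH(1,3,4) m(1)] by (elim exE conjE) (rule that)
    have qa: "\<s> q = \<r> \<alpha>" using IH(4,5) a(2) by simp
    note P = move[OF IH(1,4) a(1-5)] and Q = move[OF IH(2,5) a(1) qa a(3-5)]
    obtain \<beta> z where b: "\<beta> \<in> \<P>" "\<s> (q \<cdot> \<alpha>) = \<r> \<beta>" "z \<in> X" "\<s> \<beta> = vtx z" "u = act \<beta> z"
      "act (q \<cdot> \<alpha>) u \<in> cyl \<mu> \<longrightarrow> \<mu> \<preceq> ((q \<cdot> \<alpha>) \<cdot> \<beta>)"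
      using step[OF Q[THEN conjunct1] a(3) Q[THEN conjunct2, THEN conjunct1] m(1)] by (elim exE conjE) (rule that)
    have pb: "\<s> (p \<cdot> \<alpha>) = \<r> \<beta>" using P Q b(2) by simp
    have P': "(p \<cdot> \<alpha>) \<cdot> \<beta> \<in> \<P>" "\<s> ((p \<cdot> \<alpha>) \<cdot> \<beta>) = vtx z" "act ((p \<cdot> \<alpha>) \<cdot> \<beta>) z = act (p \<cdot> \<alpha>) u"
      "p \<cdot> \<alpha> \<preceq> ((p \<cdot> \<alpha>) \<cdot> \<beta>)" using move[of "p \<cdot> \<alpha>" u \<beta> z] P pb b(1,3-5) by simp_all
    have Q': "(q \<cdot> \<alpha>) \<cdot> \<beta> \<in> \<P>" "\<s> ((q \<cdot> \<alpha>) \<cdot> \<beta>) = vtx z" "act ((q \<cdot> \<alpha>) \<cdot> \<beta>) z = act (q \<cdot> \<alpha>) u"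
      "q \<cdot> \<alpha> \<preceq> ((q \<cdot> \<alpha>) \<cdot> \<beta>)" using move[of "q \<cdot> \<alpha>" u \<beta> z] Q b(1-5) by simp_all
    have pp: "p \<preceq> ((p \<cdot> \<alpha>) \<cdot> \<beta>)" using P P'(4) prefix_of_trans by blast
    have qq: "q \<preceq> ((q \<cdot> \<alpha>) \<cdot> \<beta>)" using Q Q'(4) prefix_of_trans by blast
    show ?case
    proof (intro exI conjI ballI impI)
      show "(p \<cdot> \<alpha>) \<cdot> \<beta> \<in> \<P>" "(q \<cdot> \<alpha>) \<cdot> \<beta> \<in> \<P>" "z \<in> X" "\<s> ((p \<cdot> \<alpha>) \<cdot> \<beta>) = vtx z"
        "\<s> ((q \<cdot> \<alpha>) \<cdot> \<beta>) = vtx z" by (fact P' Q' b)+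
      show "act ((p \<cdot> \<alpha>) \<cdot> \<beta>) z = act p0 w0" using P'(3) P IH(6) by simp
      show "act ((q \<cdot> \<alpha>) \<cdot> \<beta>) z = act q0 w0" using Q'(3) Q IH(7) by simp
      fix \<nu> assume n: "\<nu> \<in> insert \<mu> N"
      show "\<nu> \<preceq> ((p \<cdot> \<alpha>) \<cdot> \<beta>)" if c: "act p0 w0 \<in> cyl \<nu>"
      proof (cases "\<nu> = \<mu>")
        case True
        then have "\<nu> \<preceq> p \<cdot> \<alpha>" using a(6) c IH(6) by simp
        then show ?thesis by (rule prefix_of_trans[OF _ P'(4)])
      next
        case False
        then have "\<nu> \<preceq> p" using IH(8) c n by blast
        then show ?thesis by (rule prefix_of_trans[OF _ pp])
      qed
      show "\<nu> \<preceq> ((q \<cdot> \<alpha>) \<cdot> \<beta>)" if c: "act q0 w0 \<in> cyl \<nu>"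
      proof (cases "\<nu> = \<mu>")
        case True
        then show ?thesis using b(6) c Q IH(7) by simp
      next
        case False
        then have "\<nu> \<preceq> q" using IH(9) c n by blast
        then show ?thesis by (rule prefix_of_trans[OF _ qq])
      qed
    qed
  qed
qed

text \<open>Suppose \<open>\<beta>x\<close> misses the cylinder. Then a suitable path following an
  initial piece of \<open>x\<close> makes its \<open>\<beta>\<close>-translate disjoint from
  \<open>\<nu>\<close>, while its \<open>\<alpha>\<close>-translate extends \<open>\<nu>\<close>;
  the two translates have no common extension, against \<open>per\<close>.\<close>

lemma periodic_act_cyl:
  assumes fa: "finitely_aligned \<Lambda>" and \<alpha>: "\<alpha> \<in> \<P>" and \<beta>: "\<beta> \<in> \<P>" and s: "\<s> \<alpha> = \<s> \<beta>"
    and per: "\<And>\<tau>. \<lbrakk>\<tau> \<in> \<P>; \<r> \<tau> = \<s> \<alpha>\<rbrakk> \<Longrightarrow> \<M> (\<alpha> \<cdot> \<tau>) (\<beta> \<cdot> \<tau>) \<noteq> {}"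
    and x: "x \<in> X" "\<s> \<alpha> = vtx x" and \<nu>: "\<nu> \<in> \<P>" "act \<alpha> x \<in> cyl \<nu>"
  shows "act \<beta> x \<in> cyl \<nu>"
proof (rule ccontr)
  assume n: "act \<beta> x \<notin> cyl \<nu>"
  obtain z where z: "z \<in> X" "\<s> \<nu> = vtx z" "act \<alpha> x = act \<nu> z" using \<nu>(2) by (rule cylE)
  obtain \<gamma> \<delta> w where m: "\<gamma> \<in> \<P>" "\<delta> \<in> \<P>" "\<s> \<alpha> = \<r> \<gamma>" "\<s> \<nu> = \<r> \<delta>" "\<alpha> \<cdot> \<gamma> = \<nu> \<cdot> \<delta>"
    "w \<in> X" "\<s> \<gamma> = vtx w" "x = act \<gamma> w"
    using act_meet[OF \<alpha> \<nu>(1) x(1) z(1) x(2) z(2,3)] by blast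
  have sb: "\<s> \<beta> = \<r> \<gamma>" using s m(3) by simp
  have "act (\<beta> \<cdot> \<gamma>) w \<notin> cyl \<nu>" using n act_cmp[OF \<beta> m(1) sb m(6,7)] m(8) by simp
  then obtain \<tau> where t: "\<tau> \<in> \<P>" "\<r> \<tau> = vtx w" "\<M> ((\<beta> \<cdot> \<gamma>) \<cdot> \<tau>) \<nu> = {}"
    using avoid_cylinders[OF fa m(6), of "{(\<beta> \<cdot> \<gamma>, \<nu>)}"] \<nu>(1) \<beta> m(1,7) sb by auto
  have gt: "\<s> \<gamma> = \<r> \<tau>" using m(7) t(2) by simp
  have dt: "\<s> \<delta> = \<r> \<tau>"
    using src_cmp[OF \<alpha> m(1,3)] src_cmp[OF \<nu>(1) m(2,4)] m(5) gt by simp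
  have "\<alpha> \<cdot> (\<gamma> \<cdot> \<tau>) = \<nu> \<cdot> (\<delta> \<cdot> \<tau>)"
    using cmp_assoc[OF \<alpha> m(1) t(1) m(3) gt] cmp_assoc[OF \<nu>(1) m(2) t(1) m(4) dt] m(5) by simp
  then have "\<nu> \<preceq> (\<alpha> \<cdot> (\<gamma> \<cdot> \<tau>))"
    using prefix_ofI[OF \<nu>(1) cmp_closed[OF m(2) t(1) dt]] rng_cmp[OF m(2) t(1) dt] m(4) by simp
  moreover have "\<M> (\<beta> \<cdot> (\<gamma> \<cdot> \<tau>)) \<nu> = {}" using t(3) cmp_assoc[OF \<beta> m(1) t(1) sb gt] by simp
  moreover have gtp: "\<gamma> \<cdot> \<tau> \<in> \<P>" "\<r> (\<gamma> \<cdot> \<tau>) = \<s> \<alpha>" using m(1,3) t(1) gt by simp_all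
  moreover have "(\<beta> \<cdot> (\<gamma> \<cdot> \<tau>)) \<preceq> (\<beta> \<cdot> (\<gamma> \<cdot> \<tau>))"
    by (rule prefix_of_refl[OF cmp_closed[OF \<beta> gtp(1)]]) (use gtp s in simp)
  ultimately have "\<M> (\<beta> \<cdot> (\<gamma> \<cdot> \<tau>)) (\<alpha> \<cdot> (\<gamma> \<cdot> \<tau>)) = {}" using MCE_empty_mono by blast
  then show False using per[OF gtp] MCE_commute by metis
qed

end

section \<open>Ideals\<close>

lemma (in cstar_algebra) minus_minus_cancel:
  assumes x: "x \<in> carrier A" and y: "y \<in> carrier A" shows "x \<ominus> (x \<ominus> y) = y"
proof -
  have "x \<ominus> (x \<ominus> y) = x \<oplus> ((-1) \<odot> x \<oplus> y)"
    using x y by (simp add: minus_smult smult_add_right)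
  also have "\<dots> = (x \<ominus> x) \<oplus> y"
    unfolding minus_smult[OF x x] using x y by (simp only: M.a_assoc smult_carrier)
  finally show ?thesis using x y by simp
qed

text \<open>Modulo the ideal \<open>p\<close> agrees with \<open>y = p - i\<close>, and being
  idempotent it agrees with all powers of \<open>y\<close>, whose norms tend to 0; the ideal is
  closed.\<close>

lemma (in cstar_algebra) ideal_projection_near:
  assumes I: "cstar_ideal A I" and p: "p \<in> carrier A" "p \<otimes> p = p" and i: "i \<in> I" and lt: "nrm A (p \<ominus> i) < 1"
  shows "p \<in> I"
proof -
  define y where "y = p \<ominus> i"
  have I': "I \<subseteq> carrier A" "cstar_closed A I" "\<forall>x\<in>I. \<forall>y\<in>I. x \<oplus> y \<in> I" "\<forall>x\<in>I. \<forall>a\<in>carrier A. a \<otimes> x \<in> I \<and> x \<otimes> a \<in> I"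
    using I unfolding cstar_ideal_def by - (elim conjE, assumption)+
  have Ic: "x \<in> carrier A" if "x \<in> I" for x using subsetD[OF I'(1) that] .
  have add: "x \<oplus> z \<in> I" if "x \<in> I" "z \<in> I" for x z using I'(3) that by simp
  have mul: "a \<otimes> x \<in> I" "x \<otimes> a \<in> I" if "x \<in> I" "a \<in> carrier A" for x a using I'(4) that by simp_all
  have yc: "y \<in> carrier A" using p(1) Ic[OF i] by (simp add: y_def)
  have pow: "\<exists>z \<in> carrier A. p \<ominus> z \<in> I \<and> nrm A z \<le> nrm A y ^ Suc n" for n
  proof (induction n)
    case 0
    have "p \<ominus> y = i" unfolding y_def by (rule minus_minus_cancel[OF p(1) Ic[OF i]])
    then show ?case using yc i by (intro bexI[of _ y]) simp_all
  next
    case (Suc n)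
    then obtain z where z: "z \<in> carrier A" "p \<ominus> z \<in> I" "nrm A z \<le> nrm A y ^ Suc n" by blast
    have py: "p \<ominus> y \<in> I"
      unfolding y_def minus_minus_cancel[OF p(1) Ic[OF i]] by (rule i)
    have "p \<ominus> z \<otimes> y = (p \<ominus> z) \<otimes> p \<oplus> z \<otimes> (p \<ominus> y)"
      using mult_minus_left[OF p(1) z(1) p(1)] mult_minus_right[OF p(1) yc z(1)] p z(1) yc
        minus_trans[of p "z \<otimes> p" "z \<otimes> y"] by simp
    also have "\<dots> \<in> I" by (rule add[OF mul(2)[OF z(2) p(1)] mul(1)[OF py z(1)]])
    finally have "p \<ominus> z \<otimes> y \<in> I" .
    moreover have "nrm A (z \<otimes> y) \<le> nrm A y ^ Suc (Suc n)"
      using nrm_mult[OF z(1) yc] mult_right_mono[OF z(3) nrm_nonneg[OF yc]] by (simp add: mult.commute)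
    ultimately show ?case using z(1) yc by (intro bexI[of _ "z \<otimes> y"]) simp_all
  qed
  have "\<exists>c\<in>I. nrm A (p \<ominus> c) < e" if e: "e > 0" for e
  proof -
    have "nrm A y < 1" using lt by (simp add: y_def)
    then obtain n where n: "nrm A y ^ n < e" using real_arch_pow_inv[OF e] by blast
    have "nrm A y ^ Suc n \<le> nrm A y ^ n" using \<open>nrm A y < 1\<close> nrm_nonneg[OF yc] by (intro power_decreasing) auto
    then obtain z where z: "z \<in> carrier A" "p \<ominus> z \<in> I" "nrm A z < e" using pow[of n] n by force
    then show ?thesis using minus_minus_cancel[OF p(1) z(1)] by (intro bexI[OF _ z(2)]) simp
  qed
  then show ?thesis using I'(2) p(1) unfolding closed_iff by blast
qed

context graded_rep
begin

text \<open>If \<open>p = \<mu>\<beta>\<close> and \<open>q = \<nu>\<gamma>\<close> with \<open>\<beta> \<noteq> \<gamma>\<close>, then aperiodicity annihilates the left-hand side and the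
  grading the coefficient on the right.\<close>

lemma gen_entry:
  assumes p: "p \<in> \<P>" and q: "q \<in> \<P>" and w: "w \<in> X" "\<s> p = vtx w" "\<s> q = vtx w"
    and \<mu>: "\<mu> \<in> \<P>" and \<nu>: "\<nu> \<in> \<P>" and s: "\<s> \<mu> = \<s> \<nu>"
    and pre: "act p w \<in> cyl \<mu> \<Longrightarrow> \<mu> \<preceq> p" "act q w \<in> cyl \<nu> \<Longrightarrow> \<nu> \<preceq> q"
    and \<tau>: "\<tau> \<in> \<P>" "\<r> \<tau> = vtx w"
    and dis: "act p w \<notin> cyl \<mu> \<Longrightarrow> \<M> (p \<star> \<tau>) \<mu> = {}" "act q w \<notin> cyl \<nu> \<Longrightarrow> \<M> (q \<star> \<tau>) \<nu> = {}"
    and ap: "\<And>\<beta> \<gamma>. \<lbrakk>\<beta> \<in> \<P>; \<gamma> \<in> \<P>; \<s> \<mu> = \<r> \<beta>; \<s> \<nu> = \<r> \<gamma>; p = \<mu> \<star> \<beta>; q = \<nu> \<star> \<gamma>; \<beta> \<noteq> \<gamma>\<rbrakk>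
      \<Longrightarrow> \<M> (\<beta> \<star> \<tau>) (\<gamma> \<star> \<tau>) = {}"
  shows "st (p \<star> \<tau>) \<otimes> (t \<mu> \<otimes> st \<nu>) \<otimes> t (q \<star> \<tau>) =
    \<rho> (t \<mu> \<otimes> st \<nu>) (ell2_basis (act q w)) (act p w) \<odot> t (\<s> \<tau>)"
proof -
  let ?P = "p \<star> \<tau>" and ?Q = "q \<star> \<tau>" and ?x = "act q w" and ?y = "act p w"
  have sp: "\<s> p = \<r> \<tau>" and sq: "\<s> q = \<r> \<tau>" using w \<tau>(2) by simp_all
  have P: "?P \<in> \<P>" and Q: "?Q \<in> \<P>" using cmp_closed[OF p \<tau>(1) sp] cmp_closed[OF q \<tau>(1) sq] .
  have x: "?x \<in> X" and y: "?y \<in> X" using act_closed[OF q w(1,3)] act_closed[OF p w(1,2)] .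
  have ex: "ell2_basis ?x \<in> ell2 X" using x by simp
  have assoc: "st ?P \<otimes> (t \<mu> \<otimes> st \<nu>) \<otimes> t ?Q = (st ?P \<otimes> t \<mu>) \<otimes> (st \<nu> \<otimes> t ?Q)"
    using P Q \<mu> \<nu> by (simp add: mult_assoc del: cmp_closed)
  note m = rho_gen_apply[OF \<mu> \<nu> ex]
  have t0: "t (\<s> \<tau>) \<in> carrier A" using \<tau>(1) by simp
  consider "?y \<notin> cyl \<mu>" | "?y \<in> cyl \<mu>" "?x \<notin> cyl \<nu>" | "?y \<in> cyl \<mu>" "?x \<in> cyl \<nu>" by blast
  then show ?thesis
  proof cases
    case 1
    have "st ?P \<otimes> t \<mu> = \<zero>" by (rule st_t_disjoint[OF P \<mu> dis(1)[OF 1]])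
    then show ?thesis unfolding assoc m path_op_matrix(3)[OF \<mu> \<nu> ex 1] using \<nu> Q t0 by simp
  next
    case 2
    obtain z where z: "z \<in> adom \<mu>" "?y = act \<mu> z" using 2(1) by blast
    have zn: "z \<in> adom \<nu>" using z(1) s by (simp add: adom_def)
    have "act \<nu> z \<noteq> ?x" using imageI[OF zn, of "act \<nu>"] 2(2) by auto
    then have "path_op \<mu> (adj (B_ell2 X) (path_op \<nu>) (ell2_basis ?x)) ?y = 0"
      unfolding z(2) path_op_matrix(1)[OF \<mu> \<nu> ex z(1) zn] by (simp add: ell2_basis_def)
    moreover have "adj A (st ?Q \<otimes> t \<nu>) = adj A \<zero>" using st_t_disjoint[OF Q \<nu> dis(2)[OF 2(2)]] by simp
    then have "st \<nu> \<otimes> t ?Q = \<zero>" using Q \<nu> by (simp add: adj_mult)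
    ultimately show ?thesis unfolding assoc m using \<mu> P t0 by simp
  next
    case 3
    obtain \<beta> where \<beta>: "\<beta> \<in> \<P>" "\<s> \<mu> = \<r> \<beta>" "p = \<mu> \<star> \<beta>" using pre(1)[OF 3(1)] by (rule prefix_ofE)
    obtain \<gamma> where \<gamma>: "\<gamma> \<in> \<P>" "\<s> \<nu> = \<r> \<gamma>" "q = \<nu> \<star> \<gamma>" using pre(2)[OF 3(2)] by (rule prefix_ofE)
    have sb: "\<s> \<beta> = vtx w" "\<s> \<gamma> = vtx w"
      using src_cmp[OF \<mu> \<beta>(1,2)] src_cmp[OF \<nu> \<gamma>(1,2)] \<beta>(3) \<gamma>(3) w by simp_all
    have sbt: "\<s> \<beta> = \<r> \<tau>" "\<s> \<gamma> = \<r> \<tau>" using sb \<tau>(2) by simp_all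
    have yb: "?y = act \<mu> (act \<beta> w)" unfolding \<beta>(3) by (rule act_cmp[OF \<mu> \<beta>(1,2) w(1) sb(1)])
    have xc: "?x = act \<nu> (act \<gamma> w)" unfolding \<gamma>(3) by (rule act_cmp[OF \<nu> \<gamma>(1,2) w(1) sb(2)])
    have bm: "act \<beta> w \<in> adom \<mu>" using act_closed[OF \<beta>(1) w(1) sb(1)] vtx_act[OF \<beta>(1) w(1) sb(1)] \<beta>(2) by (simp add: adom_def)
    have bn: "act \<beta> w \<in> adom \<nu>" using bm s by (simp add: adom_def)
    have cn: "act \<gamma> w \<in> adom \<nu>" using act_closed[OF \<gamma>(1) w(1) sb(2)] vtx_act[OF \<gamma>(1) w(1) sb(2)] \<gamma>(2) by (simp add: adom_def)
    have bt: "\<beta> \<star> \<tau> \<in> \<P>" "\<gamma> \<star> \<tau> \<in> \<P>" using \<beta>(1) \<gamma>(1) \<tau>(1) sbt by simp_all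
    have Pb: "?P = \<mu> \<star> (\<beta> \<star> \<tau>)" unfolding \<beta>(3) by (rule cmp_assoc[OF \<mu> \<beta>(1) \<tau>(1) \<beta>(2) sbt(1)])
    have Qc: "?Q = \<nu> \<star> (\<gamma> \<star> \<tau>)" unfolding \<gamma>(3) by (rule cmp_assoc[OF \<nu> \<gamma>(1) \<tau>(1) \<gamma>(2) sbt(2)])
    have 1: "st ?P \<otimes> t \<mu> = st (\<beta> \<star> \<tau>)" unfolding Pb by (rule st_t_prefix(2)[OF \<mu> bt(1)]) (use \<beta> \<tau> sbt in simp)
    have 2: "st \<nu> \<otimes> t ?Q = t (\<gamma> \<star> \<tau>)" unfolding Qc by (rule st_t_prefix(1)[OF \<nu> bt(2)]) (use \<gamma> \<tau> sbt in simp)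
    have val: "path_op \<mu> (adj (B_ell2 X) (path_op \<nu>) (ell2_basis ?x)) ?y = (if act \<nu> (act \<beta> w) = ?x then 1 else 0)"
      unfolding yb path_op_matrix(1)[OF \<mu> \<nu> ex bm bn] by (simp add: ell2_basis_def)
    show ?thesis
    proof (cases "\<beta> = \<gamma>")
      case True
      have "\<s> (\<gamma> \<star> \<tau>) = \<s> \<tau>" by (rule src_cmp[OF \<gamma>(1) \<tau>(1) sbt(2)])
      then show ?thesis unfolding assoc m 1 2 val using True xc st_t[OF bt(2)] t0 by simp
    next
      case False
      have "act \<nu> (act \<beta> w) \<noteq> ?x"
      proof
        assume "act \<nu> (act \<beta> w) = ?x"
        then have eq: "act \<beta> w = act \<gamma> w"
          using act_inj[OF \<nu> adomD(1)[OF bn] adomD(1)[OF cn] adomD(2)[OF bn] adomD(2)[OF cn]] xc by simp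
        have "gr w + \<D> \<beta> = gr w + \<D> \<gamma>"
          using gr_act[OF \<beta>(1) w(1) sb(1)] gr_act[OF \<gamma>(1) w(1) sb(2)] eq by simp
        then have d: "\<d> \<beta> = \<d> \<gamma>" using ideg_eq_iff[of \<Lambda> \<beta> \<gamma>] by simp
        obtain \<alpha> \<delta> where "\<beta> \<star> \<alpha> \<in> \<M> \<beta> \<gamma>" using act_meet[OF \<beta>(1) \<gamma>(1) w(1) w(1) sb eq] by blast
        then show False using MCE_same_deg[OF \<beta>(1) \<gamma>(1) d False] by simp
      qed
      moreover have "st (\<beta> \<star> \<tau>) \<otimes> t (\<gamma> \<star> \<tau>) = \<zero>"
        by (rule st_t_disjoint[OF bt ap[OF \<beta>(1) \<gamma>(1) \<beta>(2) \<gamma>(2) \<beta>(3) \<gamma>(3) False]])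
      ultimately show ?thesis unfolding assoc m 1 2 val using t0 by simp
    qed
  qed
qed

text \<open>The paths are lengthened three times: to contain every generator path in whose cylinder
  their point lies, then by \<open>\<sigma>\<close> to avoid the remaining cylinders, then by
  \<open>\<kappa>\<close> to separate distinct tails by aperiodicity. After that each generator
  compresses to its own matrix entry times one and the same vertex projection.\<close>

lemma compression:
  assumes ap: "aperiodic \<Lambda>" and a: "a \<in> ck_span" and x: "x \<in> X" and y: "y \<in> X"
    and nz: "\<rho> a (ell2_basis x) y \<noteq> 0"
  shows "\<exists>p q. p \<in> \<P> \<and> q \<in> \<P> \<and> \<s> p = \<s> q \<and>
    st p \<otimes> a \<otimes> t q = \<rho> a (ell2_basis x) y \<odot> t (\<s> q)"
proof -
  let ?S = "{(\<mu>, \<nu>). \<mu> \<in> \<P> \<and> \<nu> \<in> \<P> \<and> \<s> \<mu> = \<s> \<nu>}" and ?f = "\<lambda>(\<mu>, \<nu>). t \<mu> \<otimes> st \<nu>"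
  have ex: "ell2_basis x \<in> ell2 X" using x by simp
  obtain H where H: "finite H" "H \<subseteq> (\<Union>g. hom_gens g)" "a \<in> lin A H" using lin_finite_support[OF a] by (elim exE conjE) (rule that)
  have sub: "H \<subseteq> ?f ` ?S"
  proof
    fix h assume "h \<in> H"
    then obtain g where "h \<in> hom_gens g" using H(2) by blast
    then obtain \<mu> \<nu> where h: "h = t \<mu> \<otimes> st \<nu>" "\<mu> \<in> \<P>" "\<nu> \<in> \<P>" "\<s> \<mu> = \<s> \<nu>" by (rule hom_gensE)
    then have "(\<mu>, \<nu>) \<in> ?S" "h = ?f (\<mu>, \<nu>)" by simp_all
    then show "h \<in> ?f ` ?S" by blast
  qed
  obtain C where C: "C \<subseteq> ?S" "finite C" "H = ?f ` C" using finite_subset_image[OF H(1) sub] by blast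
  have CS: "\<mu> \<in> \<P>" "\<nu> \<in> \<P>" "\<s> \<mu> = \<s> \<nu>" if "(\<mu>, \<nu>) \<in> C" for \<mu> \<nu>
    using subsetD[OF C(1) that] by simp_all
  have Hc: "H \<subseteq> carrier A" using H(2) hom_gens_closed(2) by (rule subset_trans)
  \<comment> \<open>A generator with nonzero entry links the two points: it provides paths and a
    common tail with \<open>y = \<mu>0 z\<close> and \<open>x = \<nu>0 z\<close>, from which the
    lengthening starts.\<close>
  have "\<exists>h\<in>H. \<rho> h (ell2_basis x) y \<noteq> 0"
  proof (rule ccontr)
    assume n: "\<not> (\<exists>h\<in>H. \<rho> h (ell2_basis x) y \<noteq> 0)"
    have "\<rho> a (ell2_basis x) y = 0" using H(3)
    proof (induction rule: lin.induct)
      case lin_zero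
      show ?case by (rule rho_apply(4)[OF M.zero_closed M.zero_closed ex])
    next
      case (lin_step h b c)
      have c: "h \<in> carrier A" "b \<in> carrier A" using subsetD[OF Hc lin_step.hyps(1)] lin_closed[OF lin_step.hyps(2) Hc] .
      have "\<rho> h (ell2_basis x) y = 0" using n lin_step.hyps(1) by blast
      then show ?case
        unfolding rho_apply(1)[OF smult_carrier[OF c(1)] c(2) ex] rho_apply(2)[OF c(1,1) ex] lin_step.IH by simp
    qed
    then show False using nz by simp
  qed
  then obtain h where h: "h \<in> H" "\<rho> h (ell2_basis x) y \<noteq> 0" by blast
  obtain \<mu>0 \<nu>0 where h': "(\<mu>0, \<nu>0) \<in> C" "h = t \<mu>0 \<otimes> st \<nu>0" using h(1) C(3) by auto
  note m0 = CS[OF h'(1)]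
  have v0: "path_op \<mu>0 (adj (B_ell2 X) (path_op \<nu>0) (ell2_basis x)) y \<noteq> 0"
    using h(2) unfolding h'(2) rho_gen_apply[OF m0(1,2) ex] .
  then have "y \<in> cyl \<mu>0" using path_op_matrix(3)[OF m0(1,2) ex] by blast
  then obtain z where z: "z \<in> adom \<mu>0" "y = act \<mu>0 z" by blast
  have zn: "z \<in> adom \<nu>0" using z(1) m0(3) by (simp add: adom_def)
  have xz: "x = act \<nu>0 z"
    using v0 unfolding z(2) path_op_matrix(1)[OF m0(1,2) ex z(1) zn] by (simp add: ell2_basis_def split: if_splits)
  define N where "N = fst ` C \<union> snd ` C"
  have N: "finite N" "N \<subseteq> \<P>"
    using C(2) CS unfolding N_def by auto
  obtain p q w where pq: "p \<in> \<P>" "q \<in> \<P>" "w \<in> X" "\<s> p = vtx w" "\<s> q = vtx w"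
    "act p w = y" "act q w = x" "\<forall>\<mu>\<in>N. y \<in> cyl \<mu> \<longrightarrow> \<mu> \<preceq> p" "\<forall>\<mu>\<in>N. x \<in> cyl \<mu> \<longrightarrow> \<mu> \<preceq> q"
    using refine_cylinders[OF N m0(1,2) adomD(1)[OF z(1)] adomD(2)[OF z(1)] adomD(2)[OF zn]]
    unfolding z(2)[symmetric] xz[symmetric] by (elim exE conjE) (rule that)
  \<comment> \<open>Only the cylinders that miss the respective point can be avoided; the others
    were absorbed into \<open>p\<close> and \<open>q\<close>.\<close>
  define J where "J = Pair p ` {\<mu> \<in> N. y \<notin> cyl \<mu>} \<union> Pair q ` {\<mu> \<in> N. x \<notin> cyl \<mu>}"
  have "\<exists>\<tau> \<in> \<P>. \<r> \<tau> = vtx w \<and> (\<forall>(\<mu>, \<nu>) \<in> J. \<M> (\<mu> \<star> \<tau>) \<nu> = {})"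
  proof (rule avoid_cylinders[OF fa pq(3)])
    show "finite J" using N(1) by (simp add: J_def)
    show "\<mu> \<in> \<P> \<and> \<nu> \<in> \<P> \<and> \<s> \<mu> = vtx w \<and> act \<mu> w \<notin> cyl \<nu>" if "(\<mu>, \<nu>) \<in> J" for \<mu> \<nu>
      using that N(2) pq(1-7) unfolding J_def by auto
  qed
  then obtain \<sigma> where \<sigma>: "\<sigma> \<in> \<P>" "\<r> \<sigma> = vtx w" "\<forall>(\<mu>, \<nu>) \<in> J. \<M> (\<mu> \<star> \<sigma>) \<nu> = {}" by blast
  have \<sigma>J': "\<M> (r \<star> \<sigma>) \<mu> = {}" if "(r, \<mu>) \<in> J" for r \<mu>
    using bspec[OF \<sigma>(3) that] by simp
  have \<sigma>J: "\<M> (p \<star> \<sigma>) \<mu> = {}" if "\<mu> \<in> N" "y \<notin> cyl \<mu>" for \<mu>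
    by (rule \<sigma>J') (use that in \<open>simp add: J_def\<close>)
  have \<sigma>J2: "\<M> (q \<star> \<sigma>) \<mu> = {}" if "\<mu> \<in> N" "x \<notin> cyl \<mu>" for \<mu>
    by (rule \<sigma>J') (use that in \<open>simp add: J_def\<close>)
  define tail where "tail \<mu> r = (SOME \<beta>. \<beta> \<in> \<P> \<and> \<s> \<mu> = \<r> \<beta> \<and> r = \<mu> \<star> \<beta>)" for \<mu> r
  have tail: "tail \<mu> r = \<beta>" if "\<mu> \<in> \<P>" "\<beta> \<in> \<P>" "\<s> \<mu> = \<r> \<beta>" "r = \<mu> \<star> \<beta>" for \<mu> \<beta> r
    unfolding tail_def
  proof (rule some_equality)
    show "\<beta> \<in> \<P> \<and> \<s> \<mu> = \<r> \<beta> \<and> r = \<mu> \<star> \<beta>" using that by simp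
    fix \<gamma> assume "\<gamma> \<in> \<P> \<and> \<s> \<mu> = \<r> \<gamma> \<and> r = \<mu> \<star> \<gamma>"
    then show "\<gamma> = \<beta>" using cancel_left[OF that(1) _ that(2) _ that(3)] that(4) by simp
  qed
  have tail_ex: "\<exists>\<beta>. \<beta> \<in> \<P> \<and> \<s> \<mu> = \<r> \<beta> \<and> r = \<mu> \<star> \<beta> \<and> tail \<mu> r = \<beta>" if "\<mu> \<preceq> r" for \<mu> r
    using prefix_ofE[OF that] tail by metis
  \<comment> \<open>The pairs that aperiodicity must separate: the different remainders of
    \<open>p\<close> and \<open>q\<close> after one generator's two paths, already lengthened by
    \<open>\<sigma>\<close>.\<close>
  define D where "D = (\<lambda>(\<mu>, \<nu>). (tail \<mu> p \<star> \<sigma>, tail \<nu> q \<star> \<sigma>)) `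
    {(\<mu>, \<nu>) \<in> C. \<mu> \<preceq> p \<and> \<nu> \<preceq> q \<and> tail \<mu> p \<noteq> tail \<nu> q}"
  have ss: "\<s> \<sigma> \<in> \<V>" using \<sigma>(1) by simp
  have "\<exists>\<tau> \<in> \<P>. \<r> \<tau> = \<s> \<sigma> \<and> (\<forall>(\<alpha>, \<beta>) \<in> D. \<M> (\<alpha> \<star> \<tau>) (\<beta> \<star> \<tau>) = {})"
  proof (rule aperiodic_finite[OF ap ss])
    show "finite D" unfolding D_def by (rule finite_imageI, rule finite_subset[OF _ C(2)]) auto
    fix \<alpha>' \<beta>' assume "(\<alpha>', \<beta>') \<in> D"
    then obtain \<mu> \<nu> where mn: "(\<mu>, \<nu>) \<in> C" "\<mu> \<preceq> p" "\<nu> \<preceq> q" "tail \<mu> p \<noteq> tail \<nu> q"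
      "\<alpha>' = tail \<mu> p \<star> \<sigma>" "\<beta>' = tail \<nu> q \<star> \<sigma>" by (auto simp: D_def)
    obtain \<beta> where b: "\<beta> \<in> \<P>" "\<s> \<mu> = \<r> \<beta>" "p = \<mu> \<star> \<beta>" "tail \<mu> p = \<beta>" using tail_ex[OF mn(2)] by blast
    obtain \<gamma> where c: "\<gamma> \<in> \<P>" "\<s> \<nu> = \<r> \<gamma>" "q = \<nu> \<star> \<gamma>" "tail \<nu> q = \<gamma>" using tail_ex[OF mn(3)] by blast
    have s: "\<s> \<beta> = \<r> \<sigma>" "\<s> \<gamma> = \<r> \<sigma>"
      using src_cmp[OF CS(1)[OF mn(1)] b(1,2)] src_cmp[OF CS(2)[OF mn(1)] c(1,2)] b(3) c(3) pq(4,5) \<sigma>(2) by simp_all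
    show "\<alpha>' \<in> \<P> \<and> \<beta>' \<in> \<P> \<and> \<alpha>' \<noteq> \<beta>' \<and> \<s> \<alpha>' = \<s> \<sigma> \<and> \<s> \<beta>' = \<s> \<sigma>"
      unfolding mn(5,6) b(4) c(4) using cancel_right[OF b(1) c(1) \<sigma>(1) s] mn(4) b(1,4) c(1,4) \<sigma>(1) s by auto
  qed
  then obtain \<kappa> where \<kappa>: "\<kappa> \<in> \<P>" "\<r> \<kappa> = \<s> \<sigma>" "\<forall>(\<alpha>, \<beta>) \<in> D. \<M> (\<alpha> \<star> \<kappa>) (\<beta> \<star> \<kappa>) = {}" by blast
  define \<tau> where "\<tau> = \<sigma> \<star> \<kappa>"
  have \<tau>: "\<tau> \<in> \<P>" "\<r> \<tau> = vtx w" using \<sigma>(1,2) \<kappa>(1,2) by (simp_all add: \<tau>_def)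
  have ass: "r \<star> \<tau> = (r \<star> \<sigma>) \<star> \<kappa>" "r \<star> \<sigma> \<preceq> r \<star> \<tau>"
    if r: "r \<in> \<P>" "\<s> r = \<r> \<sigma>" for r
  proof -
    show e: "r \<star> \<tau> = (r \<star> \<sigma>) \<star> \<kappa>"
      unfolding \<tau>_def by (rule cmp_assoc[symmetric, OF r(1) \<sigma>(1) \<kappa>(1) r(2) \<kappa>(2)[symmetric]])
    show "r \<star> \<sigma> \<preceq> r \<star> \<tau>"
      unfolding e using prefix_ofI[OF cmp_closed[OF r(1) \<sigma>(1) r(2)] \<kappa>(1)] src_cmp[OF r(1) \<sigma>(1) r(2)] \<kappa>(2) by simp
  qed
  have sps: "\<s> p = \<r> \<sigma>" "\<s> q = \<r> \<sigma>" using pq(4,5) \<sigma>(2) by simp_all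
  have gen: "st (p \<star> \<tau>) \<otimes> h \<otimes> t (q \<star> \<tau>) = \<rho> h (ell2_basis x) y \<odot> t (\<s> \<tau>)" if "h \<in> H" for h
  proof -
    obtain \<mu> \<nu> where mn: "(\<mu>, \<nu>) \<in> C" "h = t \<mu> \<otimes> st \<nu>" using \<open>h \<in> H\<close> C(3) by auto
    note m = CS[OF mn(1)]
    have mN: "\<mu> \<in> N" "\<nu> \<in> N" using mn(1) unfolding N_def by force+
    show ?thesis
      unfolding mn(2) pq(6)[symmetric] pq(7)[symmetric]
    proof (rule gen_entry[OF pq(1-5) m _ _ \<tau>])
      show "act p w \<in> cyl \<mu> \<Longrightarrow> \<mu> \<preceq> p" using pq(6,8) mN(1) by simp
      show "act q w \<in> cyl \<nu> \<Longrightarrow> \<nu> \<preceq> q" using pq(7,9) mN(2) by simp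
      show "\<M> (p \<star> \<tau>) \<mu> = {}" if "act p w \<notin> cyl \<mu>"
        by (rule MCE_empty_mono[OF \<sigma>J[OF mN(1)] ass(2)[OF pq(1) sps(1)] prefix_of_refl[OF m(1)]]) (use that pq(6) in simp)
      show "\<M> (q \<star> \<tau>) \<nu> = {}" if "act q w \<notin> cyl \<nu>"
        by (rule MCE_empty_mono[OF \<sigma>J2[OF mN(2)] ass(2)[OF pq(2) sps(2)] prefix_of_refl[OF m(2)]]) (use that pq(7) in simp)
      fix \<beta> \<gamma> assume b: "\<beta> \<in> \<P>" "\<gamma> \<in> \<P>" "\<s> \<mu> = \<r> \<beta>" "\<s> \<nu> = \<r> \<gamma>" "p = \<mu> \<star> \<beta>" "q = \<nu> \<star> \<gamma>" "\<beta> \<noteq> \<gamma>"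
      have tb: "tail \<mu> p = \<beta>" "tail \<nu> q = \<gamma>" by (rule tail[OF m(1) b(1,3,5)], rule tail[OF m(2) b(2,4,6)])
      have pr: "\<mu> \<preceq> p" "\<nu> \<preceq> q"
        unfolding b(5,6) by (rule prefix_ofI[OF m(1) b(1,3)], rule prefix_ofI[OF m(2) b(2,4)])
      have s: "\<s> \<beta> = \<r> \<sigma>" "\<s> \<gamma> = \<r> \<sigma>"
        using src_cmp[OF m(1) b(1,3)] src_cmp[OF m(2) b(2,4)] b(5,6) sps by simp_all
      have "(\<mu>, \<nu>) \<in> {(\<mu>, \<nu>) \<in> C. \<mu> \<preceq> p \<and> \<nu> \<preceq> q \<and> tail \<mu> p \<noteq> tail \<nu> q}"
        using mn(1) pr tb b(7) by simp
      from imageI[OF this, of "\<lambda>(\<mu>, \<nu>). (tail \<mu> p \<star> \<sigma>, tail \<nu> q \<star> \<sigma>)"]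
      have "(\<beta> \<star> \<sigma>, \<gamma> \<star> \<sigma>) \<in> D" unfolding D_def by (simp only: case_prod_conv tb)
      then show "\<M> (\<beta> \<star> \<tau>) (\<gamma> \<star> \<tau>) = {}"
        unfolding ass(1)[OF b(1) s(1)] ass(1)[OF b(2) s(2)] using \<kappa>(3) by auto
    qed
  qed
  have pt: "p \<star> \<tau> \<in> \<P>" "q \<star> \<tau> \<in> \<P>" "\<s> (p \<star> \<tau>) = \<s> \<tau>" "\<s> (q \<star> \<tau>) = \<s> \<tau>"
    using pq(1,2,4,5) \<tau> by simp_all
  have sp: "\<s> \<tau> \<in> \<P>" using \<tau>(1) by simp
  have "st (p \<star> \<tau>) \<otimes> a \<otimes> t (q \<star> \<tau>) = \<rho> a (ell2_basis x) y \<odot> t (\<s> \<tau>)"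
    using H(3)
  proof (induction rule: lin.induct)
    case lin_zero
    show ?case unfolding rho_apply(4)[OF M.zero_closed M.zero_closed ex] using pt sp by simp
  next
    case (lin_step h b c)
    have hb: "h \<in> carrier A" "b \<in> carrier A" using subsetD[OF Hc lin_step.hyps(1)] lin_closed[OF lin_step.hyps(2) Hc] .
    define P Q where "P = st (p \<star> \<tau>)" and "Q = t (q \<star> \<tau>)"
    have PQ: "P \<in> carrier A" "Q \<in> carrier A" using pt by (simp_all add: P_def Q_def)
    have "P \<otimes> ((c \<odot> h) \<oplus> b) \<otimes> Q = c \<odot> (P \<otimes> h \<otimes> Q) \<oplus> P \<otimes> b \<otimes> Q"
      using PQ hb by (simp add: mult_r_distr mult_l_distr smult_mult_r smult_mult_l)
    also have "\<dots> = c \<odot> (\<rho> h (ell2_basis x) y \<odot> t (\<s> \<tau>)) \<oplus> \<rho> b (ell2_basis x) y \<odot> t (\<s> \<tau>)"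
      unfolding P_def Q_def gen[OF lin_step.hyps(1)] lin_step.IH ..
    also have "\<dots> = (c * \<rho> h (ell2_basis x) y + \<rho> b (ell2_basis x) y) \<odot> t (\<s> \<tau>)"
      using sp by (simp add: smult_add_left)
    finally show ?case
      unfolding P_def Q_def rho_apply(1)[OF smult_carrier[OF hb(1)] hb(2) ex] rho_apply(2)[OF hb(1,1) ex] .
  qed
  then show ?thesis using pt by (intro exI[of _ "p \<star> \<tau>"] exI[of _ "q \<star> \<tau>"]) simp
qed

lemma aperiodic_ideal:
  assumes ap: "aperiodic \<Lambda>" and gen: "cstar_generates A (t ` \<P>)"
    and I: "cstar_ideal A I" and a: "a \<in> I" "a \<noteq> \<zero>"
  shows "\<exists>v \<in> \<V>. t v \<in> I"
proof -
  have I': "I \<subseteq> carrier A" "\<forall>x\<in>I. \<forall>c. c \<odot> x \<in> I" "\<forall>x\<in>I. \<forall>b\<in>carrier A. b \<otimes> x \<in> I \<and> x \<otimes> b \<in> I"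
    using I unfolding cstar_ideal_def by - (elim conjE, assumption)+
  have ac: "a \<in> carrier A" using I'(1) a(1) by blast
  have ra: "\<rho> a \<in> bounded_ops X" by (rule rho_op[OF ac])
  have "\<exists>x\<in>X. \<exists>y. \<rho> a (ell2_basis x) y \<noteq> 0"
  proof (rule ccontr)
    assume n: "\<not> (\<exists>x\<in>X. \<exists>y. \<rho> a (ell2_basis x) y \<noteq> 0)"
    have "\<rho> a = restrict (\<lambda>f x. 0) (ell2 X)"
    proof (rule op_ext_basis[OF ra op_zero_closed])
      fix x assume "x \<in> X"
      then show "\<rho> a (ell2_basis x) = restrict (\<lambda>f x. 0) (ell2 X) (ell2_basis x)" using n by (auto simp: fun_eq_iff)
    qed
    then have "\<rho> a = \<zero>\<^bsub>B_ell2 X\<^esub>" by simp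
    then have "nrm A a \<le> 0" using isometry[OF gen ac] B.nrm_eq_0[OF B.M.zero_closed] by metis
    then show False using nrm_pos[OF ac a(2)] by simp
  qed
  then obtain x y where xy: "x \<in> X" "\<rho> a (ell2_basis x) y \<noteq> 0" by blast
  have ex: "ell2_basis x \<in> ell2 X" using xy(1) by simp
  have y: "y \<in> X" using ell2_support[OF bounded_ops_closed[OF ra ex], of y] xy(2) by blast
  let ?c = "\<rho> a (ell2_basis x) y"
  \<comment> \<open>An error below half of the coefficient of \<open>a\<close> leaves for
    \<open>b\<close> a coefficient larger than the error, so that after division by it the distance
    from the ideal is less than 1.\<close>
  have "cmod ?c / 2 > 0" using xy(2) by simp
  then obtain b where b: "b \<in> ck_span" "nrm A (a \<ominus> b) < cmod ?c / 2" using span_dense[OF gen ac] by blast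
  note bc = span_closed[OF b(1)]
  let ?d = "\<rho> b (ell2_basis x) y"
  have abc: "a \<ominus> b \<in> carrier A" using ac bc by simp
  have "?c = \<rho> (a \<ominus> b) (ell2_basis x) y + ?d"
    using rho_apply(1)[OF abc bc ex] minus_add_cancel[OF ac bc] by simp
  moreover have "cmod (\<rho> (a \<ominus> b) (ell2_basis x) y) \<le> nrm A (a \<ominus> b)"
  proof -
    have "cmod (\<rho> (a \<ominus> b) (ell2_basis x) y) \<le> ell2_norm X (\<rho> (a \<ominus> b) (ell2_basis x))"
      by (rule cmod_le_ell2_norm[OF bounded_ops_closed[OF rho_op[OF abc] ex]])
    also have "\<dots> \<le> nrm (B_ell2 X) (\<rho> (a \<ominus> b))" using op_nrm_bound[OF rho_op[OF abc] ex] xy(1) by simp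
    also have "\<dots> \<le> nrm A (a \<ominus> b)" by (rule contractive[OF abc])
    finally show ?thesis .
  qed
  ultimately have d: "cmod ?d > cmod ?c / 2" using b(2) norm_triangle_ineq[of "\<rho> (a \<ominus> b) (ell2_basis x) y" ?d] by simp
  then have d0: "?d \<noteq> 0" using xy(2) by auto
  obtain p q where pq: "p \<in> \<P>" "q \<in> \<P>" "st p \<otimes> b \<otimes> t q = ?d \<odot> t (\<s> q)"
    using compression[OF ap b(1) xy(1) y d0] by blast
  let ?v = "\<s> q"
  have v: "?v \<in> \<V>" "t ?v \<in> carrier A" using pq(2) by simp_all
  define i where "i = inverse ?d \<odot> (st p \<otimes> a \<otimes> t q)"
  have "st p \<otimes> a \<otimes> t q \<in> I" using I'(3) a(1) pq(1,2) by simp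
  then have iI: "i \<in> I" using I'(2) by (simp add: i_def)
  have "t ?v \<ominus> i = inverse ?d \<odot> (st p \<otimes> (b \<ominus> a) \<otimes> t q)"
  proof -
    have "t ?v = inverse ?d \<odot> (st p \<otimes> b \<otimes> t q)" unfolding pq(3) using v(2) d0 by simp
    moreover have "st p \<otimes> (b \<ominus> a) \<otimes> t q = st p \<otimes> b \<otimes> t q \<ominus> st p \<otimes> a \<otimes> t q"
      using mult_minus_right[OF bc ac, of "st p"] mult_minus_left[of "st p \<otimes> b" "st p \<otimes> a" "t q"] pq(1,2) ac bc by simp
    ultimately show ?thesis
      using smult_minus_right[of "st p \<otimes> b \<otimes> t q" "st p \<otimes> a \<otimes> t q" "inverse ?d"] pq(1,2) ac bc by (simp add: i_def)
  qed
  also have "nrm A \<dots> = inverse (cmod ?d) * nrm A (st p \<otimes> (b \<ominus> a) \<otimes> t q)"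
    using pq(1,2) ac bc by (subst nrm_smult) (auto simp: norm_inverse)
  also have "\<dots> \<le> inverse (cmod ?d) * nrm A (a \<ominus> b)"
  proof (rule mult_left_mono)
    have "nrm A (st p \<otimes> (b \<ominus> a) \<otimes> t q) \<le> nrm A (st p \<otimes> (b \<ominus> a))"
      by (rule nrm_mult_le_right) (use pq(1,2) ac bc nrm_t_le(1)[OF pq(2)] in simp_all)
    also have "\<dots> \<le> nrm A (b \<ominus> a)"
      by (rule nrm_mult_le_left) (use pq(1,2) ac bc nrm_t_le(2)[OF pq(1)] in simp_all)
    also have "\<dots> = nrm A (a \<ominus> b)" by (rule nrm_minus_commute[OF bc ac])
    finally show "nrm A (st p \<otimes> (b \<ominus> a) \<otimes> t q) \<le> nrm A (a \<ominus> b)" .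
  qed simp
  also have "\<dots> < 1" using d b(2) d0 by (simp add: field_simps)
  finally have "nrm A (t ?v \<ominus> i) < 1" .
  then have "t ?v \<in> I" by (rule ideal_projection_near[OF I v(2) t_vertex(2)[OF v(1)] iI])
  then show ?thesis using v(1) by blast
qed

end

section \<open>The equivalence\<close>

text \<open>Equal generators act equally on some point; the grading then forces equal degrees, and
  distinct paths of one degree have no common extension.\<close>

lemma (in graded_rep) t_inj:
  assumes p: "\<alpha> \<in> \<P>" "\<beta> \<in> \<P>" "\<s> \<alpha> = \<s> \<beta>" and eq: "t \<alpha> = t \<beta>"
  shows "\<alpha> = \<beta>"
proof (rule ccontr)
  assume ne: "\<alpha> \<noteq> \<beta>"
  have "\<s> \<alpha> \<in> \<V>" using p(1) by simp
  then obtain x where x: "x \<in> X" "vtx x = \<s> \<alpha>" using vtx_surj by blast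
  have s: "\<s> \<alpha> = vtx x" "\<s> \<beta> = vtx x" using x(2) p(3) by simp_all
  have "path_op \<alpha> (ell2_basis x) = path_op \<beta> (ell2_basis x)"
    using rho_t[OF p(1)] rho_t[OF p(2)] eq by simp
  then have "ell2_basis (act \<alpha> x) (act \<alpha> x) = ell2_basis (act \<beta> x) (act \<alpha> x)"
    using path_op_basis[OF p(1) x(1)] path_op_basis[OF p(2) x(1)] s by simp
  then have e: "act \<alpha> x = act \<beta> x" by (simp add: ell2_basis_def split: if_splits)
  have "gr x + \<D> \<alpha> = gr x + \<D> \<beta>"
    using gr_act[OF p(1) x(1) s(1)] gr_act[OF p(2) x(1) s(2)] e by simp
  then have d: "\<d> \<alpha> = \<d> \<beta>" using ideg_eq_iff[of \<Lambda> \<alpha> \<beta>] by simp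
  obtain \<gamma> \<delta> where "\<alpha> \<star> \<gamma> \<in> \<M> \<alpha> \<beta>" using act_meet[OF p(1,2) x(1,1) s e] by blast
  then show False using MCE_same_deg[OF p(1,2) d ne] by simp
qed

text \<open>The description in \<open>boundary_op\<close> prescribes an operator on the basis:
  \<open>path_op\<close> satisfies it, and boundedness leaves no other choice.\<close>

lemma (in k_graph) boundary_op_eq:
  assumes fa: "finitely_aligned \<Lambda>" and \<mu>: "\<mu> \<in> \<P>"
  shows "boundary_op \<Lambda> \<mu> = path_action.path_op \<Lambda> \<B> prepend gp_rng \<mu>"
proof -
  interpret path_action \<Lambda> "\<B>" "prepend" gp_rng by (rule boundary_path_action[OF fa])
  show ?thesis
    unfolding boundary_op_def
  proof (rule the_equality)
    show 1: "path_op \<mu> \<in> bounded_ops \<B> \<and> (\<forall>x\<in>\<B>. path_op \<mu> (ell2_basis x) =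
        (if \<s> \<mu> = gp_rng x then ell2_basis (prepend \<mu> x) else (\<lambda>_. 0)))"
      using path_op_closed[OF \<mu>] path_op_basis[OF \<mu>] by simp
    fix T assume T: "T \<in> bounded_ops \<B> \<and> (\<forall>x\<in>\<B>. T (ell2_basis x) =
        (if \<s> \<mu> = gp_rng x then ell2_basis (prepend \<mu> x) else (\<lambda>_. 0)))"
    show "T = path_op \<mu>" by (rule op_ext_basis[of T "\<B>"]) (use T 1 in simp_all)
  qed
qed

lemma (in ck_kgraph) kgraph_rep_path_op:
  assumes act: "path_action \<Lambda> X act vtx" and \<pi>: "\<pi> \<in> cstar_hom A (B_ell2 X)"
    and t: "\<And>\<mu>. \<mu> \<in> \<P> \<Longrightarrow> \<pi> (t \<mu>) = path_action.path_op \<Lambda> X act vtx \<mu>"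
  shows "kgraph_rep \<Lambda> A t (B_ell2 X) \<pi>"
proof (rule kgraph_rep.intro[OF ck_kgraph_axioms B_ell2_cstar], rule kgraph_rep_axioms.intro[OF \<pi>])
  show "nrm (B_ell2 X) (\<pi> x) \<le> nrm A x" if "x \<in> carrier A" for x
    by (rule hom_contractive[OF cstar_algebra_axioms \<pi> that])
  show "\<pi> (t v) \<noteq> \<zero>\<^bsub>B_ell2 X\<^esub>" if v: "v \<in> \<V>" for v
    unfolding t[OF vertexD(1)[OF v]] by (rule path_action.path_op_vertex_nonzero[OF act v])
qed

lemma (in ck_kgraph) graded_rep_ex:
  assumes "CK_universal_for TYPE(('l, 'k) gpath ell2_op cstar) \<Lambda> A t"
  shows "\<exists>(X :: ('l, 'k) gpath set) act vtx gr \<rho>. graded_rep \<Lambda> X act vtx gr A t \<rho>"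
proof -
  let ?d = "\<lambda>u. inv_into UNIV gpath_code u :: ('l, 'k) gpath \<times> ('k \<Rightarrow> int)"
  let ?X = "gpath_code ` (\<B> \<times> UNIV) :: ('l, 'k) gpath set"
  let ?act = "\<lambda>\<mu> u. gpath_code (prepend \<mu> (fst (?d u)), snd (?d u) + \<D> \<mu>)"
  let ?vtx = "\<lambda>u. gp_rng (fst (?d u))" and ?gr = "\<lambda>u. snd (?d u)"
  have g: "graded_path_action \<Lambda> ?X ?act ?vtx ?gr"
    by (rule path_action.graded_product[OF boundary_path_action[OF fa] inj_gpath_code])
  then have a: "path_action \<Lambda> ?X ?act ?vtx" by (rule graded_path_action.axioms(1))
  obtain \<rho> where \<rho>: "\<rho> \<in> cstar_hom A (B_ell2 ?X)" "\<forall>\<mu>\<in>\<P>. \<rho> (t \<mu>) = path_action.path_op \<Lambda> ?X ?act ?vtx \<mu>"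
    using assms path_action.CK_family_path_op[OF a fa] unfolding CK_universal_for_def by blast
  have "graded_rep \<Lambda> ?X ?act ?vtx ?gr A t \<rho>"
    by (rule graded_rep.intro[OF g kgraph_rep_path_op[OF a \<rho>(1)]]) (use \<rho>(2) in \<open>simp_all add: graded_rep_axioms_def\<close>)
  then show ?thesis by blast
qed

theorem theorem4p1:
  fixes \<Lambda> :: "('l, 'k::finite) kgraph"
    and A :: "'a cstar"
    and s :: "'l \<Rightarrow> 'a"
  assumes "k_graph \<Lambda>"
    and "finitely_aligned \<Lambda>"
    and "is_kgraph_cstar \<Lambda> A s"
  shows "(aperiodic \<Lambda> \<longleftrightarrow>
            (\<forall>I. cstar_ideal A I \<and> I \<noteq> {\<zero>\<^bsub>A\<^esub>} \<longrightarrow> (\<exists>v \<in> vertices \<Lambda>. s v \<in> I)))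
       \<and> ((\<forall>I. cstar_ideal A I \<and> I \<noteq> {\<zero>\<^bsub>A\<^esub>} \<longrightarrow> (\<exists>v \<in> vertices \<Lambda>. s v \<in> I)) \<longleftrightarrow>
            inj_on (boundary_rep \<Lambda> A s) (carrier A))"
proof -
  have ck: "CK_family \<Lambda> A s" and gen: "cstar_generates A (s ` paths \<Lambda>)"
    and univ: "CK_universal_for TYPE(('l, 'k) gpath ell2_op cstar) \<Lambda> A s"
    using assms(3) by (simp_all add: is_kgraph_cstar_def)
  interpret ck_kgraph \<Lambda> A s by (rule ck_kgraph.intro[OF ck assms(1)]) (simp add: ck_kgraph_axioms_def assms(2))
  interpret Bd: path_action \<Lambda> "boundary \<Lambda>" "gp_prepend \<Lambda>" gp_rng by (rule boundary_path_action[OF fa])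
  obtain X act vtx gr \<rho> where G: "graded_rep \<Lambda> (X :: ('l, 'k) gpath set) act vtx gr A s \<rho>"
    using graded_rep_ex[OF univ] by blast
  let ?\<pi> = "boundary_rep \<Lambda> A s"
  \<comment> \<open>The description behind \<open>boundary_rep\<close> is meaningful once existence
    and uniqueness are known; the universal property gives both, since \<open>boundary_op\<close>
    and \<open>path_op\<close> agree on all paths.\<close>
  have "\<exists>!\<pi>. \<pi> \<in> cstar_hom A (B_ell2 (boundary \<Lambda>)) \<and> (\<forall>\<mu>\<in>paths \<Lambda>. \<pi> (s \<mu>) = Bd.path_op \<mu>)"
    using univ Bd.CK_family_path_op[OF fa] unfolding CK_universal_for_def by blast
  moreover have "(\<forall>\<mu>\<in>paths \<Lambda>. \<pi> (s \<mu>) = Bd.path_op \<mu>) \<longleftrightarrow> (\<forall>\<mu>\<in>paths \<Lambda>. \<pi> (s \<mu>) = boundary_op \<Lambda> \<mu>)" for \<pi>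
    using boundary_op_eq[OF fa] by simp
  ultimately have "\<exists>!\<pi>. \<pi> \<in> cstar_hom A (B_ell2 (boundary \<Lambda>)) \<and> (\<forall>\<mu>\<in>paths \<Lambda>. \<pi> (s \<mu>) = boundary_op \<Lambda> \<mu>)" by simp
  from theI'[OF this] have \<pi>: "?\<pi> \<in> cstar_hom A (B_ell2 (boundary \<Lambda>))" "\<And>\<mu>. \<mu> \<in> paths \<Lambda> \<Longrightarrow> ?\<pi> (s \<mu>) = Bd.path_op \<mu>"
    using boundary_op_eq[OF fa] by (simp_all add: boundary_rep_def induced_hom_def)
  interpret BR: kgraph_rep \<Lambda> A s "B_ell2 (boundary \<Lambda>)" ?\<pi>
    by (rule kgraph_rep_path_op[OF boundary_path_action[OF fa] \<pi>])
  have 12: "\<exists>v \<in> vertices \<Lambda>. s v \<in> I" if ap: "aperiodic \<Lambda>" and I: "cstar_ideal A I" "I \<noteq> {\<zero>\<^bsub>A\<^esub>}" for I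
  proof -
    have "\<zero>\<^bsub>A\<^esub> \<in> I" using I(1) by (simp add: cstar_ideal_def)
    then obtain a where "a \<in> I" "a \<noteq> \<zero>\<^bsub>A\<^esub>" using I(2) by blast
    then show ?thesis by (rule graded_rep.aperiodic_ideal[OF G ap gen I(1)])
  qed
  have 23: "inj_on ?\<pi> (carrier A)"
    if id: "\<forall>I. cstar_ideal A I \<and> I \<noteq> {\<zero>\<^bsub>A\<^esub>} \<longrightarrow> (\<exists>v \<in> vertices \<Lambda>. s v \<in> I)"
  proof (rule inj_onI, rule ccontr)
    let ?K = "{x \<in> carrier A. ?\<pi> x = \<zero>\<^bsub>B_ell2 (boundary \<Lambda>)\<^esub>}"
    fix a b assume ab: "a \<in> carrier A" "b \<in> carrier A" "?\<pi> a = ?\<pi> b" "a \<noteq> b"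
    have "?\<pi> (a \<ominus>\<^bsub>A\<^esub> b) = \<zero>\<^bsub>B_ell2 (boundary \<Lambda>)\<^esub>"
      unfolding BR.rho_minus[OF ab(1,2)] ab(3) by (rule BR.B.minus_self[OF BR.rho_closed[OF ab(2)]])
    then have "a \<ominus>\<^bsub>A\<^esub> b \<in> ?K" using ab(1,2) by simp
    moreover have "a \<ominus>\<^bsub>A\<^esub> b \<noteq> \<zero>\<^bsub>A\<^esub>" using minus_eq_zero_iff[OF ab(1,2)] ab(4) by simp
    ultimately have "?K \<noteq> {\<zero>\<^bsub>A\<^esub>}" by blast
    then obtain v where "v \<in> vertices \<Lambda>" "s v \<in> ?K" using id BR.kernel_ideal by blast
    then show False using BR.vertex_nonzero[of v] by simp
  qed
  have 31: "aperiodic \<Lambda>" if inj: "inj_on ?\<pi> (carrier A)"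
  proof (rule ccontr)
    assume "\<not> aperiodic \<Lambda>"
    then obtain \<alpha> \<beta> where p: "\<alpha> \<in> paths \<Lambda>" "\<beta> \<in> paths \<Lambda>" "\<alpha> \<noteq> \<beta>" "src \<Lambda> \<alpha> = src \<Lambda> \<beta>"
      and per: "\<And>\<tau>. \<lbrakk>\<tau> \<in> paths \<Lambda>; rng \<Lambda> \<tau> = src \<Lambda> \<alpha>\<rbrakk> \<Longrightarrow> MCE \<Lambda> (\<alpha> \<cdot>\<^bsub>\<Lambda>\<^esub> \<tau>) (\<beta> \<cdot>\<^bsub>\<Lambda>\<^esub> \<tau>) \<noteq> {}"
      unfolding aperiodic_def by blast
    have per': "MCE \<Lambda> (\<beta> \<cdot>\<^bsub>\<Lambda>\<^esub> \<tau>) (\<alpha> \<cdot>\<^bsub>\<Lambda>\<^esub> \<tau>) \<noteq> {}" if "\<tau> \<in> paths \<Lambda>" "rng \<Lambda> \<tau> = src \<Lambda> \<beta>" for \<tau>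
      using per[of \<tau>] that p(4) MCE_commute[of "\<beta> \<cdot>\<^bsub>\<Lambda>\<^esub> \<tau>" "\<alpha> \<cdot>\<^bsub>\<Lambda>\<^esub> \<tau>"] by simp
    \<comment> \<open>By \<open>periodic_act_cyl\<close>, used in both directions, the two points
      lie in exactly the same cylinders.\<close>
    have "gp_prepend \<Lambda> \<alpha> x = gp_prepend \<Lambda> \<beta> x" if x: "x \<in> boundary \<Lambda>" "src \<Lambda> \<alpha> = gp_rng x" for x
    proof -
      have x': "src \<Lambda> \<beta> = gp_rng x" using x(2) p(4) by simp
      show ?thesis
      proof (rule boundary_eqI[OF Bd.act_closed[OF p(1) x] Bd.act_closed[OF p(2) x(1) x']])
        fix \<mu> z assume m: "\<mu> \<in> paths \<Lambda>" "z \<in> boundary \<Lambda>" "src \<Lambda> \<mu> = gp_rng z"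
        show "\<exists>w\<in>boundary \<Lambda>. src \<Lambda> \<mu> = gp_rng w \<and> gp_prepend \<Lambda> \<beta> x = gp_prepend \<Lambda> \<mu> w"
          if "gp_prepend \<Lambda> \<alpha> x = gp_prepend \<Lambda> \<mu> z"
          using Bd.cylE[OF Bd.periodic_act_cyl[OF fa p(1,2,4) per x m(1)]] Bd.cylI[OF m(2,3)] that by metis
        show "\<exists>w\<in>boundary \<Lambda>. src \<Lambda> \<mu> = gp_rng w \<and> gp_prepend \<Lambda> \<alpha> x = gp_prepend \<Lambda> \<mu> w"
          if "gp_prepend \<Lambda> \<beta> x = gp_prepend \<Lambda> \<mu> z"
          using Bd.cylE[OF Bd.periodic_act_cyl[OF fa p(2,1) p(4)[symmetric] per' x(1) x' m(1)]] Bd.cylI[OF m(2,3)] that by metis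
      qed
    qed
    then have "Bd.path_op \<alpha> (ell2_basis x) = Bd.path_op \<beta> (ell2_basis x)" if "x \<in> boundary \<Lambda>" for x
      using Bd.path_op_basis[OF p(1) that] Bd.path_op_basis[OF p(2) that] p(4) that by simp
    then have "Bd.path_op \<alpha> = Bd.path_op \<beta>" by (rule op_ext_basis[OF Bd.path_op_closed[OF p(1)] Bd.path_op_closed[OF p(2)]])
    then have "?\<pi> (s \<alpha>) = ?\<pi> (s \<beta>)" using \<pi>(2) p(1,2) by simp
    then have "s \<alpha> = s \<beta>" using inj p(1,2) by (auto dest: inj_onD)
    then show False using graded_rep.t_inj[OF G p(1,2,4)] p(3) by simp
  qed
  show ?thesis using 12 23 31 by blast
qed

end
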